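(* Let $(A,\mathfrak{m})$ be a Noetherian local ring with infinite residue field and let $M$ be a finitely generated Cohen-Macaulay $A$-module of dimension $r \geq 2$. Let $I$ be an ideal of definition for $M$. Let $\mathbf{x} = x_1,\ldots, x_s$ be an $M$-superficial sequence with respect to $I$ and assume $1\le s \leq r-1$. The following conditions are equivalent: (i) The Ratliff-Rush filtration on $M$ with respect to $I$ behaves well mod $\mathbf{x}$. (ii) $H^{i}(L^{I}(M)) = 0$ for $i = 1,\ldots,s$.
   Context: An ideal $I\subseteq\mathfrak m$ is an ideal of definition for $M$ if $M/IM$ has finite length. For a Cohen-Macaulay module $E$ of positive dimension, $x\in I$ is $E$-superficial with respect to $I$ if $(I^{n+1}E:_E x)=I^nE$ for all $n\gg 0$. A sequence $x_1,\dots,x_s\in I\setminus I^2$ is an $M$-superficial sequence with respect to $I$ if $x_1$ is $M$-superficial and, for $2\le i\le s$, $x_i$ is $M/(x_1,\dots,x_{i-1})M$-superficial with respect to $I$. The Ratliff-Rush filtration of a module $E$ with respect to $I$ is $\widetilde{I^nE}=\bigcup_{k\ge 1}(I^{n+k}E:_E I^k)$. With $M_s=M/(x_1,\dots,x_s)M$ and $\rho:M\to M_s$ the natural map, the Ratliff-Rush filtration on $M$ with respect to $I$ "behaves well mod $\mathbf x$" if $\rho(\widetilde{I^nM})=\widetilde{I^nM_s}$ for all $n\ge 1$. $\mathcal R(I)=A[It]=\bigoplus_{n\ge0}I^nt^n$ is the Rees algebra and $\mathfrak M=\mathfrak m\oplus \mathcal R(I)_+$. $L^I(M)=\bigoplus_{n\ge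 0}M/I^{n+1}M$, with $M/I^{n+1}M$ in degree $n$; it is a (not finitely generated) graded $\mathcal R(I)$-module via the identification $L^I(M)(-1)=\bigoplus_{n\ge0}M/I^nM=M[t]/\bigoplus_{n\ge 0}I^nM\,t^n$. $H^i(-)$ denotes the $i$-th local cohomology $H^i_{\mathfrak M}(-)$. *)

theory Defs
  imports "HOL-Algebra.UnivPoly" "HOL-Algebra.QuotRing" "HOL-Algebra.Ideal_Product"
    "HOL-Algebra.Ring_Divisibility" "HOL-Library.Extended_Nat"
begin

section \<open>Local rings and ideals\<close>

definition local_ring :: "('a, 'z) ring_scheme \<Rightarrow> 'a set \<Rightarrow> bool" where
  "local_ring A \<mm> \<longleftrightarrow>
     cring A \<and> maximalideal \<mm> A \<and> (\<forall>J. maximalideal J A \<longrightarrow> J = \<mm>)"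

text \<open>In \<^const>\<open>ideals_set\<close> the product is the product of ideals and the unit is the whole ring,
  so the zeroth power of an ideal is the whole ring.\<close>

abbreviation ideal_pow :: "('a, 'z) ring_scheme \<Rightarrow> 'a set \<Rightarrow> nat \<Rightarrow> 'a set" where
  "ideal_pow A I n \<equiv> I [^]\<^bsub>ideals_set A\<^esub> n"


section \<open>Modules\<close>

definition module_span ::
    "('a, 'z) ring_scheme \<Rightarrow> ('a, 'm, 'y) module_scheme \<Rightarrow> 'm set \<Rightarrow> 'm set" where
  "module_span A M S = \<Inter>{N. submodule N A M \<and> S \<subseteq> N}"

definition fin_gen_module ::
    "('a, 'z) ring_scheme \<Rightarrow> ('a, 'm, 'y) module_scheme \<Rightarrow> bool" where
  "fin_gen_module A M \<longleftrightarrow>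
     (\<exists>S. finite S \<and> S \<subseteq> carrier M \<and> module_span A M S = carrier M)"

definition ideal_times ::
    "('a, 'z) ring_scheme \<Rightarrow> 'a set \<Rightarrow> ('a, 'm, 'y) module_scheme \<Rightarrow> 'm set" where
  "ideal_times A I M = module_span A M {a \<odot>\<^bsub>M\<^esub> x | a x. a \<in> I \<and> x \<in> carrier M}"

text \<open>The record type of modules extends that of rings; the fields \<open>mult\<close> and \<open>one\<close> play no
  role in a module and are filled with dummies here and below.\<close>

definition module_quot :: "('a, 'm, 'y) module_scheme \<Rightarrow> 'm set \<Rightarrow> ('a, 'm set) module" where
  "module_quot M N =
     \<lparr>carrier = a_rcosets\<^bsub>M\<^esub> N, monoid.mult = (\<lambda>_ _. N), one = N, zero = N, add = set_add M,
      smult = (\<lambda>a C. \<Union>x\<in>C. N +>\<^bsub>M\<^esub> (a \<odot>\<^bsub>M\<^esub> x))\<rparr>"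

definition quot_by_seq ::
    "('a, 'z) ring_scheme \<Rightarrow> ('a, 'm, 'y) module_scheme \<Rightarrow> 'a list \<Rightarrow> ('a, 'm set) module" where
  "quot_by_seq A M xs = module_quot M (ideal_times A (Idl\<^bsub>A\<^esub> (set xs)) M)"

definition colon ::
    "('a, 'm, 'y) module_scheme \<Rightarrow> 'm set \<Rightarrow> 'a set \<Rightarrow> 'm set" where
  "colon M N J = {x \<in> carrier M. \<forall>a\<in>J. a \<odot>\<^bsub>M\<^esub> x \<in> N}"

definition annihilator ::
    "('a, 'z) ring_scheme \<Rightarrow> ('a, 'm, 'y) module_scheme \<Rightarrow> 'a set" where
  "annihilator A M = {a \<in> carrier A. \<forall>x\<in>carrier M. a \<odot>\<^bsub>M\<^esub> x = \<zero>\<^bsub>M\<^esub>}"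

text \<open>Existence of a composition series: each \<open>N (Suc i)\<close> properly contains \<open>N i\<close>, with no
  submodule strictly between them.\<close>

definition finite_length_module ::
    "('a, 'z) ring_scheme \<Rightarrow> ('a, 'm, 'y) module_scheme \<Rightarrow> bool" where
  "finite_length_module A M \<longleftrightarrow>
     (\<exists>l N. N (0::nat) = {\<zero>\<^bsub>M\<^esub>} \<and> N l = carrier M \<and>
        (\<forall>i\<le>l. submodule (N i) A M) \<and>
        (\<forall>i<l. N i \<subset> N (Suc i) \<and>
           (\<forall>P. submodule P A M \<longrightarrow> N i \<subseteq> P \<longrightarrow> P \<subseteq> N (Suc i) \<longrightarrow> P = N i \<or> P = N (Suc i))))"

text \<open>The Krull dimension of \<open>A / Ann M\<close>, computed in \<open>A\<close>; it is \<open>0\<close> if \<open>M\<close> is zero.\<close>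

definition module_dim ::
    "('a, 'z) ring_scheme \<Rightarrow> ('a, 'm, 'y) module_scheme \<Rightarrow> enat" where
  "module_dim A M =
     Sup {enat l | l. \<exists>P. (\<forall>i\<le>l. primeideal (P i) A \<and> annihilator A M \<subseteq> P i) \<and>
                          (\<forall>i<l. P i \<subset> P (Suc i))}"

definition regular_sequence ::
    "('a, 'z) ring_scheme \<Rightarrow> ('a, 'm, 'y) module_scheme \<Rightarrow> 'a list \<Rightarrow> bool" where
  "regular_sequence A M xs \<longleftrightarrow>
     set xs \<subseteq> carrier A \<and>
     (\<forall>i<length xs. \<forall>y\<in>carrier (quot_by_seq A M (take i xs)).
        (xs ! i) \<odot>\<^bsub>quot_by_seq A M (take i xs)\<^esub> y = \<zero>\<^bsub>quot_by_seq A M (take i xs)\<^esub>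
          \<longrightarrow> y = \<zero>\<^bsub>quot_by_seq A M (take i xs)\<^esub>) \<and>
     ideal_times A (Idl\<^bsub>A\<^esub> (set xs)) M \<noteq> carrier M"

definition module_depth ::
    "('a, 'z) ring_scheme \<Rightarrow> 'a set \<Rightarrow> ('a, 'm, 'y) module_scheme \<Rightarrow> enat" where
  "module_depth A \<mm> M = Sup {enat (length xs) | xs. set xs \<subseteq> \<mm> \<and> regular_sequence A M xs}"

definition cohen_macaulay_module ::
    "('a, 'z) ring_scheme \<Rightarrow> 'a set \<Rightarrow> ('a, 'm, 'y) module_scheme \<Rightarrow> bool" where
  "cohen_macaulay_module A \<mm> M \<longleftrightarrow>
     carrier M \<noteq> {\<zero>\<^bsub>M\<^esub>} \<and> module_depth A \<mm> M = module_dim A M"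


section \<open>Superficial sequences and the Ratliff-Rush filtration\<close>

definition ideal_of_definition ::
    "('a, 'z) ring_scheme \<Rightarrow> 'a set \<Rightarrow> 'a set \<Rightarrow> ('a, 'm, 'y) module_scheme \<Rightarrow> bool" where
  "ideal_of_definition A \<mm> I M \<longleftrightarrow>
     ideal I A \<and> I \<subseteq> \<mm> \<and> finite_length_module A (module_quot M (ideal_times A I M))"

definition superficial ::
    "('a, 'z) ring_scheme \<Rightarrow> 'a set \<Rightarrow> ('a, 'm, 'y) module_scheme \<Rightarrow> 'a \<Rightarrow> bool" where
  "superficial A I M x \<longleftrightarrow> x \<in> I \<and>
     (\<exists>n0. \<forall>n\<ge>n0. colon M (ideal_times A (ideal_pow A I (n + 1)) M) {x}
                    = ideal_times A (ideal_pow A I n) M)"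

definition superficial_sequence ::
    "('a, 'z) ring_scheme \<Rightarrow> 'a set \<Rightarrow> ('a, 'm, 'y) module_scheme \<Rightarrow> 'a list \<Rightarrow> bool" where
  "superficial_sequence A I M xs \<longleftrightarrow>
     set xs \<subseteq> I - ideal_pow A I 2 \<and>
     (0 < length xs \<longrightarrow> superficial A I M (xs ! 0)) \<and>
     (\<forall>i. 1 \<le> i \<and> i < length xs \<longrightarrow> superficial A I (quot_by_seq A M (take i xs)) (xs ! i))"

definition ratliff_rush ::
    "('a, 'z) ring_scheme \<Rightarrow> 'a set \<Rightarrow> ('a, 'm, 'y) module_scheme \<Rightarrow> nat \<Rightarrow> 'm set" where
  "ratliff_rush A I M n =
     (\<Union>k\<in>{1..}. colon M (ideal_times A (ideal_pow A I (n + k)) M) (ideal_pow A I k))"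

definition ratliff_rush_behaves_well ::
    "('a, 'z) ring_scheme \<Rightarrow> 'a set \<Rightarrow> ('a, 'm, 'y) module_scheme \<Rightarrow> 'a list \<Rightarrow> bool" where
  "ratliff_rush_behaves_well A I M xs \<longleftrightarrow>
     (\<forall>n\<ge>1. (\<lambda>x. ideal_times A (Idl\<^bsub>A\<^esub> (set xs)) M +>\<^bsub>M\<^esub> x) ` ratliff_rush A I M n
              = ratliff_rush A I (quot_by_seq A M xs) n)"


section \<open>The Rees algebra and \<open>L\<^sup>I(M)\<close>\<close>

text \<open>\<open>A[It]\<close> as a subring of \<open>A[t]\<close>; the elements of \<^const>\<open>UP\<close> are the coefficient functions.\<close>

definition rees_algebra :: "('a, 'z) ring_scheme \<Rightarrow> 'a set \<Rightarrow> ('a, nat \<Rightarrow> 'a) up_ring" where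
  "rees_algebra A I = (UP A)\<lparr>carrier := {p \<in> carrier (UP A). \<forall>n. p n \<in> ideal_pow A I n}\<rparr>"

definition rees_max_ideal :: "('a, 'z) ring_scheme \<Rightarrow> 'a set \<Rightarrow> 'a set \<Rightarrow> (nat \<Rightarrow> 'a) set" where
  "rees_max_ideal A \<mm> I = {p \<in> carrier (rees_algebra A I). p 0 \<in> \<mm>}"

text \<open>\<open>M[t]\<close>, with scalars from \<open>A[t]\<close> (hence also from \<open>A[It]\<close>).\<close>

definition poly_module :: "('a, 'm, 'y) module_scheme \<Rightarrow> (nat \<Rightarrow> 'a, nat \<Rightarrow> 'm) module" where
  "poly_module M =
     \<lparr>carrier = up M, monoid.mult = (\<lambda>_ _ _. \<zero>\<^bsub>M\<^esub>), one = (\<lambda>_. \<zero>\<^bsub>M\<^esub>), zero = (\<lambda>_. \<zero>\<^bsub>M\<^esub>),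
      add = (\<lambda>f g n. f n \<oplus>\<^bsub>M\<^esub> g n),
      smult = (\<lambda>p f n. \<Oplus>\<^bsub>M\<^esub>i\<in>{..n}. p i \<odot>\<^bsub>M\<^esub> f (n - i))\<rparr>"

text \<open>The quotient of \<open>M[t]\<close> by the sum of the \<open>I\<^sup>n\<^sup>+\<^sup>1M t\<^sup>n\<close>; its component of degree \<open>n\<close> is
  \<open>M/I\<^sup>n\<^sup>+\<^sup>1M\<close>. Up to the shift by one this is \<open>M[t]/\<Oplus>I\<^sup>nM t\<^sup>n\<close>, whose component of
  degree \<open>0\<close> is zero.\<close>

definition L_module ::
    "('a, 'z) ring_scheme \<Rightarrow> 'a set \<Rightarrow> ('a, 'm, 'y) module_scheme
       \<Rightarrow> (nat \<Rightarrow> 'a, (nat \<Rightarrow> 'm) set) module" where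
  "L_module A I M =
     module_quot (poly_module M)
       {f \<in> carrier (poly_module M). \<forall>n. f n \<in> ideal_times A (ideal_pow A I (n + 1)) M}"


section \<open>Local cohomology\<close>

definition module_hom ::
    "('r, 'z) ring_scheme \<Rightarrow> ('r, 'm, 'y) module_scheme \<Rightarrow> ('r, 'n, 'x) module_scheme
       \<Rightarrow> ('m \<Rightarrow> 'n) set" where
  "module_hom R M N = {f \<in> carrier M \<rightarrow> carrier N.
     (\<forall>x\<in>carrier M. \<forall>y\<in>carrier M. f (x \<oplus>\<^bsub>M\<^esub> y) = f x \<oplus>\<^bsub>N\<^esub> f y) \<and>
     (\<forall>a\<in>carrier R. \<forall>x\<in>carrier M. f (a \<odot>\<^bsub>M\<^esub> x) = a \<odot>\<^bsub>N\<^esub> f x)}"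

text \<open>HOL cannot quantify over the type of the elements of the test module \<open>Y\<close>, which is the type
  of the scalars here. Nothing is lost: \<open>R\<close> itself is among the test modules, so by Baer's
  criterion the extension property follows for test modules of every type.\<close>

definition injective_module ::
    "('r, 'z) ring_scheme \<Rightarrow> ('r, 'e, 'y) module_scheme \<Rightarrow> bool" where
  "injective_module R E \<longleftrightarrow> module R E \<and>
     (\<forall>(Y :: ('r, 'r) module) S f.
        module R Y \<longrightarrow> submodule S R Y \<longrightarrow> f \<in> module_hom R (Y\<lparr>carrier := S\<rparr>) E \<longrightarrow>
          (\<exists>g\<in>module_hom R Y E. \<forall>x\<in>S. g x = f x))"

text \<open>Exactness of \<open>0 \<rightarrow> L \<rightarrow> J 0 \<rightarrow> J 1 \<rightarrow> \<dots>\<close>, with augmentation \<open>\<epsilon>\<close> and differentials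
  \<open>d i : J i \<rightarrow> J (i + 1)\<close>.\<close>

definition injective_resolution ::
    "('r, 'z) ring_scheme \<Rightarrow> ('r, 'l, 'y) module_scheme \<Rightarrow> ('l \<Rightarrow> 'e)
       \<Rightarrow> (nat \<Rightarrow> ('r, 'e) module) \<Rightarrow> (nat \<Rightarrow> 'e \<Rightarrow> 'e) \<Rightarrow> bool" where
  "injective_resolution R L \<epsilon> J d \<longleftrightarrow>
     (\<forall>i. injective_module R (J i)) \<and>
     \<epsilon> \<in> module_hom R L (J 0) \<and> inj_on \<epsilon> (carrier L) \<and>
     (\<forall>i. d i \<in> module_hom R (J i) (J (Suc i))) \<and>
     \<epsilon> ` carrier L = {x \<in> carrier (J 0). d 0 x = \<zero>\<^bsub>J 1\<^esub>} \<and>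
     (\<forall>i. d i ` carrier (J i) = {x \<in> carrier (J (Suc i)). d (Suc i) x = \<zero>\<^bsub>J (Suc (Suc i))\<^esub>})"

definition torsion_part ::
    "('r, 'z) ring_scheme \<Rightarrow> 'r set \<Rightarrow> ('r, 'e, 'y) module_scheme \<Rightarrow> 'e set" where
  "torsion_part R \<aa> E = {x \<in> carrier E. \<exists>n. \<forall>a\<in>ideal_pow R \<aa> n. a \<odot>\<^bsub>E\<^esub> x = \<zero>\<^bsub>E\<^esub>}"

text \<open>The right derived functors of the \<open>\<aa>\<close>-torsion functor: the cohomology of the torsion part of
  an injective resolution \<open>(J, d)\<close>. As usual, any injective resolution may be used, the result
  being independent of it up to isomorphism; it is a parameter because the type of elements of a
  resolution cannot be fixed once and for all. The grading plays no role in the definition: \<open>H\<^sup>i\<close> of a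
  graded module, with the grading forgotten, is the same whether computed by graded or by
  ungraded injective resolutions.\<close>

definition local_cohomology ::
    "('r, 'z) ring_scheme \<Rightarrow> 'r set \<Rightarrow> (nat \<Rightarrow> ('r, 'e) module) \<Rightarrow> (nat \<Rightarrow> 'e \<Rightarrow> 'e) \<Rightarrow> nat
       \<Rightarrow> ('r, 'e set) module" where
  "local_cohomology R \<aa> J d i =
     module_quot ((J i)\<lparr>carrier := {x \<in> torsion_part R \<aa> (J i). d i x = \<zero>\<^bsub>J (Suc i)\<^esub>}\<rparr>)
       (if i = 0 then {\<zero>\<^bsub>J 0\<^esub>} else d (i - 1) ` torsion_part R \<aa> (J (i - 1)))"

end

theory Submission
  imports Defs "HOL-Algebra.Subrings"
begin

text \<open>Let \<open>RR\<^sub>n\<close> denote the Ratliff-Rush filtration of \<open>M\<close>. The \<open>\<MM>\<close>-torsion of \<open>L = L\<^sup>I(M)\<close> is the sum of the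
  \<open>RR\<^sub>n\<^sub>+\<^sub>1 / I\<^sup>n\<^sup>+\<^sup>1M\<close>, where \<open>\<MM>\<close> is the maximal homogeneous ideal, so \<open>L\<close> modulo its torsion is \<open>D\<^sub>0\<close>, where
  \<open>D\<^sub>j\<close> is the sum of the \<open>M / (RR\<^sub>n\<^sub>+\<^sub>1 + (x\<^sub>1, \<dots>, x\<^sub>j)M)\<close>. The proof compares everything with Koszul
  cohomology on a system of generators of \<open>\<MM>\<close> that contains the \<open>x\<^sub>i t\<close>.

  First, let \<open>J\<close> be an injective resolution of \<open>L\<close>. The torsion of an injective module over a Noetherian
  ring is injective, so \<open>J\<^sup>i\<close> modulo its torsion has no Koszul cohomology, and dimension shifting shows that
  \<open>H\<^sup>1(L), \<dots>, H\<^sup>s(L)\<close> vanish if and only if the Koszul cohomology of \<open>D\<^sub>0\<close> vanishes in degrees \<open>0, \<dots>, s\<close>.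

  Secondly, \<open>D\<^sub>j\<close> has Koszul \<open>H\<^sup>0 = 0\<close> (its socle vanishes) if and only if the Ratliff-Rush filtration
  behaves well mod \<open>x\<^sub>1, \<dots>, x\<^sub>j\<close>; in that case \<open>x\<^sub>j\<^sub>+\<^sub>1 t\<close> is regular on \<open>D\<^sub>j\<close> with quotient \<open>D\<^sub>j\<^sub>+\<^sub>1\<close>,
  because \<open>x\<^sub>j\<^sub>+\<^sub>1\<close> is superficial. Hence the vanishing in degrees \<open>0, \<dots>, s\<close> means good behaviour mod
  \<open>x\<^sub>1, \<dots>, x\<^sub>j\<close> for all \<open>j \<le> s\<close>, and the case \<open>j = s\<close> implies the others.\<close>

text \<open>The resolution \<open>J\<close> is given in one fixed type, and a further resolution,
  say of some \<open>D\<^sub>j\<close>, cannot be assumed to exist there. Koszul cohomology avoids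
  this obstacle: it is computed from elements and scalars alone, so its long exact sequences can
  join modules of different types. It may replace local cohomology because only the first
  nonvanishing degree matters, and there the two agree. For each
  \<open>W = (x\<^sub>1, \<dots>, x\<^sub>j)M\<close> two submodules of \<open>M\<close> compete:
  \<open>V W n\<close>, the preimage of the filtration of \<open>M / W\<close>, and
  \<open>N W n\<close>, the filtration of \<open>M\<close> plus \<open>W\<close>. Superficiality is
  a cancellation rule for \<open>V\<close>, whereas \<open>D\<^sub>j\<close> is built from
  \<open>N\<close>; this is why regularity of \<open>x\<^sub>j\<^sub>+\<^sub>1 t\<close> on
  \<open>D\<^sub>j\<close> is obtained only after both are known to agree. An element of
  \<open>V\<close> outside \<open>N\<close> is pushed into the socle first by powers of
  \<open>I\<close>, which raise the degree, and then by powers of \<open>\<mm>\<close>, which keep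
  it. The second push comes to an end because \<open>M / IM\<close> has finite length, so that some
  \<open>\<mm>\<^sup>c\<close> maps \<open>M\<close> into \<open>IM\<close>.\<close>

lemma (in abelian_group) neg_zero [simp]: "\<ominus> \<zero> = \<zero>"
  by (metis l_zero r_neg a_inv_closed zero_closed)

lemma (in abelian_group) minus_zero_right [simp]: "x \<in> carrier G \<Longrightarrow> x \<ominus> \<zero> = x"
  by (simp add: a_minus_def)

lemma (in abelian_group) add_cancel_neg:
  assumes "x \<in> carrier G" "y \<in> carrier G"
  shows "x \<oplus> (y \<oplus> \<ominus> x) = y"
  using assms by (metis a_comm a_inv_closed r_neg2 minus_minus)

lemma (in abelian_group) add_cancel_neg2:
  assumes "x \<in> carrier G" "y \<in> carrier G" "z \<in> carrier G"
  shows "x \<oplus> (y \<oplus> (z \<oplus> \<ominus> x)) = y \<oplus> z"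
  using assms add_cancel_neg[of x "y \<oplus> z"] by (simp add: a_assoc)

lemma (in abelian_group) minus_eq_iff:
  assumes "x \<in> carrier G" "y \<in> carrier G" "z \<in> carrier G"
  shows "x \<ominus> y = z \<longleftrightarrow> x = z \<oplus> y"
  using assms by (metis a_minus_def a_assoc a_inv_closed l_neg r_neg r_zero)

lemma (in module) submodule_zero: "submodule H R M \<Longrightarrow> \<zero>\<^bsub>M\<^esub> \<in> H"
  using subgroup.one_closed[OF submodule.axioms(1)] by fastforce

lemma (in module) submodule_minus:
  "submodule H R M \<Longrightarrow> x \<in> H \<Longrightarrow> y \<in> H \<Longrightarrow> x \<ominus>\<^bsub>M\<^esub> y \<in> H"
  unfolding a_minus_def by (simp add: submoduleE(3,5))

lemma (in module) submodule_carrier: "submodule H R M \<Longrightarrow> x \<in> H \<Longrightarrow> x \<in> carrier M"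
  using submoduleE(1) by blast

lemma (in module) zero_submodule: "submodule {\<zero>\<^bsub>M\<^esub>} R M"
  by (rule submoduleI) auto

section \<open>Koszul cohomology\<close>

text \<open>A list of booleans of length \<open>length zs\<close> encodes a subset of the members of \<open>zs\<close>, and a cochain is a
  family indexed by such lists, zero on lists of any other length; the degree is the number of \<^const>\<open>True\<close>.
  A pair \<open>N \<subseteq> G\<close> of submodules stands for the module \<open>G / N\<close>, so that no quotients have to be formed.
  Cochains need not be homogeneous: \<open>koszul_vanishing P G N zs m\<close> says that \<open>H\<^sup>i(zs; G / N) = 0\<close> for
  all \<open>i < m\<close> at once.\<close>

fun koszul :: "('r, 'p, 'y) module_scheme \<Rightarrow> 'r list \<Rightarrow> (bool list \<Rightarrow> 'p) \<Rightarrow> bool list \<Rightarrow> 'p" where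
  "koszul P [] \<phi> l = \<zero>\<^bsub>P\<^esub>"
| "koszul P (z # zs) \<phi> [] = \<zero>\<^bsub>P\<^esub>"
| "koszul P (z # zs) \<phi> (False # l) = koszul P zs (\<lambda>l. \<phi> (False # l)) l"
| "koszul P (z # zs) \<phi> (True # l) = z \<odot>\<^bsub>P\<^esub> \<phi> (False # l) \<ominus>\<^bsub>P\<^esub> koszul P zs (\<lambda>l. \<phi> (True # l)) l"

definition cochains :: "('r, 'p, 'y) module_scheme \<Rightarrow> 'p set \<Rightarrow> 'r list \<Rightarrow> nat \<Rightarrow> (bool list \<Rightarrow> 'p) set" where
  "cochains P G zs m = {\<phi>. \<forall>l. \<phi> l \<in> G \<and>
     (\<not> (length l = length zs \<and> count_list l True < m) \<longrightarrow> \<phi> l = \<zero>\<^bsub>P\<^esub>)}"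

definition koszul_vanishing :: "('r, 'p, 'y) module_scheme \<Rightarrow> 'p set \<Rightarrow> 'p set \<Rightarrow> 'r list \<Rightarrow> nat \<Rightarrow> bool" where
  "koszul_vanishing P G N zs m \<longleftrightarrow> (\<forall>\<phi>\<in>cochains P G zs m. (\<forall>l. koszul P zs \<phi> l \<in> N) \<longrightarrow>
     (\<exists>w\<in>cochains P G zs (m - 1). \<forall>l. \<phi> l \<ominus>\<^bsub>P\<^esub> koszul P zs w l \<in> N))"

context module
begin

text \<open>Applied to \<open>G\<close> and to \<open>N\<close> alike: this makes the differential
  well defined on the quotient that the pair stands for.\<close>

lemma koszul_closed:
  assumes "submodule G R M"
  shows "set zs \<subseteq> carrier R \<Longrightarrow> (\<And>l. \<phi> l \<in> G) \<Longrightarrow> koszul M zs \<phi> l \<in> G"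
proof (induction zs arbitrary: \<phi> l)
  case Nil then show ?case using assms by (simp add: submodule_zero)
next
  case (Cons z zs)
  show ?case
  proof (cases l)
    case Nil then show ?thesis using assms by (simp add: submodule_zero)
  next
    case (Cons b l')
    show ?thesis
    proof (cases b)
      case True
      have "koszul M zs (\<lambda>l. \<phi> (True # l)) l' \<in> G" using Cons.IH Cons.prems by simp
      then show ?thesis using Cons True Cons.prems assms
        by (simp add: submodule_minus submodule.smult_closed)
    next
      case False
      then show ?thesis using Cons Cons.IH Cons.prems by simp
    qed
  qed
qed

lemmas koszul_carrier = koszul_closed[OF carrier_is_submodule]

lemma koszul_add:
  "set zs \<subseteq> carrier R \<Longrightarrow> (\<And>l. \<phi> l \<in> carrier M) \<Longrightarrow> (\<And>l. \<psi> l \<in> carrier M) \<Longrightarrow>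
   koszul M zs (\<lambda>l. \<phi> l \<oplus>\<^bsub>M\<^esub> \<psi> l) l = koszul M zs \<phi> l \<oplus>\<^bsub>M\<^esub> koszul M zs \<psi> l"
proof (induction zs arbitrary: \<phi> \<psi> l)
  case (Cons z zs)
  show ?case
  proof (cases l)
    case (Cons b l')
    show ?thesis
    proof (cases b)
      case True
      have "koszul M zs (\<lambda>l. \<phi> (True # l)) l' \<in> carrier M" "koszul M zs (\<lambda>l. \<psi> (True # l)) l' \<in> carrier M"
        using Cons.prems by (auto intro!: koszul_carrier)
      then show ?thesis using Cons True Cons.prems
        by (simp add: Cons.IH smult_r_distr a_minus_def M.minus_add M.a_ac)
    next
      case False
      then show ?thesis using Cons Cons.IH Cons.prems by simp
    qed
  qed simp
qed simp

lemma koszul_zero: "set zs \<subseteq> carrier R \<Longrightarrow> koszul M zs (\<lambda>l. \<zero>\<^bsub>M\<^esub>) l = \<zero>\<^bsub>M\<^esub>"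
proof (induction zs arbitrary: l)
  case (Cons z zs)
  then show ?case by (cases l; cases "hd l") (simp_all add: a_minus_def)
qed simp

lemma koszul_minus:
  assumes "set zs \<subseteq> carrier R" "\<And>l. \<phi> l \<in> carrier M" "\<And>l. \<psi> l \<in> carrier M"
  shows "koszul M zs (\<lambda>l. \<phi> l \<ominus>\<^bsub>M\<^esub> \<psi> l) l = koszul M zs \<phi> l \<ominus>\<^bsub>M\<^esub> koszul M zs \<psi> l"
proof -
  have "koszul M zs \<phi> l = koszul M zs (\<lambda>l. (\<phi> l \<ominus>\<^bsub>M\<^esub> \<psi> l) \<oplus>\<^bsub>M\<^esub> \<psi> l) l"
    using assms by (simp add: a_minus_def M.a_assoc M.l_neg)
  also have "\<dots> = koszul M zs (\<lambda>l. \<phi> l \<ominus>\<^bsub>M\<^esub> \<psi> l) l \<oplus>\<^bsub>M\<^esub> koszul M zs \<psi> l"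
    using assms by (intro koszul_add) auto
  finally show ?thesis using assms
    by (simp add: a_minus_def M.a_assoc M.r_neg koszul_carrier)
qed

lemma koszul_smult:
  "set zs \<subseteq> carrier R \<Longrightarrow> (\<And>l. \<phi> l \<in> carrier M) \<Longrightarrow> a \<in> carrier R \<Longrightarrow>
   koszul M zs (\<lambda>l. a \<odot>\<^bsub>M\<^esub> \<phi> l) l = a \<odot>\<^bsub>M\<^esub> koszul M zs \<phi> l"
proof (induction zs arbitrary: \<phi> l)
  case (Cons z zs)
  show ?case
  proof (cases l)
    case (Cons b l')
    show ?thesis
    proof (cases b)
      case True
      have "koszul M zs (\<lambda>l. \<phi> (True # l)) l' \<in> carrier M"
        using Cons.prems by (auto intro!: koszul_carrier)
      then show ?thesis using Cons True Cons.prems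
        by (simp add: Cons.IH smult_r_distr a_minus_def smult_r_minus smult_assoc1[symmetric] R.m_comm)
    next
      case False
      then show ?thesis using Cons Cons.IH Cons.prems by simp
    qed
  qed (simp add: Cons.prems)
qed simp

text \<open>The minus sign in the \<open>True\<close> case of \<open>koszul\<close> makes the two
  mixed terms, \<open>z\<close> times the differential of the \<open>False\<close> half, cancel;
  what remains is the same claim for \<open>zs\<close>.\<close>

lemma koszul_koszul:
  "set zs \<subseteq> carrier R \<Longrightarrow> (\<And>l. \<phi> l \<in> carrier M) \<Longrightarrow> koszul M zs (koszul M zs \<phi>) l = \<zero>\<^bsub>M\<^esub>"
proof (induction zs arbitrary: \<phi> l)
  case (Cons z zs)
  show ?case
  proof (cases l)
    case (Cons b l')
    show ?thesis
    proof (cases b)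
      case True
      have "koszul M (z # zs) (koszul M (z # zs) \<phi>) l =
        z \<odot>\<^bsub>M\<^esub> koszul M zs (\<lambda>l. \<phi> (False # l)) l' \<ominus>\<^bsub>M\<^esub>
        koszul M zs (\<lambda>l. z \<odot>\<^bsub>M\<^esub> \<phi> (False # l) \<ominus>\<^bsub>M\<^esub> koszul M zs (\<lambda>l. \<phi> (True # l)) l) l'"
        using Cons True by simp
      also have "\<dots> = \<zero>\<^bsub>M\<^esub>"
        using Cons.prems by (subst koszul_minus) (simp_all add: koszul_smult koszul_carrier Cons.IH minus_eq_iff)
      finally show ?thesis .
    next
      case False
      then show ?thesis using Cons Cons.IH Cons.prems by simp
    qed
  qed simp
qed simp

text \<open>The differential raises the degree by one. On a list beginning with \<open>True\<close>,
  its first summand looks at a list with one \<open>True\<close> less, and for the second both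
  bounds drop by one, which leaves \<open>m = 0\<close> as a separate case.\<close>

lemma koszul_support:
  "set zs \<subseteq> carrier R \<Longrightarrow>
   (\<And>l. \<not> (length l = length zs \<and> count_list l True < m) \<Longrightarrow> \<phi> l = \<zero>\<^bsub>M\<^esub>) \<Longrightarrow>
   \<not> (length l = length zs \<and> count_list l True < Suc m) \<Longrightarrow> koszul M zs \<phi> l = \<zero>\<^bsub>M\<^esub>"
proof (induction zs arbitrary: \<phi> l m)
  case (Cons z zs)
  show ?case
  proof (cases l)
    case (Cons b l')
    show ?thesis
    proof (cases b)
      case True
      have "\<phi> (False # l') = \<zero>\<^bsub>M\<^esub>" using Cons.prems(2)[of "False # l'"] Cons.prems(3) Cons True by auto
      moreover have "koszul M zs (\<lambda>l. \<phi> (True # l)) l' = \<zero>\<^bsub>M\<^esub>"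
      proof (cases m)
        case 0
        then have "\<And>l. \<phi> (True # l) = \<zero>\<^bsub>M\<^esub>" using Cons.prems(2) by simp
        then show ?thesis using Cons.prems(1) by (simp add: koszul_zero)
      next
        case (Suc m')
        show ?thesis
          by (rule Cons.IH[where m = m']) (use Cons.prems Suc Cons True in auto)
      qed
      ultimately show ?thesis using Cons True Cons.prems by (simp add: a_minus_def)
    next
      case False
      show ?thesis using Cons False Cons.prems Cons.IH[where m = m and \<phi> = "\<lambda>l. \<phi> (False # l)" and l = l']
        by auto
    qed
  qed simp
qed simp

lemma cochains_in: "\<phi> \<in> cochains M G zs m \<Longrightarrow> \<phi> l \<in> G"
  by (simp add: cochains_def)

lemma koszul_cochains:
  assumes "submodule G R M" "set zs \<subseteq> carrier R" "\<phi> \<in> cochains M G zs m"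
  shows "koszul M zs \<phi> \<in> cochains M G zs (Suc m)"
  using assms koszul_closed[OF assms(1,2), of \<phi>] koszul_support[OF assms(2), of m \<phi>]
  by (auto simp: cochains_def)

lemma cochains_mono: "m \<le> n \<Longrightarrow> cochains M G zs m \<subseteq> cochains M G zs n"
  by (fastforce simp: cochains_def)

lemma cochains_0: "\<phi> \<in> cochains M G zs 0 \<Longrightarrow> \<phi> = (\<lambda>l. \<zero>\<^bsub>M\<^esub>)"
  by (auto simp: cochains_def)

lemma cochains_zero: "submodule G R M \<Longrightarrow> (\<lambda>l. \<zero>\<^bsub>M\<^esub>) \<in> cochains M G zs m"
  by (simp add: cochains_def submodule_zero)

lemma cochains_minus:
  "submodule G R M \<Longrightarrow> \<phi> \<in> cochains M G zs m \<Longrightarrow> \<psi> \<in> cochains M G zs m \<Longrightarrow> (\<lambda>l. \<phi> l \<ominus>\<^bsub>M\<^esub> \<psi> l) \<in> cochains M G zs m"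
  using submodule_minus[of G] by (auto simp: cochains_def)

end

text \<open>Contraction with the \<open>k\<close>-th basis vector of the exterior algebra: position
  \<open>k\<close> is switched from \<open>False\<close> to \<open>True\<close>, with a sign for
  every \<open>True\<close> before it, and the value is zero if position \<open>k\<close> is
  \<open>True\<close> already.\<close>

fun homotopy :: "('r, 'p, 'y) module_scheme \<Rightarrow> nat \<Rightarrow> (bool list \<Rightarrow> 'p) \<Rightarrow> bool list \<Rightarrow> 'p" where
  "homotopy P k \<phi> [] = \<zero>\<^bsub>P\<^esub>"
| "homotopy P 0 \<phi> (False # l) = \<phi> (True # l)"
| "homotopy P 0 \<phi> (True # l) = \<zero>\<^bsub>P\<^esub>"
| "homotopy P (Suc k) \<phi> (False # l) = homotopy P k (\<lambda>l. \<phi> (False # l)) l"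
| "homotopy P (Suc k) \<phi> (True # l) = \<ominus>\<^bsub>P\<^esub> homotopy P k (\<lambda>l. \<phi> (True # l)) l"

context module
begin

lemma homotopy_closed:
  assumes "submodule G R M"
  shows "(\<And>l. \<phi> l \<in> G) \<Longrightarrow> homotopy M k \<phi> l \<in> G"
proof (induction l arbitrary: \<phi> k)
  case Nil then show ?case using assms by (simp add: submodule_zero)
next
  case (Cons b l)
  then show ?case using assms submodule_zero[OF assms] submoduleE(3)[OF assms]
    by (cases k; cases b) auto
qed

text \<open>The combination of \<phi> and \<psi> has the shape of the differential on lists
  beginning with \<open>True\<close>, which is where it is applied.\<close>

lemma homotopy_linear:
  "a \<in> carrier R \<Longrightarrow> (\<And>l. \<phi> l \<in> carrier M) \<Longrightarrow> (\<And>l. \<psi> l \<in> carrier M) \<Longrightarrow>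
   homotopy M k (\<lambda>l. a \<odot>\<^bsub>M\<^esub> \<phi> l \<ominus>\<^bsub>M\<^esub> \<psi> l) l = a \<odot>\<^bsub>M\<^esub> homotopy M k \<phi> l \<ominus>\<^bsub>M\<^esub> homotopy M k \<psi> l"
proof (induction l arbitrary: \<phi> \<psi> k)
  case (Cons b l)
  have "homotopy M k (\<lambda>l. \<phi> (c # l)) l \<in> carrier M" "homotopy M k (\<lambda>l. \<psi> (c # l)) l \<in> carrier M" for k c
    using Cons.prems by (auto intro!: homotopy_closed[OF carrier_is_submodule])
  then show ?case using Cons.prems
    by (cases k; cases b) (simp_all add: Cons.IH, simp_all add: a_minus_def M.minus_add smult_r_minus)
qed (simp add: a_minus_def)

lemma homotopy_cochains:
  "k < length zs \<Longrightarrow> (\<And>l. \<not> (length l = length zs \<and> count_list l True < Suc m) \<Longrightarrow> \<phi> l = \<zero>\<^bsub>M\<^esub>) \<Longrightarrow>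
   \<not> (length l = length zs \<and> count_list l True < m) \<Longrightarrow> homotopy M k \<phi> l = \<zero>\<^bsub>M\<^esub>"
proof (induction l arbitrary: zs \<phi> k m)
  case (Cons b l)
  obtain z zs' where zs: "zs = z # zs'" using Cons.prems(1) by (cases zs) auto
  show ?case
  proof (cases k)
    case 0 then show ?thesis using Cons.prems by (cases b) auto
  next
    case (Suc k')
    show ?thesis
    proof (cases b)
      case False
      have "homotopy M k' (\<lambda>l. \<phi> (False # l)) l = \<zero>\<^bsub>M\<^esub>"
        by (rule Cons.IH[where m = m and zs = zs']) (use Cons.prems zs Suc False in auto)
      then show ?thesis using Suc False by simp
    next
      case True
      have "homotopy M k' (\<lambda>l. \<phi> (True # l)) l = \<zero>\<^bsub>M\<^esub>"
      proof (cases m)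
        case 0
        have "\<phi> (True # l) = \<zero>\<^bsub>M\<^esub>" for l using Cons.prems(2)[of "True # l"] 0 by simp
        then show ?thesis using homotopy_closed[OF zero_submodule, of "\<lambda>l. \<phi> (True # l)" k' l] by simp
      next
        case (Suc m')
        show ?thesis
          by (rule Cons.IH[where m = m' and zs = zs']) (use Cons.prems zs \<open>k = Suc k'\<close> Suc True in auto)
      qed
      then show ?thesis using Suc True by simp
    qed
  qed
qed simp

text \<open>Multiplication by a member of \<open>zs\<close> is null-homotopic, hence zero on Koszul
  cohomology. At position \<open>k\<close> itself the differential produces the product directly;
  before it, both maps change sign on lists with \<open>True\<close>, and the mixed terms containing
  the head \<open>z\<close> cancel.\<close>

lemma koszul_homotopy:
  "set zs \<subseteq> carrier R \<Longrightarrow> (\<And>l. \<phi> l \<in> carrier M) \<Longrightarrow> k < length zs \<Longrightarrow> length l = length zs \<Longrightarrow>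
   koszul M zs (homotopy M k \<phi>) l \<oplus>\<^bsub>M\<^esub> homotopy M k (koszul M zs \<phi>) l = (zs ! k) \<odot>\<^bsub>M\<^esub> \<phi> l"
proof (induction l arbitrary: zs \<phi> k)
  case (Cons b l)
  obtain z zs' where zs: "zs = z # zs'" using Cons.prems(3) by (cases zs) auto
  have zsc: "set zs' \<subseteq> carrier R" "z \<in> carrier R" "length l = length zs'" using Cons.prems zs by auto
  note [simp] = Cons.prems(2)
  have [simp]: "koszul M zs' (\<lambda>l. \<phi> (c # l)) l \<in> carrier M" for l c using zsc by (auto intro!: koszul_carrier)
  have [simp]: "homotopy M k (\<lambda>l. \<phi> (c # l)) l \<in> carrier M" for k l c
    by (rule homotopy_closed[OF carrier_is_submodule]) simp
  have [simp]: "homotopy M k (koszul M zs' (\<lambda>l. \<phi> (c # l))) l \<in> carrier M" for k l c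
    by (rule homotopy_closed[OF carrier_is_submodule]) simp
  have [simp]: "koszul M zs' (homotopy M k (\<lambda>l. \<phi> (c # l))) l \<in> carrier M" for k l c
    using zsc by (auto intro!: koszul_carrier)
  show ?case
  proof (cases k)
    case 0
    then show ?thesis using zs zsc
      by (cases b) (simp_all add: a_minus_def M.a_ac M.r_neg M.r_neg1 koszul_zero M.r_neg2)
  next
    case (Suc k')
    have k': "k' < length zs'" using Suc Cons.prems zs by simp
    have IH: "koszul M zs' (homotopy M k' (\<lambda>l. \<phi> (c # l))) l \<oplus>\<^bsub>M\<^esub> homotopy M k' (koszul M zs' (\<lambda>l. \<phi> (c # l))) l
       = (zs' ! k') \<odot>\<^bsub>M\<^esub> \<phi> (c # l)" for c
      by (rule Cons.IH) (use zsc k' in auto)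
    show ?thesis
    proof (cases b)
      case False
      then show ?thesis using zs Suc IH[of False] by simp
    next
      case True
      have neg: "koszul M zs' (\<lambda>l. \<ominus>\<^bsub>M\<^esub> homotopy M k' (\<lambda>l. \<phi> (True # l)) l) l = \<ominus>\<^bsub>M\<^esub> koszul M zs' (homotopy M k' (\<lambda>l. \<phi> (True # l))) l"
        using koszul_minus[OF zsc(1), of "\<lambda>l. \<zero>\<^bsub>M\<^esub>" "homotopy M k' (\<lambda>l. \<phi> (True # l))" l] zsc
        by (simp add: a_minus_def koszul_zero)
      have sub: "homotopy M k' (\<lambda>l. z \<odot>\<^bsub>M\<^esub> \<phi> (False # l) \<ominus>\<^bsub>M\<^esub> koszul M zs' (\<lambda>l. \<phi> (True # l)) l) l
        = z \<odot>\<^bsub>M\<^esub> homotopy M k' (\<lambda>l. \<phi> (False # l)) l \<ominus>\<^bsub>M\<^esub> homotopy M k' (koszul M zs' (\<lambda>l. \<phi> (True # l))) l"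
        using zsc by (intro homotopy_linear) auto
      let ?x = "z \<odot>\<^bsub>M\<^esub> homotopy M k' (\<lambda>l. \<phi> (False # l)) l"
      let ?A = "koszul M zs' (homotopy M k' (\<lambda>l. \<phi> (True # l))) l"
      let ?B = "homotopy M k' (koszul M zs' (\<lambda>l. \<phi> (True # l))) l"
      have "koszul M zs (homotopy M k \<phi>) l0 \<oplus>\<^bsub>M\<^esub> homotopy M k (koszul M zs \<phi>) l0 =
        (?x \<ominus>\<^bsub>M\<^esub> \<ominus>\<^bsub>M\<^esub> ?A) \<oplus>\<^bsub>M\<^esub> \<ominus>\<^bsub>M\<^esub> (?x \<ominus>\<^bsub>M\<^esub> ?B)" if "l0 = True # l" for l0
        using zs Suc that by (simp add: neg sub)
      also have "(?x \<ominus>\<^bsub>M\<^esub> \<ominus>\<^bsub>M\<^esub> ?A) \<oplus>\<^bsub>M\<^esub> \<ominus>\<^bsub>M\<^esub> (?x \<ominus>\<^bsub>M\<^esub> ?B) = ?A \<oplus>\<^bsub>M\<^esub> ?B"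
        using zsc by (simp add: a_minus_def M.minus_add M.a_ac M.add_cancel_neg2)
      finally show ?thesis using zs Suc True IH[of True] by simp
    qed
  qed
qed simp

lemma submodule_cong_trans:
  assumes "submodule N R M" "x \<in> carrier M" "y \<in> carrier M" "z \<in> carrier M"
    "x \<ominus>\<^bsub>M\<^esub> y \<in> N" "y \<ominus>\<^bsub>M\<^esub> z \<in> N"
  shows "x \<ominus>\<^bsub>M\<^esub> z \<in> N"
proof -
  have "x \<ominus>\<^bsub>M\<^esub> z = (x \<ominus>\<^bsub>M\<^esub> y) \<oplus>\<^bsub>M\<^esub> (y \<ominus>\<^bsub>M\<^esub> z)"
    using assms(2-4) by (simp add: a_minus_def M.a_assoc M.r_neg1)
  then show ?thesis using assms submoduleE(5)[OF assms(1)] by simp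
qed

lemma minus_swap: "x \<in> carrier M \<Longrightarrow> y \<in> carrier M \<Longrightarrow> \<ominus>\<^bsub>M\<^esub> (x \<ominus>\<^bsub>M\<^esub> y) = y \<ominus>\<^bsub>M\<^esub> x"
  by (simp add: a_minus_def M.minus_add M.a_comm)

lemma submodule_cong_sym:
  assumes "submodule N R M" "x \<in> carrier M" "y \<in> carrier M" "x \<ominus>\<^bsub>M\<^esub> y \<in> N"
  shows "y \<ominus>\<^bsub>M\<^esub> x \<in> N"
  using submoduleE(3)[OF assms(1,4)] minus_swap[OF assms(2,3)] by simp

lemma submodule_cong_mem:
  assumes "submodule N R M" "x \<in> carrier M" "y \<in> carrier M" "x \<ominus>\<^bsub>M\<^esub> y \<in> N"
  shows "x \<in> N \<longleftrightarrow> y \<in> N"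
proof -
  have "x = (x \<ominus>\<^bsub>M\<^esub> y) \<oplus>\<^bsub>M\<^esub> y" "y = (y \<ominus>\<^bsub>M\<^esub> x) \<oplus>\<^bsub>M\<^esub> x"
    using assms(2,3) by (simp_all add: a_minus_def M.a_assoc M.l_neg)
  then show ?thesis
    using assms submodule_cong_sym[OF assms] submoduleE(5)[OF assms(1)] by metis
qed

text \<open>The truncated difference is harmless: for \<open>m = 0\<close> the zero cochain is the
  only one on either side.\<close>

lemma koszul_cochains_pred:
  assumes "submodule G R M" "set zs \<subseteq> carrier R" "\<phi> \<in> cochains M G zs (m - 1)"
  shows "koszul M zs \<phi> \<in> cochains M G zs m"
proof (cases m)
  case 0
  then have "koszul M zs \<phi> = (\<lambda>l. \<zero>\<^bsub>M\<^esub>)"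
    using cochains_0[of \<phi> G zs] assms(2,3) koszul_zero[OF assms(2)] by auto
  then show ?thesis using cochains_zero[OF assms(1)] by simp
qed (use assms koszul_cochains in auto)

end

text \<open>Lifts are chosen list by list, with zero lifted to zero, so that the result vanishes
  wherever \<open>t\<close> does and keeps its degree bound. The abstract relation \<open>S\<close>
  covers lifting through either map of a short exact sequence.\<close>

lemma cochains_choose:
  assumes "t \<in> cochains Q H zs m" "\<And>y. y \<in> H \<Longrightarrow> \<exists>x\<in>G. S y x" "S \<zero>\<^bsub>Q\<^esub> \<zero>\<^bsub>P\<^esub>" "\<zero>\<^bsub>P\<^esub> \<in> G"
  shows "\<exists>u\<in>cochains P G zs m. \<forall>l. S (t l) (u l)"
proof -
  define u where "u l = (if t l = \<zero>\<^bsub>Q\<^esub> then \<zero>\<^bsub>P\<^esub> else SOME x. x \<in> G \<and> S (t l) x)" for l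
  have "u l \<in> G \<and> S (t l) (u l)" for l
  proof (cases "t l = \<zero>\<^bsub>Q\<^esub>")
    case False
    have "\<exists>x. x \<in> G \<and> S (t l) x" using assms(1,2) by (fastforce simp: cochains_def)
    from someI_ex[OF this] show ?thesis using False by (simp add: u_def)
  qed (use assms(3,4) in \<open>simp add: u_def\<close>)
  moreover have "u \<in> cochains P G zs m"
    using calculation assms(1) by (auto simp: cochains_def u_def)
  ultimately show ?thesis by blast
qed

section \<open>Long exact sequences of Koszul cohomology\<close>

locale submodule_hom = P: module R P + Q: module R Q
  for R :: "('r, 'z) ring_scheme" (structure)
    and P :: "('r, 'p, 'y) module_scheme" and Q :: "('r, 'q, 'x) module_scheme" +
  fixes G H f
  assumes G: "submodule G R P" and H: "submodule H R Q"
    and hom: "f \<in> module_hom R (P\<lparr>carrier := G\<rparr>) (Q\<lparr>carrier := H\<rparr>)"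
begin

lemma closed: "x \<in> G \<Longrightarrow> f x \<in> H"
  and add: "x \<in> G \<Longrightarrow> y \<in> G \<Longrightarrow> f (x \<oplus>\<^bsub>P\<^esub> y) = f x \<oplus>\<^bsub>Q\<^esub> f y"
  and smult: "a \<in> carrier R \<Longrightarrow> x \<in> G \<Longrightarrow> f (a \<odot>\<^bsub>P\<^esub> x) = a \<odot>\<^bsub>Q\<^esub> f x"
  using hom by (auto simp: module_hom_def)

lemma carr: "x \<in> G \<Longrightarrow> f x \<in> carrier Q"
  using closed H Q.submodule_carrier by blast

lemma zero: "f \<zero>\<^bsub>P\<^esub> = \<zero>\<^bsub>Q\<^esub>"
  using smult[of \<zero> "\<zero>\<^bsub>P\<^esub>"] P.submodule_zero[OF G] carr by simp

lemma minus: "x \<in> G \<Longrightarrow> y \<in> G \<Longrightarrow> f (x \<ominus>\<^bsub>P\<^esub> y) = f x \<ominus>\<^bsub>Q\<^esub> f y"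
proof -
  assume xy: "x \<in> G" "y \<in> G"
  have c: "x \<in> carrier P" "y \<in> carrier P" using xy G P.submodule_carrier by blast+
  have "f x = f ((x \<ominus>\<^bsub>P\<^esub> y) \<oplus>\<^bsub>P\<^esub> y)" using c by (simp add: a_minus_def P.a_assoc P.M.l_neg)
  also have "\<dots> = f (x \<ominus>\<^bsub>P\<^esub> y) \<oplus>\<^bsub>Q\<^esub> f y" by (rule add) (use xy G P.submodule_minus in auto)
  finally have "f x \<ominus>\<^bsub>Q\<^esub> f y = f (x \<ominus>\<^bsub>P\<^esub> y)"
    using xy G P.submodule_minus carr by (subst Q.minus_eq_iff) auto
  then show ?thesis by simp
qed

lemma koszul:
  "set zs \<subseteq> carrier R \<Longrightarrow> (\<And>l. \<phi> l \<in> G) \<Longrightarrow> f (koszul P zs \<phi> l) = koszul Q zs (\<lambda>l. f (\<phi> l)) l"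
proof (induction zs arbitrary: \<phi> l)
  case Nil then show ?case by (simp add: zero)
next
  case (Cons z zs)
  show ?case
  proof (cases l)
    case (Cons b l')
    have "koszul P zs (\<lambda>l. \<phi> (c # l)) l' \<in> G" for c
      using Cons.prems by (intro P.koszul_closed[OF G]) auto
    then show ?thesis using Cons Cons.prems Cons.IH submodule.smult_closed[OF G]
      by (cases b) (auto simp: minus smult)
  qed (simp add: zero)
qed

lemma cochains: "\<phi> \<in> cochains P G zs m \<Longrightarrow> (\<lambda>l. f (\<phi> l)) \<in> cochains Q H zs m"
  by (auto simp: cochains_def closed zero)

end

text \<open>The assumptions say that \<open>0 \<rightarrow> G1 / N1 \<rightarrow> G2 / N2 \<rightarrow> G3 / N3 \<rightarrow> 0\<close> is exact.\<close>

locale ses = f: submodule_hom R P1 P2 G1 G2 f + g: submodule_hom R P2 P3 G2 G3 g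
  for R :: "('r, 'z) ring_scheme" (structure)
    and P1 :: "('r, 'p1, 'y1) module_scheme" and P2 :: "('r, 'p2, 'y2) module_scheme"
    and P3 :: "('r, 'p3, 'y3) module_scheme" and G1 G2 G3 f g +
  fixes N1 N2 N3 zs
  assumes N1: "submodule N1 R P1" "N1 \<subseteq> G1" and N2: "submodule N2 R P2" "N2 \<subseteq> G2"
    and N3: "submodule N3 R P3" "N3 \<subseteq> G3" and zs: "set zs \<subseteq> carrier R"
    and f_N: "x \<in> G1 \<Longrightarrow> f x \<in> N2 \<longleftrightarrow> x \<in> N1"
    and g_N: "u \<in> G2 \<Longrightarrow> g u \<in> N3 \<longleftrightarrow> (\<exists>x\<in>G1. u \<ominus>\<^bsub>P2\<^esub> f x \<in> N2)"
    and g_surj: "v \<in> G3 \<Longrightarrow> \<exists>u\<in>G2. v \<ominus>\<^bsub>P3\<^esub> g u \<in> N3"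
begin

lemma gf_N: "x \<in> G1 \<Longrightarrow> g (f x) \<in> N3"
  using f.closed[of x] f.carr[of x] f.Q.submodule_zero[OF N2(1)]
  by (intro iffD2[OF g_N] bexI[of _ x]) (simp_all add: a_minus_def f.Q.M.r_neg)

lemma gN: "n \<in> N2 \<Longrightarrow> g n \<in> N3"
  using f.zero f.P.submodule_zero[OF f.G] N2(2) f.Q.submodule_carrier[OF N2(1)]
  by (intro iffD2[OF g_N] bexI[of _ "\<zero>\<^bsub>P1\<^esub>"]) auto

lemma koszul_cong3:
  assumes "\<And>l. \<phi> l \<in> carrier P3" "\<And>l. \<psi> l \<in> carrier P3" "\<And>l. \<phi> l \<ominus>\<^bsub>P3\<^esub> \<psi> l \<in> N3"
  shows "koszul P3 zs \<phi> l \<ominus>\<^bsub>P3\<^esub> koszul P3 zs \<psi> l \<in> N3"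
  by (subst g.Q.koszul_minus[OF zs assms(1,2), symmetric]) (intro g.Q.koszul_closed[OF N3(1) zs] assms(3))

lemma koszul_cong2:
  assumes "\<And>l. \<phi> l \<in> carrier P2" "\<And>l. \<psi> l \<in> carrier P2" "\<And>l. \<phi> l \<ominus>\<^bsub>P2\<^esub> \<psi> l \<in> N2"
  shows "koszul P2 zs \<phi> l \<ominus>\<^bsub>P2\<^esub> koszul P2 zs \<psi> l \<in> N2"
  by (subst f.Q.koszul_minus[OF zs assms(1,2), symmetric]) (intro f.Q.koszul_closed[OF N2(1) zs] assms(3))

lemma koszul_mem3:
  assumes "\<And>l. \<phi> l \<in> carrier P3" "\<And>l. \<psi> l \<in> carrier P3" "\<And>l. \<phi> l \<ominus>\<^bsub>P3\<^esub> \<psi> l \<in> N3"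
  shows "koszul P3 zs \<phi> l \<in> N3 \<longleftrightarrow> koszul P3 zs \<psi> l \<in> N3"
  by (rule g.Q.submodule_cong_mem[OF N3(1) g.Q.koszul_carrier[OF zs] g.Q.koszul_carrier[OF zs] koszul_cong3[OF assms]])
    (rule assms)+

lemma koszul_mem2:
  assumes "\<And>l. \<phi> l \<in> carrier P2" "\<And>l. \<psi> l \<in> carrier P2" "\<And>l. \<phi> l \<ominus>\<^bsub>P2\<^esub> \<psi> l \<in> N2"
  shows "koszul P2 zs \<phi> l \<in> N2 \<longleftrightarrow> koszul P2 zs \<psi> l \<in> N2"
  by (rule f.Q.submodule_cong_mem[OF N2(1) f.Q.koszul_carrier[OF zs] f.Q.koszul_carrier[OF zs] koszul_cong2[OF assms]])
    (rule assms)+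

lemma carr1: "x \<in> G1 \<Longrightarrow> x \<in> carrier P1"
  and carr2: "y \<in> G2 \<Longrightarrow> y \<in> carrier P2"
  and carr3: "v \<in> G3 \<Longrightarrow> v \<in> carrier P3"
  using f.G f.H g.H f.P.submodule_carrier f.Q.submodule_carrier g.Q.submodule_carrier by blast+

lemma lift3:
  assumes "v \<in> cochains P3 G3 zs m"
  obtains v' where "v' \<in> cochains P2 G2 zs m" "\<And>l. v l \<ominus>\<^bsub>P3\<^esub> g (v' l) \<in> N3"
proof -
  have "\<exists>u\<in>cochains P2 G2 zs m. \<forall>l. v l \<ominus>\<^bsub>P3\<^esub> g (u l) \<in> N3"
    by (rule cochains_choose[OF assms]) (use g_surj g.zero g.Q.submodule_zero[OF N3(1)] f.Q.submodule_zero[OF g.G] in auto)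
  then show ?thesis using that by blast
qed

lemma lift2:
  assumes "t \<in> cochains P2 G2 zs m" "\<And>l. g (t l) \<in> N3"
  obtains u where "u \<in> cochains P1 G1 zs m" "\<And>l. t l \<ominus>\<^bsub>P2\<^esub> f (u l) \<in> N2"
proof -
  have "\<exists>u\<in>cochains P1 G1 zs m. \<forall>l. g (t l) \<in> N3 \<longrightarrow> t l \<ominus>\<^bsub>P2\<^esub> f (u l) \<in> N2"
    by (rule cochains_choose[OF assms(1)])
      (use g_N f.zero f.P.submodule_zero[OF f.G] f.Q.submodule_zero[OF N2(1)] in auto)
  then show ?thesis using that assms(2) by blast
qed

text \<open>Exactness at \<open>G1 / N1\<close>: a class that dies in \<open>G2 / N2\<close> comes
  from the connecting map, whose source vanishes. The primitive \<open>w\<close> is a parameter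
  because it may stem from vanishing for \<open>G2 / N2\<close> or from the homotopy.\<close>

lemma lift_coboundary:
  assumes van: "koszul_vanishing P3 G3 N3 zs m" and x: "x \<in> cochains P1 G1 zs (Suc m)" and w: "w \<in> cochains P2 G2 zs m"
    and fx: "\<And>l. f (x l) \<ominus>\<^bsub>P2\<^esub> koszul P2 zs w l \<in> N2"
  shows "\<exists>u\<in>cochains P1 G1 zs m. \<forall>l. x l \<ominus>\<^bsub>P1\<^esub> koszul P1 zs u l \<in> N1"
proof -
  note [simp] = f.P.cochains_in[OF x] f.Q.cochains_in[OF w] f.closed g.closed f.carr g.carr carr1 carr2 carr3
  have kw [simp]: "koszul P2 zs w l \<in> G2" for l by (intro f.Q.koszul_closed[OF f.H zs]) simp
  have "g (koszul P2 zs w l) \<in> N3" for l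
    using g_N[of "koszul P2 zs w l"] f.Q.submodule_cong_sym[OF N2(1) _ _ fx[of l]]
    by (intro iffD2[OF g_N]) (auto intro!: bexI[of _ "x l"])
  then have "koszul P3 zs (\<lambda>l. g (w l)) l \<in> N3" for l by (simp add: g.koszul[OF zs, symmetric])
  then obtain v where v: "v \<in> cochains P3 G3 zs (m - 1)" "\<And>l. g (w l) \<ominus>\<^bsub>P3\<^esub> koszul P3 zs v l \<in> N3"
    using van g.cochains[OF w] unfolding koszul_vanishing_def by meson
  obtain v' where v': "v' \<in> cochains P2 G2 zs (m - 1)" "\<And>l. v l \<ominus>\<^bsub>P3\<^esub> g (v' l) \<in> N3"
    using lift3[OF v(1)] by blast
  note [simp] = g.Q.cochains_in[OF v(1)] f.Q.cochains_in[OF v'(1)]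
  have kv' [simp]: "koszul P2 zs v' l \<in> G2" for l by (intro f.Q.koszul_closed[OF f.H zs]) simp
  have [simp]: "koszul P3 zs v l \<in> G3" for l by (intro g.Q.koszul_closed[OF g.H zs]) simp
  have [simp]: "koszul P3 zs (\<lambda>l. g (v' l)) l \<in> G3" for l by (intro g.Q.koszul_closed[OF g.H zs]) simp
  \<comment> \<open>Subtracting the coboundary of a lift of \<open>v\<close> keeps the coboundary of
    \<open>w\<close> and makes the image in \<open>G3 / N3\<close> zero, so that the difference
    comes from \<open>G1\<close>.\<close>
  define t where "t l = w l \<ominus>\<^bsub>P2\<^esub> koszul P2 zs v' l" for l
  have t: "t \<in> cochains P2 G2 zs m"
    unfolding t_def using f.Q.cochains_minus[OF f.H w f.Q.koszul_cochains_pred[OF f.H zs v'(1)]] .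
  note [simp] = f.Q.cochains_in[OF t]
  have "g (t l) \<in> N3" for l
  proof -
    have "g (t l) = g (w l) \<ominus>\<^bsub>P3\<^esub> koszul P3 zs (\<lambda>l. g (v' l)) l"
      by (simp add: t_def g.minus g.koszul[OF zs])
    moreover have "\<dots> \<in> N3"
      by (rule g.Q.submodule_cong_trans[OF N3(1) _ _ _ v(2)])
        (auto intro!: koszul_cong3 v'(2))
    ultimately show ?thesis by simp
  qed
  then obtain u where u: "u \<in> cochains P1 G1 zs m" "\<And>l. t l \<ominus>\<^bsub>P2\<^esub> f (u l) \<in> N2"
    using lift2[OF t] by blast
  note [simp] = f.P.cochains_in[OF u(1)]
  have [simp]: "koszul P1 zs u l \<in> G1" for l by (intro f.P.koszul_closed[OF f.G zs]) simp
  have [simp]: "koszul P2 zs (\<lambda>l. f (u l)) l \<in> G2" for l by (intro f.Q.koszul_closed[OF f.H zs]) simp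
  have "x l \<ominus>\<^bsub>P1\<^esub> koszul P1 zs u l \<in> N1" for l
  proof -
    have kt: "koszul P2 zs t l = koszul P2 zs w l"
      unfolding t_def by (subst f.Q.koszul_minus[OF zs]) (simp_all add: f.Q.koszul_koszul[OF zs])
    have "f (x l \<ominus>\<^bsub>P1\<^esub> koszul P1 zs u l) = f (x l) \<ominus>\<^bsub>P2\<^esub> koszul P2 zs (\<lambda>l. f (u l)) l"
      by (simp add: f.minus f.koszul[OF zs])
    also have "\<dots> \<in> N2"
    proof (rule f.Q.submodule_cong_trans[OF N2(1) _ _ _ fx])
      show "koszul P2 zs w l \<ominus>\<^bsub>P2\<^esub> koszul P2 zs (\<lambda>l. f (u l)) l \<in> N2"
        using koszul_cong2[of t "\<lambda>l. f (u l)" l] u(2) unfolding kt by simp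
    qed simp_all
    finally show ?thesis using f_N f.P.submodule_minus[OF f.G] by simp
  qed
  then show ?thesis using u(1) by blast
qed

text \<open>In the long exact sequence \<open>H\<^sup>i(G3 / N3)\<close> lies between
  \<open>H\<^sup>i(G2 / N2)\<close> and \<open>H\<^sup>i\<^sup>+\<^sup>1(G1 / N1)\<close>; hence the
  larger bound for \<open>G1\<close>.\<close>

lemma koszul_vanishing_right:
  assumes van2: "koszul_vanishing P2 G2 N2 zs m" and van1: "koszul_vanishing P1 G1 N1 zs (Suc m)"
  shows "koszul_vanishing P3 G3 N3 zs m"
  unfolding koszul_vanishing_def
proof (intro ballI impI)
  fix z assume z: "z \<in> cochains P3 G3 zs m" and kz: "\<forall>l. koszul P3 zs z l \<in> N3"
  note [simp] = g.Q.cochains_in[OF z] f.closed g.closed f.carr g.carr carr1 carr2 carr3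
  obtain w where w: "w \<in> cochains P2 G2 zs m" "\<And>l. z l \<ominus>\<^bsub>P3\<^esub> g (w l) \<in> N3"
    using lift3[OF z] by blast
  note [simp] = f.Q.cochains_in[OF w(1)]
  have [simp]: "koszul P2 zs w l \<in> G2" for l by (intro f.Q.koszul_closed[OF f.H zs]) simp
  have [simp]: "koszul P3 zs z l \<in> G3" for l by (intro g.Q.koszul_closed[OF g.H zs]) simp
  have [simp]: "koszul P3 zs (\<lambda>l. g (w l)) l \<in> G3" for l by (intro g.Q.koszul_closed[OF g.H zs]) simp
  have "g (koszul P2 zs w l) \<in> N3" for l
    using koszul_mem3[of z "\<lambda>l. g (w l)" l] w(2) kz by (simp add: g.koszul[OF zs])
  \<comment> \<open>\<open>x\<close> represents the image of the class of \<open>z\<close> under the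
    connecting map.\<close>
  then obtain x where x: "x \<in> cochains P1 G1 zs (Suc m)" "\<And>l. koszul P2 zs w l \<ominus>\<^bsub>P2\<^esub> f (x l) \<in> N2"
    using lift2[OF f.Q.koszul_cochains[OF f.H zs w(1)]] by blast
  note [simp] = f.P.cochains_in[OF x(1)]
  have [simp]: "koszul P1 zs x l \<in> G1" for l by (intro f.P.koszul_closed[OF f.G zs]) simp
  have [simp]: "koszul P2 zs (\<lambda>l. f (x l)) l \<in> G2" for l by (intro f.Q.koszul_closed[OF f.H zs]) simp
  have "koszul P1 zs x l \<in> N1" for l
  proof -
    have "koszul P2 zs (\<lambda>l. f (x l)) l \<in> N2"
      using koszul_mem2[of "koszul P2 zs w" "\<lambda>l. f (x l)" l] x(2) f.Q.submodule_zero[OF N2(1)]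
      by (simp add: f.Q.koszul_koszul[OF zs])
    then show ?thesis using f_N[of "koszul P1 zs x l"] f.koszul[OF zs, of x l] by simp
  qed
  then obtain u where u: "u \<in> cochains P1 G1 zs m" "\<And>l. x l \<ominus>\<^bsub>P1\<^esub> koszul P1 zs u l \<in> N1"
    using van1 x(1) unfolding koszul_vanishing_def by (metis diff_Suc_1)
  note [simp] = f.P.cochains_in[OF u(1)]
  have [simp]: "koszul P1 zs u l \<in> G1" for l by (intro f.P.koszul_closed[OF f.G zs]) simp
  have [simp]: "koszul P2 zs (\<lambda>l. f (u l)) l \<in> G2" for l by (intro f.Q.koszul_closed[OF f.H zs]) simp
  have fxu: "f (x l) \<ominus>\<^bsub>P2\<^esub> koszul P2 zs (\<lambda>l. f (u l)) l \<in> N2" for l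
    using u(2)[of l] f_N[of "x l \<ominus>\<^bsub>P1\<^esub> koszul P1 zs u l"] f.P.submodule_minus[OF f.G]
    by (simp add: f.minus f.koszul[OF zs])
  \<comment> \<open>The correction by \<open>f (u l)\<close> turns the lift into a cocycle of
    \<open>G2 / N2\<close>; the class in \<open>G3 / N3\<close> stays the same because
    \<open>g\<close> after \<open>f\<close> lands in \<open>N3\<close>.\<close>
  define w' where "w' l = w l \<ominus>\<^bsub>P2\<^esub> f (u l)" for l
  have w': "w' \<in> cochains P2 G2 zs m"
    unfolding w'_def using f.Q.cochains_minus[OF f.H w(1) f.cochains[OF u(1)]] .
  note [simp] = f.Q.cochains_in[OF w']
  have "koszul P2 zs w' l \<in> N2" for l
    unfolding w'_def
    by (subst f.Q.koszul_minus[OF zs]) (auto intro: f.Q.submodule_cong_trans[OF N2(1) _ _ _ x(2) fxu])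
  then obtain t where t: "t \<in> cochains P2 G2 zs (m - 1)" "\<And>l. w' l \<ominus>\<^bsub>P2\<^esub> koszul P2 zs t l \<in> N2"
    using van2 w' unfolding koszul_vanishing_def by meson
  note [simp] = f.Q.cochains_in[OF t(1)]
  have [simp]: "koszul P2 zs t l \<in> G2" for l by (intro f.Q.koszul_closed[OF f.H zs]) simp
  have [simp]: "koszul P3 zs (\<lambda>l. g (t l)) l \<in> G3" for l by (intro g.Q.koszul_closed[OF g.H zs]) simp
  have "z l \<ominus>\<^bsub>P3\<^esub> koszul P3 zs (\<lambda>l. g (t l)) l \<in> N3" for l
  proof (rule g.Q.submodule_cong_trans[OF N3(1) _ _ _ w(2)])
    have gw: "g (w' l) = g (w l) \<ominus>\<^bsub>P3\<^esub> g (f (u l))" by (simp add: w'_def g.minus)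
    have "g (w l) \<ominus>\<^bsub>P3\<^esub> g (w' l) = g (f (u l))"
      unfolding gw by (simp add: a_minus_def g.Q.minus_add g.Q.r_neg2)
    then have "g (w l) \<ominus>\<^bsub>P3\<^esub> g (w' l) \<in> N3" using gf_N by simp
    moreover have "g (w' l) \<ominus>\<^bsub>P3\<^esub> koszul P3 zs (\<lambda>l. g (t l)) l \<in> N3"
      using gN[OF t(2)[of l]] by (simp add: g.minus g.koszul[OF zs])
    ultimately show "g (w l) \<ominus>\<^bsub>P3\<^esub> koszul P3 zs (\<lambda>l. g (t l)) l \<in> N3"
      by (rule g.Q.submodule_cong_trans[OF N3(1), rotated 3]) auto
  qed auto
  then show "\<exists>w\<in>cochains P3 G3 zs (m - 1). \<forall>l. z l \<ominus>\<^bsub>P3\<^esub> koszul P3 zs w l \<in> N3"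
    using g.cochains[OF t(1)] by blast
qed

text \<open>Here \<open>H\<^sup>i(G1 / N1)\<close> lies between
  \<open>H\<^sup>i\<^sup>-\<^sup>1(G3 / N3)\<close> and \<open>H\<^sup>i(G2 / N2)\<close>, so one
  degree less is required of \<open>G3\<close>.\<close>

lemma koszul_vanishing_left:
  assumes "koszul_vanishing P3 G3 N3 zs m" "koszul_vanishing P2 G2 N2 zs (Suc m)"
  shows "koszul_vanishing P1 G1 N1 zs (Suc m)"
  unfolding koszul_vanishing_def
proof (intro ballI impI)
  fix x assume x: "x \<in> cochains P1 G1 zs (Suc m)" and kx: "\<forall>l. koszul P1 zs x l \<in> N1"
  have "koszul P2 zs (\<lambda>l. f (x l)) l \<in> N2" for l
    using kx f.koszul[OF zs, of x] f.P.cochains_in[OF x] f_N N1(2) by (metis subsetD)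
  then obtain w where "w \<in> cochains P2 G2 zs m" "\<And>l. f (x l) \<ominus>\<^bsub>P2\<^esub> koszul P2 zs w l \<in> N2"
    using assms(2) f.cochains[OF x] unfolding koszul_vanishing_def by (metis diff_Suc_1)
  then show "\<exists>w\<in>cochains P1 G1 zs (Suc m - 1). \<forall>l. x l \<ominus>\<^bsub>P1\<^esub> koszul P1 zs w l \<in> N1"
    using lift_coboundary[OF assms(1) x] by simp
qed

end

section \<open>Degree bounds, degree zero, and multiplication by a regular element\<close>

context module
begin

text \<open>The differential is homogeneous of degree one, so dropping the degrees from
  \<open>m\<close> on in a cochain drops the degrees from \<open>Suc m\<close> on in its
  coboundary.\<close>

lemma koszul_trunc:
  "set zs \<subseteq> carrier R \<Longrightarrow> (\<And>l. \<phi> l \<in> carrier M) \<Longrightarrow>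
   koszul M zs (\<lambda>l. if count_list l True < m then \<phi> l else \<zero>\<^bsub>M\<^esub>) l =
   (if count_list l True < Suc m then koszul M zs \<phi> l else \<zero>\<^bsub>M\<^esub>)"
proof (induction zs arbitrary: \<phi> l m)
  case (Cons z zs)
  show ?case
  proof (cases l)
    case (Cons b l')
    show ?thesis
    proof (cases b)
      case False
      then show ?thesis using Cons Cons.prems Cons.IH[where \<phi> = "\<lambda>l. \<phi> (False # l)" and l = l' and m = m] by simp
    next
      case True
      have "koszul M zs (\<lambda>l. if Suc (count_list l True) < m then \<phi> (True # l) else \<zero>\<^bsub>M\<^esub>) l' =
        (if count_list l' True < m then koszul M zs (\<lambda>l. \<phi> (True # l)) l' else \<zero>\<^bsub>M\<^esub>)"
      proof (cases m)
        case 0 then show ?thesis using Cons.prems by (simp add: koszul_zero)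
      next
        case (Suc m')
        then show ?thesis using Cons.prems Cons.IH[where \<phi> = "\<lambda>l. \<phi> (True # l)" and l = l' and m = m'] by simp
      qed
      moreover have "koszul M zs (\<lambda>l. \<phi> (True # l)) l' \<in> carrier M"
        using Cons.prems by (intro koszul_carrier) auto
      ultimately show ?thesis using Cons Cons.prems True by simp
    qed
  qed simp
qed simp

lemma cochains_trunc:
  assumes "submodule G R M" "w \<in> cochains M G zs n"
  shows "(\<lambda>l. if count_list l True < m then w l else \<zero>\<^bsub>M\<^esub>) \<in> cochains M G zs m"
  using assms(2) submodule_zero[OF assms(1)] by (auto simp: cochains_def)

text \<open>A primitive without any degree bound suffices: its components of degree
  \<open>m - 1\<close> and higher only affect the coboundary in degrees where \<phi> is zero, and
  can be cut off.\<close>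

lemma koszul_vanishingI:
  assumes G: "submodule G R M" and N: "submodule N R M" and zs: "set zs \<subseteq> carrier R"
    and *: "\<And>\<phi>. \<phi> \<in> cochains M G zs m \<Longrightarrow> (\<And>l. koszul M zs \<phi> l \<in> N) \<Longrightarrow>
      \<exists>n. \<exists>w\<in>cochains M G zs n. \<forall>l. \<phi> l \<ominus>\<^bsub>M\<^esub> koszul M zs w l \<in> N"
  shows "koszul_vanishing M G N zs m"
  unfolding koszul_vanishing_def
proof (intro ballI impI)
  fix \<phi> assume \<phi>: "\<phi> \<in> cochains M G zs m" and k: "\<forall>l. koszul M zs \<phi> l \<in> N"
  obtain n w where w: "w \<in> cochains M G zs n" "\<And>l. \<phi> l \<ominus>\<^bsub>M\<^esub> koszul M zs w l \<in> N"
    using *[OF \<phi>] k by blast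
  let ?w = "\<lambda>l. if count_list l True < m - 1 then w l else \<zero>\<^bsub>M\<^esub>"
  have wc: "w l \<in> carrier M" for l using cochains_in[OF w(1)] submodule_carrier[OF G] by blast
  have "\<phi> l \<ominus>\<^bsub>M\<^esub> koszul M zs ?w l \<in> N" for l
  proof (cases "count_list l True < m")
    case True
    then have "koszul M zs ?w l = koszul M zs w l" by (subst koszul_trunc[OF zs wc]) auto
    then show ?thesis using w(2) by simp
  next
    case False
    then have "\<phi> l = \<zero>\<^bsub>M\<^esub>" using \<phi> by (simp add: cochains_def)
    moreover have "koszul M zs ?w l = \<zero>\<^bsub>M\<^esub>"
    proof (cases m)
      case 0 then show ?thesis by (simp add: koszul_zero[OF zs])
    next
      case (Suc m') then show ?thesis using False by (subst koszul_trunc[OF zs wc]) auto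
    qed
    ultimately show ?thesis using submodule_zero[OF N] by simp
  qed
  then show "\<exists>w\<in>cochains M G zs (m - 1). \<forall>l. \<phi> l \<ominus>\<^bsub>M\<^esub> koszul M zs w l \<in> N"
    using cochains_trunc[OF G w(1)] by blast
qed

text \<open>A cochain with the smaller bound also satisfies the larger one; the primitive found
  there may have too high a degree, which \<open>koszul_vanishingI\<close> repairs.\<close>

lemma koszul_vanishing_mono:
  assumes G: "submodule G R M" and N: "submodule N R M" and zs: "set zs \<subseteq> carrier R"
    and "koszul_vanishing M G N zs n" "m \<le> n"
  shows "koszul_vanishing M G N zs m"
  using assms(4) cochains_mono[OF assms(5), of G zs]
  by (intro koszul_vanishingI[OF G N zs]) (unfold koszul_vanishing_def, blast)

text \<open>A cochain of degree 0 is a single element, placed at the list without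
  \<open>True\<close>; the components of its coboundary are the multiples by the members of
  \<open>zs\<close>.\<close>

lemma koszul_1:
  "set zs \<subseteq> carrier R \<Longrightarrow> submodule N R M \<Longrightarrow> \<phi> \<in> cochains M (carrier M) zs 1 \<Longrightarrow>
   (\<forall>l. koszul M zs \<phi> l \<in> N) \<longleftrightarrow> (\<forall>z\<in>set zs. z \<odot>\<^bsub>M\<^esub> \<phi> (replicate (length zs) False) \<in> N)"
proof (induction zs arbitrary: \<phi>)
  case Nil then show ?case by (simp add: submodule_zero)
next
  case (Cons z zs)
  have F: "(\<lambda>l. \<phi> (False # l)) \<in> cochains M (carrier M) zs 1" and T: "\<And>l. \<phi> (True # l) = \<zero>\<^bsub>M\<^esub>"
    using Cons.prems(3) by (auto simp: cochains_def)
  have all: "(\<forall>l. Q l) \<longleftrightarrow> Q [] \<and> (\<forall>l. Q (True # l)) \<and> (\<forall>l. Q (False # l))" for Q :: "bool list \<Rightarrow> bool"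
    by (metis (full_types) list.exhaust)
  have "(\<forall>l. koszul M (z # zs) \<phi> l \<in> N) \<longleftrightarrow> (\<forall>l. z \<odot>\<^bsub>M\<^esub> \<phi> (False # l) \<in> N) \<and> (\<forall>l. koszul M zs (\<lambda>l. \<phi> (False # l)) l \<in> N)"
    using Cons.prems cochains_in[OF F] by (subst all) (simp add: T koszul_zero submodule_zero)
  also have "(\<forall>l. z \<odot>\<^bsub>M\<^esub> \<phi> (False # l) \<in> N) \<longleftrightarrow> z \<odot>\<^bsub>M\<^esub> \<phi> (False # replicate (length zs) False) \<in> N"
  proof (intro iffI allI)
    fix l assume a: "z \<odot>\<^bsub>M\<^esub> \<phi> (False # replicate (length zs) False) \<in> N"
    show "z \<odot>\<^bsub>M\<^esub> \<phi> (False # l) \<in> N"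
    proof (cases "l = replicate (length zs) False")
      case False
      have "\<phi> (False # l) = \<zero>\<^bsub>M\<^esub>"
      proof (rule ccontr)
        assume "\<phi> (False # l) \<noteq> \<zero>\<^bsub>M\<^esub>"
        then have l: "length l = length zs" "count_list l True = 0" using F unfolding cochains_def by auto
        then have "\<forall>x\<in>set l. x = False" by (metis (full_types) count_list_0_iff)
        then show False using False l(1) by (metis replicate_length_same)
      qed
      then show ?thesis using Cons.prems by (simp add: submodule_zero)
    qed (use a in simp)
  qed simp
  also have "(\<forall>l. koszul M zs (\<lambda>l. \<phi> (False # l)) l \<in> N) \<longleftrightarrow> (\<forall>z\<in>set zs. z \<odot>\<^bsub>M\<^esub> \<phi> (False # replicate (length zs) False) \<in> N)"
    using Cons.IH[OF _ _ F] Cons.prems by simp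
  finally show ?case by simp
qed

text \<open>\<open>H\<^sup>0\<close> is the submodule of \<open>G / N\<close> killed by all members
  of \<open>zs\<close>. This is where vanishing becomes a statement about socles.\<close>

lemma koszul_vanishing_1:
  assumes G: "submodule G R M" and zs: "set zs \<subseteq> carrier R" and N: "submodule N R M"
  shows "koszul_vanishing M G N zs 1 \<longleftrightarrow> (\<forall>x\<in>G. (\<forall>z\<in>set zs. z \<odot>\<^bsub>M\<^esub> x \<in> N) \<longrightarrow> x \<in> N)"
proof
  assume v: "koszul_vanishing M G N zs 1"
  show "\<forall>x\<in>G. (\<forall>z\<in>set zs. z \<odot>\<^bsub>M\<^esub> x \<in> N) \<longrightarrow> x \<in> N"
  proof (intro ballI impI)
    fix x assume x: "x \<in> G" "\<forall>z\<in>set zs. z \<odot>\<^bsub>M\<^esub> x \<in> N"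
    define \<phi> where "\<phi> l = (if l = replicate (length zs) False then x else \<zero>\<^bsub>M\<^esub>)" for l
    have ct: "count_list (replicate n False) True = 0" for n by (induction n) auto
    have c: "\<phi> \<in> cochains M G zs 1" using x submodule_zero[OF G] ct by (auto simp: cochains_def \<phi>_def)
    then have "\<phi> \<in> cochains M (carrier M) zs 1" using submodule_carrier[OF G] by (auto simp: cochains_def)
    then have "\<forall>l. koszul M zs \<phi> l \<in> N" using koszul_1[OF zs N] x(2) by (simp add: \<phi>_def)
    then obtain w where w: "w \<in> cochains M G zs 0" "\<And>l. \<phi> l \<ominus>\<^bsub>M\<^esub> koszul M zs w l \<in> N"
      using v c unfolding koszul_vanishing_def by auto
    then have "\<phi> (replicate (length zs) False) \<in> N"
      using cochains_0[OF w(1)] submodule_carrier[OF G] x(1) w(2)[of "replicate (length zs) False"]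
      by (simp add: koszul_zero[OF zs] \<phi>_def)
    then show "x \<in> N" by (simp add: \<phi>_def)
  qed
next
  assume a: "\<forall>x\<in>G. (\<forall>z\<in>set zs. z \<odot>\<^bsub>M\<^esub> x \<in> N) \<longrightarrow> x \<in> N"
  show "koszul_vanishing M G N zs 1"
  proof (rule koszul_vanishingI[OF G N zs])
    fix \<phi> assume \<phi>: "\<phi> \<in> cochains M G zs 1" and k: "\<And>l. koszul M zs \<phi> l \<in> N"
    have \<phi>': "\<phi> \<in> cochains M (carrier M) zs 1" using \<phi> submodule_carrier[OF G] by (auto simp: cochains_def)
    have x: "\<phi> (replicate (length zs) False) \<in> N"
      using koszul_1[OF zs N \<phi>'] k a cochains_in[OF \<phi>] by blast
    have "\<phi> l \<in> N" for l
    proof (cases "length l = length zs \<and> count_list l True < 1")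
      case True
      then have "\<forall>x\<in>set l. x = False" by (metis (full_types) count_list_0_iff less_one)
      then have "l = replicate (length zs) False" using True by (metis replicate_length_same)
      then show ?thesis using x by simp
    next
      case False
      then have "\<phi> l = \<zero>\<^bsub>M\<^esub>" using \<phi> unfolding cochains_def by blast
      then show ?thesis using submodule_zero[OF N] by simp
    qed
    then show "\<exists>n. \<exists>w\<in>cochains M G zs n. \<forall>l. \<phi> l \<ominus>\<^bsub>M\<^esub> koszul M zs w l \<in> N"
      using cochains_zero[OF G, of zs 0] submodule_carrier[OF G cochains_in[OF \<phi>]]
      by (intro exI[of _ 0] bexI[of _ "\<lambda>l. \<zero>\<^bsub>M\<^esub>"]) (simp_all add: koszul_zero[OF zs])
  qed
qed

text \<open>By the homotopy, \<open>y\<close> annihilates the Koszul cohomology, so the long exact sequence of multiplication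
  by \<open>y\<close> on \<open>G / N\<close>, with cokernel \<open>G / N'\<close>, breaks up into short ones.\<close>

lemma koszul_vanishing_regular:
  assumes G: "submodule G R M" and N: "submodule N R M" "N \<subseteq> G" and N': "submodule N' R M" "N' \<subseteq> G"
    and zs: "set zs \<subseteq> carrier R" and y: "y \<in> set zs"
    and reg: "\<And>x. x \<in> G \<Longrightarrow> y \<odot>\<^bsub>M\<^esub> x \<in> N \<Longrightarrow> x \<in> N"
    and N'_iff: "\<And>u. u \<in> G \<Longrightarrow> u \<in> N' \<longleftrightarrow> (\<exists>x\<in>G. u \<ominus>\<^bsub>M\<^esub> y \<odot>\<^bsub>M\<^esub> x \<in> N)"
  shows "koszul_vanishing M G N zs (Suc m) \<longleftrightarrow> koszul_vanishing M G N' zs m"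
proof -
  have yR: "y \<in> carrier R" using y zs by blast
  have Gc: "x \<in> G \<Longrightarrow> x \<in> carrier M" for x using submodule_carrier[OF G] .
  have hf: "(\<lambda>x. y \<odot>\<^bsub>M\<^esub> x) \<in> module_hom R (M\<lparr>carrier := G\<rparr>) (M\<lparr>carrier := G\<rparr>)"
    using yR Gc submodule.smult_closed[OF G]
    by (auto simp: module_hom_def smult_r_distr smult_assoc1[symmetric] R.m_comm)
  have hg: "(\<lambda>x. x) \<in> module_hom R (M\<lparr>carrier := G\<rparr>) (M\<lparr>carrier := G\<rparr>)"
    by (auto simp: module_hom_def)
  interpret ses R M M M G G G "\<lambda>x. y \<odot>\<^bsub>M\<^esub> x" "\<lambda>x. x" N N N' zs
  proof (intro ses.intro submodule_hom.intro submodule_hom_axioms.intro ses_axioms.intro module_axioms G N N' zs hf hg)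
    show "\<exists>u\<in>G. v \<ominus>\<^bsub>M\<^esub> u \<in> N'" if "v \<in> G" for v
      using that Gc submodule_zero[OF N'(1)] by (intro bexI[of _ v]) (simp_all add: a_minus_def M.r_neg)
    show "y \<odot>\<^bsub>M\<^esub> x \<in> N \<longleftrightarrow> x \<in> N" if "x \<in> G" for x
      using that reg submodule.smult_closed[OF N(1) yR] by blast
  qed (use N'_iff in auto)
  show ?thesis
  proof
    assume v: "koszul_vanishing M G N zs (Suc m)"
    then have "koszul_vanishing M G N zs m" by (rule koszul_vanishing_mono[OF G N(1) zs]) simp
    then show "koszul_vanishing M G N' zs m" using koszul_vanishing_right v by blast
  next
    assume v: "koszul_vanishing M G N' zs m"
    show "koszul_vanishing M G N zs (Suc m)"
      unfolding koszul_vanishing_def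
    proof (intro ballI impI)
      fix x assume x: "x \<in> cochains M G zs (Suc m)" and kx: "\<forall>l. koszul M zs x l \<in> N"
      obtain k where k: "k < length zs" "y = zs ! k" using y by (metis in_set_conv_nth)
      have xc: "x l \<in> carrier M" for l using Gc cochains_in[OF x] by blast
      have w: "homotopy M k x \<in> cochains M G zs m"
        using homotopy_closed[OF G, of x k] cochains_in[OF x] homotopy_cochains[OF k(1), of m x] x
        unfolding cochains_def by blast
      have "y \<odot>\<^bsub>M\<^esub> x l \<ominus>\<^bsub>M\<^esub> koszul M zs (homotopy M k x) l \<in> N" for l
      proof (cases "length l = length zs")
        case True
        have c: "koszul M zs (homotopy M k x) l \<in> carrier M" "homotopy M k (koszul M zs x) l \<in> carrier M"
          using cochains_in[OF w] Gc xc by (auto intro!: koszul_carrier[OF zs] homotopy_closed[OF carrier_is_submodule])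
        have "y \<odot>\<^bsub>M\<^esub> x l \<ominus>\<^bsub>M\<^esub> koszul M zs (homotopy M k x) l = homotopy M k (koszul M zs x) l"
          using koszul_homotopy[OF zs _ k(1) True, of x] c yR xc k(2) by (subst M.minus_eq_iff) (auto simp: M.a_comm)
        then show ?thesis using homotopy_closed[OF N(1), of "koszul M zs x" k l] kx by simp
      next
        case False
        then have "x l = \<zero>\<^bsub>M\<^esub>" "koszul M zs (homotopy M k x) l = \<zero>\<^bsub>M\<^esub>"
          using x koszul_cochains[OF G zs w] by (auto simp: cochains_def)
        then show ?thesis using yR submodule_zero[OF N(1)] by simp
      qed
      then show "\<exists>w\<in>cochains M G zs (Suc m - 1). \<forall>l. x l \<ominus>\<^bsub>M\<^esub> koszul M zs w l \<in> N"
        using lift_coboundary[OF v x w] by simp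
    qed
  qed
qed

end

section \<open>Torsion of injective modules\<close>

context cring
begin

lemma ideal_pow_0: "ideal_pow R I 0 = carrier R"
  by (simp add: ideals_set_def)

lemma ideal_pow_Suc: "ideal_pow R I (Suc n) = ideal_pow R I n \<cdot> I"
  by (simp add: ideals_set_def)

lemma ideal_pow_ideal: "ideal I R \<Longrightarrow> ideal (ideal_pow R I n) R"
proof (induction n)
  case 0 show ?case unfolding ideal_pow_0 by (rule oneideal)
next
  case (Suc n) then show ?case unfolding ideal_pow_Suc by (simp add: ideal_prod_is_ideal)
qed

lemma ideal_pow_add:
  assumes "ideal I R"
  shows "ideal_pow R I (m + n) = ideal_pow R I m \<cdot> ideal_pow R I n"
proof -
  interpret IS: comm_monoid "ideals_set R" by (rule ideals_set_is_comm_monoid)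
  have "I \<in> carrier (ideals_set R)" using assms by (simp add: ideals_set_def)
  from IS.nat_pow_mult[OF this, of m n] show ?thesis by (simp add: ideals_set_def)
qed

lemma ideal_pow_1: "ideal I R \<Longrightarrow> ideal_pow R I 1 = I"
  using monoid.nat_pow_eone[of "ideals_set R" I] comm_monoid.axioms(1)[OF ideals_set_is_comm_monoid]
  by (simp add: ideals_set_def)

lemma ideal_pow_mult_mem:
  "ideal I R \<Longrightarrow> a \<in> ideal_pow R I m \<Longrightarrow> b \<in> ideal_pow R I n \<Longrightarrow> a \<otimes> b \<in> ideal_pow R I (m + n)"
  by (simp add: ideal_pow_add ideal_prod.prod)

lemma ideal_pow_antimono:
  assumes "ideal I R" "m \<le> n" shows "ideal_pow R I n \<subseteq> ideal_pow R I m"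
  using ideal_prod_inter[OF ideal_pow_ideal ideal_pow_ideal, of I I m "n - m"] assms ideal_pow_add[of I m "n - m"] by auto

lemma ideal_pow_elem: "ideal I R \<Longrightarrow> a \<in> I \<Longrightarrow> a [^] n \<in> ideal_pow R I n"
proof (induction n)
  case 0 show ?case unfolding ideal_pow_0 by simp
next
  case (Suc n) then show ?case unfolding ideal_pow_Suc nat_pow_Suc by (simp add: ideal_prod.prod)
qed

lemma ideal_colon:
  assumes "ideal I R" "a \<in> carrier R"
  shows "ideal {r \<in> carrier R. a \<otimes> r \<in> I} R"
proof (rule idealI[OF ring_axioms])
  show "subgroup {r \<in> carrier R. a \<otimes> r \<in> I} (add_monoid R)"
  proof (rule add.subgroupI)
    show "{r \<in> carrier R. a \<otimes> r \<in> I} \<noteq> {}"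
      using assms additive_subgroup.zero_closed[OF ideal.axioms(1)[OF assms(1)]] r_null zero_closed by fastforce
    fix r assume "r \<in> {r \<in> carrier R. a \<otimes> r \<in> I}"
    then show "\<ominus> r \<in> {r \<in> carrier R. a \<otimes> r \<in> I}"
      using assms additive_subgroup.a_inv_closed[OF ideal.axioms(1)[OF assms(1)]] by (simp add: r_minus)
    fix r' assume "r' \<in> {r \<in> carrier R. a \<otimes> r \<in> I}"
    then show "r \<oplus> r' \<in> {r \<in> carrier R. a \<otimes> r \<in> I}" if "r \<in> {r \<in> carrier R. a \<otimes> r \<in> I}"
      using that assms additive_subgroup.a_closed[OF ideal.axioms(1)[OF assms(1)]] by (simp add: r_distr)
  qed (use assms in auto)
next
  fix r x assume r: "r \<in> {r \<in> carrier R. a \<otimes> r \<in> I}" "x \<in> carrier R"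
  have "a \<otimes> (r \<otimes> x) = (a \<otimes> r) \<otimes> x" using r assms(2) by (simp add: m_assoc)
  then show "r \<otimes> x \<in> {r \<in> carrier R. a \<otimes> r \<in> I}"
    using r ideal.I_r_closed[OF assms(1)] by simp
  then show "x \<otimes> r \<in> {r \<in> carrier R. a \<otimes> r \<in> I}"
    using r m_comm[of x r] by simp
qed

lemma mem_add_cgenideal:
  assumes "ideal I R" "a \<in> carrier R"
  shows "x \<in> I <+> PIdl a \<longleftrightarrow> (\<exists>i\<in>I. \<exists>r\<in>carrier R. x = i \<oplus> a \<otimes> r)"
  using assms by (auto simp: set_add_def' cgenideal_def m_comm)

lemma add_cgenideal_sup:
  assumes "ideal I R" "a \<in> carrier R"
  shows "I \<subseteq> I <+> PIdl a" "a \<in> I <+> PIdl a" "ideal (I <+> PIdl a) R"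
proof -
  have "x = x \<oplus> a \<otimes> \<zero>" if "x \<in> I" for x using ideal.Icarr[OF assms(1) that] assms(2) by simp
  then show "I \<subseteq> I <+> PIdl a" using mem_add_cgenideal[OF assms] zero_closed by blast
  have "a = \<zero> \<oplus> a \<otimes> \<one>" using assms(2) by simp
  then show "a \<in> I <+> PIdl a"
    using mem_add_cgenideal[OF assms] additive_subgroup.zero_closed[OF ideal.axioms(1)[OF assms(1)]] one_closed by blast
  show "ideal (I <+> PIdl a) R" using add_ideals assms cgenideal_ideal by blast
qed

end

text \<open>The union of a nonempty chain of ideals is itself a member of the chain, so Zorn's lemma
  applies to every nonempty family, whether or not it is closed under unions.\<close>

lemma (in noetherian_ring) maximal_ideal_of_family:
  assumes "I0 \<in> S" "\<forall>I\<in>S. ideal I R"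
  shows "\<exists>I\<in>S. \<forall>J\<in>S. I \<subseteq> J \<longrightarrow> J = I"
proof (rule subset_Zorn)
  fix C assume C: "subset.chain S C"
  show "\<exists>U\<in>S. \<forall>J\<in>C. J \<subseteq> U"
  proof (cases "C = {}")
    case True then show ?thesis using assms(1) by blast
  next
    case False
    have CS: "C \<subseteq> S" using C by (simp add: pred_on.chain_def)
    have "subset.chain {I. ideal I R} C"
      unfolding pred_on.chain_def
    proof (intro conjI)
      show "C \<subseteq> {I. ideal I R}" using CS assms(2) by blast
    qed (use C in \<open>simp add: pred_on.chain_def\<close>)
    from ideal_chain_is_trivial[OF False this] have "\<Union>C \<in> S" using CS by blast
    then show ?thesis by blast
  qed
qed

text \<open>If \<open>\<pp> \<supseteq> \<qq>\<close> is a maximal counterexample and \<open>z \<in> \<aa> - \<pp>\<close>, then \<open>\<aa>\<^sup>m \<subseteq> \<pp> + (z)\<close> for some \<open>m\<close>, hence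
  \<open>\<aa>\<^sup>m\<^sup>j \<subseteq> \<pp> + (z\<^sup>j) = \<pp>\<close> for some \<open>j\<close>.\<close>

lemma (in cring) ideal_pow_subset_of_nilpotent:
  assumes "noetherian_ring R" and q: "ideal \<qq> R" and a: "ideal \<aa> R"
    and nil: "\<And>z. z \<in> \<aa> \<Longrightarrow> \<exists>i::nat. z [^] i \<in> \<qq>"
  shows "\<exists>m. ideal_pow R \<aa> m \<subseteq> \<qq>"
proof (rule ccontr)
  interpret noetherian_ring R by fact
  assume no: "\<nexists>m. ideal_pow R \<aa> m \<subseteq> \<qq>"
  define S where "S = {\<pp>. ideal \<pp> R \<and> \<qq> \<subseteq> \<pp> \<and> (\<nexists>m. ideal_pow R \<aa> m \<subseteq> \<pp>)}"
  have "\<qq> \<in> S" using no q by (simp add: S_def)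
  moreover have "\<forall>I\<in>S. ideal I R" by (simp add: S_def)
  ultimately obtain \<pp> where p: "\<pp> \<in> S" and max: "\<And>J. J \<in> S \<Longrightarrow> \<pp> \<subseteq> J \<Longrightarrow> J = \<pp>"
    using maximal_ideal_of_family[of \<qq> S] by blast
  have pI: "ideal \<pp> R" and qp: "\<qq> \<subseteq> \<pp>" and nop: "\<And>m. \<not> ideal_pow R \<aa> m \<subseteq> \<pp>"
    using p by (auto simp: S_def)
  interpret p: ideal \<pp> R by (rule pI)
  obtain z where z: "z \<in> \<aa>" "z \<notin> \<pp>" using nop[of 1] ideal_pow_1[OF a] by auto
  have zR: "z \<in> carrier R" using z a ideal.Icarr by metis
  have cI: "ideal (\<pp> <+> PIdl z) R" using add_ideals pI cgenideal_ideal zR by blast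
  have "\<pp> \<subseteq> \<pp> <+> PIdl z"
    by (rule add_cgenideal_sup(1)[OF pI zR])
  moreover have "z \<in> \<pp> <+> PIdl z"
    by (rule add_cgenideal_sup(2)[OF pI zR])
  ultimately have "\<pp> <+> PIdl z \<notin> S" using max z(2) by auto
  then obtain m where m: "ideal_pow R \<aa> m \<subseteq> \<pp> <+> PIdl z"
    using cI qp \<open>\<pp> \<subseteq> \<pp> <+> PIdl z\<close> unfolding S_def by blast
  obtain j :: nat where j: "z [^] j \<in> \<pp>" using nil[OF z(1)] qp by auto
  have "ideal_pow R \<aa> (m * i) \<subseteq> \<pp> <+> PIdl (z [^] i)" for i
  proof (induction i)
    case 0
    have "x = \<zero> \<oplus> z [^] (0::nat) \<otimes> x" if "x \<in> carrier R" for x using that by simp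
    then have "\<exists>i\<in>\<pp>. \<exists>r\<in>carrier R. x = i \<oplus> z [^] (0::nat) \<otimes> r" if "x \<in> carrier R" for x
      using that p.zero_closed by blast
    then show ?case unfolding mult_0_right ideal_pow_0 using zR by (subst subset_iff, subst mem_add_cgenideal[OF pI]) auto
  next
    case (Suc i)
    have zi: "z [^] i \<in> carrier R" "z [^] Suc i \<in> carrier R" using zR by auto
    have c: "ideal (\<pp> <+> PIdl (z [^] Suc i)) R" using add_ideals pI cgenideal_ideal zi by blast
    show ?case
    proof
      fix x assume "x \<in> ideal_pow R \<aa> (m * Suc i)"
      then have "x \<in> ideal_pow R \<aa> (m * i) \<cdot> ideal_pow R \<aa> m"
        using ideal_pow_add[OF a, of "m * i" m] by (simp add: add.commute)
      then show "x \<in> \<pp> <+> PIdl (z [^] Suc i)"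
      proof (induction x rule: ideal_prod.induct)
        case (prod s t)
        obtain p r where s: "p \<in> \<pp>" "r \<in> carrier R" "s = p \<oplus> z [^] i \<otimes> r"
          using subsetD[OF Suc prod(1)] unfolding mem_add_cgenideal[OF pI zi(1)] by blast
        obtain p' r' where t: "p' \<in> \<pp>" "r' \<in> carrier R" "t = p' \<oplus> z \<otimes> r'"
          using subsetD[OF m prod(2)] unfolding mem_add_cgenideal[OF pI zR] by blast
        have pc: "p \<in> carrier R" "p' \<in> carrier R" using s t p.Icarr by auto
        \<comment> \<open>Every term of the product except the last has a factor in \<pp>.\<close>
        have "s \<otimes> t = (p \<otimes> (p' \<oplus> z \<otimes> r') \<oplus> p' \<otimes> (z [^] i \<otimes> r)) \<oplus> z [^] Suc i \<otimes> (r \<otimes> r')"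
          using s(2) t(2) pc zR zi unfolding nat_pow_Suc s(3) t(3) by algebra
        moreover have "p \<otimes> (p' \<oplus> z \<otimes> r') \<oplus> p' \<otimes> (z [^] i \<otimes> r) \<in> \<pp>"
          using s t pc zR zi by (intro p.a_closed p.I_r_closed) auto
        ultimately show ?case using s t by (subst mem_add_cgenideal[OF pI zi(2)]) blast
      next
        case (sum s t)
        then show ?case using additive_subgroup.a_closed[OF ideal.axioms(1)[OF c]] by blast
      qed
    qed
  qed
  from this[of j] have "ideal_pow R \<aa> (m * j) \<subseteq> \<pp>"
  proof (rule subset_trans)
    have "z [^] j \<in> carrier R" using zR by simp
    then show "\<pp> <+> PIdl (z [^] j) \<subseteq> \<pp>"
      using p.a_closed p.I_r_closed[OF j] by (auto simp: mem_add_cgenideal[OF pI])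
  qed
  then show False using nop by blast
qed

text \<open>Baer's criterion for the submodule \<open>E\<close> of \<open>P\<close>: homomorphisms from ideals to \<open>E\<close> extend to the ring. A
  homomorphism is given by its graph \<open>G\<close>, which avoids naming its domain.\<close>

definition baer :: "('r, 'z) ring_scheme \<Rightarrow> ('r, 'p, 'y) module_scheme \<Rightarrow> 'p set \<Rightarrow> bool" where
  "baer R P E \<longleftrightarrow> (\<forall>G. G \<subseteq> carrier R \<times> E \<longrightarrow> (\<zero>\<^bsub>R\<^esub>, \<zero>\<^bsub>P\<^esub>) \<in> G \<longrightarrow>
     (\<forall>a p b q. (a, p) \<in> G \<longrightarrow> (b, q) \<in> G \<longrightarrow> (a \<oplus>\<^bsub>R\<^esub> b, p \<oplus>\<^bsub>P\<^esub> q) \<in> G) \<longrightarrow>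
     (\<forall>r a p. r \<in> carrier R \<longrightarrow> (a, p) \<in> G \<longrightarrow> (r \<otimes>\<^bsub>R\<^esub> a, r \<odot>\<^bsub>P\<^esub> p) \<in> G) \<longrightarrow>
     (\<forall>p. (\<zero>\<^bsub>R\<^esub>, p) \<in> G \<longrightarrow> p = \<zero>\<^bsub>P\<^esub>) \<longrightarrow>
     (\<exists>e\<in>E. \<forall>a p. (a, p) \<in> G \<longrightarrow> p = a \<odot>\<^bsub>P\<^esub> e))"

text \<open>Subtraction, written as adding the multiple by minus one, turns two values over
  \<open>a\<close> into one value over zero.\<close>

lemma (in module) graph_single_valued:
  assumes G: "G \<subseteq> carrier R \<times> carrier M"
    and add: "\<And>a p b q. (a, p) \<in> G \<Longrightarrow> (b, q) \<in> G \<Longrightarrow> (a \<oplus> b, p \<oplus>\<^bsub>M\<^esub> q) \<in> G"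
    and sm: "\<And>r a p. r \<in> carrier R \<Longrightarrow> (a, p) \<in> G \<Longrightarrow> (r \<otimes> a, r \<odot>\<^bsub>M\<^esub> p) \<in> G"
    and z: "\<And>p. (\<zero>, p) \<in> G \<Longrightarrow> p = \<zero>\<^bsub>M\<^esub>"
    and "(a, p) \<in> G" "(a, q) \<in> G"
  shows "p = q"
proof -
  have c: "a \<in> carrier R" "p \<in> carrier M" "q \<in> carrier M" using assms(5,6) G by auto
  have "(a \<oplus> \<ominus> \<one> \<otimes> a, p \<oplus>\<^bsub>M\<^esub> \<ominus> \<one> \<odot>\<^bsub>M\<^esub> q) \<in> G"
    using add[OF assms(5) sm[OF _ assms(6), of "\<ominus> \<one>"]] by simp
  moreover have "a \<oplus> \<ominus> \<one> \<otimes> a = \<zero>" using c by (simp add: R.l_minus R.r_neg)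
  ultimately have "p \<oplus>\<^bsub>M\<^esub> \<ominus> \<one> \<odot>\<^bsub>M\<^esub> q = \<zero>\<^bsub>M\<^esub>" by (intro z) simp
  then have "p \<ominus>\<^bsub>M\<^esub> q = \<zero>\<^bsub>M\<^esub>" using c by (simp add: smult_l_minus a_minus_def)
  then show ?thesis using c by (subst (asm) M.minus_eq_iff) auto
qed

text \<open>The ring as a module over itself has elements of the scalar type and so is an admissible
  test module. A homomorphism extended to the whole ring is multiplication by the image of
  one.\<close>

lemma injective_imp_baer:
  assumes inj: "injective_module R P"
  shows "baer R P (carrier P)"
proof -
  interpret module R P using inj by (simp add: injective_module_def)
  show ?thesis
    unfolding baer_def
  proof (intro allI impI)
    fix G assume G: "G \<subseteq> carrier R \<times> carrier P" "(\<zero>\<^bsub>R\<^esub>, \<zero>\<^bsub>P\<^esub>) \<in> G"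
      and add: "\<forall>a p b q. (a, p) \<in> G \<longrightarrow> (b, q) \<in> G \<longrightarrow> (a \<oplus>\<^bsub>R\<^esub> b, p \<oplus>\<^bsub>P\<^esub> q) \<in> G"
      and sm: "\<forall>r a p. r \<in> carrier R \<longrightarrow> (a, p) \<in> G \<longrightarrow> (r \<otimes>\<^bsub>R\<^esub> a, r \<odot>\<^bsub>P\<^esub> p) \<in> G"
      and z: "\<forall>p. (\<zero>\<^bsub>R\<^esub>, p) \<in> G \<longrightarrow> p = \<zero>\<^bsub>P\<^esub>"
    define Y :: "('a, 'a) module" where
      "Y = \<lparr>carrier = carrier R, monoid.mult = (\<otimes>\<^bsub>R\<^esub>), one = \<one>\<^bsub>R\<^esub>, zero = \<zero>\<^bsub>R\<^esub>, add = (\<oplus>\<^bsub>R\<^esub>), smult = (\<otimes>\<^bsub>R\<^esub>)\<rparr>"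
    have Y: "module R Y"
    proof (rule moduleI)
      show "abelian_group Y"
        by (rule abelian_groupI) (auto simp: Y_def R.a_ac intro: R.l_neg)
    qed (auto simp: Y_def R.l_distr R.r_distr R.m_assoc R.is_cring)
    interpret Y: module R Y by (rule Y)
    define f where "f a = (THE p. (a, p) \<in> G)" for a
    have f: "f a = p" if "(a, p) \<in> G" for a p
      unfolding f_def
      by (intro the_equality) (use graph_single_valued[OF G(1)] add sm z that in blast)+
    have mone: "(\<ominus>\<^bsub>R\<^esub> a, \<ominus>\<^bsub>P\<^esub> p) \<in> G" if "(a, p) \<in> G" for a p
      using sm[rule_format, OF _ that, of "\<ominus>\<^bsub>R\<^esub> \<one>\<^bsub>R\<^esub>"] that G(1) by (auto simp: smult_l_minus R.l_minus)
    have invY: "\<ominus>\<^bsub>Y\<^esub> a = \<ominus>\<^bsub>R\<^esub> a" for a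
      by (simp add: a_inv_def Y_def m_inv_def)
    have sub: "submodule (fst ` G) R Y"
    proof (rule Y.submoduleI)
      show "\<zero>\<^bsub>Y\<^esub> \<in> fst ` G" using G(2) by (force simp: Y_def)
      show "\<ominus>\<^bsub>Y\<^esub> a \<in> fst ` G" if "a \<in> fst ` G" for a using that mone by (force simp: invY)
      show "a \<oplus>\<^bsub>Y\<^esub> b \<in> fst ` G" if "a \<in> fst ` G" "b \<in> fst ` G" for a b
        using that add by (force simp: Y_def)
      show "a \<odot>\<^bsub>Y\<^esub> b \<in> fst ` G" if "a \<in> carrier R" "b \<in> fst ` G" for a b
        using that sm by (force simp: Y_def)
    qed (use G(1) in \<open>auto simp: Y_def\<close>)
    have "f \<in> module_hom R (Y\<lparr>carrier := fst ` G\<rparr>) P"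
      unfolding module_hom_def
    proof (safe, goal_cases)
      case (1 x) then show ?case using f G(1) by auto
    next
      case (2 x y) then show ?case using f add by (fastforce simp: Y_def)
    next
      case (3 a x) then show ?case using f sm by (fastforce simp: Y_def)
    qed
    then obtain g where g: "g \<in> module_hom R Y P" "\<forall>x\<in>fst ` G. g x = f x"
      using inj Y sub unfolding injective_module_def by blast
    show "\<exists>e\<in>carrier P. \<forall>a p. (a, p) \<in> G \<longrightarrow> p = a \<odot>\<^bsub>P\<^esub> e"
    proof (intro bexI[of _ "g \<one>\<^bsub>R\<^esub>"] allI impI)
      show "g \<one>\<^bsub>R\<^esub> \<in> carrier P" using g(1) by (auto simp: module_hom_def Y_def)
      fix a p assume ap: "(a, p) \<in> G"
      then have a: "a \<in> carrier R" using G by auto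
      have "p = g a" using f[OF ap] g(2) ap by force
      also have "\<dots> = g (a \<odot>\<^bsub>Y\<^esub> \<one>\<^bsub>R\<^esub>)" using a by (simp add: Y_def)
      also have "\<dots> = a \<odot>\<^bsub>P\<^esub> g \<one>\<^bsub>R\<^esub>" using g(1) a by (simp add: module_hom_def Y_def del: R.r_one)
      finally show "p = a \<odot>\<^bsub>P\<^esub> g \<one>\<^bsub>R\<^esub>" .
    qed
  qed
qed

lemma (in module) torsion_submodule:
  assumes a: "ideal \<aa> R"
  shows "submodule (torsion_part R \<aa> M) R M"
proof (rule submoduleI)
  show "\<zero>\<^bsub>M\<^esub> \<in> torsion_part R \<aa> M"
    using ideal.Icarr[OF R.ideal_pow_ideal[OF a]] by (auto simp: torsion_part_def)
  fix x assume x: "x \<in> torsion_part R \<aa> M"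
  then obtain n where n: "x \<in> carrier M" "\<And>a. a \<in> ideal_pow R \<aa> n \<Longrightarrow> a \<odot>\<^bsub>M\<^esub> x = \<zero>\<^bsub>M\<^esub>"
    by (auto simp: torsion_part_def)
  have ic: "a \<in> carrier R" if "a \<in> ideal_pow R \<aa> n" for a n
    using ideal.Icarr[OF R.ideal_pow_ideal[OF a]] that by blast
  show "\<ominus>\<^bsub>M\<^esub> x \<in> torsion_part R \<aa> M"
    using n ic by (auto simp: torsion_part_def smult_r_minus intro!: exI[of _ n])
  show "b \<odot>\<^bsub>M\<^esub> x \<in> torsion_part R \<aa> M" if b: "b \<in> carrier R" for b
  proof -
    have "a \<odot>\<^bsub>M\<^esub> (b \<odot>\<^bsub>M\<^esub> x) = \<zero>\<^bsub>M\<^esub>" if "a \<in> ideal_pow R \<aa> n" for a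
    proof -
      have "a \<odot>\<^bsub>M\<^esub> (b \<odot>\<^bsub>M\<^esub> x) = b \<odot>\<^bsub>M\<^esub> (a \<odot>\<^bsub>M\<^esub> x)"
        using ic[OF that] b n(1) by (simp add: smult_assoc1[symmetric] R.m_comm)
      then show ?thesis using n(2)[OF that] b by simp
    qed
    then show ?thesis using n(1) b by (auto simp: torsion_part_def)
  qed
  fix y assume "y \<in> torsion_part R \<aa> M"
  then obtain m where m: "y \<in> carrier M" "\<And>a. a \<in> ideal_pow R \<aa> m \<Longrightarrow> a \<odot>\<^bsub>M\<^esub> y = \<zero>\<^bsub>M\<^esub>"
    by (auto simp: torsion_part_def)
  have "a \<odot>\<^bsub>M\<^esub> (x \<oplus>\<^bsub>M\<^esub> y) = \<zero>\<^bsub>M\<^esub>" if "a \<in> ideal_pow R \<aa> (max m n)" for a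
  proof -
    have "a \<in> ideal_pow R \<aa> m" "a \<in> ideal_pow R \<aa> n"
      using that R.ideal_pow_antimono[OF a, of m "max m n"] R.ideal_pow_antimono[OF a, of n "max m n"] by auto
    then show ?thesis using n m ic[OF that] by (simp add: smult_r_distr)
  qed
  then show "x \<oplus>\<^bsub>M\<^esub> y \<in> torsion_part R \<aa> M" using n(1) m(1) by (auto simp: torsion_part_def)
qed (auto simp: torsion_part_def)

text \<open>This replaces the usual appeal to the Artin-Rees lemma. Let \<open>B\<close> be the kernel of a homomorphism from an
  ideal \<open>\<bb>\<close> to the torsion, and let \<open>\<qq>\<close> be maximal among the ideals with \<open>\<qq> \<inter> \<bb> = B\<close>. By maximality, some power of each
  element of \<open>\<aa>\<close> lies in \<open>\<qq>\<close>, so \<open>\<aa>\<^sup>m \<subseteq> \<qq>\<close>. Extend the homomorphism to \<open>\<qq> + \<bb>\<close> by zero on \<open>\<qq>\<close>: it is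
  multiplication by some \<open>e \<in> P\<close>, and \<open>e\<close> is killed by \<open>\<aa>\<^sup>m\<close>.\<close>

lemma torsion_baer:
  assumes inj: "injective_module R P" and noeth: "noetherian_ring R" and a: "ideal \<aa> R"
  shows "baer R P (torsion_part R \<aa> P)"
proof -
  interpret module R P using inj by (simp add: injective_module_def)
  interpret noetherian_ring R by (rule noeth)
  let ?T = "torsion_part R \<aa> P"
  have Tc: "?T \<subseteq> carrier P" by (auto simp: torsion_part_def)
  show ?thesis
    unfolding baer_def
  proof (intro allI impI)
    fix G assume G: "G \<subseteq> carrier R \<times> ?T" "(\<zero>\<^bsub>R\<^esub>, \<zero>\<^bsub>P\<^esub>) \<in> G"
      and add: "\<forall>a p b q. (a, p) \<in> G \<longrightarrow> (b, q) \<in> G \<longrightarrow> (a \<oplus>\<^bsub>R\<^esub> b, p \<oplus>\<^bsub>P\<^esub> q) \<in> G"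
      and sm: "\<forall>r a p. r \<in> carrier R \<longrightarrow> (a, p) \<in> G \<longrightarrow> (r \<otimes>\<^bsub>R\<^esub> a, r \<odot>\<^bsub>P\<^esub> p) \<in> G"
      and z: "\<forall>p. (\<zero>\<^bsub>R\<^esub>, p) \<in> G \<longrightarrow> p = \<zero>\<^bsub>P\<^esub>"
    have G': "G \<subseteq> carrier R \<times> carrier P" using G(1) Tc by auto
    note sv = graph_single_valued[OF G' add[rule_format] sm[rule_format] z[rule_format]]
    have mone: "(\<ominus>\<^bsub>R\<^esub> a, \<ominus>\<^bsub>P\<^esub> p) \<in> G" if "(a, p) \<in> G" for a p
      using sm[rule_format, OF _ that, of "\<ominus>\<^bsub>R\<^esub> \<one>\<^bsub>R\<^esub>"] that G' by (auto simp: smult_l_minus R.l_minus)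
    define B where "B = {a. (a, \<zero>\<^bsub>P\<^esub>) \<in> G}"
    have B0: "ideal B R"
    proof (rule idealI[OF R.ring_axioms])
      show "subgroup B (add_monoid R)"
        using G' G(2) add[rule_format, of _ "\<zero>\<^bsub>P\<^esub>" _ "\<zero>\<^bsub>P\<^esub>"] mone[of _ "\<zero>\<^bsub>P\<^esub>"]
        by (intro R.add.subgroupI) (auto simp: B_def)
      show "x \<otimes>\<^bsub>R\<^esub> a \<in> B" if "a \<in> B" "x \<in> carrier R" for a x
        using that sm[rule_format, of x a "\<zero>\<^bsub>P\<^esub>"] by (auto simp: B_def)
      then show "a \<otimes>\<^bsub>R\<^esub> x \<in> B" if "a \<in> B" "x \<in> carrier R" for a x
        using that G' R.m_comm[of a x] by (auto simp: B_def)
    qed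
    define S where "S = {\<qq>. ideal \<qq> R \<and> B \<subseteq> \<qq> \<and> \<qq> \<inter> fst ` G \<subseteq> B}"
    have "B \<in> S" using B0 by (auto simp: S_def)
    moreover have "\<forall>I\<in>S. ideal I R" by (simp add: S_def)
    ultimately obtain \<qq> where qS: "\<qq> \<in> S" and qmax: "\<And>J. J \<in> S \<Longrightarrow> \<qq> \<subseteq> J \<Longrightarrow> J = \<qq>"
      using maximal_ideal_of_family[of B S] by blast
    have q: "ideal \<qq> R" "B \<subseteq> \<qq>" "\<qq> \<inter> fst ` G \<subseteq> B" using qS by (auto simp: S_def)
    interpret q: ideal \<qq> R by (rule q(1))
    have "\<exists>i::nat. z [^]\<^bsub>R\<^esub> i \<in> \<qq>" if za: "z \<in> \<aa>" for z
    proof -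
      have zR: "z \<in> carrier R" using za a ideal.Icarr by metis
      \<comment> \<open>The colon ideals of \<qq> by the powers of \<open>z\<close> ascend and hence
        become stationary at some \<open>i\<close>. The aim is that adding \<open>z [^] i\<close> to
        \<qq> does not leave the family \<open>S\<close>.\<close>
      define C where "C i = {r \<in> carrier R. z [^]\<^bsub>R\<^esub> (i::nat) \<otimes>\<^bsub>R\<^esub> r \<in> \<qq>}" for i
      have Cid: "ideal (C i) R" for i unfolding C_def using R.ideal_colon[OF q(1)] zR by simp
      have Cmono: "C i \<subseteq> C (i + k)" for i k
      proof
        fix r assume r: "r \<in> C i"
        then have "z [^]\<^bsub>R\<^esub> k \<otimes>\<^bsub>R\<^esub> (z [^]\<^bsub>R\<^esub> i \<otimes>\<^bsub>R\<^esub> r) \<in> \<qq>" using zR by (auto simp: C_def intro: q.I_l_closed)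
        also have "z [^]\<^bsub>R\<^esub> k \<otimes>\<^bsub>R\<^esub> (z [^]\<^bsub>R\<^esub> i \<otimes>\<^bsub>R\<^esub> r) = z [^]\<^bsub>R\<^esub> (i + k) \<otimes>\<^bsub>R\<^esub> r"
          using zR r by (simp add: C_def R.nat_pow_mult[symmetric] R.m_assoc R.m_lcomm R.m_comm)
        finally show "r \<in> C (i + k)" using r by (simp add: C_def)
      qed
      have "\<exists>I\<in>range C. \<forall>J\<in>range C. I \<subseteq> J \<longrightarrow> J = I"
        by (rule maximal_ideal_of_family[of "C 0"]) (use Cid in auto)
      then obtain i where i: "\<And>J. J \<in> range C \<Longrightarrow> C i \<subseteq> J \<Longrightarrow> J = C i" by blast
      have Ci: "C (i + k) = C i" for k using i[of "C (i + k)"] Cmono by blast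
      let ?z = "z [^]\<^bsub>R\<^esub> i"
      have zi: "?z \<in> carrier R" using zR by simp
      let ?c = "\<qq> <+>\<^bsub>R\<^esub> PIdl\<^bsub>R\<^esub> ?z"
      have cI: "ideal ?c R" using R.add_ideals q(1) R.cgenideal_ideal zi by blast
      have qc: "\<qq> \<subseteq> ?c"
        by (rule R.add_cgenideal_sup(1)[OF q(1) zi])
      \<comment> \<open>The value over \<open>x\<close> is torsion, so some \<open>z [^] k\<close>
        multiplies \<open>x\<close> into the kernel \<open>B\<close> and hence into \<qq>. Then
        \<open>z [^] (i + k)\<close> multiplies \<open>r\<close> into \<qq>, by stationarity
        \<open>z [^] i\<close> does so already, and \<open>x\<close> itself lies in \<qq>.\<close>
      have "x \<in> B" if x: "x \<in> ?c" "x \<in> fst ` G" for x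
      proof -
        obtain s r where sr: "s \<in> \<qq>" "r \<in> carrier R" "x = s \<oplus>\<^bsub>R\<^esub> ?z \<otimes>\<^bsub>R\<^esub> r"
          using x(1) by (auto simp: R.mem_add_cgenideal[OF q(1) zi])
        obtain p where p: "(x, p) \<in> G" using x(2) by auto
        then obtain k where "\<forall>b\<in>ideal_pow R \<aa> k. b \<odot>\<^bsub>P\<^esub> p = \<zero>\<^bsub>P\<^esub>" using G(1) by (auto simp: torsion_part_def)
        then have "z [^]\<^bsub>R\<^esub> k \<odot>\<^bsub>P\<^esub> p = \<zero>\<^bsub>P\<^esub>" using R.ideal_pow_elem[OF a za] by blast
        then have "z [^]\<^bsub>R\<^esub> k \<otimes>\<^bsub>R\<^esub> x \<in> B"
          using sm[rule_format, OF _ p, of "z [^]\<^bsub>R\<^esub> k"] zR by (simp add: B_def)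
        then have 1: "z [^]\<^bsub>R\<^esub> k \<otimes>\<^bsub>R\<^esub> x \<in> \<qq>" using q(2) by blast
        have sc: "s \<in> carrier R" using sr q.Icarr by blast
        have "z [^]\<^bsub>R\<^esub> (i + k) \<otimes>\<^bsub>R\<^esub> r = z [^]\<^bsub>R\<^esub> k \<otimes>\<^bsub>R\<^esub> x \<oplus>\<^bsub>R\<^esub> \<ominus>\<^bsub>R\<^esub> (z [^]\<^bsub>R\<^esub> k \<otimes>\<^bsub>R\<^esub> s)"
          using sr(2,3) sc zR zi by (simp add: R.nat_pow_mult[symmetric] R.r_distr R.m_ac R.a_ac R.add_cancel_neg R.r_neg2)
        also have "\<dots> \<in> \<qq>" using q.a_closed[OF 1 q.a_inv_closed[OF q.I_l_closed[OF sr(1)]]] zR by simp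
        finally have "r \<in> C (i + k)" using sr by (simp add: C_def)
        then have "r \<in> C i" using Ci by blast
        then have "?z \<otimes>\<^bsub>R\<^esub> r \<in> \<qq>" by (simp add: C_def)
        then have "x \<in> \<qq>" using sr by simp
        then show ?thesis using q(3) x(2) by blast
      qed
      then have "?c \<in> S" using cI q(2) qc by (auto simp: S_def)
      then have "?c = \<qq>" using qmax qc by blast
      moreover have "?z \<in> ?c"
        by (rule R.add_cgenideal_sup(2)[OF q(1) zi])
      ultimately show ?thesis by blast
    qed
    then obtain m where m: "ideal_pow R \<aa> m \<subseteq> \<qq>"
      using R.ideal_pow_subset_of_nilpotent[OF noeth q(1) a] by blast
    define H where "H = {(s \<oplus>\<^bsub>R\<^esub> b, p) | s b p. s \<in> \<qq> \<and> (b, p) \<in> G}"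
    have HI: "(x, p) \<in> H" if "s \<in> \<qq>" "(b, p) \<in> G" "x = s \<oplus>\<^bsub>R\<^esub> b" for x p s b
      using that by (auto simp: H_def)
    have "\<exists>e\<in>carrier P. \<forall>b p. (b, p) \<in> H \<longrightarrow> p = b \<odot>\<^bsub>P\<^esub> e"
    proof (rule injective_imp_baer[OF inj, unfolded baer_def, rule_format])
      show "H \<subseteq> carrier R \<times> carrier P" using G' q.Icarr by (auto simp: H_def)
      show "(\<zero>\<^bsub>R\<^esub>, \<zero>\<^bsub>P\<^esub>) \<in> H" by (rule HI[OF q.zero_closed G(2)]) simp
      show "(b \<oplus>\<^bsub>R\<^esub> c, p \<oplus>\<^bsub>P\<^esub> p') \<in> H" if bc: "(b, p) \<in> H" "(c, p') \<in> H" for b p c p'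
      proof -
        obtain s b' s' c' where *: "b = s \<oplus>\<^bsub>R\<^esub> b'" "s \<in> \<qq>" "(b', p) \<in> G" "c = s' \<oplus>\<^bsub>R\<^esub> c'" "s' \<in> \<qq>" "(c', p') \<in> G"
          using bc by (auto simp: H_def)
        have "b \<oplus>\<^bsub>R\<^esub> c = (s \<oplus>\<^bsub>R\<^esub> s') \<oplus>\<^bsub>R\<^esub> (b' \<oplus>\<^bsub>R\<^esub> c')"
        proof -
          have "s \<in> carrier R" "s' \<in> carrier R" "b' \<in> carrier R" "c' \<in> carrier R"
            using * q.Icarr G' by auto
          then show ?thesis using * by (simp add: R.a_ac)
        qed
        then show ?thesis using * add by (intro HI[of "s \<oplus>\<^bsub>R\<^esub> s'" "b' \<oplus>\<^bsub>R\<^esub> c'"]) auto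
      qed
      show "(r \<otimes>\<^bsub>R\<^esub> b, r \<odot>\<^bsub>P\<^esub> p) \<in> H" if r: "r \<in> carrier R" "(b, p) \<in> H" for r b p
      proof -
        obtain s b' where *: "b = s \<oplus>\<^bsub>R\<^esub> b'" "s \<in> \<qq>" "(b', p) \<in> G" using r by (auto simp: H_def)
        have "r \<otimes>\<^bsub>R\<^esub> b = r \<otimes>\<^bsub>R\<^esub> s \<oplus>\<^bsub>R\<^esub> r \<otimes>\<^bsub>R\<^esub> b'"
        proof -
          have "s \<in> carrier R" "b' \<in> carrier R" using * q.Icarr G' by auto
          then show ?thesis using * r(1) by (simp add: R.r_distr)
        qed
        then show ?thesis using * r sm q.I_l_closed by (intro HI[of "r \<otimes>\<^bsub>R\<^esub> s" "r \<otimes>\<^bsub>R\<^esub> b'"]) auto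
      qed
      \<comment> \<open>The extension by zero on \<qq> is well defined because \<qq> meets the
        domain only in the kernel.\<close>
      show "p = \<zero>\<^bsub>P\<^esub>" if zp: "(\<zero>\<^bsub>R\<^esub>, p) \<in> H" for p
      proof -
        obtain s b where *: "\<zero>\<^bsub>R\<^esub> = s \<oplus>\<^bsub>R\<^esub> b" "s \<in> \<qq>" "(b, p) \<in> G" using zp unfolding H_def by blast
        have bc: "b \<in> carrier R" "s \<in> carrier R" using * G' q.Icarr by auto
        then have "b = \<ominus>\<^bsub>R\<^esub> s" using *(1) by (metis R.minus_equality R.minus_minus R.a_comm)
        then have "b \<in> \<qq> \<inter> fst ` G" using * by force
        then have "(b, \<zero>\<^bsub>P\<^esub>) \<in> G" using q(3) by (auto simp: B_def)
        then show ?thesis using sv *(3) by blast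
      qed
    qed
    then obtain e where e: "e \<in> carrier P" "\<And>b p. (b, p) \<in> H \<Longrightarrow> p = b \<odot>\<^bsub>P\<^esub> e" by blast
    have "(s, \<zero>\<^bsub>P\<^esub>) \<in> H" if "s \<in> \<qq>" for s
      using q.Icarr[OF that] by (intro HI[OF that G(2)]) simp
    then have "b \<odot>\<^bsub>P\<^esub> e = \<zero>\<^bsub>P\<^esub>" if "b \<in> ideal_pow R \<aa> m" for b
      using e(2)[of b "\<zero>\<^bsub>P\<^esub>"] m that by auto
    then have "e \<in> ?T" using e(1) unfolding torsion_part_def by blast
    moreover have "p = b \<odot>\<^bsub>P\<^esub> e" if "(b, p) \<in> G" for b p
      using that G' by (intro e(2) HI[of "\<zero>\<^bsub>R\<^esub>" b]) auto
    ultimately show "\<exists>e\<in>?T. \<forall>a p. (a, p) \<in> G \<longrightarrow> p = a \<odot>\<^bsub>P\<^esub> e" by blast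
  qed
qed

text \<open>Families of scalars indexed by the boolean lists of length \<open>n\<close> form a free module of rank \<open>2\<^sup>n\<close>; under the
  pairing with cochains, the Koszul boundary is adjoint to the differential.\<close>

fun pairing :: "('r, 'p, 'y) module_scheme \<Rightarrow> nat \<Rightarrow> (bool list \<Rightarrow> 'r) \<Rightarrow> (bool list \<Rightarrow> 'p) \<Rightarrow> 'p" where
  "pairing P 0 a \<phi> = a [] \<odot>\<^bsub>P\<^esub> \<phi> []"
| "pairing P (Suc n) a \<phi> = pairing P n (\<lambda>l. a (False # l)) (\<lambda>l. \<phi> (False # l)) \<oplus>\<^bsub>P\<^esub>
     pairing P n (\<lambda>l. a (True # l)) (\<lambda>l. \<phi> (True # l))"

fun boundary :: "('r, 'z) ring_scheme \<Rightarrow> 'r list \<Rightarrow> (bool list \<Rightarrow> 'r) \<Rightarrow> bool list \<Rightarrow> 'r" where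
  "boundary R [] a l = \<zero>\<^bsub>R\<^esub>"
| "boundary R (z # zs) a [] = \<zero>\<^bsub>R\<^esub>"
| "boundary R (z # zs) a (False # l) = boundary R zs (\<lambda>l. a (False # l)) l \<oplus>\<^bsub>R\<^esub> z \<otimes>\<^bsub>R\<^esub> a (True # l)"
| "boundary R (z # zs) a (True # l) = \<ominus>\<^bsub>R\<^esub> boundary R zs (\<lambda>l. a (True # l)) l"

definition chains :: "('r, 'z) ring_scheme \<Rightarrow> nat \<Rightarrow> (bool list \<Rightarrow> 'r) set" where
  "chains R n = {a. \<forall>l. a l \<in> carrier R \<and> (length l \<noteq> n \<longrightarrow> a l = \<zero>\<^bsub>R\<^esub>)}"

definition join :: "'r \<Rightarrow> (bool list \<Rightarrow> 'r) \<Rightarrow> (bool list \<Rightarrow> 'r) \<Rightarrow> bool list \<Rightarrow> 'r" where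
  "join z f g l = (case l of [] \<Rightarrow> z | False # l \<Rightarrow> f l | True # l \<Rightarrow> g l)"

lemma join_simps [simp]:
  "join z f g [] = z" "join z f g (False # l) = f l" "join z f g (True # l) = g l"
  by (simp_all add: join_def)

lemma join_eqI: "\<lbrakk>h [] = z; \<And>l. h (False # l) = f l; \<And>l. h (True # l) = g l\<rbrakk> \<Longrightarrow> h = join z f g"
  by (rule ext, rename_tac l, case_tac l) (auto simp: join_def split: bool.split)

context module
begin

lemma boundary_closed: "set zs \<subseteq> carrier R \<Longrightarrow> (\<And>l. a l \<in> carrier R) \<Longrightarrow> boundary R zs a l \<in> carrier R"
proof (induction zs arbitrary: a l)
  case (Cons z zs)
  then show ?case by (cases l; cases "hd l") auto
qed simp

lemma boundary_chains:
  assumes "set zs \<subseteq> carrier R" "a \<in> chains R (length zs)" shows "boundary R zs a \<in> chains R (length zs)"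
proof -
  have "length l \<noteq> length zs \<Longrightarrow> set zs \<subseteq> carrier R \<Longrightarrow> (\<And>l. length l \<noteq> length zs \<Longrightarrow> a l = \<zero>) \<Longrightarrow> boundary R zs a l = \<zero>" for l
  proof (induction zs arbitrary: a l)
    case (Cons z zs)
    then show ?case by (cases l; cases "hd l") auto
  qed simp
  then show ?thesis using assms boundary_closed[OF assms(1)] by (auto simp: chains_def)
qed

lemma boundary_add:
  "set zs \<subseteq> carrier R \<Longrightarrow> (\<And>l. a l \<in> carrier R) \<Longrightarrow> (\<And>l. b l \<in> carrier R) \<Longrightarrow>
   boundary R zs (\<lambda>l. a l \<oplus> b l) l = boundary R zs a l \<oplus> boundary R zs b l"
proof (induction zs arbitrary: a b l)
  case (Cons z zs)
  have "boundary R zs (\<lambda>l. a (c # l)) l \<in> carrier R" "boundary R zs (\<lambda>l. b (c # l)) l \<in> carrier R" for c l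
    using Cons.prems by (auto intro!: boundary_closed)
  then show ?case using Cons.prems
    by (cases l; cases "hd l") (simp_all add: Cons.IH R.r_distr R.a_ac R.minus_add)
qed simp

lemma boundary_smult:
  "set zs \<subseteq> carrier R \<Longrightarrow> (\<And>l. a l \<in> carrier R) \<Longrightarrow> r \<in> carrier R \<Longrightarrow>
   boundary R zs (\<lambda>l. r \<otimes> a l) l = r \<otimes> boundary R zs a l"
proof (induction zs arbitrary: a l)
  case (Cons z zs)
  have "boundary R zs (\<lambda>l. a (c # l)) l \<in> carrier R" for c l
    using Cons.prems by (auto intro!: boundary_closed)
  then show ?case using Cons.prems
    by (cases l; cases "hd l") (simp_all add: Cons.IH R.r_distr R.m_ac R.r_minus)
qed simp

lemma pairing_closed:
  assumes "submodule E R M"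
  shows "(\<And>l. a l \<in> carrier R) \<Longrightarrow> (\<And>l. \<phi> l \<in> E) \<Longrightarrow> pairing M n a \<phi> \<in> E"
  using assms submoduleE(5)[OF assms] submodule.smult_closed[OF assms]
  by (induction n arbitrary: a \<phi>) auto

lemmas pairing_carrier = pairing_closed[OF carrier_is_submodule]

lemma pairing_cong:
  "(\<And>l. length l = n \<Longrightarrow> a l = b l) \<Longrightarrow> (\<And>l. length l = n \<Longrightarrow> \<phi> l = \<psi> l) \<Longrightarrow> pairing M n a \<phi> = pairing M n b \<psi>"
proof (induction n arbitrary: a b \<phi> \<psi>)
  case (Suc n)
  have "pairing M n (\<lambda>l. a (c # l)) (\<lambda>l. \<phi> (c # l)) = pairing M n (\<lambda>l. b (c # l)) (\<lambda>l. \<psi> (c # l))" for c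
    by (rule Suc.IH) (use Suc.prems in auto)
  then show ?case by simp
qed simp

lemma pairing_add_l:
  "(\<And>l. a l \<in> carrier R) \<Longrightarrow> (\<And>l. b l \<in> carrier R) \<Longrightarrow> (\<And>l. \<phi> l \<in> carrier M) \<Longrightarrow>
   pairing M n (\<lambda>l. a l \<oplus> b l) \<phi> = pairing M n a \<phi> \<oplus>\<^bsub>M\<^esub> pairing M n b \<phi>"
  by (induction n arbitrary: a b \<phi>) (simp_all add: smult_l_distr pairing_carrier M.a_ac)

lemma pairing_smult_l:
  "(\<And>l. a l \<in> carrier R) \<Longrightarrow> r \<in> carrier R \<Longrightarrow> (\<And>l. \<phi> l \<in> carrier M) \<Longrightarrow>
   pairing M n (\<lambda>l. r \<otimes> a l) \<phi> = r \<odot>\<^bsub>M\<^esub> pairing M n a \<phi>"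
  by (induction n arbitrary: a \<phi>) (simp_all add: smult_assoc1 pairing_carrier smult_r_distr)

lemma pairing_add_r:
  "(\<And>l. a l \<in> carrier R) \<Longrightarrow> (\<And>l. \<psi> l \<in> carrier M) \<Longrightarrow> (\<And>l. \<phi> l \<in> carrier M) \<Longrightarrow>
   pairing M n a (\<lambda>l. \<phi> l \<oplus>\<^bsub>M\<^esub> \<psi> l) = pairing M n a \<phi> \<oplus>\<^bsub>M\<^esub> pairing M n a \<psi>"
  by (induction n arbitrary: a \<phi> \<psi>) (simp_all add: smult_r_distr pairing_carrier M.a_ac)

lemma pairing_minus_r:
  assumes "\<And>l. a l \<in> carrier R" "\<And>l. \<psi> l \<in> carrier M" "\<And>l. \<phi> l \<in> carrier M"
  shows "pairing M n a (\<lambda>l. \<phi> l \<ominus>\<^bsub>M\<^esub> \<psi> l) = pairing M n a \<phi> \<ominus>\<^bsub>M\<^esub> pairing M n a \<psi>"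
proof -
  have "pairing M n a \<phi> = pairing M n a (\<lambda>l. (\<phi> l \<ominus>\<^bsub>M\<^esub> \<psi> l) \<oplus>\<^bsub>M\<^esub> \<psi> l)"
    using assms by (simp add: a_minus_def M.a_assoc M.l_neg)
  also have "\<dots> = pairing M n a (\<lambda>l. \<phi> l \<ominus>\<^bsub>M\<^esub> \<psi> l) \<oplus>\<^bsub>M\<^esub> pairing M n a \<psi>"
    using assms by (intro pairing_add_r) auto
  finally have "pairing M n a \<phi> \<ominus>\<^bsub>M\<^esub> pairing M n a \<psi> = pairing M n a (\<lambda>l. \<phi> l \<ominus>\<^bsub>M\<^esub> \<psi> l)"
    using assms by (subst M.minus_eq_iff) (auto intro!: pairing_carrier)
  then show ?thesis by simp
qed

lemma pairing_smult_r:
  "(\<And>l. a l \<in> carrier R) \<Longrightarrow> r \<in> carrier R \<Longrightarrow> (\<And>l. \<phi> l \<in> carrier M) \<Longrightarrow>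
   pairing M n a (\<lambda>l. r \<odot>\<^bsub>M\<^esub> \<phi> l) = r \<odot>\<^bsub>M\<^esub> pairing M n a \<phi>"
  by (induction n arbitrary: a \<phi>) (simp_all add: smult_assoc1[symmetric] pairing_carrier smult_r_distr R.m_comm)

lemma pairing_zero_l: "(\<And>l. \<phi> l \<in> carrier M) \<Longrightarrow> pairing M n (\<lambda>l. \<zero>) \<phi> = \<zero>\<^bsub>M\<^esub>"
  by (induction n arbitrary: \<phi>) simp_all

lemma pairing_neg_l:
  "(\<And>l. a l \<in> carrier R) \<Longrightarrow> (\<And>l. \<phi> l \<in> carrier M) \<Longrightarrow>
   pairing M n (\<lambda>l. \<ominus> a l) \<phi> = \<ominus>\<^bsub>M\<^esub> pairing M n a \<phi>"
  using pairing_smult_l[of a "\<ominus> \<one>" \<phi> n] by (simp add: smult_l_minus pairing_carrier R.l_minus)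

text \<open>On the left the scalar at \<open>True\<close> meets the term with \<open>z\<close> and
  \<phi> at \<open>False\<close>; the second summand of \<open>boundary\<close> at
  \<open>False\<close> accounts for exactly this term.\<close>

lemma pairing_koszul:
  "set zs \<subseteq> carrier R \<Longrightarrow> (\<And>l. a l \<in> carrier R) \<Longrightarrow> (\<And>l. \<phi> l \<in> carrier M) \<Longrightarrow>
   pairing M (length zs) a (koszul M zs \<phi>) = pairing M (length zs) (boundary R zs a) \<phi>"
proof (induction zs arbitrary: a \<phi>)
  case (Cons z zs)
  have [simp]: "boundary R zs (\<lambda>l. a (c # l)) l \<in> carrier R" "koszul M zs (\<lambda>l. \<phi> (c # l)) l \<in> carrier M" for c l
    using Cons.prems by (auto intro!: boundary_closed koszul_carrier)
  have [simp]: "z \<in> carrier R" using Cons.prems by simp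
  note [simp] = Cons.prems(2,3)
  have [simp]: "pairing M n (\<lambda>l. a (c # l)) (\<lambda>l. \<phi> (d # l)) \<in> carrier M"
    "pairing M n (boundary R zs (\<lambda>l. a (c # l))) (\<lambda>l. \<phi> (d # l)) \<in> carrier M" for n c d
    by (auto intro!: pairing_carrier)
  have "pairing M (length (z # zs)) a (koszul M (z # zs) \<phi>) =
    pairing M (length zs) (boundary R zs (\<lambda>l. a (False # l))) (\<lambda>l. \<phi> (False # l)) \<oplus>\<^bsub>M\<^esub>
    (z \<odot>\<^bsub>M\<^esub> pairing M (length zs) (\<lambda>l. a (True # l)) (\<lambda>l. \<phi> (False # l)) \<ominus>\<^bsub>M\<^esub>
    pairing M (length zs) (boundary R zs (\<lambda>l. a (True # l))) (\<lambda>l. \<phi> (True # l)))"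
    using Cons.prems by (simp add: pairing_minus_r pairing_smult_r Cons.IH)
  also have "\<dots> = pairing M (length (z # zs)) (boundary R (z # zs) a) \<phi>"
    by (simp add: pairing_add_l pairing_smult_l pairing_neg_l a_minus_def M.a_assoc)
  finally show ?case .
qed (simp)

lemma pairing_unit:
  "length l = n \<Longrightarrow> (\<And>l. \<phi> l \<in> carrier M) \<Longrightarrow> pairing M n (\<lambda>k. if k = l then \<one> else \<zero>) \<phi> = \<phi> l"
proof (induction n arbitrary: l \<phi>)
  case (Suc n)
  then obtain b l' where l: "l = b # l'" "length l' = n" by (cases l) auto
  show ?case using Suc.IH[OF l(2), of "\<lambda>l. \<phi> (b # l)"] Suc.prems(2) l(1)
    by (cases b) (simp_all add: pairing_zero_l)
qed simp

text \<open>Baer's criterion for a submodule of a free module, again in terms of the graph of a homomorphism.\<close>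

lemma baer_extend:
  assumes E: "submodule E R M" and baer: "baer R M E"
  shows "G \<subseteq> chains R n \<times> E \<Longrightarrow> ((\<lambda>l. \<zero>), \<zero>\<^bsub>M\<^esub>) \<in> G \<Longrightarrow>
    (\<And>a p b q. (a, p) \<in> G \<Longrightarrow> (b, q) \<in> G \<Longrightarrow> (\<lambda>l. a l \<oplus> b l, p \<oplus>\<^bsub>M\<^esub> q) \<in> G) \<Longrightarrow>
    (\<And>r a p. r \<in> carrier R \<Longrightarrow> (a, p) \<in> G \<Longrightarrow> (\<lambda>l. r \<otimes> a l, r \<odot>\<^bsub>M\<^esub> p) \<in> G) \<Longrightarrow>
    (\<And>p. ((\<lambda>l. \<zero>), p) \<in> G \<Longrightarrow> p = \<zero>\<^bsub>M\<^esub>) \<Longrightarrow>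
    \<exists>w. (\<forall>l. w l \<in> E) \<and> (\<forall>a p. (a, p) \<in> G \<longrightarrow> p = pairing M n a w)"
proof (induction n arbitrary: G)
  case 0
  note G = 0
  define G' where "G' = {(a [], p) | a p. (a, p) \<in> G}"
  have b0: "a = (\<lambda>l. \<zero>)" if "a \<in> chains R 0" "a [] = \<zero>" for a
    using that by (auto simp: chains_def fun_eq_iff) (metis length_0_conv)
  have "\<exists>e\<in>E. \<forall>a p. (a, p) \<in> G' \<longrightarrow> p = a \<odot>\<^bsub>M\<^esub> e"
  proof (rule baer[unfolded baer_def, rule_format])
    show "G' \<subseteq> carrier R \<times> E" using G(1) by (auto simp: G'_def chains_def)
    show "(\<zero>, \<zero>\<^bsub>M\<^esub>) \<in> G'" using G(2) by (force simp: G'_def)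
    show "(a \<oplus> b, p \<oplus>\<^bsub>M\<^esub> q) \<in> G'" if "(a, p) \<in> G'" "(b, q) \<in> G'" for a b p q
      using that G(3) by (force simp: G'_def)
    show "(r \<otimes> a, r \<odot>\<^bsub>M\<^esub> p) \<in> G'" if "r \<in> carrier R" "(a, p) \<in> G'" for r a p
      using that G(4) by (force simp: G'_def)
    show "p = \<zero>\<^bsub>M\<^esub>" if "(\<zero>, p) \<in> G'" for p
      using that G(1,5) b0 by (force simp: G'_def)
  qed
  then obtain e where e: "e \<in> E" "\<forall>a p. (a, p) \<in> G' \<longrightarrow> p = a \<odot>\<^bsub>M\<^esub> e" by blast
  then show ?case by (intro exI[of _ "\<lambda>l. e"]) (auto simp: G'_def)
next
  case (Suc n)
  note G = Suc.prems
  let ?z = "\<lambda>l::bool list. \<zero>"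
  have z: "?z \<in> chains R n" by (simp add: chains_def)
  have Ec: "x \<in> carrier M" if "x \<in> E" for x using submodule_carrier[OF E that] .
  have dec: "a = join \<zero> (\<lambda>l. a (False # l)) (\<lambda>l. a (True # l))
      \<and> (\<lambda>l. a (False # l)) \<in> chains R n \<and> (\<lambda>l. a (True # l)) \<in> chains R n" if "a \<in> chains R (Suc n)" for a
    using that by (auto simp: chains_def intro!: join_eqI)
  have joinbv: "f \<in> chains R n \<and> g \<in> chains R n" if "(join \<zero> f g, p) \<in> G" for f g p
    using G(1) that dec[of "join \<zero> f g"] by auto
  \<comment> \<open>The restriction to families supported on lists that begin with
    \<open>False\<close>, a free module of half the rank.\<close>
  define G0 where "G0 = {(f, p). (join \<zero> f ?z, p) \<in> G}"
  have jadd: "(\<lambda>l. join \<zero> f g l \<oplus> join \<zero> f' g' l) = join \<zero> (\<lambda>l. f l \<oplus> f' l) (\<lambda>l. g l \<oplus> g' l)" for f g f' g'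
    by (rule join_eqI) auto
  have jsm: "(\<lambda>l. r \<otimes> join \<zero> f g l) = join \<zero> (\<lambda>l. r \<otimes> f l) (\<lambda>l. r \<otimes> g l)" if "r \<in> carrier R" for r f g
    using that by (intro join_eqI) auto
  have jz: "join \<zero> ?z ?z = ?z" by (rule sym, rule join_eqI) auto
  have "\<exists>w. (\<forall>l. w l \<in> E) \<and> (\<forall>a p. (a, p) \<in> G0 \<longrightarrow> p = pairing M n a w)"
  proof (rule Suc.IH)
    show "G0 \<subseteq> chains R n \<times> E" using G(1) joinbv by (auto simp: G0_def)
    show "(?z, \<zero>\<^bsub>M\<^esub>) \<in> G0" using G(2) by (simp add: G0_def jz)
    show "(\<lambda>l. a l \<oplus> b l, p \<oplus>\<^bsub>M\<^esub> q) \<in> G0" if "(a, p) \<in> G0" "(b, q) \<in> G0" for a p b q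
      using G(3)[of "join \<zero> a ?z" p "join \<zero> b ?z" q] that by (simp add: G0_def jadd)
    show "(\<lambda>l. r \<otimes> a l, r \<odot>\<^bsub>M\<^esub> p) \<in> G0" if "r \<in> carrier R" "(a, p) \<in> G0" for r a p
      using G(4)[of r "join \<zero> a ?z" p] that by (simp add: G0_def jsm)
    show "p = \<zero>\<^bsub>M\<^esub>" if "(?z, p) \<in> G0" for p
      using G(5) that by (simp add: G0_def jz)
  qed
  then obtain w0 where w0: "\<And>l. w0 l \<in> E" "\<And>a p. (a, p) \<in> G0 \<Longrightarrow> p = pairing M n a w0" by blast
  have w0c: "w0 l \<in> carrier M" for l using Ec w0(1) by blast
  \<comment> \<open>What is left of the homomorphism once \<open>w0\<close> accounts for the
    \<open>False\<close> half. It depends on the \<open>True\<close> half alone, because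
    \<open>w0\<close> reproduces the values of all families whose \<open>True\<close> half is
    zero.\<close>
  define G1 where "G1 = {(g, p \<ominus>\<^bsub>M\<^esub> pairing M n f w0) | f g p. (join \<zero> f g, p) \<in> G}"
  have G1I: "(x, y) \<in> G1" if "(join \<zero> f x, p) \<in> G" "y = p \<ominus>\<^bsub>M\<^esub> pairing M n f w0" for f x p y
    using that by (auto simp: G1_def)
  have bc: "pairing M n f w0 \<in> carrier M" if "f \<in> chains R n" for f
    using that w0c by (intro pairing_carrier) (auto simp: chains_def)
  have "\<exists>w. (\<forall>l. w l \<in> E) \<and> (\<forall>a p. (a, p) \<in> G1 \<longrightarrow> p = pairing M n a w)"
  proof (rule Suc.IH)
    show "G1 \<subseteq> chains R n \<times> E"
    proof clarify
      fix g q assume "(g, q) \<in> G1"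
      then obtain f p where *: "(join \<zero> f g, p) \<in> G" "q = p \<ominus>\<^bsub>M\<^esub> pairing M n f w0" by (auto simp: G1_def)
      have "pairing M n f w0 \<in> E" using joinbv[OF *(1)] w0(1) by (intro pairing_closed[OF E]) (auto simp: chains_def)
      then show "g \<in> chains R n \<and> q \<in> E" using * joinbv G(1) submodule_minus[OF E] by auto
    qed
    show "(?z, \<zero>\<^bsub>M\<^esub>) \<in> G1"
      by (rule G1I[of ?z _ "\<zero>\<^bsub>M\<^esub>"]) (use G(2) w0c in \<open>simp_all add: jz pairing_zero_l\<close>)
    show "(\<lambda>l. a l \<oplus> b l, p \<oplus>\<^bsub>M\<^esub> q) \<in> G1" if ab: "(a, p) \<in> G1" "(b, q) \<in> G1" for a p b q
    proof -
      obtain f p' f' q' where *: "(join \<zero> f a, p') \<in> G" "p = p' \<ominus>\<^bsub>M\<^esub> pairing M n f w0"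
        "(join \<zero> f' b, q') \<in> G" "q = q' \<ominus>\<^bsub>M\<^esub> pairing M n f' w0" using ab by (auto simp: G1_def)
      have fb: "f \<in> chains R n" "f' \<in> chains R n" "p' \<in> carrier M" "q' \<in> carrier M"
        using joinbv *(1,3) G(1) Ec by auto
      show ?thesis
      proof (rule G1I)
        show "(join \<zero> (\<lambda>l. f l \<oplus> f' l) (\<lambda>l. a l \<oplus> b l), p' \<oplus>\<^bsub>M\<^esub> q') \<in> G"
          using G(3)[OF *(1,3)] by (simp add: jadd)
        have "pairing M n (\<lambda>l. f l \<oplus> f' l) w0 = pairing M n f w0 \<oplus>\<^bsub>M\<^esub> pairing M n f' w0"
          using fb w0c by (intro pairing_add_l) (auto simp: chains_def)
        then show "p \<oplus>\<^bsub>M\<^esub> q = (p' \<oplus>\<^bsub>M\<^esub> q') \<ominus>\<^bsub>M\<^esub> pairing M n (\<lambda>l. f l \<oplus> f' l) w0"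
          using fb bc[OF fb(1)] bc[OF fb(2)] *(2,4) by (simp add: a_minus_def M.minus_add M.a_ac)
      qed
    qed
    show "(\<lambda>l. r \<otimes> a l, r \<odot>\<^bsub>M\<^esub> p) \<in> G1" if r: "r \<in> carrier R" "(a, p) \<in> G1" for r a p
    proof -
      obtain f p' where *: "(join \<zero> f a, p') \<in> G" "p = p' \<ominus>\<^bsub>M\<^esub> pairing M n f w0" using r by (auto simp: G1_def)
      have fb: "f \<in> chains R n" "p' \<in> carrier M" using joinbv *(1) G(1) Ec by auto
      show ?thesis
      proof (rule G1I)
        show "(join \<zero> (\<lambda>l. r \<otimes> f l) (\<lambda>l. r \<otimes> a l), r \<odot>\<^bsub>M\<^esub> p') \<in> G"
          using G(4)[OF r(1) *(1)] r by (simp add: jsm)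
        have "pairing M n (\<lambda>l. r \<otimes> f l) w0 = r \<odot>\<^bsub>M\<^esub> pairing M n f w0"
          using fb w0c r by (intro pairing_smult_l) (auto simp: chains_def)
        then show "r \<odot>\<^bsub>M\<^esub> p = r \<odot>\<^bsub>M\<^esub> p' \<ominus>\<^bsub>M\<^esub> pairing M n (\<lambda>l. r \<otimes> f l) w0"
          using fb bc[OF fb(1)] *(2) r by (simp add: a_minus_def smult_r_distr smult_r_minus)
      qed
    qed
    show "p = \<zero>\<^bsub>M\<^esub>" if zp: "(?z, p) \<in> G1" for p
    proof -
      obtain f p' where *: "(join \<zero> f ?z, p') \<in> G" "p = p' \<ominus>\<^bsub>M\<^esub> pairing M n f w0" using zp by (auto simp: G1_def)
      have "p' = pairing M n f w0" using w0(2)[of f p'] * by (simp add: G0_def)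
      then show ?thesis using *(2) bc[of f] joinbv[OF *(1)] by (simp add: a_minus_def M.r_neg)
    qed
  qed
  then obtain w1 where w1: "\<And>l. w1 l \<in> E" "\<And>a p. (a, p) \<in> G1 \<Longrightarrow> p = pairing M n a w1" by blast
  have w1c: "w1 l \<in> carrier M" for l using Ec w1(1) by blast
  show ?case
  proof (intro exI[of _ "join \<zero>\<^bsub>M\<^esub> w0 w1"] conjI allI impI)
    show "join \<zero>\<^bsub>M\<^esub> w0 w1 l \<in> E" for l
      using w0(1) w1(1) submodule_zero[OF E] by (auto simp: join_def split: list.split bool.split)
    fix a p assume ap: "(a, p) \<in> G"
    let ?f = "\<lambda>l. a (False # l)" and ?g = "\<lambda>l. a (True # l)"
    have a: "a = join \<zero> ?f ?g" "?f \<in> chains R n" "?g \<in> chains R n" using dec[of a] G(1) ap by auto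
    have "p \<ominus>\<^bsub>M\<^esub> pairing M n ?f w0 = pairing M n ?g w1"
      by (rule w1(2), rule G1I[of ?f _ p]) (use ap a(1) in auto)
    then have "p = pairing M n ?g w1 \<oplus>\<^bsub>M\<^esub> pairing M n ?f w0"
      using bc[OF a(2)] a(3) w1c ap G(1) Ec
      by (subst (asm) M.minus_eq_iff) (auto intro!: pairing_carrier simp: chains_def)
    moreover have "pairing M n ?g w1 \<in> carrier M" using a(3) w1c by (intro pairing_carrier) (auto simp: chains_def)
    ultimately show "p = pairing M (Suc n) a (join \<zero>\<^bsub>M\<^esub> w0 w1)"
      using bc[OF a(2)] by (simp add: M.a_comm)
  qed
qed

text \<open>The list is finite, so one power \<open>\<aa>\<^sup>k\<close> kills the multiples of
  \<open>x\<close> by all generators; then \<open>\<aa>\<^sup>k\<^sup>+\<^sup>1\<close> kills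
  \<open>x\<close>. In other words, a module modulo its torsion has no socle.\<close>

lemma torsion_mem_of_gens:
  assumes a: "\<aa> = Idl (set zs)" "set zs \<subseteq> carrier R" and x: "x \<in> carrier M"
    and zx: "\<And>z. z \<in> set zs \<Longrightarrow> z \<odot>\<^bsub>M\<^esub> x \<in> torsion_part R \<aa> M"
  shows "x \<in> torsion_part R \<aa> M"
proof -
  have aI: "ideal \<aa> R" using a R.genideal_ideal by simp
  let ?T = "torsion_part R \<aa> M"
  have ic: "b \<in> carrier R" if "b \<in> ideal_pow R \<aa> n" for b n
    using ideal.Icarr[OF R.ideal_pow_ideal[OF aI]] that by blast
  have "\<forall>z\<in>set zs. \<exists>n. \<forall>b\<in>ideal_pow R \<aa> n. b \<odot>\<^bsub>M\<^esub> (z \<odot>\<^bsub>M\<^esub> x) = \<zero>\<^bsub>M\<^esub>"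
    using zx by (auto simp: torsion_part_def)
  then obtain n where n: "\<And>z b. z \<in> set zs \<Longrightarrow> b \<in> ideal_pow R \<aa> (n z) \<Longrightarrow> b \<odot>\<^bsub>M\<^esub> (z \<odot>\<^bsub>M\<^esub> x) = \<zero>\<^bsub>M\<^esub>"
    by metis
  define k where "k = Max (insert 0 (n ` set zs))"
  have k: "n z \<le> k" if "z \<in> set zs" for z unfolding k_def using that by (intro Max_ge) auto
  define J where "J = {c \<in> carrier R. \<forall>b\<in>ideal_pow R \<aa> k. b \<odot>\<^bsub>M\<^esub> (c \<odot>\<^bsub>M\<^esub> x) = \<zero>\<^bsub>M\<^esub>}"
  have "ideal J R"
  proof (rule idealI[OF R.ring_axioms])
    show "subgroup J (add_monoid R)"
      using ic x by (intro R.add.subgroupI)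
        (auto simp: J_def smult_l_minus smult_r_minus smult_l_distr smult_r_distr intro!: exI[of _ \<zero>])
    fix c y assume c: "c \<in> J" "y \<in> carrier R"
    have "b \<odot>\<^bsub>M\<^esub> (y \<otimes> c \<odot>\<^bsub>M\<^esub> x) = \<zero>\<^bsub>M\<^esub>" if b: "b \<in> ideal_pow R \<aa> k" for b
    proof -
      have "b \<odot>\<^bsub>M\<^esub> (y \<otimes> c \<odot>\<^bsub>M\<^esub> x) = y \<odot>\<^bsub>M\<^esub> (b \<odot>\<^bsub>M\<^esub> (c \<odot>\<^bsub>M\<^esub> x))"
        using c x ic[OF b] by (simp add: J_def smult_assoc1[symmetric] R.m_ac)
      then show ?thesis using c b by (simp add: J_def)
    qed
    then show "y \<otimes> c \<in> J" "c \<otimes> y \<in> J" using c by (auto simp: J_def R.m_comm)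
  qed
  moreover have "set zs \<subseteq> J"
    using a(2) n k R.ideal_pow_antimono[OF aI] by (fastforce simp: J_def)
  ultimately have aJ: "\<aa> \<subseteq> J" using a R.genideal_minimal by metis
  have "b \<odot>\<^bsub>M\<^esub> x = \<zero>\<^bsub>M\<^esub>" if "b \<in> ideal_pow R \<aa> (Suc k)" for b
    using that unfolding R.ideal_pow_Suc
  proof (induction b rule: ideal_prod.induct)
    case (prod i j)
    then show ?case using aJ x ic by (auto simp: smult_assoc1 J_def)
  next
    case (sum s t)
    have "s \<in> carrier R" "t \<in> carrier R"
      using sum R.ideal_prod_in_carrier[OF R.ideal_pow_ideal[OF aI] aI] by blast+
    then show ?case using sum x by (simp add: smult_l_distr)
  qed
  then show ?thesis using x unfolding torsion_part_def by blast
qed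

end

text \<open>Let \<open>\<phi>\<close> be a cocycle modulo torsion. By the homotopy, pairing it with a Koszul cycle gives a torsion
  element. As the torsion is injective, \<open>\<phi>\<close> agrees on cycles with a torsion cochain \<open>\<psi>\<close>. Then \<open>\<phi> - \<psi>\<close> factors
  through the boundary, and it is a coboundary because \<open>P\<close> is injective.\<close>

lemma koszul_vanishing_injective:
  assumes inj: "injective_module R P" and noeth: "noetherian_ring R"
    and a: "\<aa> = Idl\<^bsub>R\<^esub> (set zs)" "set zs \<subseteq> carrier R"
  shows "koszul_vanishing P (carrier P) (torsion_part R \<aa> P) zs m"
proof -
  interpret module R P using inj by (simp add: injective_module_def)
  have aI: "ideal \<aa> R" using a R.genideal_ideal by simp
  let ?T = "torsion_part R \<aa> P" and ?n = "length zs"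
  have T: "submodule ?T R P" by (rule torsion_submodule[OF aI])
  have Tc: "x \<in> carrier P" if "x \<in> ?T" for x using that by (simp add: torsion_part_def)
  show ?thesis
  proof (rule koszul_vanishingI[OF carrier_is_submodule T a(2)])
    fix \<phi> assume \<phi>: "\<phi> \<in> cochains P (carrier P) zs m" and k\<phi>: "\<And>l. koszul P zs \<phi> l \<in> ?T"
    note [simp] = cochains_in[OF \<phi>]
    have kc [simp]: "koszul P zs \<phi> l \<in> carrier P" for l using k\<phi> Tc by blast
    have bvc: "b l \<in> carrier R" if "b \<in> chains R n" for b l n using that by (simp add: chains_def)
    have pairT: "pairing P ?n b \<phi> \<in> ?T" if b: "b \<in> chains R ?n" "boundary R zs b = (\<lambda>l. \<zero>\<^bsub>R\<^esub>)" for b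
    proof (rule torsion_mem_of_gens[OF a])
      note [simp] = bvc[OF b(1)]
      show "pairing P ?n b \<phi> \<in> carrier P" by (intro pairing_carrier) auto
      fix z assume "z \<in> set zs"
      then obtain k where k: "k < ?n" "z = zs ! k" by (metis in_set_conv_nth)
      then have zR: "zs ! k \<in> carrier R" using a(2) by auto
      have h [simp]: "homotopy P k \<phi> l \<in> carrier P" "homotopy P k (koszul P zs \<phi>) l \<in> carrier P" for l
        by (auto intro!: homotopy_closed[OF carrier_is_submodule])
      have kh [simp]: "koszul P zs (homotopy P k \<phi>) l \<in> carrier P" for l by (intro koszul_carrier a(2)) auto
      have "z \<odot>\<^bsub>P\<^esub> pairing P ?n b \<phi> = pairing P ?n b (\<lambda>l. z \<odot>\<^bsub>P\<^esub> \<phi> l)"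
        using k zR by (intro pairing_smult_r[symmetric]) auto
      also have "\<dots> = pairing P ?n b (\<lambda>l. koszul P zs (homotopy P k \<phi>) l \<oplus>\<^bsub>P\<^esub> homotopy P k (koszul P zs \<phi>) l)"
        using koszul_homotopy[OF a(2) _ k(1), of \<phi>] k(2) by (intro pairing_cong) auto
      also have "\<dots> = pairing P ?n b (koszul P zs (homotopy P k \<phi>)) \<oplus>\<^bsub>P\<^esub> pairing P ?n b (homotopy P k (koszul P zs \<phi>))"
        by (intro pairing_add_r) auto
      also have "pairing P ?n b (koszul P zs (homotopy P k \<phi>)) = \<zero>\<^bsub>P\<^esub>"
        using pairing_koszul[OF a(2), of b "homotopy P k \<phi>"] b(2) pairing_zero_l[of "homotopy P k \<phi>"] by simp
      finally have "z \<odot>\<^bsub>P\<^esub> pairing P ?n b \<phi> = pairing P ?n b (homotopy P k (koszul P zs \<phi>))"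
        by (simp add: pairing_carrier)
      also have "\<dots> \<in> ?T" using k\<phi> by (intro pairing_closed[OF T] homotopy_closed[OF T]) auto
      finally show "z \<odot>\<^bsub>P\<^esub> pairing P ?n b \<phi> \<in> ?T" .
    qed
    have bvz: "(\<lambda>l. \<zero>\<^bsub>R\<^esub>) \<in> chains R n" for n by (simp add: chains_def)
    have bva: "(\<lambda>l. b l \<oplus>\<^bsub>R\<^esub> c l) \<in> chains R n" if "b \<in> chains R n" "c \<in> chains R n" for b c n
      using that by (simp add: chains_def)
    have bvs: "(\<lambda>l. r \<otimes>\<^bsub>R\<^esub> b l) \<in> chains R n" if "r \<in> carrier R" "b \<in> chains R n" for b r n
      using that by (simp add: chains_def)
    have bdz: "boundary R zs (\<lambda>l. \<zero>\<^bsub>R\<^esub>) = (\<lambda>l. \<zero>\<^bsub>R\<^esub>)"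
      using boundary_smult[OF a(2), of "\<lambda>l. \<zero>\<^bsub>R\<^esub>" "\<zero>\<^bsub>R\<^esub>"] boundary_closed[OF a(2), of "\<lambda>l. \<zero>\<^bsub>R\<^esub>"] by (simp add: fun_eq_iff)
    have bda: "boundary R zs (\<lambda>l. b l \<oplus>\<^bsub>R\<^esub> c l) = (\<lambda>l. boundary R zs b l \<oplus>\<^bsub>R\<^esub> boundary R zs c l)"
      if "b \<in> chains R n" "c \<in> chains R n" for b c n
      using boundary_add[OF a(2)] bvc that by (simp add: fun_eq_iff)
    have bds: "boundary R zs (\<lambda>l. r \<otimes>\<^bsub>R\<^esub> b l) = (\<lambda>l. r \<otimes>\<^bsub>R\<^esub> boundary R zs b l)"
      if "r \<in> carrier R" "b \<in> chains R n" for b r n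
      using boundary_smult[OF a(2)] bvc that by (simp add: fun_eq_iff)
    have bpa: "pairing P ?n (\<lambda>l. b l \<oplus>\<^bsub>R\<^esub> c l) \<psi> = pairing P ?n b \<psi> \<oplus>\<^bsub>P\<^esub> pairing P ?n c \<psi>"
      if "b \<in> chains R ?n" "c \<in> chains R ?n" "\<And>l. \<psi> l \<in> carrier P" for b c \<psi>
      using that bvc by (intro pairing_add_l) auto
    have bps: "pairing P ?n (\<lambda>l. r \<otimes>\<^bsub>R\<^esub> b l) \<psi> = r \<odot>\<^bsub>P\<^esub> pairing P ?n b \<psi>"
      if "r \<in> carrier R" "b \<in> chains R ?n" "\<And>l. \<psi> l \<in> carrier P" for b r \<psi>
      using that bvc by (intro pairing_smult_l) auto
    define G1 where "G1 = {(b, pairing P ?n b \<phi>) | b. b \<in> chains R ?n \<and> boundary R zs b = (\<lambda>l. \<zero>\<^bsub>R\<^esub>)}"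
    have "\<exists>w. (\<forall>l. w l \<in> ?T) \<and> (\<forall>b p. (b, p) \<in> G1 \<longrightarrow> p = pairing P ?n b w)"
    proof (rule baer_extend[OF T torsion_baer[OF inj noeth aI]])
      show "G1 \<subseteq> chains R ?n \<times> ?T" using pairT by (auto simp: G1_def)
      show "((\<lambda>l. \<zero>\<^bsub>R\<^esub>), \<zero>\<^bsub>P\<^esub>) \<in> G1"
        using bvz bdz pairing_zero_l[of \<phi> ?n] by (auto simp: G1_def)
      show "(\<lambda>l. b l \<oplus>\<^bsub>R\<^esub> c l, p \<oplus>\<^bsub>P\<^esub> q) \<in> G1" if "(b, p) \<in> G1" "(c, q) \<in> G1" for b p c q
        using that bva bda[of b ?n c] bpa[of b c \<phi>] by (auto simp: G1_def)
      show "(\<lambda>l. r \<otimes>\<^bsub>R\<^esub> b l, r \<odot>\<^bsub>P\<^esub> p) \<in> G1" if "r \<in> carrier R" "(b, p) \<in> G1" for r b p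
        using that bvs bds[of r b ?n] bps[of r b \<phi>] by (auto simp: G1_def)
      show "p = \<zero>\<^bsub>P\<^esub>" if "((\<lambda>l. \<zero>\<^bsub>R\<^esub>), p) \<in> G1" for p
        using that pairing_zero_l[of \<phi> ?n] by (auto simp: G1_def)
    qed
    then obtain \<psi> where \<psi>: "\<And>l. \<psi> l \<in> ?T" "\<And>b p. (b, p) \<in> G1 \<Longrightarrow> p = pairing P ?n b \<psi>" by blast
    have \<psi>c [simp]: "\<psi> l \<in> carrier P" for l using \<psi>(1) Tc by blast
    define \<chi> where "\<chi> l = \<phi> l \<ominus>\<^bsub>P\<^esub> \<psi> l" for l
    have \<chi>c [simp]: "\<chi> l \<in> carrier P" for l by (simp add: \<chi>_def)
    have \<chi>0: "pairing P ?n b \<chi> = \<zero>\<^bsub>P\<^esub>" if "b \<in> chains R ?n" "boundary R zs b = (\<lambda>l. \<zero>\<^bsub>R\<^esub>)" for b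
    proof -
      have "pairing P ?n b \<phi> = pairing P ?n b \<psi>" using that by (intro \<psi>(2)) (auto simp: G1_def)
      moreover have "pairing P ?n b \<chi> = pairing P ?n b \<phi> \<ominus>\<^bsub>P\<^esub> pairing P ?n b \<psi>"
        unfolding \<chi>_def using bvc[OF that(1)] by (intro pairing_minus_r) auto
      ultimately show ?thesis using bvc[OF that(1)] by (simp add: a_minus_def pairing_carrier M.r_neg)
    qed
    \<comment> \<open>The graph is single-valued because \<chi> pairs to zero with the cycles, which
      form the kernel of the boundary.\<close>
    define G2 where "G2 = {(boundary R zs b, pairing P ?n b \<chi>) | b. b \<in> chains R ?n}"
    have G2I: "(x, y) \<in> G2" if "b \<in> chains R ?n" "x = boundary R zs b" "y = pairing P ?n b \<chi>" for x y b
      using that by (auto simp: G2_def)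
    have "\<exists>w. (\<forall>l. w l \<in> carrier P) \<and> (\<forall>b p. (b, p) \<in> G2 \<longrightarrow> p = pairing P ?n b w)"
    proof (rule baer_extend[OF carrier_is_submodule injective_imp_baer[OF inj]])
      show "G2 \<subseteq> chains R ?n \<times> carrier P" using boundary_chains[OF a(2)] bvc by (auto simp: G2_def intro!: pairing_carrier)
      show "((\<lambda>l. \<zero>\<^bsub>R\<^esub>), \<zero>\<^bsub>P\<^esub>) \<in> G2"
        using bdz pairing_zero_l[of \<chi> ?n] by (intro G2I[OF bvz]) auto
      show "(\<lambda>l. b l \<oplus>\<^bsub>R\<^esub> c l, p \<oplus>\<^bsub>P\<^esub> q) \<in> G2" if bc: "(b, p) \<in> G2" "(c, q) \<in> G2" for b p c q
      proof -
        obtain b' c' where *: "b' \<in> chains R ?n" "b = boundary R zs b'" "p = pairing P ?n b' \<chi>"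
          "c' \<in> chains R ?n" "c = boundary R zs c'" "q = pairing P ?n c' \<chi>" using bc by (auto simp: G2_def)
        show ?thesis using bda[OF *(1,4)] bpa[OF *(1,4), of \<chi>] * by (intro G2I[OF bva[OF *(1,4)]]) auto
      qed
      show "(\<lambda>l. r \<otimes>\<^bsub>R\<^esub> b l, r \<odot>\<^bsub>P\<^esub> p) \<in> G2" if rb: "r \<in> carrier R" "(b, p) \<in> G2" for r b p
      proof -
        obtain b' where *: "b' \<in> chains R ?n" "b = boundary R zs b'" "p = pairing P ?n b' \<chi>" using rb by (auto simp: G2_def)
        show ?thesis using bds[OF rb(1) *(1)] bps[OF rb(1) *(1), of \<chi>] * by (intro G2I[OF bvs[OF rb(1) *(1)]]) auto
      qed
      show "p = \<zero>\<^bsub>P\<^esub>" if "((\<lambda>l. \<zero>\<^bsub>R\<^esub>), p) \<in> G2" for p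
        using that \<chi>0 by (auto simp: G2_def)
    qed
    then obtain w where w: "\<And>l. w l \<in> carrier P" "\<And>b p. (b, p) \<in> G2 \<Longrightarrow> p = pairing P ?n b w" by blast
    \<comment> \<open>Lists of other lengths do not enter the pairing, so \<open>w\<close> may be
      set to zero there. On lists of the right length the bound \<open>Suc ?n\<close> is no
      restriction.\<close>
    define w' where "w' l = (if length l = ?n then w l else \<zero>\<^bsub>P\<^esub>)" for l
    have w'c [simp]: "w' l \<in> carrier P" for l using w(1) by (simp add: w'_def)
    have cnt: "count_list l True < Suc ?n" if "length l = ?n" for l
      using count_le_length[of l True] that by simp
    have w'coch: "w' \<in> cochains P (carrier P) zs (Suc ?n)"
      unfolding cochains_def w'_def using cnt w(1) by (simp del: not_less)
    have "\<phi> l \<ominus>\<^bsub>P\<^esub> koszul P zs w' l \<in> ?T" for l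
    proof (cases "length l = ?n")
      case True
      let ?u = "\<lambda>k. if k = l then \<one>\<^bsub>R\<^esub> else \<zero>\<^bsub>R\<^esub>"
      have u: "?u \<in> chains R ?n" using True by (auto simp: chains_def)
      have kw [simp]: "koszul P zs w' l \<in> carrier P" for l by (intro koszul_carrier a(2)) simp
      have "\<chi> l = pairing P ?n ?u \<chi>" using pairing_unit[OF True, of \<chi>] by simp
      also have "\<dots> = pairing P ?n (boundary R zs ?u) w" by (rule w(2)) (rule G2I[OF u refl refl])
      also have "\<dots> = pairing P ?n (boundary R zs ?u) w'" by (rule pairing_cong) (auto simp: w'_def)
      also have "\<dots> = pairing P ?n ?u (koszul P zs w')" using a(2) by (intro pairing_koszul[symmetric]) auto
      also have "\<dots> = koszul P zs w' l" using pairing_unit[OF True, of "koszul P zs w'"] by simp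
      finally have "\<phi> l \<ominus>\<^bsub>P\<^esub> \<psi> l = koszul P zs w' l" by (simp add: \<chi>_def)
      then have "\<phi> l = koszul P zs w' l \<oplus>\<^bsub>P\<^esub> \<psi> l" by (subst (asm) M.minus_eq_iff) auto
      then have "\<phi> l \<ominus>\<^bsub>P\<^esub> koszul P zs w' l = \<psi> l" by (subst M.minus_eq_iff) (auto simp: M.a_comm)
      then show ?thesis using \<psi>(1) by simp
    next
      case False
      then have "\<phi> l = \<zero>\<^bsub>P\<^esub>" "koszul P zs w' l = \<zero>\<^bsub>P\<^esub>"
        using \<phi> koszul_cochains[OF carrier_is_submodule a(2) w'coch] by (auto simp: cochains_def)
      then show ?thesis using submodule_zero[OF T] by simp
    qed
    then show "\<exists>n. \<exists>w\<in>cochains P (carrier P) zs n. \<forall>l. \<phi> l \<ominus>\<^bsub>P\<^esub> koszul P zs w l \<in> ?T"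
      using w'coch by blast
  qed
qed

lemma (in cring) torsion_hom:
  assumes "f \<in> module_hom R P Q" "x \<in> torsion_part R \<aa> P" "ideal \<aa> R" "f \<zero>\<^bsub>P\<^esub> = \<zero>\<^bsub>Q\<^esub>"
  shows "f x \<in> torsion_part R \<aa> Q"
proof -
  obtain n where n: "x \<in> carrier P" "\<And>a. a \<in> ideal_pow R \<aa> n \<Longrightarrow> a \<odot>\<^bsub>P\<^esub> x = \<zero>\<^bsub>P\<^esub>"
    using assms(2) by (auto simp: torsion_part_def)
  have "a \<odot>\<^bsub>Q\<^esub> f x = \<zero>\<^bsub>Q\<^esub>" if "a \<in> ideal_pow R \<aa> n" for a
    using assms(1,4) n(1) n(2)[OF that] ideal.Icarr[OF ideal_pow_ideal[OF assms(3)] that]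
    by (simp add: module_hom_def) metis
  then show ?thesis using assms(1) n(1) by (auto simp: torsion_part_def module_hom_def)
qed

lemma (in module) submodule_inter:
  assumes "submodule G R M" "submodule H R M"
  shows "submodule (G \<inter> H) R M"
  using submoduleE(1,3-5)[OF assms(1)] submoduleE(3-5)[OF assms(2)]
    submodule_zero[OF assms(1)] submodule_zero[OF assms(2)]
  by (intro submoduleI) auto

section \<open>Local cohomology and dimension shifting\<close>

text \<open>The augmentation is left out; it enters only as the map \<theta> in
  \<open>dimension_shift\<close>, so the resolved module may have elements of a different
  type.\<close>

locale torsion_resolution =
  fixes R :: "('r, 'z) ring_scheme" (structure) and \<aa> :: "'r set" and zs :: "'r list"
    and J :: "nat \<Rightarrow> ('r, 'e) module" and d :: "nat \<Rightarrow> 'e \<Rightarrow> 'e"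
  assumes cring: "cring R" and noeth: "noetherian_ring R"
    and gens: "\<aa> = Idl (set zs)" "set zs \<subseteq> carrier R"
    and inj: "\<And>i. injective_module R (J i)"
    and d_hom: "\<And>i. d i \<in> module_hom R (J i) (J (Suc i))"
    and exact: "\<And>i. d i ` carrier (J i) = {x \<in> carrier (J (Suc i)). d (Suc i) x = \<zero>\<^bsub>J (Suc (Suc i))\<^esub>}"
begin

sublocale R: cring R by (rule cring)

sublocale Ji: module R "J i" for i using inj by (simp add: injective_module_def)

lemma d_sub: "submodule_hom R (J i) (J (Suc i)) (carrier (J i)) (carrier (J (Suc i))) (d i)"
  using d_hom[of i]
  by (intro submodule_hom.intro submodule_hom_axioms.intro Ji.module_axioms Ji.carrier_is_submodule) simp

sublocale di: submodule_hom R "J i" "J (Suc i)" "carrier (J i)" "carrier (J (Suc i))" "d i" for i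
  by (rule d_sub)

definition tor where "tor i = torsion_part R \<aa> (J i)"

definition kerd where "kerd i = {x \<in> carrier (J i). d i x = \<zero>\<^bsub>J (Suc i)\<^esub>}"

text \<open>The vanishing of \<open>H\<^sup>i\<^sup>+\<^sup>1\<close>, moved one step back to
  \<open>J i\<close>: modulo cocycles and torsion, \<open>J i\<close> embeds in
  \<open>J (Suc i)\<close> modulo torsion. In this form it is exactness of a sequence of modules
  modulo torsion.\<close>

definition torsion_exact where "torsion_exact i \<longleftrightarrow>
  (\<forall>a\<in>carrier (J i). d i a \<in> tor (Suc i) \<longrightarrow> (\<exists>b\<in>kerd i. a \<ominus>\<^bsub>J i\<^esub> b \<in> tor i))"

lemma aI: "ideal \<aa> R" using gens R.genideal_ideal by simp

lemma tor_sub: "submodule (tor i) R (J i)"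
  unfolding tor_def by (rule Ji.torsion_submodule[OF aI])

lemma d_tor: "x \<in> tor i \<Longrightarrow> d i x \<in> tor (Suc i)"
  unfolding tor_def by (rule R.torsion_hom[OF d_hom _ aI di.zero])

lemma tor_carrier: "x \<in> tor i \<Longrightarrow> x \<in> carrier (J i)"
  by (simp add: tor_def torsion_part_def)

lemma kerd_sub: "submodule (kerd i) R (J i)"
proof (rule Ji.submoduleI)
  show "\<ominus>\<^bsub>J i\<^esub> a \<in> kerd i" if "a \<in> kerd i" for a
  proof -
    have a: "a \<in> carrier (J i)" "d i a = \<zero>\<^bsub>J (Suc i)\<^esub>" using that by (auto simp: kerd_def)
    have "\<ominus>\<^bsub>J i\<^esub> a = \<zero>\<^bsub>J i\<^esub> \<ominus>\<^bsub>J i\<^esub> a" using a by (simp add: a_minus_def)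
    then show ?thesis using a by (simp add: kerd_def di.minus di.zero)
  qed
qed (auto simp: kerd_def di.zero di.add di.smult)

lemma kerd_carrier: "x \<in> kerd i \<Longrightarrow> x \<in> carrier (J i)"
  by (simp add: kerd_def)

lemma d_kerd: "x \<in> carrier (J i) \<Longrightarrow> d i x \<in> kerd (Suc i)"
  using exact[of i] by (auto simp: kerd_def)

lemma kerd_d: "v \<in> kerd (Suc i) \<Longrightarrow> \<exists>x\<in>carrier (J i). v = d i x"
  using exact[of i] by (auto simp: kerd_def)

text \<open>By exactness of \<open>J\<close>, a torsion cocycle of degree \<open>Suc i\<close> is
  \<open>d i a\<close> for some \<open>a\<close>. It is the differential of a torsion element
  exactly if \<open>a\<close> becomes torsion after subtracting a cocycle.\<close>

lemma cohomology_zero_iff: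
  "carrier (local_cohomology R \<aa> J d (Suc i)) = {\<zero>\<^bsub>local_cohomology R \<aa> J d (Suc i)\<^esub>} \<longleftrightarrow> torsion_exact i"
proof -
  let ?i = "Suc i"
  define Z where "Z = {x \<in> tor ?i. d ?i x = \<zero>\<^bsub>J (Suc ?i)\<^esub>}"
  define B where "B = d i ` tor i"
  have B: "subgroup B (add_monoid (J ?i))"
  proof (rule Ji.add.subgroupI)
    show "B \<noteq> {}" using Ji.submodule_zero[OF tor_sub] by (auto simp: B_def)
    show "B \<subseteq> carrier (J ?i)" using d_tor tor_carrier by (auto simp: B_def)
    fix x assume x: "x \<in> B"
    then obtain t where t: "t \<in> tor i" "x = d i t" by (auto simp: B_def)
    have "d i (\<zero>\<^bsub>J i\<^esub> \<ominus>\<^bsub>J i\<^esub> t) = \<ominus>\<^bsub>J ?i\<^esub> x"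
      using t di.carr[OF tor_carrier[OF t(1)]] by (subst di.minus) (auto simp: tor_carrier di.zero a_minus_def)
    then show "\<ominus>\<^bsub>J ?i\<^esub> x \<in> B"
      using Ji.submodule_minus[OF tor_sub Ji.submodule_zero[OF tor_sub] t(1)] unfolding B_def by (metis imageI)
    fix y assume "y \<in> B"
    then obtain t' where t': "t' \<in> tor i" "y = d i t'" by (auto simp: B_def)
    have "x \<oplus>\<^bsub>J ?i\<^esub> y = d i (t \<oplus>\<^bsub>J i\<^esub> t')" using t t' tor_carrier by (simp add: di.add)
    then show "x \<oplus>\<^bsub>J ?i\<^esub> y \<in> B" using Ji.submoduleE(5)[OF tor_sub t(1) t'(1)] by (simp add: B_def)
  qed
  have Zc: "x \<in> carrier (J ?i)" if "x \<in> Z" for x using that tor_carrier by (simp add: Z_def)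
  have Z0: "\<zero>\<^bsub>J ?i\<^esub> \<in> Z" using Ji.submodule_zero[OF tor_sub] by (simp add: Z_def di.zero)
  have lc: "local_cohomology R \<aa> J d ?i = module_quot ((J ?i)\<lparr>carrier := Z\<rparr>) B"
    by (simp add: local_cohomology_def Z_def B_def tor_def)
  have cos: "B +>\<^bsub>(J ?i)\<lparr>carrier := Z\<rparr>\<^esub> x = B +>\<^bsub>J ?i\<^esub> x" for x
    by (simp add: a_r_coset_def r_coset_def)
  have "carrier (local_cohomology R \<aa> J d ?i) = (\<lambda>x. B +>\<^bsub>J ?i\<^esub> x) ` Z"
    unfolding lc by (auto simp: module_quot_def A_RCOSETS_def' cos)
  moreover have "\<zero>\<^bsub>local_cohomology R \<aa> J d ?i\<^esub> = B" unfolding lc by (simp add: module_quot_def)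
  moreover have "B +>\<^bsub>J ?i\<^esub> x = B \<longleftrightarrow> x \<in> B" if "x \<in> Z" for x
    using Ji.a_coset_join1[OF _ Zc[OF that] B] Ji.a_coset_join2[OF Zc[OF that] B] by blast
  moreover have "(\<lambda>x. B +>\<^bsub>J ?i\<^esub> x) ` Z = {B} \<longleftrightarrow> (\<forall>x\<in>Z. B +>\<^bsub>J ?i\<^esub> x = B)"
    using Z0 by (auto simp: set_eq_iff image_iff)
  ultimately have "carrier (local_cohomology R \<aa> J d ?i) = {\<zero>\<^bsub>local_cohomology R \<aa> J d ?i\<^esub>} \<longleftrightarrow> Z \<subseteq> B"
    by (simp add: subset_eq)
  also have "\<dots> \<longleftrightarrow> torsion_exact i"
  proof
    assume ZB: "Z \<subseteq> B"
    show "torsion_exact i" unfolding torsion_exact_def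
    proof (intro ballI impI)
      fix a assume a: "a \<in> carrier (J i)" "d i a \<in> tor (Suc i)"
      then have "d i a \<in> Z" using d_kerd[OF a(1)] by (simp add: Z_def kerd_def)
      then obtain w where w: "w \<in> tor i" "d i a = d i w" using ZB by (auto simp: B_def)
      have wc: "w \<in> carrier (J i)" using w tor_carrier by blast
      have "d i (a \<ominus>\<^bsub>J i\<^esub> w) = \<zero>\<^bsub>J ?i\<^esub>"
        using di.minus[OF a(1) wc] w(2) di.carr[OF wc] by (simp add: a_minus_def Ji.M.r_neg)
      then have "a \<ominus>\<^bsub>J i\<^esub> w \<in> kerd i" using a wc by (simp add: kerd_def)
      moreover have "a \<ominus>\<^bsub>J i\<^esub> (a \<ominus>\<^bsub>J i\<^esub> w) = w"
        using a wc by (simp add: a_minus_def Ji.minus_add Ji.M.r_neg2 Ji.M.minus_minus)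
      ultimately show "\<exists>b\<in>kerd i. a \<ominus>\<^bsub>J i\<^esub> b \<in> tor i" using w(1) by (intro bexI) auto
    qed
  next
    assume torsion_exact: "torsion_exact i"
    show "Z \<subseteq> B"
    proof
      fix x assume x: "x \<in> Z"
      then have "x \<in> kerd ?i" using tor_carrier by (simp add: Z_def kerd_def)
      then obtain a where a: "a \<in> carrier (J i)" "x = d i a" using kerd_d by blast
      moreover have "d i a \<in> tor ?i" using x a by (simp add: Z_def)
      ultimately obtain b where b: "b \<in> kerd i" "a \<ominus>\<^bsub>J i\<^esub> b \<in> tor i" using torsion_exact unfolding torsion_exact_def by blast
      have "d i (a \<ominus>\<^bsub>J i\<^esub> b) = x" using a b(1) by (simp add: kerd_def di.minus di.carr)
      then show "x \<in> B" using b(2) by (auto simp: B_def)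
    qed
  qed
  finally show ?thesis .
qed

lemma koszul_vanishing_J: "koszul_vanishing (J i) (carrier (J i)) (tor i) zs m"
  unfolding tor_def by (rule koszul_vanishing_injective[OF inj noeth gens])

lemma gens_tor: "x \<in> carrier (J i) \<Longrightarrow> (\<And>z. z \<in> set zs \<Longrightarrow> z \<odot>\<^bsub>J i\<^esub> x \<in> tor i) \<Longrightarrow> x \<in> tor i"
  unfolding tor_def by (rule Ji.torsion_mem_of_gens[OF gens])

text \<open>Here \<open>G / N\<close> is the \<open>i\<close>-th cocycle module of \<open>J\<close> modulo torsion. It embeds in \<open>J i\<close> modulo torsion, which has
  no Koszul cohomology, and \<open>torsion_exact i\<close> says that the cokernel is torsion-free, hence isomorphic
  to the next cocycle module modulo torsion.\<close>

lemma dimension_shift: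
  fixes P :: "('r, 'p, 'y) module_scheme"
  assumes \<theta>: "submodule_hom R P (J i) G (carrier (J i)) \<theta>"
    and N: "submodule N R P" "N \<subseteq> G" and \<theta>N: "\<And>x. x \<in> G \<Longrightarrow> \<theta> x \<in> tor i \<longleftrightarrow> x \<in> N"
    and im: "\<theta> ` G = kerd i"
  shows "koszul_vanishing P G N zs (Suc (Suc m)) \<longleftrightarrow>
    torsion_exact i \<and> koszul_vanishing (J (Suc i)) (kerd (Suc i)) (kerd (Suc i) \<inter> tor (Suc i)) zs (Suc m)"
proof -
  interpret \<theta>: submodule_hom R P "J i" G "carrier (J i)" \<theta> by (rule \<theta>)
  note zs = gens(2)
  have exI: "torsion_exact i" if van: "koszul_vanishing P G N zs (Suc (Suc m))"
    unfolding torsion_exact_def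
  proof (intro ballI impI)
    have van2: "koszul_vanishing P G N zs 2"
      by (rule \<theta>.P.koszul_vanishing_mono[OF \<theta>.G N(1) zs van]) simp
    fix a assume a: "a \<in> carrier (J i)" "d i a \<in> tor (Suc i)"
    \<comment> \<open>The sum of the image of \<theta> and the torsion;
      \<open>torsion_exact i\<close> claims that every \<open>a\<close> with torsion differential
      lies in it.\<close>
    define S where "S = {x \<in> carrier (J i). \<exists>g\<in>G. x \<ominus>\<^bsub>J i\<^esub> \<theta> g \<in> tor i}"
    have S: "submodule S R (J i)"
    proof (rule Ji.submoduleI)
      show "\<zero>\<^bsub>J i\<^esub> \<in> S"
        using \<theta>.zero \<theta>.P.submodule_zero[OF \<theta>.G] Ji.submodule_zero[OF tor_sub]
        by (auto simp: S_def intro!: bexI[of _ "\<zero>\<^bsub>P\<^esub>"])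
      fix x assume x: "x \<in> S"
      then obtain g where g: "x \<in> carrier (J i)" "g \<in> G" "x \<ominus>\<^bsub>J i\<^esub> \<theta> g \<in> tor i" by (auto simp: S_def)
      show "r \<odot>\<^bsub>J i\<^esub> x \<in> S" if r: "r \<in> carrier R" for r
      proof -
        have "r \<odot>\<^bsub>J i\<^esub> (x \<ominus>\<^bsub>J i\<^esub> \<theta> g) = r \<odot>\<^bsub>J i\<^esub> x \<ominus>\<^bsub>J i\<^esub> \<theta> (r \<odot>\<^bsub>P\<^esub> g)"
          using r g \<theta>.carr[OF g(2)] by (simp add: a_minus_def Ji.smult_r_distr Ji.smult_r_minus \<theta>.smult)
        then have "r \<odot>\<^bsub>J i\<^esub> x \<ominus>\<^bsub>J i\<^esub> \<theta> (r \<odot>\<^bsub>P\<^esub> g) \<in> tor i"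
          using submodule.smult_closed[OF tor_sub r g(3)] by simp
        then show ?thesis using submodule.smult_closed[OF \<theta>.G r g(2)] g(1) r by (auto simp: S_def)
      qed
      from this[of "\<ominus> \<one>"] show "\<ominus>\<^bsub>J i\<^esub> x \<in> S" using g(1) by (simp add: Ji.smult_l_minus)
      fix y assume y: "y \<in> S"
      then obtain h where h: "y \<in> carrier (J i)" "h \<in> G" "y \<ominus>\<^bsub>J i\<^esub> \<theta> h \<in> tor i" by (auto simp: S_def)
      have "(x \<ominus>\<^bsub>J i\<^esub> \<theta> g) \<oplus>\<^bsub>J i\<^esub> (y \<ominus>\<^bsub>J i\<^esub> \<theta> h) = (x \<oplus>\<^bsub>J i\<^esub> y) \<ominus>\<^bsub>J i\<^esub> \<theta> (g \<oplus>\<^bsub>P\<^esub> h)"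
        using g h \<theta>.carr[OF g(2)] \<theta>.carr[OF h(2)] by (simp add: a_minus_def \<theta>.add Ji.minus_add Ji.M.a_ac)
      then have "(x \<oplus>\<^bsub>J i\<^esub> y) \<ominus>\<^bsub>J i\<^esub> \<theta> (g \<oplus>\<^bsub>P\<^esub> h) \<in> tor i" using Ji.submoduleE(5)[OF tor_sub g(3) h(3)] by simp
      then show "x \<oplus>\<^bsub>J i\<^esub> y \<in> S" using \<theta>.P.submoduleE(5)[OF \<theta>.G g(2) h(2)] g(1) h(1) by (auto simp: S_def)
    qed (auto simp: S_def)
    have kS: "x \<in> S" if x: "x \<in> kerd i" for x
    proof -
      obtain g where g: "g \<in> G" "x = \<theta> g" using x im by auto
      then show ?thesis using Ji.submodule_zero[OF tor_sub] kerd_carrier[OF x]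
        by (auto simp: S_def a_minus_def Ji.M.r_neg intro!: bexI[of _ g])
    qed
    \<comment> \<open>Otherwise some multiple \<open>b\<close> of \<open>a\<close> is a nonzero
      socle element modulo \<open>S\<close>. The coboundary of \<open>b\<close> then lifts to a
      cocycle of degree 1 in \<open>G / N\<close>, hence to a coboundary. So \<open>b\<close> minus
      an element of the image of \<theta> is a cocycle of degree 0 in \<open>J i\<close> modulo
      torsion, where there are none except zero, and \<open>b\<close> lies in \<open>S\<close> after
      all.\<close>
    have "a \<in> S"
    proof (rule ccontr)
      assume aS: "a \<notin> S"
      obtain n0 where n0: "\<And>u. u \<in> ideal_pow R \<aa> n0 \<Longrightarrow> u \<odot>\<^bsub>J (Suc i)\<^esub> d i a = \<zero>\<^bsub>J (Suc i)\<^esub>"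
        using a(2) by (auto simp: tor_def torsion_part_def)
      have ic: "u \<in> carrier R" if "u \<in> ideal_pow R \<aa> n" for u n
        using ideal.Icarr[OF R.ideal_pow_ideal[OF aI] that] .
      have ex0: "\<forall>u\<in>ideal_pow R \<aa> n0. u \<odot>\<^bsub>J i\<^esub> a \<in> S"
        using n0 ic a(1) by (auto intro!: kS simp: kerd_def di.smult)
      \<comment> \<open>The least power of \<aa> that carries \<open>a\<close> into \<open>S\<close>
        is not the zeroth; an element \<open>u\<close> of the power before it gives the socle
        element.\<close>
      define Q where "Q n \<longleftrightarrow> (\<forall>u\<in>ideal_pow R \<aa> n. u \<odot>\<^bsub>J i\<^esub> a \<in> S)" for n
      define n where "n = (LEAST n. Q n)"
      have "Q n" unfolding n_def by (rule LeastI[of Q n0]) (simp add: Q_def ex0)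
      then have n: "\<forall>u\<in>ideal_pow R \<aa> n. u \<odot>\<^bsub>J i\<^esub> a \<in> S" by (simp add: Q_def)
      have "n \<noteq> 0"
      proof
        assume "n = 0"
        then have "\<one> \<odot>\<^bsub>J i\<^esub> a \<in> S" using n unfolding \<open>n = 0\<close> R.ideal_pow_0 by blast
        then show False using aS a(1) by simp
      qed
      then obtain n' where n': "n = Suc n'" by (cases n) auto
      then have "\<not> (\<forall>u\<in>ideal_pow R \<aa> n'. u \<odot>\<^bsub>J i\<^esub> a \<in> S)"
        using not_less_Least[of n' Q] unfolding n_def Q_def by simp
      then obtain u where u: "u \<in> ideal_pow R \<aa> n'" "u \<odot>\<^bsub>J i\<^esub> a \<notin> S" by blast
      define b where "b = u \<odot>\<^bsub>J i\<^esub> a"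
      have b: "b \<in> carrier (J i)" using u(1) ic a(1) by (simp add: b_def)
      have zb: "z \<odot>\<^bsub>J i\<^esub> b \<in> S" if z: "z \<in> set zs" for z
      proof -
        have za: "z \<in> \<aa>" "z \<in> carrier R" using z gens R.genideal_self[OF gens(2)] by auto
        have "u \<otimes> z \<in> ideal_pow R \<aa> n" unfolding n' R.ideal_pow_Suc using u(1) za by (simp add: ideal_prod.prod)
        then have "(u \<otimes> z) \<odot>\<^bsub>J i\<^esub> a \<in> S" using n by blast
        then show ?thesis using za u(1) ic a(1) by (simp add: b_def Ji.smult_assoc1[symmetric] R.m_comm)
      qed
      let ?r = "replicate (length zs) False"
      define \<beta> where "\<beta> l = (if l = ?r then b else \<zero>\<^bsub>J i\<^esub>)" for l
      have ct: "count_list (replicate n False) True = 0" for n by (induction n) auto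
      have \<beta>: "\<beta> \<in> cochains (J i) (carrier (J i)) zs 1" using b ct by (auto simp: cochains_def \<beta>_def)
      have \<beta>c: "\<beta> l \<in> carrier (J i)" for l using b by (simp add: \<beta>_def)
      have kc: "koszul (J i) zs \<beta> l \<in> carrier (J i)" for l using \<beta>c by (intro Ji.koszul_carrier[OF zs])
      have kS': "koszul (J i) zs \<beta> l \<in> S" for l
        using Ji.koszul_1[OF zs S \<beta>] zb by (simp add: \<beta>_def)
      have "\<exists>\<phi>\<in>cochains P G zs 2. \<forall>l. koszul (J i) zs \<beta> l \<in> S \<longrightarrow> koszul (J i) zs \<beta> l \<ominus>\<^bsub>J i\<^esub> \<theta> (\<phi> l) \<in> tor i"
      proof (rule cochains_choose)
        show "koszul (J i) zs \<beta> \<in> cochains (J i) (carrier (J i)) zs 2"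
          using Ji.koszul_cochains[OF Ji.carrier_is_submodule zs \<beta>] by (simp add: numeral_2_eq_2)
        show "\<exists>x\<in>G. y \<in> S \<longrightarrow> y \<ominus>\<^bsub>J i\<^esub> \<theta> x \<in> tor i" for y
          using \<theta>.P.submodule_zero[OF \<theta>.G] by (auto simp: S_def)
        show "\<zero>\<^bsub>J i\<^esub> \<in> S \<longrightarrow> \<zero>\<^bsub>J i\<^esub> \<ominus>\<^bsub>J i\<^esub> \<theta> \<zero>\<^bsub>P\<^esub> \<in> tor i"
          using Ji.submodule_zero[OF tor_sub] by (simp add: \<theta>.zero)
        show "\<zero>\<^bsub>P\<^esub> \<in> G" by (rule \<theta>.P.submodule_zero[OF \<theta>.G])
      qed
      then obtain \<phi> where \<phi>: "\<phi> \<in> cochains P G zs 2" and \<phi>\<beta>: "\<And>l. koszul (J i) zs \<beta> l \<ominus>\<^bsub>J i\<^esub> \<theta> (\<phi> l) \<in> tor i"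
        using kS' by blast
      note \<phi>G = \<theta>.P.cochains_in[OF \<phi>]
      have \<theta>\<phi>c: "\<theta> (\<phi> l) \<in> carrier (J i)" for l using \<theta>.carr \<phi>G by blast
      have "koszul P zs \<phi> l \<in> N" for l
      proof -
        have "koszul (J i) zs (\<lambda>l. koszul (J i) zs \<beta> l \<ominus>\<^bsub>J i\<^esub> \<theta> (\<phi> l)) l \<in> tor i"
          by (rule Ji.koszul_closed[OF tor_sub zs \<phi>\<beta>])
        also have "koszul (J i) zs (\<lambda>l. koszul (J i) zs \<beta> l \<ominus>\<^bsub>J i\<^esub> \<theta> (\<phi> l)) l =
          \<zero>\<^bsub>J i\<^esub> \<ominus>\<^bsub>J i\<^esub> koszul (J i) zs (\<lambda>l. \<theta> (\<phi> l)) l"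
          using kc \<theta>\<phi>c \<beta>c by (subst Ji.koszul_minus[OF zs]) (simp_all add: Ji.koszul_koszul[OF zs])
        finally have "koszul (J i) zs (\<lambda>l. \<theta> (\<phi> l)) l \<in> tor i"
          using Ji.submodule_cong_mem[OF tor_sub[of i], of "\<zero>\<^bsub>J i\<^esub>" "koszul (J i) zs (\<lambda>l. \<theta> (\<phi> l)) l"]
            Ji.koszul_carrier[OF zs, of "\<lambda>l. \<theta> (\<phi> l)"] \<theta>\<phi>c Ji.submodule_zero[OF tor_sub[of i]]
          by simp
        then have "\<theta> (koszul P zs \<phi> l) \<in> tor i" using \<theta>.koszul[OF zs, of \<phi> l] \<phi>G by simp
        then show ?thesis using \<theta>N \<theta>.P.koszul_closed[OF \<theta>.G zs, of \<phi> l] \<phi>G by blast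
      qed
      then obtain w where w: "w \<in> cochains P G zs 1" "\<And>l. \<phi> l \<ominus>\<^bsub>P\<^esub> koszul P zs w l \<in> N"
        using van2 \<phi> unfolding koszul_vanishing_def by fastforce
      note wG = \<theta>.P.cochains_in[OF w(1)]
      have \<theta>wc: "\<theta> (w l) \<in> carrier (J i)" for l using \<theta>.carr wG by blast
      have kwG: "koszul P zs w l \<in> G" for l using wG by (intro \<theta>.P.koszul_closed[OF \<theta>.G zs])
      have 1: "\<theta> (\<phi> l) \<ominus>\<^bsub>J i\<^esub> koszul (J i) zs (\<lambda>l. \<theta> (w l)) l \<in> tor i" for l
      proof -
        have "\<theta> (\<phi> l \<ominus>\<^bsub>P\<^esub> koszul P zs w l) \<in> tor i" using \<theta>N w(2) N(2) by blast
        then show ?thesis using \<theta>.minus[OF \<phi>G kwG, of l l] \<theta>.koszul[OF zs, of w l] wG by simp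
      qed
      have "koszul (J i) zs (\<lambda>l. \<beta> l \<ominus>\<^bsub>J i\<^esub> \<theta> (w l)) l \<in> tor i" for l
      proof -
        have "koszul (J i) zs \<beta> l \<ominus>\<^bsub>J i\<^esub> koszul (J i) zs (\<lambda>l. \<theta> (w l)) l \<in> tor i"
          by (rule Ji.submodule_cong_trans[OF tor_sub kc \<theta>\<phi>c Ji.koszul_carrier[OF zs \<theta>wc] \<phi>\<beta> 1])
        then show ?thesis using Ji.koszul_minus[OF zs, of \<beta> i "\<lambda>l. \<theta> (w l)" l] \<beta>c \<theta>wc by simp
      qed
      moreover have "(\<lambda>l. \<beta> l \<ominus>\<^bsub>J i\<^esub> \<theta> (w l)) \<in> cochains (J i) (carrier (J i)) zs 1"
        by (rule Ji.cochains_minus[OF Ji.carrier_is_submodule \<beta> \<theta>.cochains[OF w(1)]])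
      ultimately obtain v where v: "v \<in> cochains (J i) (carrier (J i)) zs 0"
        "\<And>l. (\<beta> l \<ominus>\<^bsub>J i\<^esub> \<theta> (w l)) \<ominus>\<^bsub>J i\<^esub> koszul (J i) zs v l \<in> tor i"
        using koszul_vanishing_J[of i 1] unfolding koszul_vanishing_def by fastforce
      have "koszul (J i) zs v l = \<zero>\<^bsub>J i\<^esub>" for l using Ji.cochains_0[OF v(1)] Ji.koszul_zero[OF zs] by simp
      then have "b \<ominus>\<^bsub>J i\<^esub> \<theta> (w ?r) \<in> tor i" using v(2)[of ?r] b \<theta>wc by (simp add: \<beta>_def)
      then have "b \<in> S" using b wG by (auto simp: S_def)
      then show False using u(2) by (simp add: b_def)
    qed
    then obtain g where "g \<in> G" "a \<ominus>\<^bsub>J i\<^esub> \<theta> g \<in> tor i" by (auto simp: S_def)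
    then show "\<exists>b\<in>kerd i. a \<ominus>\<^bsub>J i\<^esub> b \<in> tor i" using im by blast
  qed
  have main: "koszul_vanishing P G N zs (Suc (Suc m)) \<longleftrightarrow>
      koszul_vanishing (J (Suc i)) (kerd (Suc i)) (kerd (Suc i) \<inter> tor (Suc i)) zs (Suc m)" if torsion_exact: "torsion_exact i"
  proof -
    have int: "submodule (kerd (Suc i) \<inter> tor (Suc i)) R (J (Suc i))"
      by (rule Ji.submodule_inter[OF kerd_sub tor_sub])
    have dh: "submodule_hom R (J i) (J (Suc i)) (carrier (J i)) (kerd (Suc i)) (d i)"
    proof (intro submodule_hom.intro submodule_hom_axioms.intro Ji.module_axioms Ji.carrier_is_submodule kerd_sub)
      show "d i \<in> module_hom R (J i\<lparr>carrier := carrier (J i)\<rparr>) (J (Suc i)\<lparr>carrier := kerd (Suc i)\<rparr>)"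
        using d_hom[of i] d_kerd by (auto simp: module_hom_def)
    qed
    interpret ses R P "J i" "J (Suc i)" G "carrier (J i)" "kerd (Suc i)" \<theta> "d i" N "tor i" "kerd (Suc i) \<inter> tor (Suc i)" zs
    proof (intro ses.intro ses_axioms.intro \<theta> dh N tor_sub int zs)
      show "\<theta> x \<in> tor i \<longleftrightarrow> x \<in> N" if "x \<in> G" for x by (rule \<theta>N[OF that])
      show "d i u \<in> kerd (Suc i) \<inter> tor (Suc i) \<longleftrightarrow> (\<exists>x\<in>G. u \<ominus>\<^bsub>J i\<^esub> \<theta> x \<in> tor i)" if u: "u \<in> carrier (J i)" for u
      proof
        assume "d i u \<in> kerd (Suc i) \<inter> tor (Suc i)"
        then obtain b where b: "b \<in> kerd i" "u \<ominus>\<^bsub>J i\<^esub> b \<in> tor i" using torsion_exact u unfolding torsion_exact_def by blast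
        obtain x where "x \<in> G" "b = \<theta> x" using im b(1) by blast
        then show "\<exists>x\<in>G. u \<ominus>\<^bsub>J i\<^esub> \<theta> x \<in> tor i" using b(2) by blast
      next
        assume "\<exists>x\<in>G. u \<ominus>\<^bsub>J i\<^esub> \<theta> x \<in> tor i"
        then obtain x where x: "x \<in> G" "u \<ominus>\<^bsub>J i\<^esub> \<theta> x \<in> tor i" by blast
        have k: "\<theta> x \<in> kerd i" using im x(1) by blast
        have "d i (u \<ominus>\<^bsub>J i\<^esub> \<theta> x) = d i u" using u k by (simp add: kerd_def di.minus di.carr)
        then show "d i u \<in> kerd (Suc i) \<inter> tor (Suc i)" using d_tor[OF x(2)] d_kerd[OF u] by simp
      qed
      show "\<exists>u\<in>carrier (J i). v \<ominus>\<^bsub>J (Suc i)\<^esub> d i u \<in> kerd (Suc i) \<inter> tor (Suc i)" if v: "v \<in> kerd (Suc i)" for v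
      proof -
        obtain u where u: "u \<in> carrier (J i)" "v = d i u" using kerd_d[OF v] by blast
        then have "v \<ominus>\<^bsub>J (Suc i)\<^esub> d i u = \<zero>\<^bsub>J (Suc i)\<^esub>" by (simp add: a_minus_def Ji.M.r_neg di.carr)
        then show ?thesis using u(1) Ji.submodule_zero[OF int] by (intro bexI[of _ u]) auto
      qed
      show "tor i \<subseteq> carrier (J i)" using tor_carrier by blast
    qed auto
    show ?thesis using koszul_vanishing_right[OF koszul_vanishing_J] koszul_vanishing_left[OF _ koszul_vanishing_J] by blast
  qed
  show ?thesis using exI main by blast
qed

text \<open>\<open>dimension_shift\<close> iterated along the inclusions of the cocycle modules. It
  starts from the fact that cocycles modulo torsion have no socle, so degree 0 always
  vanishes.\<close>

lemma koszul_vanishing_kerd: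
  "koszul_vanishing (J i) (kerd i) (kerd i \<inter> tor i) zs (Suc m) \<longleftrightarrow> (\<forall>j<m. torsion_exact (i + j))"
proof (induction m arbitrary: i)
  case 0
  have "submodule (kerd i \<inter> tor i) R (J i)"
    by (rule Ji.submodule_inter[OF kerd_sub tor_sub])
  from Ji.koszul_vanishing_1[OF kerd_sub gens(2) this] show ?case using gens_tor kerd_carrier by auto
next
  case (Suc m)
  have sub: "submodule (kerd i \<inter> tor i) R (J i)"
    by (rule Ji.submodule_inter[OF kerd_sub tor_sub])
  have h: "submodule_hom R (J i) (J i) (kerd i) (carrier (J i)) (\<lambda>x. x)"
    by (intro submodule_hom.intro submodule_hom_axioms.intro Ji.module_axioms Ji.carrier_is_submodule kerd_sub)
      (auto simp: module_hom_def kerd_def)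
  have "koszul_vanishing (J i) (kerd i) (kerd i \<inter> tor i) zs (Suc (Suc m)) \<longleftrightarrow> torsion_exact i \<and> (\<forall>j<m. torsion_exact (Suc i + j))"
    unfolding Suc.IH[symmetric] by (rule dimension_shift[OF h sub]) auto
  also have "\<dots> \<longleftrightarrow> (\<forall>j<Suc m. torsion_exact (i + j))"
    by (metis (no_types, lifting) add.right_neutral add_Suc_shift less_Suc_eq_0_disj)
  finally show ?case .
qed

text \<open>The first shift leads from the resolved module to the cocycles of \<open>J 1\<close>,
  the others stay within the resolution. The bound \<open>Suc s\<close> means degrees
  \<open>0\<close> to \<open>s\<close>, and \<open>1 \<le> s\<close> leaves room for the first
  shift.\<close>

lemma koszul_vanishing_iff_cohomology_zero:
  fixes P :: "('r, 'p, 'y) module_scheme"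
  assumes "submodule_hom R P (J 0) G (carrier (J 0)) \<theta>"
    and "submodule N R P" "N \<subseteq> G" and "\<And>x. x \<in> G \<Longrightarrow> \<theta> x \<in> tor 0 \<longleftrightarrow> x \<in> N"
    and "\<theta> ` G = kerd 0" and "1 \<le> s"
  shows "koszul_vanishing P G N zs (Suc s) \<longleftrightarrow> (\<forall>i\<in>{1..s}.
    carrier (local_cohomology R \<aa> J d i) = {\<zero>\<^bsub>local_cohomology R \<aa> J d i\<^esub>})"
proof -
  obtain m where m: "s = Suc m" using assms(6) by (cases s) auto
  have "koszul_vanishing P G N zs (Suc s) \<longleftrightarrow> torsion_exact 0 \<and> (\<forall>j<m. torsion_exact (Suc 0 + j))"
    unfolding koszul_vanishing_kerd[symmetric] m by (rule dimension_shift[OF assms(1-5)])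
  also have "\<dots> \<longleftrightarrow> (\<forall>j<s. torsion_exact j)"
    by (metis (no_types, lifting) m add_Suc plus_nat.add_0 less_Suc_eq_0_disj)
  also have "\<dots> \<longleftrightarrow> (\<forall>i\<in>{1..s}. carrier (local_cohomology R \<aa> J d i) = {\<zero>\<^bsub>local_cohomology R \<aa> J d i\<^esub>})"
  proof
    assume a: "\<forall>j<s. torsion_exact j"
    show "\<forall>i\<in>{1..s}. carrier (local_cohomology R \<aa> J d i) = {\<zero>\<^bsub>local_cohomology R \<aa> J d i\<^esub>}"
    proof
      fix i assume "i \<in> {1..s}"
      then obtain j where "i = Suc j" "j < s" by (cases i) auto
      then show "carrier (local_cohomology R \<aa> J d i) = {\<zero>\<^bsub>local_cohomology R \<aa> J d i\<^esub>}"
        using a cohomology_zero_iff by simp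
    qed
  next
    assume a: "\<forall>i\<in>{1..s}. carrier (local_cohomology R \<aa> J d i) = {\<zero>\<^bsub>local_cohomology R \<aa> J d i\<^esub>}"
    show "\<forall>j<s. torsion_exact j"
    proof (intro allI impI)
      fix j assume "j < s"
      then have "Suc j \<in> {1..s}" by simp
      then show "torsion_exact j" using a cohomology_zero_iff[of j] by blast
    qed
  qed
  finally show ?thesis .
qed

end

section \<open>Noetherian subrings\<close>

text \<open>Modules over a subring \<open>S\<close> are represented by the sets of elements of the overring closed under the operations,
  so that rings can be adjoined to step by step without a change of type.\<close>

definition scalar_closed :: "('r, 'z) ring_scheme \<Rightarrow> 'r set \<Rightarrow> 'r set \<Rightarrow> bool" where
  "scalar_closed R S K \<longleftrightarrow> \<zero>\<^bsub>R\<^esub> \<in> K \<and> (\<forall>x\<in>K. \<forall>y\<in>K. x \<oplus>\<^bsub>R\<^esub> y \<in> K) \<and> (\<forall>s\<in>S. \<forall>x\<in>K. s \<otimes>\<^bsub>R\<^esub> x \<in> K)"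

definition finite_span :: "('r, 'z) ring_scheme \<Rightarrow> 'r set \<Rightarrow> 'r set \<Rightarrow> 'r set \<Rightarrow> bool" where
  "finite_span R S K G \<longleftrightarrow> finite G \<and> G \<subseteq> K \<and> (\<forall>K'. scalar_closed R S K' \<and> G \<subseteq> K' \<longrightarrow> K \<subseteq> K')"

definition noetherian_subring :: "('r, 'z) ring_scheme \<Rightarrow> 'r set \<Rightarrow> bool" where
  "noetherian_subring R S \<longleftrightarrow> (\<forall>K. K \<subseteq> S \<longrightarrow> scalar_closed R S K \<longrightarrow> (\<exists>G. finite_span R S K G))"

lemma finite_spanD:
  assumes "finite_span R S K G"
  shows "finite G" "G \<subseteq> K" "\<And>K'. scalar_closed R S K' \<Longrightarrow> G \<subseteq> K' \<Longrightarrow> K \<subseteq> K'"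
  using assms by (auto simp: finite_span_def)

text \<open>The values at \<open>z\<close> of the polynomials of degree less than \<open>n\<close> with coefficients in \<open>S\<close>.\<close>

fun polys_below :: "('r, 'z) ring_scheme \<Rightarrow> 'r set \<Rightarrow> 'r \<Rightarrow> nat \<Rightarrow> 'r set" where
  "polys_below R S z 0 = {\<zero>\<^bsub>R\<^esub>}"
| "polys_below R S z (Suc n) = {p \<oplus>\<^bsub>R\<^esub> c \<otimes>\<^bsub>R\<^esub> z [^]\<^bsub>R\<^esub> n | p c. p \<in> polys_below R S z n \<and> c \<in> S}"

lemma scalar_closedD:
  assumes "scalar_closed R S K"
  shows "\<zero>\<^bsub>R\<^esub> \<in> K" "\<And>x y. x \<in> K \<Longrightarrow> y \<in> K \<Longrightarrow> x \<oplus>\<^bsub>R\<^esub> y \<in> K"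
    "\<And>s x. s \<in> S \<Longrightarrow> x \<in> K \<Longrightarrow> s \<otimes>\<^bsub>R\<^esub> x \<in> K"
  using assms by (auto simp: scalar_closed_def)

section \<open>Hilbert's basis theorem for adjoining one element\<close>

locale adjoin = cring R for R (structure) +
  fixes S :: "'a set" and z :: 'a
  assumes S: "subring S R" and zR: "z \<in> carrier R"
begin

abbreviation "P \<equiv> polys_below R S z"
definition "T = (\<Union>n. P n)"

lemma SR: "c \<in> S \<Longrightarrow> c \<in> carrier R" using subringE(1)[OF S] by blast

lemma polys_below_SucI: "p \<in> P n \<Longrightarrow> c \<in> S \<Longrightarrow> x = p \<oplus> c \<otimes> z [^] n \<Longrightarrow> x \<in> P (Suc n)"
  by auto

lemma polys_below_carrier: "x \<in> P n \<Longrightarrow> x \<in> carrier R"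
  by (induction n arbitrary: x) (auto simp: SR zR)

lemma polys_below_zero: "\<zero> \<in> P n"
proof (induction n)
  case (Suc n)
  then show ?case by (rule polys_below_SucI[of _ _ \<zero>]) (use subringE(2)[OF S] zR in auto)
qed simp

lemma polys_below_add: "x \<in> P n \<Longrightarrow> y \<in> P n \<Longrightarrow> x \<oplus> y \<in> P n"
proof (induction n arbitrary: x y)
  case (Suc n)
  obtain p c q e where *: "p \<in> P n" "c \<in> S" "x = p \<oplus> c \<otimes> z [^] n" "q \<in> P n" "e \<in> S" "y = q \<oplus> e \<otimes> z [^] n"
    using Suc.prems by auto
  have c: "p \<in> carrier R" "q \<in> carrier R" "c \<in> carrier R" "e \<in> carrier R" "z [^] n \<in> carrier R"
    using * polys_below_carrier SR zR by auto
  have "x \<oplus> y = (p \<oplus> q) \<oplus> (c \<oplus> e) \<otimes> z [^] n" unfolding *(3,6) using c by algebra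
  then show ?case using Suc.IH[OF *(1,4)] subringE(7)[OF S *(2,5)] by (intro polys_below_SucI)
qed simp

lemma polys_below_smult: "s \<in> S \<Longrightarrow> x \<in> P n \<Longrightarrow> s \<otimes> x \<in> P n"
proof (induction n arbitrary: x)
  case (Suc n)
  obtain p c where *: "p \<in> P n" "c \<in> S" "x = p \<oplus> c \<otimes> z [^] n" using Suc.prems by auto
  have c: "p \<in> carrier R" "s \<in> carrier R" "c \<in> carrier R" "z [^] n \<in> carrier R"
    using * polys_below_carrier SR zR Suc.prems by auto
  have "s \<otimes> x = s \<otimes> p \<oplus> (s \<otimes> c) \<otimes> z [^] n" unfolding *(3) using c by algebra
  then show ?case using Suc.IH[OF Suc.prems(1) *(1)] subringE(6)[OF S Suc.prems(1) *(2)] by (intro polys_below_SucI)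
qed (simp add: SR)

lemma polys_below_Suc: "P n \<subseteq> P (Suc n)"
proof
  fix x assume x: "x \<in> P n"
  show "x \<in> P (Suc n)"
    by (rule polys_below_SucI[OF x subringE(2)[OF S]]) (use polys_below_carrier[OF x] zR in simp)
qed

lemma polys_below_mono: "m \<le> n \<Longrightarrow> P m \<subseteq> P n"
  by (rule lift_Suc_mono_le[of P]) (rule polys_below_Suc)

lemma polys_below_z: "x \<in> P n \<Longrightarrow> z \<otimes> x \<in> P (Suc n)"
proof (induction n arbitrary: x)
  case 0 then show ?case using polys_below_zero[of "Suc 0"] zR by (simp del: polys_below.simps(2))
next
  case (Suc n)
  obtain p c where *: "p \<in> P n" "c \<in> S" "x = p \<oplus> c \<otimes> z [^] n" using Suc.prems by auto
  have c: "p \<in> carrier R" "c \<in> carrier R" "z [^] n \<in> carrier R"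
    using * polys_below_carrier SR zR by auto
  have "z \<otimes> x = z \<otimes> p \<oplus> c \<otimes> z [^] Suc n" unfolding *(3) nat_pow_Suc using c zR by algebra
  then show ?case using Suc.IH[OF *(1)] *(2) polys_below_SucI by blast
qed

lemma TI: "x \<in> P n \<Longrightarrow> x \<in> T" by (auto simp: T_def)

lemma T_carrier: "x \<in> T \<Longrightarrow> x \<in> carrier R" using polys_below_carrier by (auto simp: T_def)

lemma S_T: "S \<subseteq> T"
proof
  fix c assume c: "c \<in> S"
  show "c \<in> T" by (rule TI[of _ 1]) (use c SR in \<open>auto intro!: exI[of _ c]\<close>)
qed

lemma z_T: "z \<in> T"
proof -
  have "z = \<zero> \<oplus> \<one> \<otimes> z [^] (1::nat)" using zR by simp
  then have "z \<in> P (Suc 1)" using polys_below_zero subringE(3)[OF S] by (intro polys_below_SucI)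
  then show ?thesis by (rule TI)
qed

lemma T_add: "x \<in> T \<Longrightarrow> y \<in> T \<Longrightarrow> x \<oplus> y \<in> T"
proof -
  assume "x \<in> T" "y \<in> T"
  then obtain m n where "x \<in> P m" "y \<in> P n" by (auto simp: T_def)
  then have "x \<in> P (max m n)" "y \<in> P (max m n)" using polys_below_mono[of m "max m n"] polys_below_mono[of n "max m n"] by auto
  then show ?thesis using polys_below_add TI by blast
qed

lemma T_smult: "s \<in> S \<Longrightarrow> x \<in> T \<Longrightarrow> s \<otimes> x \<in> T"
  using polys_below_smult by (auto simp: T_def)

lemma T_z: "x \<in> T \<Longrightarrow> z [^] (n::nat) \<otimes> x \<in> T"
proof (induction n)
  case 0 then show ?case using T_carrier by simp
next
  case (Suc n)
  then have "z \<otimes> (z [^] n \<otimes> x) \<in> T" using polys_below_z unfolding T_def by blast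
  then show ?case using T_carrier[OF Suc.prems] zR by (simp add: m_ac)
qed

lemma T_mult: "x \<in> T \<Longrightarrow> y \<in> T \<Longrightarrow> x \<otimes> y \<in> T"
proof -
  assume x: "x \<in> T" and y: "y \<in> T"
  have "x \<in> P n \<Longrightarrow> x \<otimes> y \<in> T" for n
  proof (induction n arbitrary: x)
    case 0 then show ?case using T_carrier[OF y] TI[OF polys_below_zero] by simp
  next
    case (Suc n)
    obtain p c where *: "p \<in> P n" "c \<in> S" "x = p \<oplus> c \<otimes> z [^] n" using Suc.prems by auto
    have c: "p \<in> carrier R" "c \<in> carrier R" "z [^] n \<in> carrier R" "y \<in> carrier R"
      using * polys_below_carrier SR zR T_carrier[OF y] by auto
    have "x \<otimes> y = p \<otimes> y \<oplus> c \<otimes> (z [^] n \<otimes> y)" unfolding *(3) using c by algebra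
    then show ?case using Suc.IH[OF *(1)] T_add T_smult[OF *(2) T_z[OF y]] by simp
  qed
  then show ?thesis using x by (auto simp: T_def)
qed

lemma T_subring: "subring T R"
proof (rule subringI)
  show "\<one> \<in> T" using S_T subringE(3)[OF S] by blast
  show "\<ominus> x \<in> T" if "x \<in> T" for x
    using T_smult[OF subringE(5)[OF S subringE(3)[OF S]] that] T_carrier[OF that] by (simp add: l_minus)
qed (use T_carrier T_mult T_add in auto)

text \<open>The ideals of leading coefficients from Hilbert's proof. Since \<open>z\<close> may
  satisfy relations over \<open>S\<close>, an element has no degree of its own; the bound
  \<open>n\<close> refers to a chosen expression.\<close>

definition lead :: "'a set \<Rightarrow> nat \<Rightarrow> 'a set" where
  "lead K n = {c \<in> S. \<exists>p\<in>P n. p \<oplus> c \<otimes> z [^] n \<in> K}"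

lemma lead_scalar_closed:
  assumes K: "scalar_closed R T K"
  shows "scalar_closed R S (lead K n)"
  unfolding scalar_closed_def
proof (intro conjI ballI)
  show "\<zero> \<in> lead K n"
    using scalar_closedD(1)[OF K] polys_below_zero subringE(2)[OF S] zR by (auto simp: lead_def intro!: bexI[of _ \<zero>])
  fix x assume "x \<in> lead K n"
  then obtain p where p: "x \<in> S" "p \<in> P n" "p \<oplus> x \<otimes> z [^] n \<in> K" by (auto simp: lead_def)
  have c: "p \<in> carrier R" "x \<in> carrier R" "z [^] n \<in> carrier R" using p polys_below_carrier SR zR by auto
  show "s \<otimes> x \<in> lead K n" if s: "s \<in> S" for s
  proof -
    have "s \<otimes> (p \<oplus> x \<otimes> z [^] n) = s \<otimes> p \<oplus> (s \<otimes> x) \<otimes> z [^] n" using c SR[OF s] by algebra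
    then have "s \<otimes> p \<oplus> (s \<otimes> x) \<otimes> z [^] n \<in> K" using scalar_closedD(3)[OF K, of s] S_T s p(3) by (metis subsetD)
    then show ?thesis using polys_below_smult[OF s p(2)] subringE(6)[OF S s p(1)] by (auto simp: lead_def)
  qed
  fix y assume "y \<in> lead K n"
  then obtain q where q: "y \<in> S" "q \<in> P n" "q \<oplus> y \<otimes> z [^] n \<in> K" by (auto simp: lead_def)
  have c': "q \<in> carrier R" "y \<in> carrier R" using q polys_below_carrier SR by auto
  have "(p \<oplus> x \<otimes> z [^] n) \<oplus> (q \<oplus> y \<otimes> z [^] n) = (p \<oplus> q) \<oplus> (x \<oplus> y) \<otimes> z [^] n" using c c' by algebra
  then have "(p \<oplus> q) \<oplus> (x \<oplus> y) \<otimes> z [^] n \<in> K" using scalar_closedD(2)[OF K p(3) q(3)] by simp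
  then show "x \<oplus> y \<in> lead K n" using polys_below_add[OF p(2) q(2)] subringE(7)[OF S p(1) q(1)] by (auto simp: lead_def)
qed

lemma lead_Suc:
  assumes K: "scalar_closed R T K"
  shows "lead K n \<subseteq> lead K (Suc n)"
proof
  fix x assume "x \<in> lead K n"
  then obtain p where p: "x \<in> S" "p \<in> P n" "p \<oplus> x \<otimes> z [^] n \<in> K" by (auto simp: lead_def)
  have c: "p \<in> carrier R" "x \<in> carrier R" "z [^] n \<in> carrier R" using p polys_below_carrier SR zR by auto
  have "z \<otimes> (p \<oplus> x \<otimes> z [^] n) = z \<otimes> p \<oplus> x \<otimes> z [^] Suc n" unfolding nat_pow_Suc using c zR by algebra
  then have "z \<otimes> p \<oplus> x \<otimes> z [^] Suc n \<in> K" using scalar_closedD(3)[OF K z_T p(3)] by simp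
  then show "x \<in> lead K (Suc n)" using polys_below_z[OF p(2)] p(1) unfolding lead_def by blast
qed

lemma lead_mono: "scalar_closed R T K \<Longrightarrow> m \<le> n \<Longrightarrow> lead K m \<subseteq> lead K n"
  by (rule lift_Suc_mono_le[of "lead K"]) (rule lead_Suc)

lemma T_noeth:
  assumes noeth: "noetherian_subring R S"
  shows "noetherian_subring R T"
  unfolding noetherian_subring_def
proof (intro allI impI)
  fix K assume KT: "K \<subseteq> T" and K: "scalar_closed R T K"
  have LS: "lead K n \<subseteq> S" for n by (auto simp: lead_def)
  define G where "G n = (SOME G. finite_span R S (lead K n) G)" for n
  have "finite_span R S (lead K n) (G n)" for n
    unfolding G_def by (rule someI_ex) (use noeth LS lead_scalar_closed[OF K] in \<open>simp add: noetherian_subring_def\<close>)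
  note G = finite_spanD[OF this]
  have "scalar_closed R S (\<Union>n. lead K n)"
    unfolding scalar_closed_def
  proof (intro conjI ballI)
    fix x y assume "x \<in> (\<Union>n. lead K n)" "y \<in> (\<Union>n. lead K n)"
    then obtain m n where "x \<in> lead K m" "y \<in> lead K n" by auto
    then have "x \<in> lead K (max m n)" "y \<in> lead K (max m n)"
      using lead_mono[OF K, of m "max m n"] lead_mono[OF K, of n "max m n"] by auto
    from scalar_closedD(2)[OF lead_scalar_closed[OF K] this] show "x \<oplus> y \<in> (\<Union>n. lead K n)" by (rule UN_I[OF UNIV_I])
  next
    show "\<zero> \<in> (\<Union>n. lead K n)" using scalar_closedD(1)[OF lead_scalar_closed[OF K]] by blast
  next
    fix s x assume s: "s \<in> S" and "x \<in> (\<Union>n. lead K n)"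
    then obtain n where "x \<in> lead K n" by auto
    from scalar_closedD(3)[OF lead_scalar_closed[OF K] s this] show "s \<otimes> x \<in> (\<Union>n. lead K n)" by (rule UN_I[OF UNIV_I])
  qed
  moreover have "(\<Union>n. lead K n) \<subseteq> S" using LS by blast
  ultimately obtain G0 where "finite_span R S (\<Union>n. lead K n) G0"
    using noeth unfolding noetherian_subring_def by blast
  note G0 = finite_spanD[OF this]
  have "\<exists>N. F \<subseteq> lead K N" if "finite F" "F \<subseteq> (\<Union>n. lead K n)" for F
    using that
  proof (induction F)
    case (insert x F)
    obtain m where "x \<in> lead K m" using insert.prems by blast
    moreover obtain N where "F \<subseteq> lead K N" using insert by blast
    ultimately have "insert x F \<subseteq> lead K (max N m)"
      using lead_mono[OF K, of m "max N m"] lead_mono[OF K, of N "max N m"] by auto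
    then show ?case by blast
  qed simp
  \<comment> \<open>The union of the ascending leading coefficient ideals is finitely generated and
    hence reached at some \<open>N\<close>; generators of degree at most \<open>N\<close> will
    do.\<close>
  from this[OF G0(1,2)] obtain N where "G0 \<subseteq> lead K N" by blast
  from G0(3)[OF lead_scalar_closed[OF K] this] have N: "lead K n \<subseteq> lead K N" for n by blast
  define f where "f n c = (SOME p. p \<in> P n \<and> p \<oplus> c \<otimes> z [^] n \<in> K)" for n c
  have f: "f n c \<in> P n \<and> f n c \<oplus> c \<otimes> z [^] n \<in> K" if "c \<in> G n" for n c
    unfolding f_def by (rule someI_ex) (use G(2) that in \<open>auto simp: lead_def\<close>)
  define F where "F = (\<Union>n\<in>{..N}. (\<lambda>c. f n c \<oplus> c \<otimes> z [^] n) ` G n)"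
  have "K \<subseteq> K'" if K': "scalar_closed R T K'" "F \<subseteq> K'" for K'
  proof -
    \<comment> \<open>The induction below applies its hypothesis to a difference that must lie in
      \<open>K\<close>. So the element subtracted has to be found in \<open>K\<close> and in the
      competitor at once.\<close>
    have KK: "scalar_closed R T (K \<inter> K')" using K K'(1) by (auto simp: scalar_closed_def)
    have le: "lead K n \<subseteq> lead (K \<inter> K') n" if "n \<le> N" for n
    proof (rule G(3)[OF lead_scalar_closed[OF KK]])
      show "G n \<subseteq> lead (K \<inter> K') n"
      proof
        fix c assume c: "c \<in> G n"
        then have "f n c \<oplus> c \<otimes> z [^] n \<in> F" using that by (auto simp: F_def)
        then show "c \<in> lead (K \<inter> K') n" using f[OF c] K'(2) G(2) LS c unfolding lead_def by blast
      qed
    qed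
    have lead: "lead K n \<subseteq> lead (K \<inter> K') n" for n
    proof (cases "n \<le> N")
      case False
      then have "lead (K \<inter> K') N \<subseteq> lead (K \<inter> K') n" using lead_mono[OF KK] by simp
      then show ?thesis using N[of n] le[of N] by blast
    qed (rule le)
    have "x \<in> K \<Longrightarrow> x \<in> P n \<Longrightarrow> x \<in> K'" for x n
    proof (induction n arbitrary: x)
      case 0 then show ?case using scalar_closedD(1)[OF K'(1)] by simp
    next
      case (Suc n)
      obtain p c where p: "p \<in> P n" "c \<in> S" "x = p \<oplus> c \<otimes> z [^] n" using Suc.prems by auto
      then have "c \<in> lead K n" using Suc.prems(1) unfolding lead_def by blast
      then obtain q where q: "q \<in> P n" "q \<oplus> c \<otimes> z [^] n \<in> K" "q \<oplus> c \<otimes> z [^] n \<in> K'"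
        using lead unfolding lead_def by blast
      let ?y = "q \<oplus> c \<otimes> z [^] n"
      have cc: "p \<in> carrier R" "q \<in> carrier R" "c \<in> carrier R" "z [^] n \<in> carrier R"
        using p q polys_below_carrier SR zR by auto
      have m1: "\<ominus> \<one> \<in> S" using subringE(3,5)[OF S] by blast
      \<comment> \<open>Both elements have the leading coefficient \<open>c\<close>, so their
        difference has an expression of lower degree.\<close>
      have "p \<oplus> \<ominus> \<one> \<otimes> q = x \<oplus> \<ominus> \<one> \<otimes> ?y" unfolding p(3) using cc by algebra
      moreover have "x \<oplus> \<ominus> \<one> \<otimes> ?y \<in> K"
        using scalar_closedD[OF K] Suc.prems(1) q(2) m1 S_T by blast
      ultimately have "p \<oplus> \<ominus> \<one> \<otimes> q \<in> K'"
        using Suc.IH[of "p \<oplus> \<ominus> \<one> \<otimes> q"] polys_below_add[OF p(1) polys_below_smult[OF m1 q(1)]] by simp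
      then have "(p \<oplus> \<ominus> \<one> \<otimes> q) \<oplus> ?y \<in> K'" using scalar_closedD(2)[OF K'(1)] q(3) by blast
      moreover have "(p \<oplus> \<ominus> \<one> \<otimes> q) \<oplus> ?y = x" unfolding p(3) using cc by algebra
      ultimately show ?case by simp
    qed
    then show ?thesis using KT unfolding T_def by blast
  qed
  moreover have "finite F" using G(1) by (auto simp: F_def)
  moreover have "F \<subseteq> K" using f by (auto simp: F_def)
  ultimately have "finite_span R T K F" unfolding finite_span_def by blast
  then show "\<exists>G. finite_span R T K G" ..
qed

end

lemma (in cring) noetherian_subring_finite_adjoin:
  assumes "finite F" "F \<subseteq> carrier R" "subring S R" "noetherian_subring R S"
  shows "\<exists>T. subring T R \<and> noetherian_subring R T \<and> S \<subseteq> T \<and> F \<subseteq> T"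
  using assms(1,2)
proof (induction F)
  case empty then show ?case using assms by blast
next
  case (insert z F)
  then obtain T where T: "subring T R" "noetherian_subring R T" "S \<subseteq> T" "F \<subseteq> T" by (metis insert_subset)
  interpret adjoin R T z
    using T insert by (intro adjoin.intro adjoin_axioms.intro is_cring) auto
  show ?case using T_subring T_noeth[OF T(2)] S_T z_T T by blast
qed

lemma (in cring) noetherian_if_noetherian_subring:
  assumes "noetherian_subring R (carrier R)"
  shows "noetherian_ring R"
proof (rule noetherian_ringI)
  fix K assume K: "ideal K R"
  then interpret K: ideal K R .
  have rs: "scalar_closed R (carrier R) K'" if "ideal K' R" for K'
    using that additive_subgroup.zero_closed[OF ideal.axioms(1)[OF that]]
      additive_subgroup.a_closed[OF ideal.axioms(1)[OF that]] ideal.I_l_closed[OF that]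
    by (auto simp: scalar_closed_def)
  obtain G where "finite_span R (carrier R) K G"
    using assms rs[OF K] K.a_subset unfolding noetherian_subring_def by blast
  note G = finite_spanD[OF this]
  have GR: "G \<subseteq> carrier R" using G K.a_subset by blast
  have "K \<subseteq> Idl G" using G(3)[OF rs[OF genideal_ideal[OF GR]] genideal_self[OF GR]] .
  moreover have "Idl G \<subseteq> K" by (rule genideal_minimal[OF K G(2)])
  ultimately show "\<exists>A\<subseteq>carrier R. finite A \<and> K = Idl A" using G(1) GR by blast
qed

section \<open>The Rees algebra\<close>

lemma ideals_one: "\<one>\<^bsub>ideals_set R\<^esub> = carrier R"
  by (simp add: ideals_set_def)

lemma (in ideal) finsum_in_ideal:
  assumes "\<And>i. i \<in> B \<Longrightarrow> f i \<in> I"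
  shows "(\<Oplus>i\<in>B. f i) \<in> I"
proof (cases "finite B")
  case True
  then show ?thesis using assms
  proof (induction B)
    case (insert x F)
    then have "(\<Oplus>i\<in>insert x F. f i) = f x \<oplus> (\<Oplus>i\<in>F. f i)"
      using Icarr by (intro finsum_insert) auto
    then show ?case using insert by simp
  qed simp
qed (simp add: finsum_infinite)

lemma (in module) finsum_in_submodule:
  assumes N: "submodule N R M" and "\<And>i. i \<in> B \<Longrightarrow> f i \<in> N"
  shows "(\<Oplus>\<^bsub>M\<^esub>i\<in>B. f i) \<in> N"
proof (cases "finite B")
  case True
  then show ?thesis using assms(2)
  proof (induction B)
    case empty then show ?case using submodule_zero[OF N] by simp
  next
    case (insert x F)
    then have "(\<Oplus>\<^bsub>M\<^esub>i\<in>insert x F. f i) = f x \<oplus>\<^bsub>M\<^esub> (\<Oplus>\<^bsub>M\<^esub>i\<in>F. f i)"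
      using submodule_carrier[OF N] by (intro M.finsum_insert) auto
    then show ?case using insert submoduleE(5)[OF N] by simp
  qed
qed (use submodule_zero[OF N] in \<open>simp add: M.finsum_infinite\<close>)

lemma (in module) finsum_smult_rdistr:
  "finite B \<Longrightarrow> x \<in> carrier M \<Longrightarrow> f \<in> B \<rightarrow> carrier R \<Longrightarrow>
   (\<Oplus>i\<in>B. f i) \<odot>\<^bsub>M\<^esub> x = (\<Oplus>\<^bsub>M\<^esub>i\<in>B. f i \<odot>\<^bsub>M\<^esub> x)"
proof (induction B rule: finite_induct)
  case (insert b B)
  then show ?case by (simp add: Pi_def smult_l_distr)
qed simp

section \<open>The module \<open>M[t]\<close>\<close>

context module
begin

lemma poly_module_simps:
  "carrier (poly_module M) = up M" "\<zero>\<^bsub>poly_module M\<^esub> = (\<lambda>_. \<zero>\<^bsub>M\<^esub>)"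
  "f \<oplus>\<^bsub>poly_module M\<^esub> g = (\<lambda>n. f n \<oplus>\<^bsub>M\<^esub> g n)"
  "p \<odot>\<^bsub>poly_module M\<^esub> f = (\<lambda>n. \<Oplus>\<^bsub>M\<^esub>i\<in>{..n}. p i \<odot>\<^bsub>M\<^esub> f (n - i))"
  by (simp_all add: poly_module_def)

lemma up_iff: "f \<in> up M \<longleftrightarrow> (\<forall>n. f n \<in> carrier M) \<and> (\<exists>n. \<forall>m>n. f m = \<zero>\<^bsub>M\<^esub>)"
  by (auto simp: up_def bound_def)

lemma poly_module_smult_closed:
  assumes p: "p \<in> up R" and f: "f \<in> up M"
  shows "(\<lambda>n. \<Oplus>\<^bsub>M\<^esub>i\<in>{..n}. p i \<odot>\<^bsub>M\<^esub> f (n - i)) \<in> up M"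
proof -
  obtain m where m: "\<And>i. m < i \<Longrightarrow> p i = \<zero>" using p by (auto simp: up_def bound_def)
  obtain k where k: "\<And>i. k < i \<Longrightarrow> f i = \<zero>\<^bsub>M\<^esub>" using f by (auto simp: up_iff)
  have pc: "p i \<in> carrier R" and fc: "f i \<in> carrier M" for i using p f by (auto simp: up_iff)
  have "(\<Oplus>\<^bsub>M\<^esub>i\<in>{..n}. p i \<odot>\<^bsub>M\<^esub> f (n - i)) = \<zero>\<^bsub>M\<^esub>" if n: "m + k < n" for n
  proof -
    have "p i \<odot>\<^bsub>M\<^esub> f (n - i) = \<zero>\<^bsub>M\<^esub>" for i
    proof (cases "m < i")
      case False
      then have "k < n - i" using n by simp
      then show ?thesis using k pc by simp
    qed (use m fc in simp)
    then show ?thesis by (simp add: M.finsum_zero)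
  qed
  then show ?thesis using pc fc by (auto simp: up_iff intro!: M.finsum_closed)
qed

text \<open>The outer sums are cut off at \<open>k\<close> with \<open>n\<close> fixed, and
  \<open>k\<close> grows. Each step adds the same diagonal on both sides, namely the terms that
  involve \<open>f (n - Suc k)\<close>.\<close>

lemma poly_module_smult_assoc:
  assumes p: "p \<in> up R" and q: "q \<in> up R" and f: "f \<in> up M"
  shows "(\<Oplus>\<^bsub>M\<^esub>j\<in>{..n}. (\<Oplus>i\<in>{..j}. p i \<otimes> q (j - i)) \<odot>\<^bsub>M\<^esub> f (n - j)) =
    (\<Oplus>\<^bsub>M\<^esub>j\<in>{..n}. p j \<odot>\<^bsub>M\<^esub> (\<Oplus>\<^bsub>M\<^esub>i\<in>{..n - j}. q i \<odot>\<^bsub>M\<^esub> f (n - j - i)))"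
proof -
  have pc: "p i \<in> carrier R" and qc: "q i \<in> carrier R" and fc: "f i \<in> carrier M" for i
    using p q f by (auto simp: up_iff)
  note [simp] = pc qc fc
  have "k \<le> n \<Longrightarrow> (\<Oplus>\<^bsub>M\<^esub>j\<in>{..k}. (\<Oplus>i\<in>{..j}. p i \<otimes> q (j - i)) \<odot>\<^bsub>M\<^esub> f (n - j)) =
    (\<Oplus>\<^bsub>M\<^esub>j\<in>{..k}. p j \<odot>\<^bsub>M\<^esub> (\<Oplus>\<^bsub>M\<^esub>i\<in>{..k - j}. q i \<odot>\<^bsub>M\<^esub> f (n - j - i)))" for k
  proof (induction k)
    case 0 then show ?case by (simp add: Pi_def smult_assoc1)
  next
    case (Suc k)
    let ?S = "\<lambda>j k. \<Oplus>\<^bsub>M\<^esub>i\<in>{..k}. q i \<odot>\<^bsub>M\<^esub> f (n - j - i)"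
    have Sc: "?S j k \<in> carrier M" for j k by (intro M.finsum_closed) auto
    have "(\<Oplus>\<^bsub>M\<^esub>j\<in>{..Suc k}. (\<Oplus>i\<in>{..j}. p i \<otimes> q (j - i)) \<odot>\<^bsub>M\<^esub> f (n - j)) =
      (\<Oplus>i\<in>{..Suc k}. p i \<otimes> q (Suc k - i)) \<odot>\<^bsub>M\<^esub> f (n - Suc k) \<oplus>\<^bsub>M\<^esub>
      (\<Oplus>\<^bsub>M\<^esub>j\<in>{..k}. p j \<odot>\<^bsub>M\<^esub> ?S j (k - j))"
      using Suc by (subst M.finsum_Suc) (auto intro!: smult_closed R.finsum_closed)
    also have "(\<Oplus>i\<in>{..Suc k}. p i \<otimes> q (Suc k - i)) \<odot>\<^bsub>M\<^esub> f (n - Suc k) =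
      (\<Oplus>\<^bsub>M\<^esub>j\<in>{..Suc k}. p j \<odot>\<^bsub>M\<^esub> (q (Suc k - j) \<odot>\<^bsub>M\<^esub> f (n - Suc k)))"
      by (subst finsum_smult_rdistr) (auto simp: smult_assoc1)
    also have "\<dots> = p (Suc k) \<odot>\<^bsub>M\<^esub> (q 0 \<odot>\<^bsub>M\<^esub> f (n - Suc k)) \<oplus>\<^bsub>M\<^esub>
      (\<Oplus>\<^bsub>M\<^esub>j\<in>{..k}. p j \<odot>\<^bsub>M\<^esub> (q (Suc k - j) \<odot>\<^bsub>M\<^esub> f (n - Suc k)))"
      by (subst M.finsum_Suc) auto
    finally have L: "(\<Oplus>\<^bsub>M\<^esub>j\<in>{..Suc k}. (\<Oplus>i\<in>{..j}. p i \<otimes> q (j - i)) \<odot>\<^bsub>M\<^esub> f (n - j)) =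
      p (Suc k) \<odot>\<^bsub>M\<^esub> (q 0 \<odot>\<^bsub>M\<^esub> f (n - Suc k)) \<oplus>\<^bsub>M\<^esub>
      ((\<Oplus>\<^bsub>M\<^esub>j\<in>{..k}. p j \<odot>\<^bsub>M\<^esub> (q (Suc k - j) \<odot>\<^bsub>M\<^esub> f (n - Suc k))) \<oplus>\<^bsub>M\<^esub>
       (\<Oplus>\<^bsub>M\<^esub>j\<in>{..k}. p j \<odot>\<^bsub>M\<^esub> ?S j (k - j)))"
      using Sc by (simp add: M.a_assoc)
    have "(\<Oplus>\<^bsub>M\<^esub>j\<in>{..Suc k}. p j \<odot>\<^bsub>M\<^esub> ?S j (Suc k - j)) =
      p (Suc k) \<odot>\<^bsub>M\<^esub> ?S (Suc k) 0 \<oplus>\<^bsub>M\<^esub> (\<Oplus>\<^bsub>M\<^esub>j\<in>{..k}. p j \<odot>\<^bsub>M\<^esub> ?S j (Suc k - j))"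
      using Sc by (subst M.finsum_Suc) auto
    also have "(\<Oplus>\<^bsub>M\<^esub>j\<in>{..k}. p j \<odot>\<^bsub>M\<^esub> ?S j (Suc k - j)) =
      (\<Oplus>\<^bsub>M\<^esub>j\<in>{..k}. p j \<odot>\<^bsub>M\<^esub> (q (Suc k - j) \<odot>\<^bsub>M\<^esub> f (n - Suc k)) \<oplus>\<^bsub>M\<^esub> p j \<odot>\<^bsub>M\<^esub> ?S j (k - j))"
    proof (rule M.finsum_cong')
      fix j assume j: "j \<in> {..k}"
      have "?S j (Suc k - j) = q (Suc k - j) \<odot>\<^bsub>M\<^esub> f (n - j - (Suc k - j)) \<oplus>\<^bsub>M\<^esub> ?S j (k - j)"
        using j by (simp add: Suc_diff_le)
      also have "n - j - (Suc k - j) = n - Suc k" using j by simp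
      finally show "p j \<odot>\<^bsub>M\<^esub> ?S j (Suc k - j) =
        p j \<odot>\<^bsub>M\<^esub> (q (Suc k - j) \<odot>\<^bsub>M\<^esub> f (n - Suc k)) \<oplus>\<^bsub>M\<^esub> p j \<odot>\<^bsub>M\<^esub> ?S j (k - j)"
        using Sc by (simp add: smult_r_distr)
    qed (use Sc in auto)
    also have "\<dots> = (\<Oplus>\<^bsub>M\<^esub>j\<in>{..k}. p j \<odot>\<^bsub>M\<^esub> (q (Suc k - j) \<odot>\<^bsub>M\<^esub> f (n - Suc k))) \<oplus>\<^bsub>M\<^esub>
       (\<Oplus>\<^bsub>M\<^esub>j\<in>{..k}. p j \<odot>\<^bsub>M\<^esub> ?S j (k - j))"
      using Sc by (intro M.finsum_addf) auto
    finally show ?case using L by simp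
  qed
  from this[of n] show ?thesis by simp
qed

lemma poly_module_abelian_group: "abelian_group (poly_module M)"
proof (rule abelian_groupI)
  fix f g h
  assume f: "f \<in> carrier (poly_module M)"
  show "\<zero>\<^bsub>poly_module M\<^esub> \<oplus>\<^bsub>poly_module M\<^esub> f = f" using f by (auto simp: poly_module_simps up_iff)
  show "\<exists>y\<in>carrier (poly_module M). y \<oplus>\<^bsub>poly_module M\<^esub> f = \<zero>\<^bsub>poly_module M\<^esub>"
  proof (rule bexI)
    show "(\<lambda>n. \<ominus>\<^bsub>M\<^esub> f n) \<in> carrier (poly_module M)"
      using f by (auto simp: poly_module_simps up_iff)
    show "(\<lambda>n. \<ominus>\<^bsub>M\<^esub> f n) \<oplus>\<^bsub>poly_module M\<^esub> f = \<zero>\<^bsub>poly_module M\<^esub>"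
      using f by (auto simp: poly_module_simps up_iff M.l_neg)
  qed
  assume g: "g \<in> carrier (poly_module M)"
  show "f \<oplus>\<^bsub>poly_module M\<^esub> g = g \<oplus>\<^bsub>poly_module M\<^esub> f"
    using f g by (auto simp: poly_module_simps up_iff M.a_comm)
  show "f \<oplus>\<^bsub>poly_module M\<^esub> g \<in> carrier (poly_module M)"
  proof -
    obtain m k where "\<And>i. m < i \<Longrightarrow> f i = \<zero>\<^bsub>M\<^esub>" "\<And>i. k < i \<Longrightarrow> g i = \<zero>\<^bsub>M\<^esub>"
      using f g by (auto simp: poly_module_simps up_iff)
    then show ?thesis using f g by (auto simp: poly_module_simps up_iff intro!: exI[of _ "m + k"])
  qed
  assume h: "h \<in> carrier (poly_module M)"
  show "f \<oplus>\<^bsub>poly_module M\<^esub> g \<oplus>\<^bsub>poly_module M\<^esub> h = f \<oplus>\<^bsub>poly_module M\<^esub> (g \<oplus>\<^bsub>poly_module M\<^esub> h)"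
    using f g h by (auto simp: poly_module_simps up_iff M.a_assoc)
next
  show "\<zero>\<^bsub>poly_module M\<^esub> \<in> carrier (poly_module M)" by (auto simp: poly_module_simps up_iff)
qed

end

locale rees = cring A for A (structure) +
  fixes I :: "'a set"
  assumes I: "ideal I A"
begin

lemma UP_cring: "UP_cring A"
  by (simp add: UP_cring_def is_cring)

lemma UPc: "cring (UP A)" by (rule UP_cring.UP_cring[OF UP_cring])

abbreviation "RA \<equiv> rees_algebra A I"

lemma up_iff: "f \<in> up A \<longleftrightarrow> (\<forall>n. f n \<in> carrier A) \<and> (\<exists>n. \<forall>m>n. f m = \<zero>)"
  by (auto simp: up_def bound_def)

lemma ipc: "a \<in> ideal_pow A I n \<Longrightarrow> a \<in> carrier A"
  using ideal.Icarr[OF ideal_pow_ideal[OF I]] .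

lemma rees_carrier: "p \<in> carrier RA \<longleftrightarrow> p \<in> up A \<and> (\<forall>n. p n \<in> ideal_pow A I n)"
  by (simp add: rees_algebra_def UP_def)

lemma rees_up: "p \<in> carrier RA \<Longrightarrow> p \<in> up A" by (simp add: rees_carrier)

lemma rees_add: "p \<in> up A \<Longrightarrow> q \<in> up A \<Longrightarrow> p \<oplus>\<^bsub>RA\<^esub> q = (\<lambda>n. p n \<oplus> q n)"
  and rees_mult: "p \<in> up A \<Longrightarrow> q \<in> up A \<Longrightarrow> p \<otimes>\<^bsub>RA\<^esub> q = (\<lambda>n. \<Oplus>i\<in>{..n}. p i \<otimes> q (n - i))"
  and rees_zero: "\<zero>\<^bsub>RA\<^esub> = (\<lambda>_. \<zero>)"
  and rees_one: "\<one>\<^bsub>RA\<^esub> = (\<lambda>n. if n = 0 then \<one> else \<zero>)"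
  by (simp_all add: rees_algebra_def UP_def)

lemma rees_subring: "subring (carrier RA) (UP A)"
proof -
  interpret U: cring "UP A" by (rule UPc)
  have c: "carrier (UP A) = up A" by (simp add: UP_def)
  show ?thesis
  proof (rule U.subringI)
    show "carrier RA \<subseteq> carrier (UP A)" using rees_up c by auto
    have ip: "ideal (ideal_pow A I n) A" for n by (rule ideal_pow_ideal[OF I])
    show "\<one>\<^bsub>UP A\<^esub> \<in> carrier RA"
      using additive_subgroup.zero_closed[OF ideal.axioms(1)[OF ip]] up_one_closed
      by (auto simp: rees_carrier UP_def ideals_one)
    fix p assume p: "p \<in> carrier RA"
    have "\<ominus>\<^bsub>UP A\<^esub> p = (\<lambda>n. \<ominus> p n)"
    proof (rule U.minus_equality)
      show "(\<lambda>n. \<ominus> p n) \<oplus>\<^bsub>UP A\<^esub> p = \<zero>\<^bsub>UP A\<^esub>"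
        using p up_a_inv_closed[OF rees_up[OF p]] by (auto simp: UP_def rees_carrier up_iff l_neg)
    qed (use p up_a_inv_closed[OF rees_up[OF p]] c rees_up in auto)
    then show "\<ominus>\<^bsub>UP A\<^esub> p \<in> carrier RA"
      using p up_a_inv_closed[OF rees_up[OF p]] additive_subgroup.a_inv_closed[OF ideal.axioms(1)[OF ip]]
      by (auto simp: rees_carrier)
    fix q assume q: "q \<in> carrier RA"
    show "p \<otimes>\<^bsub>UP A\<^esub> q \<in> carrier RA"
    proof -
      have "p \<otimes>\<^bsub>UP A\<^esub> q = (\<lambda>n. \<Oplus>i\<in>{..n}. p i \<otimes> q (n - i))" using p q rees_up by (simp add: UP_def)
      moreover have "(\<Oplus>i\<in>{..n}. p i \<otimes> q (n - i)) \<in> ideal_pow A I n" for n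
      proof (rule ideal.finsum_in_ideal[OF ip])
        fix i assume "i \<in> {..n}"
        then show "p i \<otimes> q (n - i) \<in> ideal_pow A I n"
          using ideal_pow_mult_mem[OF I, of "p i" i "q (n - i)" "n - i"] p q by (simp add: rees_carrier)
      qed
      ultimately show ?thesis using up_mult_closed[OF rees_up[OF p] rees_up[OF q]] by (simp add: rees_carrier)
    qed
    show "p \<oplus>\<^bsub>UP A\<^esub> q \<in> carrier RA"
    proof -
      have "p \<oplus>\<^bsub>UP A\<^esub> q = (\<lambda>n. p n \<oplus> q n)" using p q rees_up by (simp add: UP_def)
      then show ?thesis using up_add_closed[OF rees_up[OF p] rees_up[OF q]] p q
          additive_subgroup.a_closed[OF ideal.axioms(1)[OF ip]] by (simp add: rees_carrier)
    qed
  qed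
qed

lemma rees_cring: "cring RA"
proof -
  interpret U: cring "UP A" by (rule UPc)
  have "cring (UP A\<lparr>carrier := carrier RA\<rparr>)"
    using U.subcring_iff[OF subringE(1)[OF rees_subring]] U.subcringI'[OF rees_subring] by simp
  then show ?thesis by (simp add: rees_algebra_def)
qed

sublocale RA: cring RA by (rule rees_cring)

lemma poly_module_module:
  assumes "module A M"
  shows "module RA (poly_module M)"
proof -
  interpret M: module A M by fact
  show ?thesis
  proof (rule moduleI)
    show "cring RA" by (rule rees_cring)
    show "abelian_group (poly_module M)" by (rule M.poly_module_abelian_group)
    fix p x assume p: "p \<in> carrier RA" and x: "x \<in> carrier (poly_module M)"
    have pu: "p \<in> up A" and xu: "x \<in> up M" using p x rees_up by (auto simp: M.poly_module_simps)
    have pc: "p n \<in> carrier A" and xc: "x n \<in> carrier M" for n using pu xu by (auto simp: up_iff M.up_iff)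
    show "p \<odot>\<^bsub>poly_module M\<^esub> x \<in> carrier (poly_module M)"
      using M.poly_module_smult_closed[OF pu xu] by (simp add: M.poly_module_simps)
    show "p \<odot>\<^bsub>poly_module M\<^esub> (x \<oplus>\<^bsub>poly_module M\<^esub> y) = p \<odot>\<^bsub>poly_module M\<^esub> x \<oplus>\<^bsub>poly_module M\<^esub> p \<odot>\<^bsub>poly_module M\<^esub> y"
      if y: "y \<in> carrier (poly_module M)" for y
    proof -
      have "y n \<in> carrier M" for n using y by (auto simp: M.poly_module_simps M.up_iff)
      then show ?thesis using pc xc by (simp add: M.poly_module_simps M.smult_r_distr M.M.finsum_addf)
    qed
    show "(p \<oplus>\<^bsub>RA\<^esub> q) \<odot>\<^bsub>poly_module M\<^esub> x = p \<odot>\<^bsub>poly_module M\<^esub> x \<oplus>\<^bsub>poly_module M\<^esub> q \<odot>\<^bsub>poly_module M\<^esub> x"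
      if q: "q \<in> carrier RA" for q
    proof -
      have qu: "q \<in> up A" using q rees_up by auto
      then have "q n \<in> carrier A" for n by (auto simp: up_iff)
      then show ?thesis using pc xc by (simp add: M.poly_module_simps rees_add[OF pu qu] M.smult_l_distr M.M.finsum_addf)
    qed
    show "(p \<otimes>\<^bsub>RA\<^esub> q) \<odot>\<^bsub>poly_module M\<^esub> x = p \<odot>\<^bsub>poly_module M\<^esub> (q \<odot>\<^bsub>poly_module M\<^esub> x)"
      if q: "q \<in> carrier RA" for q
      using M.poly_module_smult_assoc[OF pu rees_up[OF q] xu]
      by (simp add: M.poly_module_simps rees_mult[OF pu rees_up[OF q]])
  next
    fix x assume x: "x \<in> carrier (poly_module M)"
    then have xc: "x n \<in> carrier M" for n by (auto simp: M.poly_module_simps M.up_iff)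
    have "(\<Oplus>\<^bsub>M\<^esub>i\<in>{..n}. (if i = 0 then \<one> else \<zero>) \<odot>\<^bsub>M\<^esub> x (n - i)) = x n" for n
    proof (cases n)
      case (Suc m)
      have "(\<Oplus>\<^bsub>M\<^esub>i\<in>{..Suc m}. (if i = 0 then \<one> else \<zero>) \<odot>\<^bsub>M\<^esub> x (Suc m - i)) =
        (\<Oplus>\<^bsub>M\<^esub>i\<in>{..m}. \<zero>\<^bsub>M\<^esub>) \<oplus>\<^bsub>M\<^esub> x (Suc m)"
        using xc by (subst M.M.finsum_Suc2) auto
      then show ?thesis using Suc xc by (simp add: M.M.finsum_zero)
    qed (use xc in simp)
    then show "\<one>\<^bsub>RA\<^esub> \<odot>\<^bsub>poly_module M\<^esub> x = x" by (simp add: M.poly_module_simps rees_one)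
  qed
qed

definition mon :: "'a \<Rightarrow> nat \<Rightarrow> nat \<Rightarrow> 'a" where
  "mon a n = (\<lambda>i. if i = n then a else \<zero>)"

lemma mon_monom: "a \<in> carrier A \<Longrightarrow> monom (UP A) a n = mon a n"
  by (auto simp: UP_def mon_def)

lemma mon_up: "a \<in> carrier A \<Longrightarrow> mon a n \<in> up A"
  by (auto simp: mon_def up_iff)

lemma mon_carrier: "a \<in> ideal_pow A I n \<Longrightarrow> mon a n \<in> carrier RA"
  using mon_up[OF ipc] additive_subgroup.zero_closed[OF ideal.axioms(1)[OF ideal_pow_ideal[OF I]]]
  by (auto simp: rees_carrier) (auto simp: mon_def)

lemma mon_mult:
  assumes "a \<in> carrier A" "b \<in> carrier A"
  shows "mon a m \<otimes>\<^bsub>RA\<^esub> mon b n = mon (a \<otimes> b) (m + n)"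
proof -
  interpret U: UP_cring A "UP A" using UP_cring by (simp add: UP_cring_def)
  have "mon a m \<otimes>\<^bsub>RA\<^esub> mon b n = monom (UP A) a m \<otimes>\<^bsub>UP A\<^esub> monom (UP A) b n"
    using assms by (simp add: mon_monom rees_algebra_def)
  also have "\<dots> = monom (UP A) (a \<otimes> b) (m + n)" using assms by simp
  finally show ?thesis using assms by (simp add: mon_monom)
qed

lemma mon_add:
  assumes "a \<in> carrier A" "b \<in> carrier A"
  shows "mon a m \<oplus>\<^bsub>RA\<^esub> mon b m = mon (a \<oplus> b) m"
  using assms by (auto simp: rees_add mon_up) (auto simp: mon_def)

lemma mon_smult:
  assumes "module A M" "a \<in> carrier A" "f \<in> up M"
  shows "mon a k \<odot>\<^bsub>poly_module M\<^esub> f = (\<lambda>n. if k \<le> n then a \<odot>\<^bsub>M\<^esub> f (n - k) else \<zero>\<^bsub>M\<^esub>)"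
proof
  interpret M: module A M by fact
  fix n
  have fc: "f i \<in> carrier M" for i using assms by (auto simp: M.up_iff)
  have "(mon a k \<odot>\<^bsub>poly_module M\<^esub> f) n = (\<Oplus>\<^bsub>M\<^esub>i\<in>{..n}. if k = i then a \<odot>\<^bsub>M\<^esub> f (n - i) else \<zero>\<^bsub>M\<^esub>)"
    using assms(2) fc by (auto simp: M.poly_module_simps mon_def intro!: M.M.finsum_cong')
  also have "\<dots> = (if k \<le> n then a \<odot>\<^bsub>M\<^esub> f (n - k) else \<zero>\<^bsub>M\<^esub>)"
  proof (cases "k \<le> n")
    case True
    then show ?thesis using assms(2) fc by (simp add: M.M.finsum_singleton[of k "{..n}" "\<lambda>i. a \<odot>\<^bsub>M\<^esub> f (n - i)"])
  next
    case False
    have "(\<Oplus>\<^bsub>M\<^esub>i\<in>{..n}. if k = i then a \<odot>\<^bsub>M\<^esub> f (n - i) else \<zero>\<^bsub>M\<^esub>) = (\<Oplus>\<^bsub>M\<^esub>i\<in>{..n}. \<zero>\<^bsub>M\<^esub>)"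
      using False by (intro M.M.finsum_cong') auto
    then show ?thesis using False by (simp add: M.M.finsum_zero)
  qed
  finally show "(mon a k \<odot>\<^bsub>poly_module M\<^esub> f) n = (if k \<le> n then a \<odot>\<^bsub>M\<^esub> f (n - k) else \<zero>\<^bsub>M\<^esub>)" .
qed

text \<open>Over the constants the Rees algebra is generated by the finitely many \<open>a t\<close>
  with \<open>a\<close> from a generating set of \<open>I\<close>. The constants inherit the
  Noetherian property from \<open>A\<close>, and adjoining finitely many elements preserves
  it.\<close>

lemma rees_noetherian:
  assumes "noetherian_ring A"
  shows "noetherian_ring RA"
proof -
  interpret N: noetherian_ring A by fact
  define S where "S = (\<lambda>a. mon a 0) ` carrier A"
  have Sc: "mon a 0 \<in> carrier RA" if "a \<in> carrier A" for a using mon_carrier[of a 0] that by (simp add: ideals_one)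
  have minus: "\<ominus>\<^bsub>RA\<^esub> mon a n = mon (\<ominus> a) n" if "a \<in> ideal_pow A I n" for a n
  proof (rule RA.minus_equality)
    have "\<ominus> a \<in> ideal_pow A I n"
      using additive_subgroup.a_inv_closed[OF ideal.axioms(1)[OF ideal_pow_ideal[OF I]] that] .
    then show "mon (\<ominus> a) n \<in> carrier RA" by (rule mon_carrier)
    show "mon (\<ominus> a) n \<oplus>\<^bsub>RA\<^esub> mon a n = \<zero>\<^bsub>RA\<^esub>"
      using ipc[OF that] by (simp add: mon_add l_neg rees_zero) (simp add: mon_def)
  qed (rule mon_carrier[OF that])
  have S: "subring S RA"
  proof (rule RA.subringI)
    show "S \<subseteq> carrier RA" using Sc by (auto simp: S_def)
    have "\<one>\<^bsub>RA\<^esub> = mon \<one> 0" by (simp add: rees_one mon_def)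
    then show "\<one>\<^bsub>RA\<^esub> \<in> S" by (simp add: S_def)
    show "\<ominus>\<^bsub>RA\<^esub> h \<in> S" if "h \<in> S" for h using that minus[of _ 0] by (auto simp: S_def ideals_one)
    show "h \<otimes>\<^bsub>RA\<^esub> k \<in> S" "h \<oplus>\<^bsub>RA\<^esub> k \<in> S" if "h \<in> S" "k \<in> S" for h k
      using that by (auto simp: S_def mon_mult mon_add)
  qed
  have idl: "ideal {a \<in> carrier A. mon a 0 \<in> K} A" if K: "scalar_closed RA S K" for K
  proof (rule idealI[OF ring_axioms])
    show "subgroup {a \<in> carrier A. mon a 0 \<in> K} (add_monoid A)"
    proof (rule add.subgroupI)
      have "mon \<zero> 0 = \<zero>\<^bsub>RA\<^esub>" by (simp add: rees_zero mon_def)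
      then show "{a \<in> carrier A. mon a 0 \<in> K} \<noteq> {}" using scalar_closedD(1)[OF K] by auto
      fix a assume a: "a \<in> {a \<in> carrier A. mon a 0 \<in> K}"
      have "mon (\<ominus> \<one>) 0 \<otimes>\<^bsub>RA\<^esub> mon a 0 \<in> K" using scalar_closedD(3)[OF K, of "mon (\<ominus> \<one>) 0"] a by (simp add: S_def)
      then show "\<ominus> a \<in> {a \<in> carrier A. mon a 0 \<in> K}" using a by (simp add: mon_mult l_minus)
      show "a \<oplus> b \<in> {a \<in> carrier A. mon a 0 \<in> K}" if "b \<in> {a \<in> carrier A. mon a 0 \<in> K}" for b
        using a that scalar_closedD(2)[OF K, of "mon a 0" "mon b 0"] by (simp add: mon_add)
    qed auto
    fix a x assume a: "a \<in> {a \<in> carrier A. mon a 0 \<in> K}" and x: "x \<in> carrier A"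
    have "mon x 0 \<otimes>\<^bsub>RA\<^esub> mon a 0 \<in> K" using scalar_closedD(3)[OF K, of "mon x 0" "mon a 0"] a x by (simp add: S_def)
    then show "x \<otimes> a \<in> {a \<in> carrier A. mon a 0 \<in> K}" using a x by (simp add: mon_mult)
    then show "a \<otimes> x \<in> {a \<in> carrier A. mon a 0 \<in> K}" using a x by (simp add: m_comm)
  qed
  have nS: "noetherian_subring RA S"
    unfolding noetherian_subring_def
  proof (intro allI impI)
    fix K assume KS: "K \<subseteq> S" and K: "scalar_closed RA S K"
    obtain G where G: "G \<subseteq> carrier A" "finite G" "{a \<in> carrier A. mon a 0 \<in> K} = Idl G"
      using N.finetely_gen[OF idl[OF K]] by blast
    have "finite_span RA S K ((\<lambda>a. mon a 0) ` G)"
      unfolding finite_span_def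
    proof (intro conjI allI impI)
      show "(\<lambda>a. mon a 0) ` G \<subseteq> K" using genideal_self[OF G(1)] G(3) by blast
      fix K' assume K': "scalar_closed RA S K' \<and> (\<lambda>a. mon a 0) ` G \<subseteq> K'"
      then have "G \<subseteq> {a \<in> carrier A. mon a 0 \<in> K'}" using G(1) by blast
      then have "Idl G \<subseteq> {a \<in> carrier A. mon a 0 \<in> K'}" using genideal_minimal idl K' by blast
      then show "K \<subseteq> K'" using KS G(3) by (auto simp: S_def)
    qed (use G(2) in simp)
    then show "\<exists>G. finite_span RA S K G" ..
  qed
  obtain F where F: "F \<subseteq> carrier A" "finite F" "I = Idl F" using N.finetely_gen[OF I] by blast
  have FI: "F \<subseteq> I" using genideal_self F by blast
  have "mon a 1 \<in> carrier RA" if "a \<in> I" for a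
    using mon_carrier[of a 1] that ideal_pow_1[OF I] by simp
  then have "(\<lambda>a. mon a 1) ` F \<subseteq> carrier RA" using FI by blast
  from RA.noetherian_subring_finite_adjoin[OF finite_imageI[OF F(2)] this S nS]
  obtain T where T: "subring T RA" "noetherian_subring RA T" "S \<subseteq> T" "(\<lambda>a. mon a 1) ` F \<subseteq> T" by blast
  have Tmon0: "mon r 0 \<in> T" if "r \<in> carrier A" for r using that T(3) by (auto simp: S_def)
  have mon0_eq: "mon \<zero> n = \<zero>\<^bsub>RA\<^esub>" for n by (simp add: rees_zero mon_def)
  \<comment> \<open>\<open>T\<close> is known to contain \<open>a t\<close> only for the generators
    \<open>a\<close> of \<open>I\<close>; as the admissible \<open>a\<close> form an ideal, it
    contains \<open>a t\<close> for all \<open>a\<close> in \<open>I\<close>.\<close>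
  have idl1: "ideal {a \<in> I. mon a 1 \<in> T} A"
  proof (rule idealI[OF ring_axioms])
    interpret I: ideal I A by (rule I)
    show "subgroup {a \<in> I. mon a 1 \<in> T} (add_monoid A)"
    proof (rule add.subgroupI)
      have "\<zero> \<in> {a \<in> I. mon a 1 \<in> T}" using subringE(2)[OF T(1)] I.zero_closed by (simp add: mon0_eq)
      then show "{a \<in> I. mon a 1 \<in> T} \<noteq> {}" by blast
      fix a assume a: "a \<in> {a \<in> I. mon a 1 \<in> T}"
      then show "\<ominus> a \<in> {a \<in> I. mon a 1 \<in> T}"
        using minus[of a 1] ideal_pow_1[OF I] subringE(5)[OF T(1), of "mon a 1"] I.a_inv_closed by simp
      show "a \<oplus> b \<in> {a \<in> I. mon a 1 \<in> T}" if "b \<in> {a \<in> I. mon a 1 \<in> T}" for b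
        using a that subringE(7)[OF T(1), of "mon a 1" "mon b 1"] I.Icarr I.a_closed by (simp add: mon_add)
    qed (use I.Icarr in auto)
    fix a x assume a: "a \<in> {a \<in> I. mon a 1 \<in> T}" and x: "x \<in> carrier A"
    have "mon x 0 \<otimes>\<^bsub>RA\<^esub> mon a 1 \<in> T" using subringE(6)[OF T(1) Tmon0[OF x]] a by simp
    then show "x \<otimes> a \<in> {a \<in> I. mon a 1 \<in> T}" using a x I.Icarr I.I_l_closed by (simp add: mon_mult)
    then show "a \<otimes> x \<in> {a \<in> I. mon a 1 \<in> T}" using a x I.Icarr by (simp add: m_comm)
  qed
  have "I \<subseteq> {a \<in> I. mon a 1 \<in> T}" using genideal_minimal[OF idl1, of F] F(3) FI T(4) by blast
  then have Tmon1: "mon a 1 \<in> T" if "a \<in> I" for a using that by blast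
  have Tmon: "mon a n \<in> T" if "a \<in> ideal_pow A I n" for a n
    using that
  proof (induction n arbitrary: a)
    case 0 then show ?case using Tmon0 by (simp add: ideals_one)
  next
    case (Suc n)
    have Ic: "c \<in> carrier A" if "c \<in> I" for c using ideal.Icarr[OF I that] .
    from Suc.prems have "a \<in> ideal_pow A I n \<cdot> I" unfolding ideal_pow_Suc .
    then show ?case
    proof (induction a rule: ideal_prod.induct)
      case (prod b c)
      have "mon (b \<otimes> c) (Suc n) = mon b n \<otimes>\<^bsub>RA\<^esub> mon c 1" using mon_mult[OF ipc[OF prod(1)] Ic[OF prod(2)]] by simp
      then show ?case using subringE(6)[OF T(1) Suc.IH[OF prod(1)] Tmon1[OF prod(2)]] by simp
    next
      case (sum b c)
      have "b \<in> carrier A" "c \<in> carrier A"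
        using sum ideal_prod_in_carrier[OF ideal_pow_ideal[OF I] I] by blast+
      then show ?case using subringE(7)[OF T(1) sum(3,4)] by (simp add: mon_add)
    qed
  qed
  \<comment> \<open>A polynomial is exhausted by removing its top monomial; \<open>q\<close> is the
    rest.\<close>
  have fin: "p \<in> carrier RA \<Longrightarrow> (\<And>i. n \<le> i \<Longrightarrow> p i = \<zero>) \<Longrightarrow> p \<in> T" for p n
  proof (induction n arbitrary: p)
    case 0
    then have "p = \<zero>\<^bsub>RA\<^esub>" by (auto simp: rees_zero)
    then show ?case using subringE(2)[OF T(1)] by simp
  next
    case (Suc n)
    define q where "q i = (if i = n then \<zero> else p i)" for i
    have z: "\<zero> \<in> ideal_pow A I i" for i
      using additive_subgroup.zero_closed[OF ideal.axioms(1)[OF ideal_pow_ideal[OF I]]] .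
    have q: "q \<in> carrier RA" using Suc.prems(1) z by (auto simp: rees_carrier up_iff q_def)
    have "q \<in> T"
    proof (rule Suc.IH[OF q])
      fix i assume "n \<le> i"
      then show "q i = \<zero>" using Suc.prems(2)[of i] by (cases "i = n") (auto simp: q_def)
    qed
    moreover have pn: "p n \<in> ideal_pow A I n" using Suc.prems(1) by (simp add: rees_carrier)
    moreover have "p = q \<oplus>\<^bsub>RA\<^esub> mon (p n) n"
      using Suc.prems(1) ipc[OF pn] q
      by (subst rees_add) (auto simp: rees_up mon_up, auto simp: q_def mon_def rees_carrier up_iff)
    ultimately show ?case using subringE(7)[OF T(1) _ Tmon[OF pn]] by metis
  qed
  have "carrier RA \<subseteq> T"
  proof
    fix p assume p: "p \<in> carrier RA"
    then obtain n where "\<And>m. n < m \<Longrightarrow> p m = \<zero>" by (auto simp: rees_carrier up_iff)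
    then show "p \<in> T" using fin[OF p, of "Suc n"] by simp
  qed
  then have "T = carrier RA" using subringE(1)[OF T(1)] by blast
  then show ?thesis using T(2) RA.noetherian_if_noetherian_subring by simp
qed

end

section \<open>Ratliff-Rush filtrations modulo a submodule\<close>

context module
begin

lemma submoduleI':
  assumes "H \<subseteq> carrier M" "\<zero>\<^bsub>M\<^esub> \<in> H" "\<And>a b. a \<in> H \<Longrightarrow> b \<in> H \<Longrightarrow> a \<oplus>\<^bsub>M\<^esub> b \<in> H"
    "\<And>a x. a \<in> carrier R \<Longrightarrow> x \<in> H \<Longrightarrow> a \<odot>\<^bsub>M\<^esub> x \<in> H"
  shows "submodule H R M"
proof (rule submoduleI[OF assms(1,2) _ assms(3,4)])
  fix a assume a: "a \<in> H"
  have "\<ominus> \<one> \<odot>\<^bsub>M\<^esub> a \<in> H" using assms(4)[OF _ a, of "\<ominus> \<one>"] by simp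
  then show "\<ominus>\<^bsub>M\<^esub> a \<in> H" using a assms(1) by (auto simp: smult_l_minus)
qed

lemma module_span_submodule:
  assumes "S \<subseteq> carrier M" shows "submodule (module_span R M S) R M"
proof (rule submoduleI')
  show "module_span R M S \<subseteq> carrier M"
    using assms carrier_is_submodule by (auto simp: module_span_def)
qed (auto simp: module_span_def submodule_zero submoduleE(4,5))

lemma module_span_minimal: "submodule N R M \<Longrightarrow> S \<subseteq> N \<Longrightarrow> module_span R M S \<subseteq> N"
  by (auto simp: module_span_def)

lemma ideal_times_sub:
  assumes "J \<subseteq> carrier R" shows "submodule (ideal_times R J M) R M"
  unfolding ideal_times_def by (rule module_span_submodule) (use assms in auto)

lemma ideal_times_mem: "a \<in> J \<Longrightarrow> x \<in> carrier M \<Longrightarrow> a \<odot>\<^bsub>M\<^esub> x \<in> ideal_times R J M"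
  by (auto simp: ideal_times_def module_span_def)

lemma ideal_times_min:
  assumes "submodule N R M" "\<And>a x. a \<in> J \<Longrightarrow> x \<in> carrier M \<Longrightarrow> a \<odot>\<^bsub>M\<^esub> x \<in> N"
  shows "ideal_times R J M \<subseteq> N"
  unfolding ideal_times_def by (rule module_span_minimal[OF assms(1)]) (use assms(2) in auto)

lemma ideal_times_mono: "J \<subseteq> J' \<Longrightarrow> J' \<subseteq> carrier R \<Longrightarrow> ideal_times R J M \<subseteq> ideal_times R J' M"
  by (rule ideal_times_min[OF ideal_times_sub]) (auto intro: ideal_times_mem)

lemma smult_preimage:
  assumes "submodule N R M" "a \<in> carrier R"
  shows "submodule {x \<in> carrier M. a \<odot>\<^bsub>M\<^esub> x \<in> N} R M"
proof (rule submoduleI')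
  fix b x assume "b \<in> carrier R" "x \<in> {x \<in> carrier M. a \<odot>\<^bsub>M\<^esub> x \<in> N}"
  moreover have "a \<odot>\<^bsub>M\<^esub> (b \<odot>\<^bsub>M\<^esub> x) = b \<odot>\<^bsub>M\<^esub> (a \<odot>\<^bsub>M\<^esub> x)" if "b \<in> carrier R" "x \<in> carrier M" for b x
    using assms(2) that by (simp add: smult_assoc1[symmetric] R.m_comm)
  ultimately show "b \<odot>\<^bsub>M\<^esub> x \<in> {x \<in> carrier M. a \<odot>\<^bsub>M\<^esub> x \<in> N}"
    using submoduleE(4)[OF assms(1)] by simp
qed (use assms submodule_zero[OF assms(1)] submoduleE(5)[OF assms(1)] in \<open>auto simp: smult_r_distr\<close>)

text \<open>The sum of two submodules, phrased as a congruence modulo \<open>W\<close>, which is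
  also the criterion for two cosets of \<open>W\<close> to be equal.\<close>

definition msum :: "'c set \<Rightarrow> 'c set \<Rightarrow> 'c set" where
  "msum N W = {x \<in> carrier M. \<exists>p\<in>N. x \<ominus>\<^bsub>M\<^esub> p \<in> W}"

lemma msumI: "p \<in> N \<Longrightarrow> w \<in> W \<Longrightarrow> p \<in> carrier M \<Longrightarrow> w \<in> carrier M \<Longrightarrow> x = p \<oplus>\<^bsub>M\<^esub> w \<Longrightarrow> x \<in> msum N W"
  unfolding msum_def by (auto intro!: bexI[of _ p]) (metis M.a_comm M.minus_eq_iff M.a_closed)

lemma msumE:
  assumes "x \<in> msum N W" "submodule N R M"
  obtains p w where "p \<in> N" "w \<in> W" "x = p \<oplus>\<^bsub>M\<^esub> w" "p \<in> carrier M" "w \<in> carrier M"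
proof -
  obtain p where p: "x \<in> carrier M" "p \<in> N" "x \<ominus>\<^bsub>M\<^esub> p \<in> W" using assms(1) by (auto simp: msum_def)
  have pc: "p \<in> carrier M" using p assms submodule_carrier by blast
  have "p \<oplus>\<^bsub>M\<^esub> (x \<ominus>\<^bsub>M\<^esub> p) = x" using p(1) pc by (simp add: a_minus_def M.add_cancel_neg)
  then show ?thesis using that[of p "x \<ominus>\<^bsub>M\<^esub> p"] p pc by simp
qed

lemma msum_sub:
  assumes N: "submodule N R M" and W: "submodule W R M"
  shows "submodule (msum N W) R M"
proof (rule submoduleI')
  show "\<zero>\<^bsub>M\<^esub> \<in> msum N W"
    using submodule_zero[OF N] submodule_zero[OF W] by (intro msumI[of "\<zero>\<^bsub>M\<^esub>" _ "\<zero>\<^bsub>M\<^esub>"]) auto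
  fix a assume a: "a \<in> msum N W"
  then obtain p w where p: "p \<in> N" "w \<in> W" "a = p \<oplus>\<^bsub>M\<^esub> w" "p \<in> carrier M" "w \<in> carrier M" using msumE[OF _ N] by blast
  show "r \<odot>\<^bsub>M\<^esub> a \<in> msum N W" if r: "r \<in> carrier R" for r
    using p r submoduleE(4)[OF N r p(1)] submoduleE(4)[OF W r p(2)]
    by (intro msumI[of "r \<odot>\<^bsub>M\<^esub> p" _ "r \<odot>\<^bsub>M\<^esub> w"]) (auto simp: smult_r_distr)
  fix b assume b: "b \<in> msum N W"
  then obtain q v where q: "q \<in> N" "v \<in> W" "b = q \<oplus>\<^bsub>M\<^esub> v" "q \<in> carrier M" "v \<in> carrier M" using msumE[OF _ N] by blast
  show "a \<oplus>\<^bsub>M\<^esub> b \<in> msum N W"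
    using p q submoduleE(5)[OF N p(1) q(1)] submoduleE(5)[OF W p(2) q(2)]
    by (intro msumI[of "p \<oplus>\<^bsub>M\<^esub> q" _ "w \<oplus>\<^bsub>M\<^esub> v"]) (auto simp: M.a_ac)
qed (auto simp: msum_def)

lemma msum_left: "submodule N R M \<Longrightarrow> submodule W R M \<Longrightarrow> N \<subseteq> msum N W"
  using submodule_carrier submodule_zero[of W] by (auto intro!: msumI[of _ _ "\<zero>\<^bsub>M\<^esub>"])

lemma msum_right: "submodule N R M \<Longrightarrow> submodule W R M \<Longrightarrow> W \<subseteq> msum N W"
  using submodule_carrier submodule_zero[of N] by (auto intro!: msumI[of "\<zero>\<^bsub>M\<^esub>"])

lemma msum_min: "submodule H R M \<Longrightarrow> submodule N R M \<Longrightarrow> N \<subseteq> H \<Longrightarrow> W \<subseteq> H \<Longrightarrow> msum N W \<subseteq> H"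
  using submoduleE(5)[of H] by (auto elim!: msumE)

lemma msum_zero: "submodule N R M \<Longrightarrow> msum N {\<zero>\<^bsub>M\<^esub>} = N"
  using msum_min[of N N "{\<zero>\<^bsub>M\<^esub>}"] msum_left[of N "{\<zero>\<^bsub>M\<^esub>}"] zero_submodule submodule_zero[of N] by blast

end

section \<open>Quotients, pulled back to the module\<close>

locale quotient_module = module R M for R (structure) and M (structure) +
  fixes W
  assumes W: "submodule W R M"
begin

abbreviation "Q \<equiv> module_quot M W"

lemma W_sg: "subgroup W (add_monoid M)" using W by (rule submodule.axioms(1))

lemma W_as: "abelian_subgroup W M"
  by (rule abelian_subgroupI3) (simp_all add: additive_subgroup_def W_sg M.abelian_group_axioms)

lemma coset_mem: "x \<in> W +>\<^bsub>M\<^esub> m \<longleftrightarrow> (\<exists>w\<in>W. x = w \<oplus>\<^bsub>M\<^esub> m)"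
  by (auto simp: a_r_coset_def')

lemma coset_eq:
  assumes "m \<in> carrier M" "m' \<in> carrier M"
  shows "W +>\<^bsub>M\<^esub> m = W +>\<^bsub>M\<^esub> m' \<longleftrightarrow> m \<ominus>\<^bsub>M\<^esub> m' \<in> W"
proof
  assume "W +>\<^bsub>M\<^esub> m = W +>\<^bsub>M\<^esub> m'"
  moreover have "m \<in> W +>\<^bsub>M\<^esub> m" using assms submodule_zero[OF W] by (auto simp: coset_mem intro!: bexI[of _ "\<zero>\<^bsub>M\<^esub>"])
  ultimately obtain w where "w \<in> W" "m = w \<oplus>\<^bsub>M\<^esub> m'" by (auto simp: coset_mem)
  then show "m \<ominus>\<^bsub>M\<^esub> m' \<in> W" using assms submodule_carrier[OF W] by (metis M.minus_eq_iff)
next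
  assume a: "m \<ominus>\<^bsub>M\<^esub> m' \<in> W"
  have "m = (m \<ominus>\<^bsub>M\<^esub> m') \<oplus>\<^bsub>M\<^esub> m'" using assms by (simp add: a_minus_def M.a_assoc M.l_neg)
  then have "m \<in> W +>\<^bsub>M\<^esub> m'" using a coset_mem by blast
  then show "W +>\<^bsub>M\<^esub> m = W +>\<^bsub>M\<^esub> m'" using M.a_repr_independence[OF _ assms(2) W_sg] by simp
qed

lemma Q_carrier: "carrier Q = (\<lambda>m. W +>\<^bsub>M\<^esub> m) ` carrier M"
  by (auto simp: module_quot_def A_RCOSETS_def')

lemma Q_zero: "\<zero>\<^bsub>Q\<^esub> = W +>\<^bsub>M\<^esub> \<zero>\<^bsub>M\<^esub>"
  using submodule_carrier[OF W] by (simp add: module_quot_def subset_iff)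

lemma Q_add: "m \<in> carrier M \<Longrightarrow> m' \<in> carrier M \<Longrightarrow> (W +>\<^bsub>M\<^esub> m) \<oplus>\<^bsub>Q\<^esub> (W +>\<^bsub>M\<^esub> m') = W +>\<^bsub>M\<^esub> (m \<oplus>\<^bsub>M\<^esub> m')"
  using abelian_subgroup.a_rcos_sum[OF W_as] by (simp add: module_quot_def)

lemma Q_smult:
  assumes "a \<in> carrier R" "m \<in> carrier M"
  shows "a \<odot>\<^bsub>Q\<^esub> (W +>\<^bsub>M\<^esub> m) = W +>\<^bsub>M\<^esub> (a \<odot>\<^bsub>M\<^esub> m)"
proof -
  have "W +>\<^bsub>M\<^esub> (a \<odot>\<^bsub>M\<^esub> x) = W +>\<^bsub>M\<^esub> (a \<odot>\<^bsub>M\<^esub> m)" if x: "x \<in> W +>\<^bsub>M\<^esub> m" for x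
  proof -
    obtain w where w: "w \<in> W" "x = w \<oplus>\<^bsub>M\<^esub> m" using x unfolding coset_mem by blast
    have wc: "w \<in> carrier M" using w submodule_carrier[OF W] by blast
    have "a \<odot>\<^bsub>M\<^esub> x \<ominus>\<^bsub>M\<^esub> a \<odot>\<^bsub>M\<^esub> m = a \<odot>\<^bsub>M\<^esub> w"
      using w(2) wc assms by (subst M.minus_eq_iff) (auto simp: smult_r_distr)
    then show ?thesis using submoduleE(4)[OF W assms(1) w(1)] w(2) wc assms by (subst coset_eq) auto
  qed
  moreover have "m \<in> W +>\<^bsub>M\<^esub> m" using assms submodule_zero[OF W] by (auto simp: coset_mem intro!: bexI[of _ "\<zero>\<^bsub>M\<^esub>"])
  ultimately have "(\<Union>x\<in>W +>\<^bsub>M\<^esub> m. W +>\<^bsub>M\<^esub> (a \<odot>\<^bsub>M\<^esub> x)) = W +>\<^bsub>M\<^esub> (a \<odot>\<^bsub>M\<^esub> m)" by blast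
  then show ?thesis by (simp add: module_quot_def)
qed

lemma Q_module: "module R Q"
proof (rule moduleI)
  show "cring R" by (rule R.is_cring)
  show "abelian_group Q"
  proof (rule abelian_groupI)
    fix x assume "x \<in> carrier Q"
    then obtain m where m: "m \<in> carrier M" "x = W +>\<^bsub>M\<^esub> m" by (auto simp: Q_carrier)
    show "\<zero>\<^bsub>Q\<^esub> \<oplus>\<^bsub>Q\<^esub> x = x" using m by (simp add: Q_zero Q_add)
    show "\<exists>y\<in>carrier Q. y \<oplus>\<^bsub>Q\<^esub> x = \<zero>\<^bsub>Q\<^esub>"
      using m by (intro bexI[of _ "W +>\<^bsub>M\<^esub> \<ominus>\<^bsub>M\<^esub> m"]) (simp_all add: Q_zero Q_add Q_carrier M.l_neg)
  qed (auto simp: Q_carrier Q_zero Q_add M.a_ac)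
qed (auto simp: Q_carrier Q_add Q_smult smult_l_distr smult_r_distr smult_assoc1)

sublocale Q: module R Q by (rule Q_module)

lemma coset_zero_iff: "m \<in> carrier M \<Longrightarrow> W +>\<^bsub>M\<^esub> m = \<zero>\<^bsub>Q\<^esub> \<longleftrightarrow> m \<in> W"
  unfolding Q_zero by (subst coset_eq) auto

text \<open>\<open>J (M / W)\<close> is the image of \<open>JM\<close>, so its preimage is
  \<open>JM + W\<close>. With this, statements about filtrations of \<open>M / W\<close> become
  statements about submodules of \<open>M\<close>.\<close>

lemma ideal_times_quot:
  assumes J: "J \<subseteq> carrier R" and m: "m \<in> carrier M"
  shows "W +>\<^bsub>M\<^esub> m \<in> ideal_times R J Q \<longleftrightarrow> m \<in> msum (ideal_times R J M) W"
proof
  note JM = ideal_times_sub[OF J]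
  let ?N = "(\<lambda>p. W +>\<^bsub>M\<^esub> p) ` ideal_times R J M"
  have "ideal_times R J Q \<subseteq> ?N"
  proof (rule Q.ideal_times_min)
    show "submodule ?N R Q"
    proof (rule Q.submoduleI')
      show "?N \<subseteq> carrier Q" using submodule_carrier[OF JM] by (auto simp: Q_carrier)
      show "\<zero>\<^bsub>Q\<^esub> \<in> ?N" using submodule_zero[OF JM] by (auto simp: Q_zero)
    next
      fix a b assume "a \<in> ?N" "b \<in> ?N"
      then show "a \<oplus>\<^bsub>Q\<^esub> b \<in> ?N" using submodule_carrier[OF JM] submoduleE(5)[OF JM] by (auto simp: Q_add)
    next
      fix a x assume "a \<in> carrier R" "x \<in> ?N"
      then show "a \<odot>\<^bsub>Q\<^esub> x \<in> ?N" using submodule_carrier[OF JM] submoduleE(4)[OF JM] by (auto simp: Q_smult)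
    qed
    show "a \<odot>\<^bsub>Q\<^esub> x \<in> ?N" if "a \<in> J" "x \<in> carrier Q" for a x
      using that ideal_times_mem[of a J] J by (auto simp: Q_carrier Q_smult)
  qed
  moreover assume "W +>\<^bsub>M\<^esub> m \<in> ideal_times R J Q"
  ultimately obtain p where "p \<in> ideal_times R J M" "W +>\<^bsub>M\<^esub> m = W +>\<^bsub>M\<^esub> p" by blast
  then show "m \<in> msum (ideal_times R J M) W"
    using coset_eq[OF m] submodule_carrier[OF JM] m by (auto simp: msum_def)
next
  note JM = ideal_times_sub[OF J]
  let ?N = "{p \<in> carrier M. W +>\<^bsub>M\<^esub> p \<in> ideal_times R J Q}"
  have JQ: "submodule (ideal_times R J Q) R Q" by (rule Q.ideal_times_sub[OF J])
  have N: "submodule ?N R M"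
  proof (rule submoduleI')
    show "\<zero>\<^bsub>M\<^esub> \<in> ?N" using Q.submodule_zero[OF JQ] Q_zero by simp
    show "a \<oplus>\<^bsub>M\<^esub> b \<in> ?N" if "a \<in> ?N" "b \<in> ?N" for a b
      using that Q.submoduleE(5)[OF JQ] Q_add by force
    show "r \<odot>\<^bsub>M\<^esub> b \<in> ?N" if "r \<in> carrier R" "b \<in> ?N" for r b
      using that Q.submoduleE(4)[OF JQ] Q_smult by force
  qed auto
  have "ideal_times R J M \<subseteq> ?N"
  proof (rule ideal_times_min[OF N])
    fix a x assume ax: "a \<in> J" "x \<in> carrier M"
    then have "a \<odot>\<^bsub>Q\<^esub> (W +>\<^bsub>M\<^esub> x) \<in> ideal_times R J Q" by (intro Q.ideal_times_mem) (auto simp: Q_carrier)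
    then show "a \<odot>\<^bsub>M\<^esub> x \<in> ?N" using ax J by (auto simp: Q_smult)
  qed
  moreover have "W \<subseteq> ?N"
  proof
    fix w assume w: "w \<in> W"
    then have "W +>\<^bsub>M\<^esub> w = \<zero>\<^bsub>Q\<^esub>" using coset_zero_iff submodule_carrier[OF W] by blast
    then show "w \<in> ?N" using Q.submodule_zero[OF JQ] submodule_carrier[OF W w] by simp
  qed
  moreover assume "m \<in> msum (ideal_times R J M) W"
  ultimately show "W +>\<^bsub>M\<^esub> m \<in> ideal_times R J Q" using msum_min[OF N JM] by blast
qed

end

section \<open>The two filtrations of \<open>M\<close> attached to a submodule
  \<open>W\<close>\<close>

locale rr_module = module R M for R (structure) and M (structure) +
  fixes I
  assumes I: "ideal I R"
begin

definition "IM n = ideal_times R (ideal_pow R I n) M"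

text \<open>\<open>V W n\<close> is the preimage in \<open>M\<close> of the Ratliff-Rush filtration of \<open>M / W\<close>, and \<open>N W n\<close> is the part of it that
  comes from the Ratliff-Rush filtration of \<open>M\<close>.\<close>

definition "V W n = {m \<in> carrier M. \<exists>k\<ge>1. \<forall>a\<in>ideal_pow R I k. a \<odot>\<^bsub>M\<^esub> m \<in> msum (IM (n + k)) W}"

definition "rr n = V {\<zero>\<^bsub>M\<^esub>} n"

definition "N W n = msum (rr n) W"

lemma ipc: "a \<in> ideal_pow R I n \<Longrightarrow> a \<in> carrier R"
  using ideal.Icarr[OF R.ideal_pow_ideal[OF I]] .

lemma IM_sub: "submodule (IM n) R M"
  unfolding IM_def by (rule ideal_times_sub) (use ipc in blast)

lemma IM_smult: "a \<in> ideal_pow R I k \<Longrightarrow> x \<in> IM n \<Longrightarrow> a \<odot>\<^bsub>M\<^esub> x \<in> IM (n + k)"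
proof -
  assume a: "a \<in> ideal_pow R I k" and x: "x \<in> IM n"
  have "IM n \<subseteq> {x \<in> carrier M. a \<odot>\<^bsub>M\<^esub> x \<in> IM (n + k)}"
    unfolding IM_def[of n]
  proof (rule ideal_times_min)
    show "submodule {x \<in> carrier M. a \<odot>\<^bsub>M\<^esub> x \<in> IM (n + k)} R M"
      by (rule smult_preimage[OF IM_sub ipc[OF a]])
    fix b y assume b: "b \<in> ideal_pow R I n" and y: "y \<in> carrier M"
    have "(b \<otimes> a) \<odot>\<^bsub>M\<^esub> y \<in> IM (n + k)" unfolding IM_def by (rule ideal_times_mem[OF R.ideal_pow_mult_mem[OF I b a] y])
    then show "b \<odot>\<^bsub>M\<^esub> y \<in> {x \<in> carrier M. a \<odot>\<^bsub>M\<^esub> x \<in> IM (n + k)}"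
      using ipc[OF a] ipc[OF b] y by (simp add: smult_assoc1[symmetric] R.m_comm)
  qed
  then show ?thesis using x by blast
qed

lemma IM_antimono: "m \<le> n \<Longrightarrow> IM n \<subseteq> IM m"
  unfolding IM_def by (rule ideal_times_mono[OF R.ideal_pow_antimono[OF I]]) (use ipc in auto)

lemma IM_0: "IM 0 = carrier M"
proof
  show "carrier M \<subseteq> IM 0"
  proof
    fix x assume x: "x \<in> carrier M"
    have "\<one> \<odot>\<^bsub>M\<^esub> x \<in> IM 0" unfolding IM_def R.ideal_pow_0 by (rule ideal_times_mem[OF R.one_closed x])
    then show "x \<in> IM 0" using x by simp
  qed
qed (use submodule_carrier[OF IM_sub] in auto)

lemma msum_smult:
  assumes "submodule W R M" "a \<in> ideal_pow R I k" "x \<in> msum (IM n) W"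
  shows "a \<odot>\<^bsub>M\<^esub> x \<in> msum (IM (n + k)) W"
proof -
  obtain p w where *: "p \<in> IM n" "w \<in> W" "x = p \<oplus>\<^bsub>M\<^esub> w" "p \<in> carrier M" "w \<in> carrier M"
    using msumE[OF assms(3) IM_sub] .
  show ?thesis using * IM_smult[OF assms(2) *(1)] submoduleE(4)[OF assms(1) ipc[OF assms(2)] *(2)] ipc[OF assms(2)]
    by (intro msumI[of "a \<odot>\<^bsub>M\<^esub> p" _ "a \<odot>\<^bsub>M\<^esub> w"]) (auto simp: smult_r_distr)
qed

text \<open>A product of ideals is additively generated by products, and the scalars that carry
  \<open>m\<close> into \<open>H\<close> are closed under addition.\<close>

lemma ideal_pow_gen_smult:
  assumes H: "submodule H R M" and m: "m \<in> carrier M"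
    and *: "\<And>b c. b \<in> ideal_pow R I j \<Longrightarrow> c \<in> ideal_pow R I k \<Longrightarrow> b \<odot>\<^bsub>M\<^esub> (c \<odot>\<^bsub>M\<^esub> m) \<in> H"
    and a: "a \<in> ideal_pow R I (j + k)"
  shows "a \<odot>\<^bsub>M\<^esub> m \<in> H"
  using a unfolding R.ideal_pow_add[OF I]
proof (induction a rule: ideal_prod.induct)
  case (prod b c)
  then show ?case using *[OF prod] ipc m by (simp add: smult_assoc1)
next
  case (sum s t)
  have "s \<in> carrier R" "t \<in> carrier R"
    using sum R.ideal_prod_in_carrier[OF R.ideal_pow_ideal[OF I] R.ideal_pow_ideal[OF I]] by blast+
  then show ?case using sum m submoduleE(5)[OF H] by (simp add: smult_l_distr)
qed

text \<open>The union over \<open>k\<close> in the Ratliff-Rush filtration is increasing, so that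
  finitely many elements can share one exponent.\<close>

lemma V_exp_mono:
  assumes W: "submodule W R M" and m: "m \<in> carrier M"
    and k: "\<forall>a\<in>ideal_pow R I k. a \<odot>\<^bsub>M\<^esub> m \<in> msum (IM (n + k)) W" and "k \<le> k'"
  shows "\<forall>a\<in>ideal_pow R I k'. a \<odot>\<^bsub>M\<^esub> m \<in> msum (IM (n + k')) W"
proof
  fix a assume a: "a \<in> ideal_pow R I k'"
  show "a \<odot>\<^bsub>M\<^esub> m \<in> msum (IM (n + k')) W"
  proof (rule ideal_pow_gen_smult[OF msum_sub[OF IM_sub W] m])
    show "a \<in> ideal_pow R I ((k' - k) + k)" using a assms(4) by simp
    fix b c assume "b \<in> ideal_pow R I (k' - k)" "c \<in> ideal_pow R I k"
    then have "b \<odot>\<^bsub>M\<^esub> (c \<odot>\<^bsub>M\<^esub> m) \<in> msum (IM (n + k + (k' - k))) W" using msum_smult[OF W] k by blast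
    then show "b \<odot>\<^bsub>M\<^esub> (c \<odot>\<^bsub>M\<^esub> m) \<in> msum (IM (n + k')) W" using assms(4) by simp
  qed
qed

lemma VI:
  assumes W: "submodule W R M" and m: "m \<in> carrier M"
    and k: "\<And>a. a \<in> ideal_pow R I k \<Longrightarrow> a \<odot>\<^bsub>M\<^esub> m \<in> msum (IM (n + k)) W"
  shows "m \<in> V W n"
  using V_exp_mono[OF W m, of k n "Suc k"] k m by (auto simp: V_def intro!: exI[of _ "Suc k"])

lemma VE:
  assumes "m \<in> V W n"
  obtains k where "m \<in> carrier M" "\<forall>a\<in>ideal_pow R I k. a \<odot>\<^bsub>M\<^esub> m \<in> msum (IM (n + k)) W"
  using assms by (auto simp: V_def)

lemma V_sub:
  assumes W: "submodule W R M"
  shows "submodule (V W n) R M"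
proof (rule submoduleI')
  have S: "submodule (msum (IM k) W) R M" for k by (rule msum_sub[OF IM_sub W])
  show "\<zero>\<^bsub>M\<^esub> \<in> V W n"
    by (rule VI[OF W, of _ 0]) (use submodule_zero[OF S] in \<open>auto simp: ideals_one\<close>)
  fix x assume x: "x \<in> V W n"
  obtain k where k: "x \<in> carrier M" "\<forall>a\<in>ideal_pow R I k. a \<odot>\<^bsub>M\<^esub> x \<in> msum (IM (n + k)) W" using VE[OF x] .
  show "r \<odot>\<^bsub>M\<^esub> x \<in> V W n" if r: "r \<in> carrier R" for r
  proof (rule VI[OF W, of _ k])
    fix a assume a: "a \<in> ideal_pow R I k"
    have "a \<odot>\<^bsub>M\<^esub> (r \<odot>\<^bsub>M\<^esub> x) = r \<odot>\<^bsub>M\<^esub> (a \<odot>\<^bsub>M\<^esub> x)" using k(1) r ipc[OF a] by (simp add: smult_assoc1[symmetric] R.m_comm)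
    then show "a \<odot>\<^bsub>M\<^esub> (r \<odot>\<^bsub>M\<^esub> x) \<in> msum (IM (n + k)) W" using k(2) a submoduleE(4)[OF S r] by simp
  qed (use k r in simp)
  fix y assume y: "y \<in> V W n"
  obtain l where l: "y \<in> carrier M" "\<forall>a\<in>ideal_pow R I l. a \<odot>\<^bsub>M\<^esub> y \<in> msum (IM (n + l)) W" using VE[OF y] .
  have "a \<odot>\<^bsub>M\<^esub> (x \<oplus>\<^bsub>M\<^esub> y) \<in> msum (IM (n + max k l)) W" if a: "a \<in> ideal_pow R I (max k l)" for a
    using V_exp_mono[OF W k(1,2), of "max k l"] V_exp_mono[OF W l(1,2), of "max k l"] a ipc[OF a] k(1) l(1)
      submoduleE(5)[OF S] by (simp add: smult_r_distr)
  then show "x \<oplus>\<^bsub>M\<^esub> y \<in> V W n" using k(1) l(1) by (intro VI[OF W, of _ "max k l"]) auto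
qed (auto simp: V_def)

lemma V_mono:
  assumes "W \<subseteq> W'" shows "V W n \<subseteq> V W' n"
proof -
  have "msum H W \<subseteq> msum H W'" for H using assms by (auto simp: msum_def)
  then show ?thesis unfolding V_def by blast
qed

lemma W_V:
  assumes W: "submodule W R M" shows "W \<subseteq> V W n"
proof
  fix w assume w: "w \<in> W"
  show "w \<in> V W n"
    by (rule VI[OF W, of _ 0]) (use submodule_carrier[OF W w] submoduleE(4)[OF W _ w] msum_right[OF IM_sub W, of n] in \<open>auto simp: ideals_one\<close>)
qed

lemma V_smult:
  assumes W: "submodule W R M" and b: "b \<in> ideal_pow R I j" and x: "x \<in> V W n"
  shows "b \<odot>\<^bsub>M\<^esub> x \<in> V W (n + j)"
proof -
  obtain k where k: "x \<in> carrier M" "\<forall>a\<in>ideal_pow R I k. a \<odot>\<^bsub>M\<^esub> x \<in> msum (IM (n + k)) W" using VE[OF x] .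
  show ?thesis
  proof (rule VI[OF W, of _ k])
    fix a assume a: "a \<in> ideal_pow R I k"
    have "a \<odot>\<^bsub>M\<^esub> (b \<odot>\<^bsub>M\<^esub> x) = b \<odot>\<^bsub>M\<^esub> (a \<odot>\<^bsub>M\<^esub> x)" using k(1) ipc[OF b] ipc[OF a] by (simp add: smult_assoc1[symmetric] R.m_comm)
    moreover have "b \<odot>\<^bsub>M\<^esub> (a \<odot>\<^bsub>M\<^esub> x) \<in> msum (IM (n + k + j)) W" using msum_smult[OF W b] k(2) a by blast
    ultimately show "a \<odot>\<^bsub>M\<^esub> (b \<odot>\<^bsub>M\<^esub> x) \<in> msum (IM (n + j + k)) W" by (simp add: ac_simps)
  qed (use k ipc[OF b] in simp)
qed

lemma IM_V:
  assumes W: "submodule W R M" shows "IM n \<subseteq> V W n"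
proof
  fix x assume x: "x \<in> IM n"
  show "x \<in> V W n"
    by (rule VI[OF W, of _ 0])
      (use x submodule_carrier[OF IM_sub x] submoduleE(4)[OF IM_sub _ x] msum_left[OF IM_sub W, of n] in \<open>auto simp: ideals_one\<close>)
qed

lemma V_0: "submodule W R M \<Longrightarrow> V W 0 = carrier M"
  using IM_V[of W 0] IM_0 submodule_carrier[OF V_sub[of W 0]] by blast

text \<open>\<open>I\<close> is finitely generated, so one exponent \<open>k\<close> serves for all
  multiples of \<open>m\<close> by elements of \<open>I\<close>. As
  \<open>n + (k + 1) = Suc n + k\<close>, the exponent \<open>k + 1\<close> then serves for
  \<open>m\<close>.\<close>

lemma V_colon:
  assumes W: "submodule W R M" and noeth: "noetherian_ring R"
    and m: "m \<in> carrier M" and *: "\<And>a. a \<in> I \<Longrightarrow> a \<odot>\<^bsub>M\<^esub> m \<in> V W (Suc n)"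
  shows "m \<in> V W n"
proof -
  have S: "submodule (msum (IM k) W) R M" for k by (rule msum_sub[OF IM_sub W])
  obtain F where F: "F \<subseteq> carrier R" "finite F" "I = Idl F" using noetherian_ring.finetely_gen[OF noeth I] by blast
  have FI: "F \<subseteq> I" using R.genideal_self F by blast
  define kf where "kf z = (SOME k. \<forall>b\<in>ideal_pow R I k. b \<odot>\<^bsub>M\<^esub> (z \<odot>\<^bsub>M\<^esub> m) \<in> msum (IM (Suc n + k)) W)" for z
  have kf: "\<forall>b\<in>ideal_pow R I (kf z). b \<odot>\<^bsub>M\<^esub> (z \<odot>\<^bsub>M\<^esub> m) \<in> msum (IM (Suc n + kf z)) W" if "z \<in> F" for z
  proof -
    have "z \<odot>\<^bsub>M\<^esub> m \<in> V W (Suc n)" using * FI that by blast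
    then have "\<exists>k. \<forall>b\<in>ideal_pow R I k. b \<odot>\<^bsub>M\<^esub> (z \<odot>\<^bsub>M\<^esub> m) \<in> msum (IM (Suc n + k)) W"
      unfolding V_def by blast
    then show ?thesis unfolding kf_def by (rule someI_ex)
  qed
  define k where "k = Max (insert 0 (kf ` F))"
  have k: "kf z \<le> k" if "z \<in> F" for z unfolding k_def using that F(2) by (intro Max_ge) auto
  have zk: "\<forall>b\<in>ideal_pow R I k. b \<odot>\<^bsub>M\<^esub> (z \<odot>\<^bsub>M\<^esub> m) \<in> msum (IM (Suc n + k)) W" if z: "z \<in> F" for z
  proof (rule V_exp_mono[OF W _ kf[OF z] k[OF z]])
    show "z \<odot>\<^bsub>M\<^esub> m \<in> carrier M" using z F(1) m by auto
  qed
  define J where "J = {c \<in> carrier R. \<forall>b\<in>ideal_pow R I k. b \<odot>\<^bsub>M\<^esub> (c \<odot>\<^bsub>M\<^esub> m) \<in> msum (IM (Suc n + k)) W}"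
  have swap: "b \<odot>\<^bsub>M\<^esub> (y \<odot>\<^bsub>M\<^esub> x) = y \<odot>\<^bsub>M\<^esub> (b \<odot>\<^bsub>M\<^esub> x)" if "b \<in> carrier R" "y \<in> carrier R" "x \<in> carrier M" for b y x
    using that by (simp add: smult_assoc1[symmetric] R.m_comm)
  have "ideal J R"
  proof (rule idealI[OF R.ring_axioms])
    show "subgroup J (add_monoid R)"
    proof (rule R.add.subgroupI)
      have "\<zero> \<in> J" using ipc m submodule_zero[OF S] by (auto simp: J_def)
      then show "J \<noteq> {}" by blast
      show "\<ominus> c \<in> J" if "c \<in> J" for c
        using that ipc m submoduleE(3)[OF S] by (auto simp: J_def smult_l_minus smult_r_minus)
      show "c \<oplus> e \<in> J" if "c \<in> J" "e \<in> J" for c e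
        using that ipc m submoduleE(5)[OF S] by (auto simp: J_def smult_l_distr smult_r_distr)
    qed (auto simp: J_def)
    fix c y assume c: "c \<in> J" "y \<in> carrier R"
    have "b \<odot>\<^bsub>M\<^esub> ((y \<otimes> c) \<odot>\<^bsub>M\<^esub> m) \<in> msum (IM (Suc n + k)) W" if b: "b \<in> ideal_pow R I k" for b
    proof -
      have "b \<odot>\<^bsub>M\<^esub> ((y \<otimes> c) \<odot>\<^bsub>M\<^esub> m) = y \<odot>\<^bsub>M\<^esub> (b \<odot>\<^bsub>M\<^esub> (c \<odot>\<^bsub>M\<^esub> m))"
        using c m ipc[OF b] swap[of b y "c \<odot>\<^bsub>M\<^esub> m"] by (simp add: J_def smult_assoc1)
      then show ?thesis using c b submoduleE(4)[OF S c(2)] by (simp add: J_def)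
    qed
    then show "y \<otimes> c \<in> J" using c by (simp add: J_def)
    then show "c \<otimes> y \<in> J" using c by (simp add: J_def R.m_comm)
  qed
  moreover have "F \<subseteq> J" using zk F(1) by (auto simp: J_def)
  ultimately have IJ: "I \<subseteq> J" using R.genideal_minimal F(3) by simp
  show ?thesis
  proof (rule VI[OF W m, of "k + 1"])
    fix a assume a: "a \<in> ideal_pow R I (k + 1)"
    show "a \<odot>\<^bsub>M\<^esub> m \<in> msum (IM (n + (k + 1))) W"
    proof (rule ideal_pow_gen_smult[OF S m _ a])
      fix b c assume "b \<in> ideal_pow R I k" "c \<in> ideal_pow R I 1"
      then show "b \<odot>\<^bsub>M\<^esub> (c \<odot>\<^bsub>M\<^esub> m) \<in> msum (IM (n + (k + 1))) W"
        using IJ R.ideal_pow_1[OF I] by (auto simp: J_def)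
    qed
  qed
qed

text \<open>Superficiality allows to cancel \<open>x\<close> only in degrees from \<open>n0\<close>
  on. Multiplication by a power of \<open>I\<close> with exponent at least \<open>n0\<close> leads
  there, and the Ratliff-Rush filtration does not see such a multiplication.\<close>

lemma V_superficial:
  assumes W: "submodule W R M" and x: "x \<in> I"
    and sup: "\<And>n m. n0 \<le> n \<Longrightarrow> m \<in> carrier M \<Longrightarrow> x \<odot>\<^bsub>M\<^esub> m \<in> msum (IM (Suc n)) W \<Longrightarrow> m \<in> msum (IM n) W"
    and m: "m \<in> carrier M" and xm: "x \<odot>\<^bsub>M\<^esub> m \<in> V W (Suc n)"
  shows "m \<in> V W n"
proof -
  have xR: "x \<in> carrier R" using ideal.Icarr[OF I x] .
  obtain k where k: "\<forall>a\<in>ideal_pow R I k. a \<odot>\<^bsub>M\<^esub> (x \<odot>\<^bsub>M\<^esub> m) \<in> msum (IM (Suc n + k)) W" using VE[OF xm] .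
  let ?k = "max k n0"
  have k': "\<forall>a\<in>ideal_pow R I ?k. a \<odot>\<^bsub>M\<^esub> (x \<odot>\<^bsub>M\<^esub> m) \<in> msum (IM (Suc n + ?k)) W"
    by (rule V_exp_mono[OF W _ k]) (use xR m in auto)
  show ?thesis
  proof (rule VI[OF W m, of ?k])
    fix a assume a: "a \<in> ideal_pow R I ?k"
    have "x \<odot>\<^bsub>M\<^esub> (a \<odot>\<^bsub>M\<^esub> m) = a \<odot>\<^bsub>M\<^esub> (x \<odot>\<^bsub>M\<^esub> m)" using xR m ipc[OF a] by (simp add: smult_assoc1[symmetric] R.m_comm)
    then have "x \<odot>\<^bsub>M\<^esub> (a \<odot>\<^bsub>M\<^esub> m) \<in> msum (IM (Suc (n + ?k))) W" using k' a by simp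
    then show "a \<odot>\<^bsub>M\<^esub> m \<in> msum (IM (n + ?k)) W" using sup[of "n + ?k" "a \<odot>\<^bsub>M\<^esub> m"] ipc[OF a] m by simp
  qed
qed

lemma rr_sub: "submodule (rr n) R M" unfolding rr_def by (rule V_sub[OF zero_submodule])

lemma N_sub: "submodule W R M \<Longrightarrow> submodule (N W n) R M"
  unfolding N_def by (rule msum_sub[OF rr_sub])

lemma rr_V: "submodule W R M \<Longrightarrow> rr n \<subseteq> V W n"
  unfolding rr_def by (rule V_mono) (simp add: submodule_zero)

lemma N_V: "submodule W R M \<Longrightarrow> N W n \<subseteq> V W n"
  unfolding N_def by (rule msum_min[OF V_sub rr_sub rr_V W_V])

lemma N_smult:
  assumes W: "submodule W R M" and b: "b \<in> ideal_pow R I j" and x: "x \<in> N W n"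
  shows "b \<odot>\<^bsub>M\<^esub> x \<in> N W (n + j)"
proof -
  obtain p w where *: "p \<in> rr n" "w \<in> W" "x = p \<oplus>\<^bsub>M\<^esub> w" "p \<in> carrier M" "w \<in> carrier M"
    using msumE[OF x[unfolded N_def] rr_sub] .
  have "b \<odot>\<^bsub>M\<^esub> p \<in> rr (n + j)" using V_smult[OF zero_submodule b] *(1) by (simp add: rr_def)
  then show ?thesis unfolding N_def using * submoduleE(4)[OF W ipc[OF b] *(2)] ipc[OF b]
    by (intro msumI[of "b \<odot>\<^bsub>M\<^esub> p" _ "b \<odot>\<^bsub>M\<^esub> w"]) (auto simp: smult_r_distr)
qed

lemma N_mono: "W \<subseteq> W' \<Longrightarrow> N W n \<subseteq> N W' n"
  by (auto simp: N_def msum_def)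

lemma IM_N: "submodule W R M \<Longrightarrow> IM n \<subseteq> N W n"
  using IM_V[OF zero_submodule, of n] msum_left[OF rr_sub, of W n] by (auto simp: N_def rr_def)

lemma W_N: "submodule W R M \<Longrightarrow> W \<subseteq> N W n"
  unfolding N_def by (rule msum_right[OF rr_sub])

lemma rr_N: "submodule W R M \<Longrightarrow> rr n \<subseteq> N W n"
  unfolding N_def by (rule msum_left[OF rr_sub])

text \<open>Good behaviour descends from \<open>W' = W + xM\<close> to \<open>W\<close>. An element
  of \<open>V W (Suc n)\<close> lies in \<open>V W' (Suc n)\<close> and so has the form
  \<open>r + w + xm\<close> with \<open>r\<close> from the filtration of \<open>M\<close>. Then
  \<open>xm\<close> lies in \<open>V W (Suc n)\<close>, cancellation puts \<open>m\<close> into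
  \<open>V W n\<close>, and by induction \<open>m\<close> lies in \<open>N W n\<close>, so that
  \<open>xm\<close> lies in \<open>N W (Suc n)\<close>. In degree 0 both filtrations are all of
  \<open>M\<close>.\<close>

lemma step_down:
  assumes W: "submodule W R M" and W': "submodule W' R M" and x: "x \<in> I"
    and W'_eq: "W' = msum W ((\<lambda>m. x \<odot>\<^bsub>M\<^esub> m) ` carrier M)"
    and sup: "\<And>n m. m \<in> carrier M \<Longrightarrow> x \<odot>\<^bsub>M\<^esub> m \<in> V W (Suc n) \<Longrightarrow> m \<in> V W n"
    and rr_lifts: "\<And>n. 1 \<le> n \<Longrightarrow> V W' n \<subseteq> N W' n"
  shows "V W n \<subseteq> N W n"
proof (induction n)
  case 0
  have "carrier M \<subseteq> rr 0" unfolding rr_def by (simp add: V_0[OF zero_submodule])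
  then show ?case using rr_N[OF W, of 0] submodule_carrier[OF V_sub[OF W]] by blast
next
  case (Suc n)
  have xR: "x \<in> carrier R" using ideal.Icarr[OF I x] .
  have WW': "W \<subseteq> W'"
  proof
    fix w assume w: "w \<in> W"
    have "\<zero>\<^bsub>M\<^esub> \<in> (\<lambda>m. x \<odot>\<^bsub>M\<^esub> m) ` carrier M" using xR by (intro image_eqI[of _ _ "\<zero>\<^bsub>M\<^esub>"]) auto
    then show "w \<in> W'" unfolding W'_eq using w submodule_carrier[OF W w] by (intro msumI[of w _ "\<zero>\<^bsub>M\<^esub>"]) auto
  qed
  show ?case
  proof
    fix u assume u: "u \<in> V W (Suc n)"
    then have "u \<in> N W' (Suc n)" using V_mono[OF WW'] rr_lifts[of "Suc n"] by auto
    then obtain r v where r: "r \<in> rr (Suc n)" "v \<in> W'" "u = r \<oplus>\<^bsub>M\<^esub> v" "r \<in> carrier M" "v \<in> carrier M"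
      using msumE[OF _ rr_sub] unfolding N_def by blast
    obtain w y where w: "w \<in> W" "y \<in> (\<lambda>m. x \<odot>\<^bsub>M\<^esub> m) ` carrier M" "v = w \<oplus>\<^bsub>M\<^esub> y" "w \<in> carrier M" "y \<in> carrier M"
      using msumE[OF _ W] r(2) unfolding W'_eq by blast
    obtain m where m: "m \<in> carrier M" "y = x \<odot>\<^bsub>M\<^esub> m" using w(2) by blast
    have rwV: "r \<oplus>\<^bsub>M\<^esub> w \<in> V W (Suc n)"
      using rr_V[OF W] W_V[OF W] r(1) w(1) submoduleE(5)[OF V_sub[OF W]] by blast
    have uy: "u \<ominus>\<^bsub>M\<^esub> (r \<oplus>\<^bsub>M\<^esub> w) = y"
      using r(3,4) w(3,4,5) by (subst M.minus_eq_iff) (auto simp: M.a_ac)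
    have "x \<odot>\<^bsub>M\<^esub> m \<in> V W (Suc n)" using submodule_minus[OF V_sub[OF W] u rwV] uy m(2) by simp
    then have "m \<in> N W n" using sup[OF m(1)] Suc by blast
    then have "y \<in> N W (Suc n)" using N_smult[OF W, of x 1 m n] x R.ideal_pow_1[OF I] m(2) by simp
    moreover have "r \<oplus>\<^bsub>M\<^esub> w \<in> N W (Suc n)"
      using rr_N[OF W] W_N[OF W] r(1) w(1) submoduleE(5)[OF N_sub[OF W]] by blast
    moreover have "u = (r \<oplus>\<^bsub>M\<^esub> w) \<oplus>\<^bsub>M\<^esub> y" using r(3,4) w(3,4,5) by (simp add: M.a_assoc)
    ultimately show "u \<in> N W (Suc n)" using submoduleE(5)[OF N_sub[OF W]] by simp
  qed
qed

lemma rr_eq: "ratliff_rush R I M n = rr n"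
  unfolding rr_def V_def msum_zero[OF IM_sub] by (auto simp: ratliff_rush_def colon_def IM_def)

lemma rr_quot:
  assumes W: "submodule W R M" and m: "m \<in> carrier M"
  shows "W +>\<^bsub>M\<^esub> m \<in> ratliff_rush R I (module_quot M W) n \<longleftrightarrow> m \<in> V W n"
proof -
  interpret Q: quotient_module R M W
    by (intro quotient_module.intro quotient_module_axioms.intro module_axioms W)
  have "W +>\<^bsub>M\<^esub> m \<in> carrier (module_quot M W)" using m by (auto simp: Q.Q_carrier)
  moreover have "a \<odot>\<^bsub>module_quot M W\<^esub> (W +>\<^bsub>M\<^esub> m) \<in> ideal_times R (ideal_pow R I k) (module_quot M W)
      \<longleftrightarrow> a \<odot>\<^bsub>M\<^esub> m \<in> msum (IM k) W" if "a \<in> carrier R" for a k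
    using that m ipc unfolding IM_def by (subst Q.Q_smult) (auto intro!: Q.ideal_times_quot)
  ultimately show ?thesis using m ipc by (auto simp: ratliff_rush_def colon_def V_def)
qed

lemma superficial_quot:
  assumes W: "submodule W R M" and sup: "superficial R I (module_quot M W) x"
  shows "\<exists>n0. \<forall>n\<ge>n0. \<forall>m\<in>carrier M. x \<odot>\<^bsub>M\<^esub> m \<in> msum (IM (Suc n)) W \<longrightarrow> m \<in> msum (IM n) W"
proof -
  interpret Q: quotient_module R M W
    by (intro quotient_module.intro quotient_module_axioms.intro module_axioms W)
  have xI: "x \<in> I" using sup by (simp add: superficial_def)
  have xR: "x \<in> carrier R" using ideal.Icarr[OF I xI] .
  obtain n0 where n0: "\<And>n. n \<ge> n0 \<Longrightarrow> colon (module_quot M W) (ideal_times R (ideal_pow R I (n + 1)) (module_quot M W)) {x}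
      = ideal_times R (ideal_pow R I n) (module_quot M W)" using sup unfolding superficial_def by blast
  have iff: "W +>\<^bsub>M\<^esub> m \<in> ideal_times R (ideal_pow R I n) (module_quot M W) \<longleftrightarrow> m \<in> msum (IM n) W" if "m \<in> carrier M" for m n
    unfolding IM_def by (rule Q.ideal_times_quot) (use ipc that in auto)
  have "m \<in> msum (IM n) W" if n: "n \<ge> n0" and m: "m \<in> carrier M" and xm: "x \<odot>\<^bsub>M\<^esub> m \<in> msum (IM (Suc n)) W" for n m
  proof -
    have "x \<odot>\<^bsub>module_quot M W\<^esub> (W +>\<^bsub>M\<^esub> m) \<in> ideal_times R (ideal_pow R I (n + 1)) (module_quot M W)"
      using iff[of "x \<odot>\<^bsub>M\<^esub> m" "n + 1"] xm m xR by (simp add: Q.Q_smult)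
    then have "W +>\<^bsub>M\<^esub> m \<in> colon (module_quot M W) (ideal_times R (ideal_pow R I (n + 1)) (module_quot M W)) {x}"
      using m by (auto simp: colon_def Q.Q_carrier)
    then show ?thesis using n0[OF n] iff[OF m] by simp
  qed
  then show ?thesis by blast
qed

end

section \<open>Koszul cohomology of Ratliff-Rush quotients\<close>

context module
begin

text \<open>Somewhere between the exponents 0 and \<open>k\<close> the multiples of \<open>m\<close>
  enter the family, and an element \<open>u\<close> of the last power before that moment is the
  witness. \<open>H\<close> depends on the exponent because multiplication by \<open>I\<close>
  raises the degree; for \<mm> a constant family is used.\<close>

lemma pow_socle:
  assumes J: "ideal J R" and m: "m \<in> carrier M" "m \<notin> H 0"
    and k: "\<And>a. a \<in> ideal_pow R J k \<Longrightarrow> a \<odot>\<^bsub>M\<^esub> m \<in> H k"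
  shows "\<exists>n. \<exists>u\<in>ideal_pow R J n. u \<odot>\<^bsub>M\<^esub> m \<notin> H n \<and> (\<forall>a\<in>J. a \<odot>\<^bsub>M\<^esub> (u \<odot>\<^bsub>M\<^esub> m) \<in> H (Suc n))"
proof -
  have ic: "a \<in> carrier R" if "a \<in> ideal_pow R J n" for a n
    using ideal.Icarr[OF R.ideal_pow_ideal[OF J] that] .
  define Q where "Q n \<longleftrightarrow> (\<forall>a\<in>ideal_pow R J n. a \<odot>\<^bsub>M\<^esub> m \<in> H n)" for n
  have "Q k" using k by (simp add: Q_def)
  have "\<not> Q 0"
  proof
    assume "Q 0"
    then have "\<one> \<odot>\<^bsub>M\<^esub> m \<in> H 0" unfolding Q_def R.ideal_pow_0 by blast
    then show False using m by simp
  qed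
  have "\<exists>n. \<not> Q n \<and> Q (Suc n)"
  proof (rule ccontr)
    assume no: "\<nexists>n. \<not> Q n \<and> Q (Suc n)"
    have "\<not> Q n" for n by (induction n) (use \<open>\<not> Q 0\<close> no in auto)
    then show False using \<open>Q k\<close> by blast
  qed
  then obtain n where n: "\<not> Q n" "Q (Suc n)" by blast
  then obtain u where u: "u \<in> ideal_pow R J n" "u \<odot>\<^bsub>M\<^esub> m \<notin> H n" by (auto simp: Q_def)
  have "a \<odot>\<^bsub>M\<^esub> (u \<odot>\<^bsub>M\<^esub> m) \<in> H (Suc n)" if a: "a \<in> J" for a
  proof -
    have "u \<otimes> a \<in> ideal_pow R J (Suc n)" unfolding R.ideal_pow_Suc using u(1) a by (rule ideal_prod.prod)
    then have "(u \<otimes> a) \<odot>\<^bsub>M\<^esub> m \<in> H (Suc n)" using n(2) unfolding Q_def by blast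
    then show ?thesis using ic[OF u(1)] ideal.Icarr[OF J a] m(1) by (simp add: smult_assoc1[symmetric] R.m_comm)
  qed
  then show ?thesis using u by blast
qed

lemma gens_smult_iff:
  assumes H: "submodule H R M" and f: "f \<in> carrier M" and a: "\<aa> = Idl (set zs)" "set zs \<subseteq> carrier R"
  shows "(\<forall>z\<in>set zs. z \<odot>\<^bsub>M\<^esub> f \<in> H) \<longleftrightarrow> (\<forall>p\<in>\<aa>. p \<odot>\<^bsub>M\<^esub> f \<in> H)"
proof
  assume z: "\<forall>z\<in>set zs. z \<odot>\<^bsub>M\<^esub> f \<in> H"
  have "ideal {p \<in> carrier R. p \<odot>\<^bsub>M\<^esub> f \<in> H} R"
  proof (rule idealI[OF R.ring_axioms])
    show "subgroup {p \<in> carrier R. p \<odot>\<^bsub>M\<^esub> f \<in> H} (add_monoid R)"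
    proof (rule R.add.subgroupI)
      have "\<zero> \<in> {p \<in> carrier R. p \<odot>\<^bsub>M\<^esub> f \<in> H}" using f submodule_zero[OF H] by simp
      then show "{p \<in> carrier R. p \<odot>\<^bsub>M\<^esub> f \<in> H} \<noteq> {}" by blast
    qed (use f submoduleE(3,5)[OF H] in \<open>auto simp: smult_l_minus smult_l_distr\<close>)
    fix p x assume p: "p \<in> {p \<in> carrier R. p \<odot>\<^bsub>M\<^esub> f \<in> H}" and x: "x \<in> carrier R"
    then show "x \<otimes> p \<in> {p \<in> carrier R. p \<odot>\<^bsub>M\<^esub> f \<in> H}"
      using f submoduleE(4)[OF H x] by (simp add: smult_assoc1)
    then show "p \<otimes> x \<in> {p \<in> carrier R. p \<odot>\<^bsub>M\<^esub> f \<in> H}" using p x by (simp add: R.m_comm)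
  qed
  moreover have "set zs \<subseteq> {p \<in> carrier R. p \<odot>\<^bsub>M\<^esub> f \<in> H}" using z a(2) by blast
  ultimately have "\<aa> \<subseteq> {p \<in> carrier R. p \<odot>\<^bsub>M\<^esub> f \<in> H}" unfolding a(1) by (rule R.genideal_minimal)
  then show "\<forall>p\<in>\<aa>. p \<odot>\<^bsub>M\<^esub> f \<in> H" by blast
next
  assume "\<forall>p\<in>\<aa>. p \<odot>\<^bsub>M\<^esub> f \<in> H"
  then show "\<forall>z\<in>set zs. z \<odot>\<^bsub>M\<^esub> f \<in> H" using R.genideal_self[OF a(2)] unfolding a(1) by blast
qed

lemma ideal_times_insert:
  assumes S: "S \<subseteq> carrier R" and x: "x \<in> carrier R"
  shows "ideal_times R (Idl (insert x S)) M = msum (ideal_times R (Idl S) M) ((\<lambda>m. x \<odot>\<^bsub>M\<^esub> m) ` carrier M)"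
proof -
  have IS: "ideal (Idl S) R" by (rule R.genideal_ideal[OF S])
  have ixS: "insert x S \<subseteq> carrier R" using S x by blast
  have IxS: "ideal (Idl (insert x S)) R" by (rule R.genideal_ideal[OF ixS])
  have c: "Idl S \<subseteq> carrier R" "Idl (insert x S) \<subseteq> carrier R" using ideal.Icarr[OF IS] ideal.Icarr[OF IxS] by blast+
  have sub: "Idl S \<subseteq> Idl (insert x S)" using R.genideal_minimal[OF IxS] R.genideal_self[OF ixS] by blast
  have xin: "x \<in> Idl (insert x S)" using R.genideal_self[OF ixS] by blast
  have xM: "submodule ((\<lambda>m. x \<odot>\<^bsub>M\<^esub> m) ` carrier M) R M"
  proof (rule submoduleI')
    show "\<zero>\<^bsub>M\<^esub> \<in> (\<lambda>m. x \<odot>\<^bsub>M\<^esub> m) ` carrier M" using x by (intro image_eqI[of _ _ "\<zero>\<^bsub>M\<^esub>"]) auto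
    fix a assume "a \<in> (\<lambda>m. x \<odot>\<^bsub>M\<^esub> m) ` carrier M"
    then obtain m where m: "m \<in> carrier M" "a = x \<odot>\<^bsub>M\<^esub> m" by blast
    show "r \<odot>\<^bsub>M\<^esub> a \<in> (\<lambda>m. x \<odot>\<^bsub>M\<^esub> m) ` carrier M" if "r \<in> carrier R" for r
      using m x that by (intro image_eqI[of _ _ "r \<odot>\<^bsub>M\<^esub> m"]) (auto simp: smult_assoc1[symmetric] R.m_comm)
    fix b assume "b \<in> (\<lambda>m. x \<odot>\<^bsub>M\<^esub> m) ` carrier M"
    then obtain m' where m': "m' \<in> carrier M" "b = x \<odot>\<^bsub>M\<^esub> m'" by blast
    show "a \<oplus>\<^bsub>M\<^esub> b \<in> (\<lambda>m. x \<odot>\<^bsub>M\<^esub> m) ` carrier M"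
      using m m' x by (intro image_eqI[of _ _ "m \<oplus>\<^bsub>M\<^esub> m'"]) (auto simp: smult_r_distr)
  qed (use x in auto)
  show ?thesis
  proof (rule antisym)
    show "ideal_times R (Idl (insert x S)) M \<subseteq> msum (ideal_times R (Idl S) M) ((\<lambda>m. x \<odot>\<^bsub>M\<^esub> m) ` carrier M)"
    proof (rule ideal_times_min[OF msum_sub[OF ideal_times_sub[OF c(1)] xM]])
      fix a m assume a: "a \<in> Idl (insert x S)" and m: "m \<in> carrier M"
      have "Idl (insert x S) \<subseteq> Idl S <+> PIdl x"
        using R.genideal_minimal[OF R.add_cgenideal_sup(3)[OF IS x]] R.add_cgenideal_sup(1,2)[OF IS x] R.genideal_self[OF S] by blast
      then have "a \<in> Idl S <+> PIdl x" using a by blast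
      then obtain i r where i: "i \<in> Idl S" "r \<in> carrier R" "a = i \<oplus> x \<otimes> r"
        unfolding R.mem_add_cgenideal[OF IS x] by blast
      have "i \<in> carrier R" using i(1) c by blast
      then show "a \<odot>\<^bsub>M\<^esub> m \<in> msum (ideal_times R (Idl S) M) ((\<lambda>m. x \<odot>\<^bsub>M\<^esub> m) ` carrier M)"
        using i m x ideal_times_mem[OF i(1) m]
        by (intro msumI[of "i \<odot>\<^bsub>M\<^esub> m" _ "x \<odot>\<^bsub>M\<^esub> (r \<odot>\<^bsub>M\<^esub> m)"]) (auto simp: smult_l_distr smult_assoc1)
    qed
    show "msum (ideal_times R (Idl S) M) ((\<lambda>m. x \<odot>\<^bsub>M\<^esub> m) ` carrier M) \<subseteq> ideal_times R (Idl (insert x S)) M"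
      using ideal_times_mono[OF sub c(2)] ideal_times_mem[OF xin] by (intro msum_min ideal_times_sub c) auto
  qed
qed

end

locale rees_rr = rr_module R M I for R (structure) and M (structure) and I
begin

sublocale RE: rees R I
  by (intro rees.intro rees_axioms.intro R.is_cring I)

abbreviation "RA \<equiv> rees_algebra R I"
abbreviation "PM \<equiv> poly_module M"

sublocale PM: module RA PM by (rule RE.poly_module_module[OF module_axioms])

definition "gr H = {f \<in> up M. \<forall>n. f n \<in> H (n::nat)}"

lemma gr_sub:
  assumes H: "\<And>n. submodule (H n) R M"
    and sm: "\<And>j n b x. b \<in> ideal_pow R I j \<Longrightarrow> x \<in> H n \<Longrightarrow> b \<odot>\<^bsub>M\<^esub> x \<in> H (n + j)"
  shows "submodule (gr H) RA PM"
proof (rule PM.submoduleI')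
  show "gr H \<subseteq> carrier PM" by (auto simp: gr_def poly_module_simps)
  show "\<zero>\<^bsub>PM\<^esub> \<in> gr H" using PM.zero_closed submodule_zero[OF H] by (simp add: gr_def poly_module_simps)
  show "f \<oplus>\<^bsub>PM\<^esub> g \<in> gr H" if "f \<in> gr H" "g \<in> gr H" for f g
    using that PM.a_closed[of f g] submoduleE(5)[OF H] by (simp add: gr_def poly_module_simps)
  show "p \<odot>\<^bsub>PM\<^esub> f \<in> gr H" if p: "p \<in> carrier RA" and f: "f \<in> gr H" for p f
  proof -
    have "(\<Oplus>\<^bsub>M\<^esub>i\<in>{..n}. p i \<odot>\<^bsub>M\<^esub> f (n - i)) \<in> H n" for n
    proof (rule finsum_in_submodule[OF H])
      fix i assume "i \<in> {..n}"
      then show "p i \<odot>\<^bsub>M\<^esub> f (n - i) \<in> H n"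
        using sm[of "p i" i "f (n - i)" "n - i"] p f by (simp add: RE.rees_carrier gr_def)
    qed
    then show ?thesis using PM.smult_closed[OF p, of f] f by (simp add: gr_def poly_module_simps)
  qed
qed

text \<open>\<open>D\<^sub>j\<close> is \<open>PM\<close> modulo \<open>PN W\<close> for \<open>W = (x\<^sub>1, \<dots>, x\<^sub>j)M\<close>; the module \<open>L\<^sup>I(M)\<close> is \<open>PM\<close> modulo \<open>NL\<close> below.\<close>

definition "PN W = gr (\<lambda>n. N W (Suc n))"

lemma PN_sub: "submodule W R M \<Longrightarrow> submodule (PN W) RA PM"
  unfolding PN_def by (rule gr_sub[OF N_sub]) (use N_smult in force)+

definition "NL = gr (\<lambda>n. IM (Suc n))"

lemma NL_sub: "submodule NL RA PM"
  unfolding NL_def by (rule gr_sub[OF IM_sub]) (use IM_smult in force)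

lemma L_eq: "L_module R I M = module_quot PM NL"
  by (simp add: L_module_def NL_def gr_def IM_def poly_module_simps)

lemma mon_smult: "a \<in> carrier R \<Longrightarrow> f \<in> up M \<Longrightarrow>
    RE.mon a k \<odot>\<^bsub>PM\<^esub> f = (\<lambda>n. if k \<le> n then a \<odot>\<^bsub>M\<^esub> f (n - k) else \<zero>\<^bsub>M\<^esub>)"
  by (rule RE.mon_smult[OF module_axioms])

lemma single_up: "m \<in> carrier M \<Longrightarrow> (\<lambda>i. if i = k then m else \<zero>\<^bsub>M\<^esub>) \<in> up M"
  by (auto simp: up_iff)

end

text \<open>The exponent \<open>c\<close> is how the finite length of \<open>M / IM\<close> enters:
  a power of \<mm> maps \<open>M\<close> into \<open>IM\<close>. It makes the degree zero part of
  the maximal ideal act nilpotently on each \<open>M / I\<^sup>nM\<close>.\<close>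

locale rees_rr_local = rees_rr R M I for R (structure) and M (structure) and I +
  fixes \<mm> :: "'a set" and c :: nat
  assumes mm: "ideal \<mm> R" and noeth: "noetherian_ring R"
    and c: "\<And>a x. a \<in> ideal_pow R \<mm> c \<Longrightarrow> x \<in> carrier M \<Longrightarrow> a \<odot>\<^bsub>M\<^esub> x \<in> IM 1"
begin

sublocale mm: rr_module R M \<mm>
  by (intro rr_module.intro rr_module_axioms.intro module_axioms mm)

abbreviation "MM \<equiv> rees_max_ideal R \<mm> I"

lemma MM_iff: "p \<in> MM \<longleftrightarrow> p \<in> carrier RA \<and> p 0 \<in> \<mm>"
  by (simp add: rees_max_ideal_def)

lemma MM_ideal: "ideal MM RA"
proof (rule idealI[OF RE.RA.ring_axioms])
  interpret m: ideal \<mm> R by (rule mm)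
  have pc: "p n \<in> carrier R" if "p \<in> carrier RA" for p n using that by (auto simp: RE.rees_carrier RE.up_iff)
  show "subgroup MM (add_monoid RA)"
  proof (rule RE.RA.add.subgroupI)
    have "\<zero>\<^bsub>RA\<^esub> \<in> MM" using RE.RA.zero_closed by (simp add: MM_iff RE.rees_zero)
    then show "MM \<noteq> {}" by blast
    fix p assume p: "p \<in> MM"
    have "(\<ominus>\<^bsub>RA\<^esub> p \<oplus>\<^bsub>RA\<^esub> p) 0 = \<zero>" using p RE.RA.l_neg[of p] by (simp add: MM_iff RE.rees_zero)
    then have 0: "(\<ominus>\<^bsub>RA\<^esub> p) 0 \<oplus> p 0 = \<zero>" using p RE.RA.a_inv_closed[of p] by (simp add: MM_iff RE.rees_add RE.rees_up)
    have pR: "p \<in> carrier RA" using p by (simp add: MM_iff)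
    have "(\<ominus>\<^bsub>RA\<^esub> p) 0 = \<ominus> p 0"
      using R.minus_equality[OF 0] pc[OF pR, of 0] pc[OF RE.RA.a_inv_closed[OF pR], of 0] by simp
    then show "\<ominus>\<^bsub>RA\<^esub> p \<in> MM" using p by (simp add: MM_iff)
    show "p \<oplus>\<^bsub>RA\<^esub> q \<in> MM" if "q \<in> MM" for q
      using p that RE.RA.a_closed[of p q] by (simp add: MM_iff RE.rees_add RE.rees_up)
  qed (auto simp: MM_iff)
  fix p x assume p: "p \<in> MM" and x: "x \<in> carrier RA"
  have "(x \<otimes>\<^bsub>RA\<^esub> p) 0 = x 0 \<otimes> p 0"
    using p x pc by (simp add: MM_iff RE.rees_mult RE.rees_up)
  then show "x \<otimes>\<^bsub>RA\<^esub> p \<in> MM" using p x pc m.I_l_closed by (simp add: MM_iff)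
  then show "p \<otimes>\<^bsub>RA\<^esub> x \<in> MM" using p x by (simp add: MM_iff RE.RA.m_comm)
qed

lemma mon_MM: "a \<in> I \<Longrightarrow> RE.mon a 1 \<in> MM"
  using RE.mon_carrier[of a 1] R.ideal_pow_1[OF I] additive_subgroup.zero_closed[OF ideal.axioms(1)[OF mm]]
  by (simp add: MM_iff RE.mon_def)

text \<open>Every block of \<open>c\<close> factors from \<mm> yields one factor from
  \<open>I\<close>.\<close>

lemma mm_pow_smult: "a \<in> ideal_pow R \<mm> (c * n) \<Longrightarrow> x \<in> carrier M \<Longrightarrow> a \<odot>\<^bsub>M\<^esub> x \<in> IM n"
proof (induction n arbitrary: a x)
  case 0 then show ?case by (simp add: IM_0 ideals_one)
next
  case (Suc n)
  show ?case
  proof (rule mm.ideal_pow_gen_smult[OF IM_sub Suc.prems(2)])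
    show "a \<in> ideal_pow R \<mm> (c + c * n)" using Suc.prems(1) by simp
    fix b e assume b: "b \<in> ideal_pow R \<mm> c" and e: "e \<in> ideal_pow R \<mm> (c * n)"
    have "IM n \<subseteq> {y \<in> carrier M. b \<odot>\<^bsub>M\<^esub> y \<in> IM (Suc n)}"
      unfolding IM_def[of n]
    proof (rule ideal_times_min[OF smult_preimage[OF IM_sub mm.ipc[OF b]]])
      fix a' y assume a': "a' \<in> ideal_pow R I n" and y: "y \<in> carrier M"
      have "a' \<odot>\<^bsub>M\<^esub> (b \<odot>\<^bsub>M\<^esub> y) \<in> IM (1 + n)" by (rule IM_smult[OF a' c[OF b y]])
      then show "a' \<odot>\<^bsub>M\<^esub> y \<in> {y \<in> carrier M. b \<odot>\<^bsub>M\<^esub> y \<in> IM (Suc n)}"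
        using ipc[OF a'] mm.ipc[OF b] y by (simp add: smult_assoc1[symmetric] R.m_comm)
    qed
    then show "b \<odot>\<^bsub>M\<^esub> (e \<odot>\<^bsub>M\<^esub> x) \<in> IM (Suc n)" using Suc.IH[OF e Suc.prems(2)] by blast
  qed
qed

text \<open>Good behaviour in terms of \<open>M\<close>: the filtration of \<open>M / W\<close>
  lifts to that of \<open>M\<close>. The opposite inclusion is \<open>N_V\<close>.\<close>

definition "rr_lifts W \<longleftrightarrow> (\<forall>n\<ge>1. V W n \<subseteq> N W n)"

text \<open>If the filtrations agree and \<open>f\<close> is killed by all \<open>a t\<close> with
  \<open>a\<close> in \<open>I\<close>, then \<open>I\<close> multiplies each coefficient of
  \<open>f\<close> into \<open>V\<close> two degrees up, and \<open>V_colon\<close> puts the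
  coefficient into \<open>V\<close> one degree up. Conversely, an element of \<open>V\<close>
  outside \<open>N\<close> is multiplied into the socle, first with respect to \<open>I\<close> and
  then with respect to \<mm>.\<close>

lemma socle_iff_rr_lifts:
  assumes W: "submodule W R M"
  shows "(\<forall>f\<in>up M. (\<forall>p\<in>MM. p \<odot>\<^bsub>PM\<^esub> f \<in> PN W) \<longrightarrow> f \<in> PN W) \<longleftrightarrow> rr_lifts W"
proof
  assume rr_lifts: "rr_lifts W"
  show "\<forall>f\<in>up M. (\<forall>p\<in>MM. p \<odot>\<^bsub>PM\<^esub> f \<in> PN W) \<longrightarrow> f \<in> PN W"
  proof (intro ballI impI)
    fix f assume f: "f \<in> up M" and pf: "\<forall>p\<in>MM. p \<odot>\<^bsub>PM\<^esub> f \<in> PN W"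
    have "f n \<in> N W (Suc n)" for n
    proof -
      have "a \<odot>\<^bsub>M\<^esub> f n \<in> V W (Suc (Suc n))" if a: "a \<in> I" for a
      proof -
        have aR: "a \<in> carrier R" using ideal.Icarr[OF I a] .
        have "RE.mon a 1 \<odot>\<^bsub>PM\<^esub> f \<in> PN W" using pf mon_MM[OF a] by blast
        then have "(RE.mon a 1 \<odot>\<^bsub>PM\<^esub> f) (Suc n) \<in> N W (Suc (Suc n))" unfolding PN_def gr_def by blast
        then show ?thesis using N_V[OF W] mon_smult[OF aR f, of 1] by auto
      qed
      moreover have "f n \<in> carrier M" using f by (simp add: up_iff)
      ultimately have "f n \<in> V W (Suc n)" using V_colon[OF W noeth] by blast
      then show ?thesis using rr_lifts by (auto simp: rr_lifts_def)
    qed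
    then show "f \<in> PN W" using f by (simp add: PN_def gr_def)
  qed
next
  assume tf: "\<forall>f\<in>up M. (\<forall>p\<in>MM. p \<odot>\<^bsub>PM\<^esub> f \<in> PN W) \<longrightarrow> f \<in> PN W"
  show "rr_lifts W" unfolding rr_lifts_def
  proof (intro allI impI subsetI, rule ccontr)
    fix n m assume n: "1 \<le> n" and m: "m \<in> V W n" and mN: "m \<notin> N W n"
    obtain k where k: "m \<in> carrier M" "\<forall>a\<in>ideal_pow R I k. a \<odot>\<^bsub>M\<^esub> m \<in> msum (IM (n + k)) W" using VE[OF m] .
    have "msum (IM (n + k)) W \<subseteq> N W (n + k)" by (rule msum_min[OF N_sub[OF W] IM_sub IM_N[OF W] W_N[OF W]])
    then have "\<And>a. a \<in> ideal_pow R I k \<Longrightarrow> a \<odot>\<^bsub>M\<^esub> m \<in> N W (n + k)" using k(2) by blast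
    moreover have "m \<notin> N W (n + 0)" using mN by simp
    ultimately obtain j u where u: "u \<in> ideal_pow R I j" "u \<odot>\<^bsub>M\<^esub> m \<notin> N W (n + j)"
      "\<forall>a\<in>I. a \<odot>\<^bsub>M\<^esub> (u \<odot>\<^bsub>M\<^esub> m) \<in> N W (n + Suc j)"
      using pow_socle[OF I k(1), of "\<lambda>j. N W (n + j)" k] by blast
    define m1 where "m1 = u \<odot>\<^bsub>M\<^esub> m"
    define n1 where "n1 = n + j"
    have m1: "m1 \<in> carrier M" using k(1) ipc[OF u(1)] by (simp add: m1_def)
    \<comment> \<open>Elements of \<mm> have degree zero in the Rees algebra, so the family is
      constant this time. The exponent \<open>c * n1\<close> works because it carries
      \<open>M\<close> into \<open>IM n1\<close>, which is contained in
      \<open>N W n1\<close>.\<close>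
    have "\<exists>j'. \<exists>u'\<in>ideal_pow R \<mm> j'. u' \<odot>\<^bsub>M\<^esub> m1 \<notin> N W n1 \<and> (\<forall>a\<in>\<mm>. a \<odot>\<^bsub>M\<^esub> (u' \<odot>\<^bsub>M\<^esub> m1) \<in> N W n1)"
    proof (rule pow_socle[OF mm m1, of "\<lambda>_. N W n1" "c * n1"])
      show "m1 \<notin> N W n1" using u(2) by (simp add: m1_def n1_def)
      show "a \<odot>\<^bsub>M\<^esub> m1 \<in> N W n1" if "a \<in> ideal_pow R \<mm> (c * n1)" for a
        using mm_pow_smult[OF that m1] IM_N[OF W] by blast
    qed
    then obtain j' u' where u': "u' \<in> ideal_pow R \<mm> j'" "u' \<odot>\<^bsub>M\<^esub> m1 \<notin> N W n1"
      "\<forall>a\<in>\<mm>. a \<odot>\<^bsub>M\<^esub> (u' \<odot>\<^bsub>M\<^esub> m1) \<in> N W n1" by blast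
    define m2 where "m2 = u' \<odot>\<^bsub>M\<^esub> m1"
    have m2: "m2 \<in> carrier M" using m1 mm.ipc[OF u'(1)] by (simp add: m2_def)
    have Im2: "a \<odot>\<^bsub>M\<^esub> m2 \<in> N W (Suc n1)" if a: "a \<in> I" for a
    proof -
      have aR: "a \<in> carrier R" using ideal.Icarr[OF I a] .
      have "u' \<odot>\<^bsub>M\<^esub> (a \<odot>\<^bsub>M\<^esub> m1) \<in> N W (Suc n1)"
        using u(3) a submoduleE(4)[OF N_sub[OF W] mm.ipc[OF u'(1)]] by (simp add: m1_def n1_def)
      then show ?thesis using aR m1 mm.ipc[OF u'(1)] by (simp add: m2_def smult_assoc1[symmetric] R.m_comm)
    qed
    \<comment> \<open>The degree \<open>n1 - 1\<close> is the one in which \<open>PN W\<close> has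
      the component \<open>N W n1\<close>; the difference is a true one since \<open>n1\<close> is
      positive.\<close>
    define f where "f i = (if i = n1 - 1 then m2 else \<zero>\<^bsub>M\<^esub>)" for i
    have f: "f \<in> up M" using single_up[OF m2] by (simp add: f_def[abs_def])
    have n1: "1 \<le> n1" using n by (simp add: n1_def)
    have "p \<odot>\<^bsub>PM\<^esub> f \<in> PN W" if p: "p \<in> MM" for p
    proof -
      have pR: "p \<in> carrier RA" using p by (simp add: MM_iff)
      have pI: "p i \<in> ideal_pow R I i" for i using pR by (simp add: RE.rees_carrier)
      have "p i \<odot>\<^bsub>M\<^esub> f (l - i) \<in> N W (Suc l)" if i: "i \<le> l" for i l
      proof (cases "l - i = n1 - 1")
        case False
        then show ?thesis using ipc[OF pI] submodule_zero[OF N_sub[OF W]] by (simp add: f_def)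
      next
        case True
        then have l: "Suc l = n1 + i" using i n1 by simp
        have "p i \<odot>\<^bsub>M\<^esub> m2 \<in> N W (n1 + i)"
        proof (cases i)
          case 0
          then show ?thesis using p u'(3) by (simp add: MM_iff m2_def)
        next
          \<comment> \<open>In positive degree \<open>p i\<close> is a sum of products with one
            factor in \<open>I\<close>, which already moves \<open>m2\<close> into \<open>N\<close>;
            the other factors only shift the degree.\<close>
          case (Suc i')
          show ?thesis
          proof (rule ideal_pow_gen_smult[OF N_sub[OF W] m2])
            show "p i \<in> ideal_pow R I (i' + 1)" using pI[of i] Suc by simp
            fix b e assume b: "b \<in> ideal_pow R I i'" and e: "e \<in> ideal_pow R I 1"
            have "e \<in> I" using e R.ideal_pow_1[OF I] by simp
            then have "b \<odot>\<^bsub>M\<^esub> (e \<odot>\<^bsub>M\<^esub> m2) \<in> N W (Suc n1 + i')" by (rule N_smult[OF W b Im2])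
            then show "b \<odot>\<^bsub>M\<^esub> (e \<odot>\<^bsub>M\<^esub> m2) \<in> N W (n1 + i)" using Suc by simp
          qed
        qed
        then show ?thesis using True l by (simp add: f_def)
      qed
      then have "(\<Oplus>\<^bsub>M\<^esub>i\<in>{..l}. p i \<odot>\<^bsub>M\<^esub> f (l - i)) \<in> N W (Suc l)" for l
        by (intro finsum_in_submodule[OF N_sub[OF W]]) simp
      then show ?thesis using PM.smult_closed[OF pR, of f] f by (simp add: PN_def gr_def poly_module_simps)
    qed
    then have "f \<in> PN W" using tf f by blast
    then have "f (n1 - 1) \<in> N W (Suc (n1 - 1))" unfolding PN_def gr_def by blast
    then show False using n1 u'(2) by (simp add: f_def m2_def)
  qed
qed

lemma mon_MM_pow: "a \<in> ideal_pow R I k \<Longrightarrow> RE.mon a k \<in> ideal_pow RA MM k"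
proof (induction k arbitrary: a)
  case 0 then show ?case using RE.mon_carrier[of a 0] unfolding RE.RA.ideal_pow_0 by simp
next
  case (Suc k)
  from Suc.prems have "a \<in> ideal_pow R I k \<cdot> I" unfolding R.ideal_pow_Suc .
  then show ?case
  proof (induction a rule: ideal_prod.induct)
    case (prod b e)
    have "RE.mon (b \<otimes> e) (Suc k) = RE.mon b k \<otimes>\<^bsub>RA\<^esub> RE.mon e 1"
      using RE.mon_mult[OF ipc[OF prod(1)] ideal.Icarr[OF I prod(2)], of k 1] by simp
    then show ?case unfolding RE.RA.ideal_pow_Suc
      using Suc.IH[OF prod(1)] mon_MM[OF prod(2)] by (simp add: ideal_prod.prod)
  next
    case (sum s t)
    have "s \<in> carrier R" "t \<in> carrier R"
      using sum R.ideal_prod_in_carrier[OF R.ideal_pow_ideal[OF I] I] by blast+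
    then have "RE.mon (s \<oplus> t) (Suc k) = RE.mon s (Suc k) \<oplus>\<^bsub>RA\<^esub> RE.mon t (Suc k)" by (simp add: RE.mon_add)
    then show ?case
      using additive_subgroup.a_closed[OF ideal.axioms(1)[OF RE.RA.ideal_pow_ideal[OF MM_ideal]] sum(3,4)] by metis
  qed
qed

text \<open>In a product of \<open>K\<close> factors at most \<open>i\<close> of them can contribute
  a positive power of \<open>t\<close> to the coefficient of degree \<open>i\<close>; the other
  \<open>K - i\<close> contribute their constant terms, which lie in \<mm>.\<close>

lemma MM_pow_coeff: "p \<in> ideal_pow RA MM K \<Longrightarrow> p i \<in> ideal_pow R \<mm> (K - i)"
proof (induction K arbitrary: p i)
  case 0
  then have "p \<in> carrier RA" using RE.RA.ideal_pow_0 by blast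
  then show ?case by (simp add: ideals_one RE.rees_carrier RE.up_iff)
next
  case (Suc K)
  have id: "ideal (ideal_pow R \<mm> n) R" for n by (rule R.ideal_pow_ideal[OF mm])
  from Suc.prems have "p \<in> ideal_pow RA MM K \<cdot>\<^bsub>RA\<^esub> MM" unfolding RE.RA.ideal_pow_Suc .
  then show ?case
  proof (induction p arbitrary: i rule: ideal_prod.induct)
    case (prod q r)
    have qR: "q \<in> carrier RA" using ideal.Icarr[OF RE.RA.ideal_pow_ideal[OF MM_ideal] prod(1)] .
    have rR: "r \<in> carrier RA" and r0: "r 0 \<in> \<mm>" using prod(2) by (auto simp: MM_iff)
    have rc: "r j \<in> carrier R" for j using rR by (auto simp: RE.rees_carrier RE.up_iff)
    have "q j \<otimes> r (i - j) \<in> ideal_pow R \<mm> (Suc K - i)" if "j \<le> i" for j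
    proof (cases "j = i")
      case True
      have "q i \<otimes> r 0 \<in> ideal_pow R \<mm> (Suc (K - i))"
        unfolding R.ideal_pow_Suc using Suc.IH[OF prod(1)] r0 by (rule ideal_prod.prod)
      moreover have "Suc K - i \<le> Suc (K - i)" by simp
      ultimately have "q i \<otimes> r 0 \<in> ideal_pow R \<mm> (Suc K - i)"
        using R.ideal_pow_antimono[OF mm] by blast
      then show ?thesis using True by simp
    next
      case False
      have "q j \<otimes> r (i - j) \<in> ideal_pow R \<mm> (K - j)"
        using ideal.I_r_closed[OF id Suc.IH[OF prod(1)] rc] .
      moreover have "Suc K - i \<le> K - j" using False that by simp
      ultimately show ?thesis using R.ideal_pow_antimono[OF mm] by blast
    qed
    then have "(\<Oplus>j\<in>{..i}. q j \<otimes> r (i - j)) \<in> ideal_pow R \<mm> (Suc K - i)"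
      by (intro ideal.finsum_in_ideal[OF id]) simp
    then show ?case using qR rR by (simp add: RE.rees_mult RE.rees_up)
  next
    case (sum q r)
    have "q \<in> carrier RA" "r \<in> carrier RA"
      using sum RE.RA.ideal_prod_in_carrier[OF RE.RA.ideal_pow_ideal[OF MM_ideal] MM_ideal] by blast+
    then show ?case using sum additive_subgroup.a_closed[OF ideal.axioms(1)[OF id]]
      by (simp add: RE.rees_add RE.rees_up)
  qed
qed

text \<open>Testing with monomials \<open>a t\<^sup>K\<close> gives the Ratliff-Rush condition. In
  the other direction, the coefficients of \<open>p\<close> of degree at least \<open>k\<close> are
  handled by that condition, and those of lower degree by their high \<mm>-adic order.\<close>

lemma torsion_L_iff:
  assumes f: "f \<in> up M"
  shows "(\<exists>K. \<forall>p\<in>ideal_pow RA MM K. p \<odot>\<^bsub>PM\<^esub> f \<in> NL) \<longleftrightarrow> f \<in> PN {\<zero>\<^bsub>M\<^esub>}"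
proof -
  have N0: "N {\<zero>\<^bsub>M\<^esub>} n = rr n" for n unfolding N_def by (rule msum_zero[OF rr_sub])
  have fc: "f n \<in> carrier M" for n using f by (auto simp: up_iff)
  show ?thesis
  proof
    assume "\<exists>K. \<forall>p\<in>ideal_pow RA MM K. p \<odot>\<^bsub>PM\<^esub> f \<in> NL"
    then obtain K where K: "\<And>p. p \<in> ideal_pow RA MM K \<Longrightarrow> p \<odot>\<^bsub>PM\<^esub> f \<in> NL" by blast
    have "f n \<in> rr (Suc n)" for n
      unfolding rr_def
    proof (rule VI[OF zero_submodule fc, of K])
      fix a assume a: "a \<in> ideal_pow R I K"
      have "(RE.mon a K \<odot>\<^bsub>PM\<^esub> f) (n + K) \<in> IM (Suc (n + K))"
        using K[OF mon_MM_pow[OF a]] unfolding NL_def gr_def by blast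
      then show "a \<odot>\<^bsub>M\<^esub> f n \<in> msum (IM (Suc n + K)) {\<zero>\<^bsub>M\<^esub>}"
        unfolding msum_zero[OF IM_sub] using mon_smult[OF ipc[OF a] f, of K] by simp
    qed
    then show "f \<in> PN {\<zero>\<^bsub>M\<^esub>}" using f by (simp add: PN_def gr_def N0)
  next
    assume fN: "f \<in> PN {\<zero>\<^bsub>M\<^esub>}"
    obtain D where D: "\<And>n. D < n \<Longrightarrow> f n = \<zero>\<^bsub>M\<^esub>" using f by (auto simp: up_iff)
    define kf where "kf n = (SOME k. \<forall>a\<in>ideal_pow R I k. a \<odot>\<^bsub>M\<^esub> f n \<in> msum (IM (Suc n + k)) {\<zero>\<^bsub>M\<^esub>})" for n
    have kf: "\<forall>a\<in>ideal_pow R I (kf n). a \<odot>\<^bsub>M\<^esub> f n \<in> msum (IM (Suc n + kf n)) {\<zero>\<^bsub>M\<^esub>}" for n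
    proof -
      have "f n \<in> V {\<zero>\<^bsub>M\<^esub>} (Suc n)" using fN by (simp add: PN_def gr_def N0 rr_def)
      then have "\<exists>k. \<forall>a\<in>ideal_pow R I k. a \<odot>\<^bsub>M\<^esub> f n \<in> msum (IM (Suc n + k)) {\<zero>\<^bsub>M\<^esub>}"
        unfolding V_def by blast
      then show ?thesis unfolding kf_def by (rule someI_ex)
    qed
    \<comment> \<open>A polynomial has finitely many coefficients, so one Ratliff-Rush exponent
      serves for all of them.\<close>
    define k where "k = Max (kf ` {..D})"
    have k: "a \<odot>\<^bsub>M\<^esub> f n \<in> IM (Suc n + k)" if n: "n \<le> D" and a: "a \<in> ideal_pow R I k" for n a
    proof -
      have "kf n \<le> k" unfolding k_def using n by (intro Max_ge) auto
      from V_exp_mono[OF zero_submodule fc kf this] a show ?thesis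
        unfolding msum_zero[OF IM_sub] by blast
    qed
    \<comment> \<open>Coefficients \<open>p i\<close> with \<open>i < k\<close> lie in
      \<open>\<mm>\<^sup>C\<close> and so map \<open>M\<close> into \<open>IM (D + k + 1)\<close>.
      This is deep enough, since a nonzero \<open>f (n - i)\<close> forces
      \<open>n \<le> D + i < D + k\<close>.\<close>
    define C where "C = c * (D + k + 1)"
    have "p \<odot>\<^bsub>PM\<^esub> f \<in> NL" if p: "p \<in> ideal_pow RA MM (k + C)" for p
    proof -
      have pR: "p \<in> carrier RA" using ideal.Icarr[OF RE.RA.ideal_pow_ideal[OF MM_ideal] p] .
      have pI: "p i \<in> ideal_pow R I i" for i using pR by (simp add: RE.rees_carrier)
      have "p i \<odot>\<^bsub>M\<^esub> f (n - i) \<in> IM (Suc n)" if i: "i \<le> n" for i n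
      proof (cases "n - i \<le> D")
        case False
        then show ?thesis using D ipc[OF pI] submodule_zero[OF IM_sub] by simp
      next
        case nD: True
        show ?thesis
        proof (cases "k \<le> i")
          case True
          show ?thesis
          proof (rule ideal_pow_gen_smult[OF IM_sub fc])
            show "p i \<in> ideal_pow R I ((i - k) + k)" using pI[of i] True by simp
            fix b e assume b: "b \<in> ideal_pow R I (i - k)" and e: "e \<in> ideal_pow R I k"
            have "b \<odot>\<^bsub>M\<^esub> (e \<odot>\<^bsub>M\<^esub> f (n - i)) \<in> IM (Suc (n - i) + k + (i - k))"
              by (rule IM_smult[OF b k[OF nD e]])
            then show "b \<odot>\<^bsub>M\<^esub> (e \<odot>\<^bsub>M\<^esub> f (n - i)) \<in> IM (Suc n)" using True i by simp
          qed
        next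
          case False
          have "p i \<in> ideal_pow R \<mm> (k + C - i)" by (rule MM_pow_coeff[OF p])
          moreover have "C \<le> k + C - i" using False by simp
          ultimately have "p i \<in> ideal_pow R \<mm> C" using R.ideal_pow_antimono[OF mm] by blast
          then have "p i \<odot>\<^bsub>M\<^esub> f (n - i) \<in> IM (D + k + 1)" unfolding C_def by (rule mm_pow_smult[OF _ fc])
          moreover have "Suc n \<le> D + k + 1" using nD False i by linarith
          ultimately show ?thesis using IM_antimono by blast
        qed
      qed
      then have "(\<Oplus>\<^bsub>M\<^esub>i\<in>{..n}. p i \<odot>\<^bsub>M\<^esub> f (n - i)) \<in> IM (Suc n)" for n
        by (intro finsum_in_submodule[OF IM_sub]) simp
      then show ?thesis using PM.smult_closed[OF pR, of f] f by (simp add: NL_def gr_def poly_module_simps)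
    qed
    then show "\<exists>K. \<forall>p\<in>ideal_pow RA MM K. p \<odot>\<^bsub>PM\<^esub> f \<in> NL" by blast
  qed
qed

end

section \<open>Modules of finite length over a local ring\<close>

lemma (in cring) local_ring_unit:
  assumes noeth: "noetherian_ring R" and loc: "local_ring R \<mm>" and u: "u \<in> carrier R" "u \<notin> \<mm>"
  shows "\<exists>v\<in>carrier R. v \<otimes> u = \<one>"
proof (rule ccontr)
  assume no: "\<not> (\<exists>v\<in>carrier R. v \<otimes> u = \<one>)"
  define S where "S = {J. ideal J R \<and> u \<in> J \<and> \<one> \<notin> J}"
  have "PIdl u \<in> S"
    unfolding S_def
  proof (intro CollectI conjI notI)
    show "ideal (PIdl u) R" by (rule cgenideal_ideal[OF u(1)])
    show "u \<in> PIdl u" by (rule cgenideal_self[OF u(1)])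
    assume "\<one> \<in> PIdl u"
    then obtain v where "v \<in> carrier R" "\<one> = v \<otimes> u" unfolding cgenideal_def by blast
    then show False using no by metis
  qed
  moreover have "\<forall>J\<in>S. ideal J R" by (simp add: S_def)
  ultimately have "\<exists>J\<in>S. \<forall>K\<in>S. J \<subseteq> K \<longrightarrow> K = J"
    by (rule noetherian_ring.maximal_ideal_of_family[OF noeth])
  then obtain J where J: "J \<in> S" "\<forall>K\<in>S. J \<subseteq> K \<longrightarrow> K = J" by (rule bexE)
  have JI: "ideal J R" "u \<in> J" "\<one> \<notin> J" using J(1) by (auto simp: S_def)
  have "maximalideal J R"
  proof (rule maximalidealI[OF JI(1)])
    show "carrier R \<noteq> J" using JI(3) one_closed by metis
    fix K assume K: "ideal K R" "J \<subseteq> K" "K \<subseteq> carrier R"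
    show "K = J \<or> K = carrier R"
    proof (cases "\<one> \<in> K")
      case True then show ?thesis using ideal.one_imp_carrier[OF K(1)] by simp
    next
      case False
      then have "K \<in> S" using K(1) subsetD[OF K(2) JI(2)] by (simp add: S_def)
      then show ?thesis using bspec[OF J(2)] K(2) by blast
    qed
  qed
  then have "J = \<mm>" using loc by (simp add: local_ring_def)
  then show False using JI(2) u(2) by simp
qed

text \<open>\<mm> kills every composition factor, so its power of exponent \<open>l\<close>, the
  length of the series, kills the module. For the factor: if \<open>av\<close> were outside
  \<open>N i\<close>, then \<open>N i\<close> and the multiples of \<open>av\<close> would span
  \<open>N (Suc i)\<close>. So \<open>(1 - ra)v\<close> would lie in \<open>N i\<close> for some
  \<open>r\<close>; as \<open>1 - ra\<close> is a unit, \<open>v\<close> would too.\<close>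

lemma (in module) finite_length_annihilated:
  assumes noeth: "noetherian_ring R" and loc: "local_ring R \<mm>" and fl: "finite_length_module R M"
  shows "\<exists>c. \<forall>a\<in>ideal_pow R \<mm> c. \<forall>x\<in>carrier M. a \<odot>\<^bsub>M\<^esub> x = \<zero>\<^bsub>M\<^esub>"
proof -
  have mx: "maximalideal \<mm> R" using loc by (simp add: local_ring_def)
  have mm: "ideal \<mm> R" using mx by (rule maximalideal.axioms(1))
  obtain l N where chain: "N (0::nat) = {\<zero>\<^bsub>M\<^esub>} \<and> N l = carrier M \<and> (\<forall>i\<le>l. submodule (N i) R M) \<and>
      (\<forall>i<l. N i \<subset> N (Suc i) \<and>
        (\<forall>P. submodule P R M \<longrightarrow> N i \<subseteq> P \<longrightarrow> P \<subseteq> N (Suc i) \<longrightarrow> P = N i \<or> P = N (Suc i)))"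
    using fl unfolding finite_length_module_def by (elim exE)
  have N0: "N 0 = {\<zero>\<^bsub>M\<^esub>}" and Nl: "N l = carrier M"
    and Nsub: "\<And>i. i \<le> l \<Longrightarrow> submodule (N i) R M"
    and Nlt: "\<And>i. i < l \<Longrightarrow> N i \<subset> N (Suc i)"
    and Nsimple: "\<And>i P. i < l \<Longrightarrow> submodule P R M \<Longrightarrow> N i \<subseteq> P \<Longrightarrow> P \<subseteq> N (Suc i) \<Longrightarrow> P = N i \<or> P = N (Suc i)"
    using chain by simp_all
  have step: "a \<odot>\<^bsub>M\<^esub> v \<in> N i" if i: "i < l" and a: "a \<in> \<mm>" and v: "v \<in> N (Suc i)" for i a v
  proof (rule ccontr)
    assume av: "a \<odot>\<^bsub>M\<^esub> v \<notin> N i"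
    have aR: "a \<in> carrier R" using ideal.Icarr[OF mm a] .
    have Ni: "submodule (N i) R M" and NS: "submodule (N (Suc i)) R M" using Nsub[of i] Nsub[of "Suc i"] i by simp_all
    have vc: "v \<in> carrier M" using submodule_carrier[OF NS v] .
    have avc: "a \<odot>\<^bsub>M\<^esub> v \<in> carrier M" using aR vc by simp
    let ?C = "(\<lambda>r. r \<odot>\<^bsub>M\<^esub> (a \<odot>\<^bsub>M\<^esub> v)) ` carrier R"
    have C: "submodule ?C R M"
    proof (rule submoduleI')
      show "\<zero>\<^bsub>M\<^esub> \<in> ?C" using smult_l_null[OF avc, symmetric] R.zero_closed by (rule image_eqI)
      fix x assume "x \<in> ?C"
      then obtain r where r: "r \<in> carrier R" "x = r \<odot>\<^bsub>M\<^esub> (a \<odot>\<^bsub>M\<^esub> v)" by blast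
      show "b \<odot>\<^bsub>M\<^esub> x \<in> ?C" if "b \<in> carrier R" for b
        using r that avc by (intro image_eqI[of _ _ "b \<otimes> r"]) (auto simp: smult_assoc1)
      fix y assume "y \<in> ?C"
      then obtain s where s: "s \<in> carrier R" "y = s \<odot>\<^bsub>M\<^esub> (a \<odot>\<^bsub>M\<^esub> v)" by blast
      show "x \<oplus>\<^bsub>M\<^esub> y \<in> ?C"
        using r s avc by (intro image_eqI[of _ _ "r \<oplus> s"]) (auto simp: smult_l_distr)
    qed (use avc in auto)
    have avC: "a \<odot>\<^bsub>M\<^esub> v \<in> ?C" using smult_one[OF avc, symmetric] R.one_closed by (rule image_eqI)
    have CN: "?C \<subseteq> N (Suc i)" by (intro image_subsetI submoduleE(4)[OF NS] aR v)
    have "msum (N i) ?C = N i \<or> msum (N i) ?C = N (Suc i)"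
      by (rule Nsimple[OF i msum_sub[OF Ni C] msum_left[OF Ni C] msum_min[OF NS Ni psubset_imp_subset[OF Nlt[OF i]] CN]])
    moreover have "msum (N i) ?C \<noteq> N i" using subsetD[OF msum_right[OF Ni C] avC] av by metis
    ultimately have "v \<in> msum (N i) ?C" using v by simp
    then obtain p w where pw: "p \<in> N i" "w \<in> ?C" "v = p \<oplus>\<^bsub>M\<^esub> w" "p \<in> carrier M" "w \<in> carrier M" using msumE[OF _ Ni] by blast
    obtain r where r: "r \<in> carrier R" "w = r \<odot>\<^bsub>M\<^esub> (a \<odot>\<^bsub>M\<^esub> v)" using pw(2) by blast
    define u where "u = \<one> \<ominus> r \<otimes> a"
    have uR: "u \<in> carrier R" using r aR by (simp add: u_def)
    have "u \<notin> \<mm>"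
    proof
      assume "u \<in> \<mm>"
      moreover have "r \<otimes> a \<in> \<mm>" using ideal.I_l_closed[OF mm a r(1)] .
      ultimately have "u \<oplus> r \<otimes> a \<in> \<mm>" using additive_subgroup.a_closed[OF ideal.axioms(1)[OF mm]] by blast
      moreover have "u \<oplus> r \<otimes> a = \<one>" using r aR unfolding u_def by algebra
      ultimately have "\<mm> = carrier R" using ideal.one_imp_carrier[OF mm] by simp
      then show False using maximalideal.I_notcarr[OF mx] by simp
    qed
    then obtain t where t: "t \<in> carrier R" "t \<otimes> u = \<one>" using R.local_ring_unit[OF noeth loc uR] by blast
    have "u \<odot>\<^bsub>M\<^esub> v = v \<ominus>\<^bsub>M\<^esub> r \<odot>\<^bsub>M\<^esub> (a \<odot>\<^bsub>M\<^esub> v)"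
      using r aR vc by (simp add: u_def a_minus_def smult_l_distr smult_l_minus smult_assoc1)
    also have "\<dots> = p" unfolding r(2)[symmetric] by (rule iffD2[OF M.minus_eq_iff[OF vc pw(5,4)] pw(3)])
    finally have "t \<odot>\<^bsub>M\<^esub> (u \<odot>\<^bsub>M\<^esub> v) \<in> N i" using submoduleE(4)[OF Ni t(1) pw(1)] by simp
    then have "v \<in> N i" using t uR vc by (simp add: smult_assoc1[symmetric])
    then show False using av submoduleE(4)[OF Ni aR] by blast
  qed
  have "j \<le> l \<Longrightarrow> a \<in> ideal_pow R \<mm> j \<Longrightarrow> v \<in> N j \<Longrightarrow> a \<odot>\<^bsub>M\<^esub> v = \<zero>\<^bsub>M\<^esub>" for j a v
  proof (induction j arbitrary: a v)
    case 0 then show ?case using N0 by (simp add: ideals_one)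
  next
    case (Suc j)
    have vc: "v \<in> carrier M" using submodule_carrier[OF Nsub[OF Suc.prems(1)] Suc.prems(3)] .
    from Suc.prems(2) have "a \<in> ideal_pow R \<mm> j \<cdot> \<mm>" unfolding R.ideal_pow_Suc .
    then show ?case
    proof (induction a rule: ideal_prod.induct)
      case (prod b e)
      have "b \<odot>\<^bsub>M\<^esub> (e \<odot>\<^bsub>M\<^esub> v) = \<zero>\<^bsub>M\<^esub>"
        using Suc.IH[OF _ prod(1) step[OF _ prod(2) Suc.prems(3)]] Suc.prems(1) by simp
      then show ?case using vc ideal.Icarr[OF R.ideal_pow_ideal[OF mm] prod(1)] ideal.Icarr[OF mm prod(2)]
        by (simp add: smult_assoc1)
    next
      case (sum s t)
      have "s \<in> carrier R" "t \<in> carrier R"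
        using sum R.ideal_prod_in_carrier[OF R.ideal_pow_ideal[OF mm] mm] by blast+
      then show ?case using sum vc by (simp add: smult_l_distr)
    qed
  qed
  from this[of l] show ?thesis using Nl by blast
qed

section \<open>Passing from \<open>D\<^sub>j\<close> to
  \<open>D\<^sub>j\<^sub>+\<^sub>1\<close>\<close>

context rees_rr_local
begin

text \<open>Identifies the cokernel of \<open>x t\<close> on \<open>M[t]\<close> modulo
  \<open>PN W\<close> as \<open>M[t]\<close> modulo \<open>PN W'\<close>. In positive degrees this
  is \<open>N W' = N W + xM\<close>, read off component by component.\<close>

lemma PN_step:
  assumes W: "submodule W R M" and W': "submodule W' R M" and x: "x \<in> I"
    and W'_eq: "W' = msum W ((\<lambda>m. x \<odot>\<^bsub>M\<^esub> m) ` carrier M)"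
    and u: "u \<in> up M"
  shows "u \<in> PN W' \<longleftrightarrow> (\<exists>f\<in>up M. u \<ominus>\<^bsub>PM\<^esub> RE.mon x 1 \<odot>\<^bsub>PM\<^esub> f \<in> PN W)"
proof -
  have xR: "x \<in> carrier R" using ideal.Icarr[OF I x] .
  have uc: "u n \<in> carrier M" for n using u by (simp add: up_iff)
  have monR: "RE.mon x 1 \<in> carrier RA" using RE.mon_carrier[of x 1] R.ideal_pow_1[OF I] x by simp
  have minus: "(g \<ominus>\<^bsub>PM\<^esub> h) n = g n \<ominus>\<^bsub>M\<^esub> h n" if "g \<in> up M" "h \<in> up M" for g h n
  proof -
    have gh: "g \<in> carrier PM" "h \<in> carrier PM" using that by (simp_all add: poly_module_simps)
    have "(g \<ominus>\<^bsub>PM\<^esub> h) \<oplus>\<^bsub>PM\<^esub> h = g" using gh by (simp add: a_minus_def PM.a_assoc PM.M.l_neg)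
    then have "((g \<ominus>\<^bsub>PM\<^esub> h) \<oplus>\<^bsub>PM\<^esub> h) n = g n" by simp
    then have "(g \<ominus>\<^bsub>PM\<^esub> h) n \<oplus>\<^bsub>M\<^esub> h n = g n" by (simp only: poly_module_simps)
    moreover have "(g \<ominus>\<^bsub>PM\<^esub> h) n \<in> carrier M" "g n \<in> carrier M" "h n \<in> carrier M"
      using PM.M.minus_closed[OF gh] that by (simp_all add: poly_module_simps up_iff)
    ultimately show ?thesis by (metis M.minus_eq_iff)
  qed
  have yf: "RE.mon x 1 \<odot>\<^bsub>PM\<^esub> f = (\<lambda>n. if 1 \<le> n then x \<odot>\<^bsub>M\<^esub> f (n - 1) else \<zero>\<^bsub>M\<^esub>)" if "f \<in> up M" for f
    by (rule mon_smult[OF xR that])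
  have yfu: "RE.mon x 1 \<odot>\<^bsub>PM\<^esub> f \<in> up M" if "f \<in> up M" for f
    using PM.smult_closed[OF monR, of f] that by (simp add: poly_module_simps)
  have xM0: "\<zero>\<^bsub>M\<^esub> \<in> (\<lambda>m. x \<odot>\<^bsub>M\<^esub> m) ` carrier M" using xR by (intro image_eqI[of _ _ "\<zero>\<^bsub>M\<^esub>"]) auto
  have WW': "W \<subseteq> W'"
  proof
    fix w assume "w \<in> W"
    then show "w \<in> W'" unfolding W'_eq
      by (rule msumI[OF _ xM0]) (use submodule_carrier[OF W \<open>w \<in> W\<close>] in simp_all)
  qed
  have xW': "x \<odot>\<^bsub>M\<^esub> m \<in> W'" if "m \<in> carrier M" for m
    unfolding W'_eq by (rule msumI[OF submodule_zero[OF W] imageI[OF that]]) (use that xR in simp_all)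
  show ?thesis
  proof
    assume "\<exists>f\<in>up M. u \<ominus>\<^bsub>PM\<^esub> RE.mon x 1 \<odot>\<^bsub>PM\<^esub> f \<in> PN W"
    then obtain f where f: "f \<in> up M" "u \<ominus>\<^bsub>PM\<^esub> RE.mon x 1 \<odot>\<^bsub>PM\<^esub> f \<in> PN W" by blast
    let ?h = "RE.mon x 1 \<odot>\<^bsub>PM\<^esub> f"
    have "u n \<in> N W' (Suc n)" for n
    proof -
      have "(u \<ominus>\<^bsub>PM\<^esub> ?h) n \<in> N W (Suc n)" using f(2) unfolding PN_def gr_def by blast
      then have 1: "u n \<ominus>\<^bsub>M\<^esub> ?h n \<in> N W' (Suc n)" using minus[OF u yfu[OF f(1)]] N_mono[OF WW'] by auto
      have "?h n \<in> W'" using f(1) yf[OF f(1)] xW' submodule_zero[OF W'] by (auto simp: up_iff)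
      then have 2: "?h n \<in> N W' (Suc n)" using W_N[OF W'] by blast
      have "?h n \<in> carrier M" using yfu[OF f(1)] by (simp add: up_iff)
      then show ?thesis using submodule_cong_mem[OF N_sub[OF W'] uc _ 1] 2 by blast
    qed
    then show "u \<in> PN W'" using u by (simp add: PN_def gr_def)
  next
    assume uW': "u \<in> PN W'"
    have torsion_exact: "\<exists>m\<in>carrier M. u (Suc n) \<ominus>\<^bsub>M\<^esub> x \<odot>\<^bsub>M\<^esub> m \<in> N W (Suc (Suc n))" for n
    proof -
      have "u (Suc n) \<in> N W' (Suc (Suc n))" using uW' by (simp add: PN_def gr_def)
      then obtain r v where r: "r \<in> rr (Suc (Suc n))" "v \<in> W'" "u (Suc n) = r \<oplus>\<^bsub>M\<^esub> v" "r \<in> carrier M" "v \<in> carrier M"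
        using msumE[OF _ rr_sub] unfolding N_def by blast
      obtain w y where w: "w \<in> W" "y \<in> (\<lambda>m. x \<odot>\<^bsub>M\<^esub> m) ` carrier M" "v = w \<oplus>\<^bsub>M\<^esub> y" "w \<in> carrier M" "y \<in> carrier M"
        using msumE[OF _ W] r(2) unfolding W'_eq by blast
      obtain m where m: "m \<in> carrier M" "y = x \<odot>\<^bsub>M\<^esub> m" using w(2) by blast
      have "u (Suc n) \<ominus>\<^bsub>M\<^esub> y = r \<oplus>\<^bsub>M\<^esub> w"
        using r(3,4) w(3,4,5) by (subst M.minus_eq_iff) (auto simp: M.a_assoc)
      moreover have "r \<oplus>\<^bsub>M\<^esub> w \<in> N W (Suc (Suc n))" unfolding N_def using r w by (intro msumI[of r _ w]) auto
      ultimately have "u (Suc n) \<ominus>\<^bsub>M\<^esub> x \<odot>\<^bsub>M\<^esub> m \<in> N W (Suc (Suc n))" unfolding m(2) by (simp only:)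
      then show ?thesis using m(1) by (rule bexI)
    qed
    \<comment> \<open>Zero is chosen wherever \<open>u\<close> vanishes, so that \<open>f\<close>
      has finitely many nonzero coefficients.\<close>
    define f where "f n = (if u (Suc n) = \<zero>\<^bsub>M\<^esub> then \<zero>\<^bsub>M\<^esub> else
      SOME m. m \<in> carrier M \<and> u (Suc n) \<ominus>\<^bsub>M\<^esub> x \<odot>\<^bsub>M\<^esub> m \<in> N W (Suc (Suc n)))" for n
    have f: "f n \<in> carrier M \<and> u (Suc n) \<ominus>\<^bsub>M\<^esub> x \<odot>\<^bsub>M\<^esub> f n \<in> N W (Suc (Suc n))" for n
    proof (cases "u (Suc n) = \<zero>\<^bsub>M\<^esub>")
      case True
      then show ?thesis using xR submodule_zero[OF N_sub[OF W]] by (simp add: f_def)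
    next
      case False
      have "\<exists>m. m \<in> carrier M \<and> u (Suc n) \<ominus>\<^bsub>M\<^esub> x \<odot>\<^bsub>M\<^esub> m \<in> N W (Suc (Suc n))" using torsion_exact by blast
      from someI_ex[OF this] show ?thesis using False by (simp add: f_def)
    qed
    obtain D where D: "\<And>n. D < n \<Longrightarrow> u n = \<zero>\<^bsub>M\<^esub>" using u by (auto simp: up_iff)
    have fu: "f \<in> up M" unfolding up_iff using f D by (auto simp: f_def intro!: exI[of _ D])
    have "(u \<ominus>\<^bsub>PM\<^esub> RE.mon x 1 \<odot>\<^bsub>PM\<^esub> f) n \<in> N W (Suc n)" for n
    proof (cases n)
      case (Suc k)
      have "(RE.mon x 1 \<odot>\<^bsub>PM\<^esub> f) (Suc k) = x \<odot>\<^bsub>M\<^esub> f k" by (subst yf[OF fu]) simp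
      then show ?thesis using f[of k] unfolding Suc minus[OF u yfu[OF fu]] by simp
    next
      \<comment> \<open>Multiples of \<open>x t\<close> have no component of degree 0; there
        \<open>N W' 1\<close> and \<open>N W 1\<close> agree because \<open>xM\<close> lies in
        \<open>IM 1\<close>.\<close>
      case 0
      have "u 0 \<in> N W' 1" using uW' by (simp add: PN_def gr_def)
      moreover have "N W' 1 \<subseteq> N W 1"
        unfolding N_def[of W']
      proof (rule msum_min[OF N_sub[OF W] rr_sub rr_N[OF W]])
        have "(\<lambda>m. x \<odot>\<^bsub>M\<^esub> m) ` carrier M \<subseteq> N W 1"
        proof clarify
          fix m assume m: "m \<in> carrier M"
          have "x \<odot>\<^bsub>M\<^esub> m \<in> IM 1" unfolding IM_def R.ideal_pow_1[OF I] by (rule ideal_times_mem[OF x m])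
          then show "x \<odot>\<^bsub>M\<^esub> m \<in> N W 1" using IM_N[OF W] by blast
        qed
        then show "W' \<subseteq> N W 1" unfolding W'_eq by (rule msum_min[OF N_sub[OF W] W W_N[OF W]])
      qed
      moreover have "(RE.mon x 1 \<odot>\<^bsub>PM\<^esub> f) 0 = \<zero>\<^bsub>M\<^esub>" by (subst yf[OF fu]) simp
      ultimately show ?thesis using uc[of 0] unfolding 0 minus[OF u yfu[OF fu]] by auto
    qed
    moreover have "u \<ominus>\<^bsub>PM\<^esub> RE.mon x 1 \<odot>\<^bsub>PM\<^esub> f \<in> up M"
      using PM.M.minus_closed[of u "RE.mon x 1 \<odot>\<^bsub>PM\<^esub> f"] u yfu[OF fu] by (simp add: poly_module_simps)
    ultimately show "\<exists>f\<in>up M. u \<ominus>\<^bsub>PM\<^esub> RE.mon x 1 \<odot>\<^bsub>PM\<^esub> f \<in> PN W"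
      using fu by (auto simp: PN_def gr_def)
  qed
qed

lemma koszul_vanishing_PN_1:
  assumes W: "submodule W R M" and gens: "MM = Idl\<^bsub>RA\<^esub> (set zs)" "set zs \<subseteq> carrier RA"
  shows "koszul_vanishing PM (carrier PM) (PN W) zs 1 \<longleftrightarrow> rr_lifts W"
  unfolding PM.koszul_vanishing_1[OF PM.carrier_is_submodule gens(2) PN_sub[OF W]] socle_iff_rr_lifts[OF W, symmetric]
  using PM.gens_smult_iff[OF PN_sub[OF W] _ gens] by (simp add: poly_module_simps)

text \<open>An instance of \<open>koszul_vanishing_regular\<close> for \<open>x t\<close>.
  Cancellation of \<open>x\<close> is known for \<open>V\<close>, and \<open>rr_lifts\<close>
  carries it over to \<open>N\<close>, which makes \<open>x t\<close> regular.\<close>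

lemma koszul_vanishing_PN_Suc:
  assumes W: "submodule W R M" and W': "submodule W' R M" and x: "x \<in> I"
    and W'_eq: "W' = msum W ((\<lambda>m. x \<odot>\<^bsub>M\<^esub> m) ` carrier M)"
    and sup: "\<And>n m. m \<in> carrier M \<Longrightarrow> x \<odot>\<^bsub>M\<^esub> m \<in> V W (Suc n) \<Longrightarrow> m \<in> V W n"
    and zs: "set zs \<subseteq> carrier RA" "RE.mon x 1 \<in> set zs"
    and rr_lifts: "rr_lifts W"
  shows "koszul_vanishing PM (carrier PM) (PN W) zs (Suc k) \<longleftrightarrow> koszul_vanishing PM (carrier PM) (PN W') zs k"
proof (rule PM.koszul_vanishing_regular[OF PM.carrier_is_submodule PN_sub[OF W] _ PN_sub[OF W'] _ zs])
  have xR: "x \<in> carrier R" using ideal.Icarr[OF I x] .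
  show "PN W \<subseteq> carrier PM" "PN W' \<subseteq> carrier PM" by (auto simp: PN_def gr_def poly_module_simps)
  show "f \<in> PN W" if f: "f \<in> carrier PM" and yf: "RE.mon x 1 \<odot>\<^bsub>PM\<^esub> f \<in> PN W" for f
  proof -
    have fu: "f \<in> up M" using f by (simp add: poly_module_simps)
    have "f n \<in> N W (Suc n)" for n
    proof -
      have "(RE.mon x 1 \<odot>\<^bsub>PM\<^esub> f) (Suc n) \<in> N W (Suc (Suc n))" using yf unfolding PN_def gr_def by blast
      then have "x \<odot>\<^bsub>M\<^esub> f n \<in> V W (Suc (Suc n))" using N_V[OF W] mon_smult[OF xR fu, of 1] by auto
      then have "f n \<in> V W (Suc n)" using sup fu by (simp add: up_iff)
      then show ?thesis using rr_lifts by (auto simp: rr_lifts_def)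
    qed
    then show ?thesis using fu by (simp add: PN_def gr_def)
  qed
  show "u \<in> PN W' \<longleftrightarrow> (\<exists>f\<in>carrier PM. u \<ominus>\<^bsub>PM\<^esub> RE.mon x 1 \<odot>\<^bsub>PM\<^esub> f \<in> PN W)" if "u \<in> carrier PM" for u
    using PN_step[OF W W' x W'_eq, of u] that by (simp add: poly_module_simps)
qed

end

section \<open>The whole superficial sequence, and the comparison with local cohomology\<close>

locale rees_rr_seq = rees_rr_local R M I \<mm> c for R (structure) and M (structure) and I \<mm> c +
  fixes xs :: "'a list" and zs :: "(nat \<Rightarrow> 'a) list"
  assumes sup_seq: "superficial_sequence R I M xs"
    and gens: "MM = Idl\<^bsub>RA\<^esub> (set zs)" "set zs \<subseteq> carrier RA"
    and mon_zs: "\<And>x. x \<in> set xs \<Longrightarrow> RE.mon x 1 \<in> set zs"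
begin

definition "W i = ideal_times R (Idl (set (take i xs))) M"

lemma xsI: "x \<in> set xs \<Longrightarrow> x \<in> I"
  using sup_seq by (auto simp: superficial_sequence_def)

lemma xsR: "set (take i xs) \<subseteq> carrier R"
  using xsI ideal.Icarr[OF I] set_take_subset[of i xs] by blast

lemma W_sub: "submodule (W i) R M"
  unfolding W_def by (rule ideal_times_sub) (use ideal.Icarr[OF R.genideal_ideal[OF xsR]] in blast)

lemma W_0: "W 0 = {\<zero>\<^bsub>M\<^esub>}"
proof
  have z: "Idl {} = {\<zero>}"
    using R.genideal_minimal[OF R.zeroideal, of "{}"]
      additive_subgroup.zero_closed[OF ideal.axioms(1)[OF R.genideal_ideal[of "{}"]]] by auto
  show "W 0 \<subseteq> {\<zero>\<^bsub>M\<^esub>}" unfolding W_def by (rule ideal_times_min[OF zero_submodule]) (simp add: z)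
qed (use submodule_zero[OF W_sub] in auto)

lemma W_Suc:
  assumes "i < length xs"
  shows "W (Suc i) = msum (W i) ((\<lambda>m. (xs ! i) \<odot>\<^bsub>M\<^esub> m) ` carrier M)"
proof -
  have "xs ! i \<in> carrier R" using xsI ideal.Icarr[OF I] assms nth_mem by blast
  moreover have "set (take (Suc i) xs) = insert (xs ! i) (set (take i xs))"
    using assms by (simp add: take_Suc_conv_app_nth)
  ultimately show ?thesis unfolding W_def using ideal_times_insert[OF xsR] by simp
qed

lemma quot_W: "quot_by_seq R M (take i xs) = module_quot M (W i)"
  by (simp add: quot_by_seq_def W_def)

lemma V_colon_xs:
  assumes i: "i < length xs" and m: "m \<in> carrier M" and xm: "(xs ! i) \<odot>\<^bsub>M\<^esub> m \<in> V (W i) (Suc n)"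
  shows "m \<in> V (W i) n"
proof -
  have xI: "xs ! i \<in> I" using xsI i by simp
  have "\<exists>n0. \<forall>n\<ge>n0. \<forall>m\<in>carrier M. (xs ! i) \<odot>\<^bsub>M\<^esub> m \<in> msum (IM (Suc n)) (W i) \<longrightarrow> m \<in> msum (IM n) (W i)"
  proof (cases i)
    case 0
    have "superficial R I M (xs ! 0)" using sup_seq i 0 by (simp add: superficial_sequence_def)
    then obtain n0 where n0: "\<And>n. n \<ge> n0 \<Longrightarrow> colon M (IM (n + 1)) {xs ! 0} = IM n"
      unfolding superficial_def IM_def by blast
    have "m \<in> IM n" if "n \<ge> n0" "m \<in> carrier M" "(xs ! 0) \<odot>\<^bsub>M\<^esub> m \<in> IM (Suc n)" for n m
      using n0[OF that(1)] that(2,3) by (auto simp: colon_def)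
    then show ?thesis unfolding 0 W_0 msum_zero[OF IM_sub] by blast
  next
    case (Suc j)
    have "superficial R I (quot_by_seq R M (take i xs)) (xs ! i)"
      using sup_seq i Suc unfolding superficial_sequence_def by simp
    then show ?thesis unfolding quot_W by (rule superficial_quot[OF W_sub])
  qed
  then obtain n0 where n0: "\<And>n m. n0 \<le> n \<Longrightarrow> m \<in> carrier M \<Longrightarrow>
      (xs ! i) \<odot>\<^bsub>M\<^esub> m \<in> msum (IM (Suc n)) (W i) \<Longrightarrow> m \<in> msum (IM n) (W i)" by blast
  show ?thesis by (rule V_superficial[OF W_sub xI n0 m xm])
qed

lemma rr_lifts_step_down: "i < length xs \<Longrightarrow> rr_lifts (W (Suc i)) \<Longrightarrow> rr_lifts (W i)"
  using step_down[OF W_sub W_sub xsI[OF nth_mem] W_Suc, of i] V_colon_xs unfolding rr_lifts_def by blast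

lemma rr_lifts_antimono: "j \<le> length xs \<Longrightarrow> i \<le> j \<Longrightarrow> rr_lifts (W j) \<Longrightarrow> rr_lifts (W i)"
proof (induction j)
  case (Suc j)
  then show ?case
    using rr_lifts_step_down[of j] by (cases "i = Suc j") auto
qed simp

text \<open>Degree 0 is \<open>rr_lifts (W i)\<close>. If it holds, the remaining degrees pass to
  \<open>W (Suc i)\<close>; if it fails, both sides are false, the left one already in degree
  0.\<close>

lemma koszul_vanishing_iff_rr_lifts:
  "i + k \<le> length xs \<Longrightarrow> koszul_vanishing PM (carrier PM) (PN (W i)) zs (Suc k) \<longleftrightarrow> (\<forall>j\<le>k. rr_lifts (W (i + j)))"
proof (induction k arbitrary: i)
  case 0
  then show ?case using koszul_vanishing_PN_1[OF W_sub gens] by simp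
next
  case (Suc k)
  have i: "i < length xs" using Suc.prems by simp
  have xI: "xs ! i \<in> I" using xsI i by simp
  show ?case
  proof (cases "rr_lifts (W i)")
    case True
    have "koszul_vanishing PM (carrier PM) (PN (W i)) zs (Suc (Suc k)) \<longleftrightarrow> koszul_vanishing PM (carrier PM) (PN (W (Suc i))) zs (Suc k)"
      by (rule koszul_vanishing_PN_Suc[OF W_sub W_sub xI W_Suc[OF i] V_colon_xs[OF i] gens(2) _ True])
        (use mon_zs i in auto)
    also have "\<dots> \<longleftrightarrow> (\<forall>j\<le>k. rr_lifts (W (Suc i + j)))" using Suc by simp
    also have "\<dots> \<longleftrightarrow> (\<forall>j\<le>Suc k. rr_lifts (W (i + j)))"
    proof
      assume a: "\<forall>j\<le>k. rr_lifts (W (Suc i + j))"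
      show "\<forall>j\<le>Suc k. rr_lifts (W (i + j))"
      proof (intro allI impI)
        fix j assume "j \<le> Suc k"
        then show "rr_lifts (W (i + j))" using a True by (cases j) auto
      qed
    next
      assume a: "\<forall>j\<le>Suc k. rr_lifts (W (i + j))"
      show "\<forall>j\<le>k. rr_lifts (W (Suc i + j))" using a by (metis add_Suc_shift Suc_le_mono)
    qed
    finally show ?thesis .
  next
    case False
    have "\<not> koszul_vanishing PM (carrier PM) (PN (W i)) zs (Suc (Suc k))"
    proof
      assume "koszul_vanishing PM (carrier PM) (PN (W i)) zs (Suc (Suc k))"
      then have "koszul_vanishing PM (carrier PM) (PN (W i)) zs 1"
        by (rule PM.koszul_vanishing_mono[OF PM.carrier_is_submodule PN_sub[OF W_sub] gens(2)]) simp
      then show False using koszul_vanishing_PN_1[OF W_sub gens] False by simp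
    qed
    moreover have "\<not> (\<forall>j\<le>Suc k. rr_lifts (W (i + j)))" using False by (auto intro!: exI[of _ 0])
    ultimately show ?thesis by simp
  qed
qed

text \<open>\<open>rr n\<close> and \<open>V\<close> have the same image in \<open>M / W\<close>
  exactly if each element of \<open>V\<close> is congruent modulo \<open>W\<close> to one of
  \<open>rr n\<close>, that is, lies in \<open>N\<close>.\<close>

lemma behaves_well_iff_rr_lifts: "ratliff_rush_behaves_well R I M xs \<longleftrightarrow> rr_lifts (W (length xs))"
proof -
  let ?W = "W (length xs)"
  interpret Q: quotient_module R M ?W
    by (intro quotient_module.intro quotient_module_axioms.intro module_axioms W_sub)
  have q: "quot_by_seq R M xs = module_quot M ?W" using quot_W[of "length xs"] by simp
  have rq: "ratliff_rush R I (module_quot M ?W) n = (\<lambda>m. ?W +>\<^bsub>M\<^esub> m) ` V ?W n" for n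
  proof (rule Set.set_eqI)
    fix C
    have "C \<in> ratliff_rush R I (module_quot M ?W) n \<Longrightarrow> C \<in> (\<lambda>m. ?W +>\<^bsub>M\<^esub> m) ` carrier M"
      using Q.Q_carrier by (auto simp: ratliff_rush_def colon_def)
    then show "C \<in> ratliff_rush R I (module_quot M ?W) n \<longleftrightarrow> C \<in> (\<lambda>m. ?W +>\<^bsub>M\<^esub> m) ` V ?W n"
      using rr_quot[OF W_sub] submodule_carrier[OF V_sub[OF W_sub]] by blast
  qed
  have "(\<lambda>m. ?W +>\<^bsub>M\<^esub> m) ` rr n = (\<lambda>m. ?W +>\<^bsub>M\<^esub> m) ` V ?W n \<longleftrightarrow> V ?W n \<subseteq> N ?W n" for n
  proof
    assume eq: "(\<lambda>m. ?W +>\<^bsub>M\<^esub> m) ` rr n = (\<lambda>m. ?W +>\<^bsub>M\<^esub> m) ` V ?W n"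
    show "V ?W n \<subseteq> N ?W n"
    proof
      fix m assume m: "m \<in> V ?W n"
      then obtain r where r: "r \<in> rr n" "?W +>\<^bsub>M\<^esub> m = ?W +>\<^bsub>M\<^esub> r" using eq by blast
      have c: "m \<in> carrier M" "r \<in> carrier M"
        using submodule_carrier[OF V_sub[OF W_sub] m] submodule_carrier[OF rr_sub r(1)] by auto
      then have "m \<ominus>\<^bsub>M\<^esub> r \<in> ?W" using Q.coset_eq r(2) by simp
      then show "m \<in> N ?W n" using c r(1) by (auto simp: N_def msum_def)
    qed
  next
    assume le: "V ?W n \<subseteq> N ?W n"
    have "?W +>\<^bsub>M\<^esub> m \<in> (\<lambda>m. ?W +>\<^bsub>M\<^esub> m) ` rr n" if m: "m \<in> V ?W n" for m
    proof -
      obtain r where r: "m \<in> carrier M" "r \<in> rr n" "m \<ominus>\<^bsub>M\<^esub> r \<in> ?W" using subsetD[OF le m] unfolding N_def msum_def by blast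
      then have "?W +>\<^bsub>M\<^esub> m = ?W +>\<^bsub>M\<^esub> r" using Q.coset_eq submodule_carrier[OF rr_sub] by simp
      then show ?thesis using r(2) by blast
    qed
    then show "(\<lambda>m. ?W +>\<^bsub>M\<^esub> m) ` rr n = (\<lambda>m. ?W +>\<^bsub>M\<^esub> m) ` V ?W n" using rr_V[OF W_sub] by blast
  qed
  then show ?thesis
    unfolding ratliff_rush_behaves_well_def rr_lifts_def q rq rr_eq by (simp add: W_def)
qed

lemma behaves_well_iff_koszul_vanishing:
  "ratliff_rush_behaves_well R I M xs \<longleftrightarrow> koszul_vanishing PM (carrier PM) (PN {\<zero>\<^bsub>M\<^esub>}) zs (Suc (length xs))"
proof -
  have "rr_lifts (W (length xs)) \<longleftrightarrow> (\<forall>j\<le>length xs. rr_lifts (W (0 + j)))"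
    using rr_lifts_antimono by auto
  then show ?thesis using koszul_vanishing_iff_rr_lifts[of 0 "length xs"] by (simp add: behaves_well_iff_rr_lifts W_0)
qed

text \<open>\<theta> is the composite of \<open>M[t]\<close> onto \<open>L\<close> with the
  augmentation. By \<open>torsion_L_iff\<close> the preimage of the torsion of \<open>J 0\<close>
  under it is \<open>PN\<close> of the zero submodule, so that the pair in
  \<open>dimension_shift\<close> represents \<open>L\<close> modulo torsion without a second
  quotient.\<close>

lemma koszul_vanishing_iff_cohomology:
  assumes res: "injective_resolution RA (L_module R I M) \<epsilon> J d" and s: "1 \<le> s"
  shows "koszul_vanishing PM (carrier PM) (PN {\<zero>\<^bsub>M\<^esub>}) zs (Suc s) \<longleftrightarrow>
    (\<forall>i\<in>{1..s}. carrier (local_cohomology RA MM J d i) = {\<zero>\<^bsub>local_cohomology RA MM J d i\<^esub>})"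
proof -
  note r = res[unfolded injective_resolution_def L_eq]
  interpret L: quotient_module RA PM NL
    by (intro quotient_module.intro quotient_module_axioms.intro PM.module_axioms NL_sub)
  interpret T: torsion_resolution RA MM zs J d
    by (rule torsion_resolution.intro)
      (use RE.rees_cring RE.rees_noetherian[OF noeth] gens r in auto)
  have eps: "\<epsilon> \<in> module_hom RA (module_quot PM NL) (J 0)" using r by blast
  have inj: "inj_on \<epsilon> (carrier (module_quot PM NL))" using r by blast
  have im: "\<epsilon> ` carrier (module_quot PM NL) = T.kerd 0" using r by (simp add: T.kerd_def)
  define \<theta> where "\<theta> f = \<epsilon> (NL +>\<^bsub>PM\<^esub> f)" for f
  have cosetQ: "NL +>\<^bsub>PM\<^esub> f \<in> carrier (module_quot PM NL)" if "f \<in> carrier PM" for f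
    using that by (auto simp: L.Q_carrier)
  have \<theta>hom: "\<theta> \<in> module_hom RA PM (J 0)"
    using eps cosetQ by (simp add: module_hom_def \<theta>_def Pi_iff L.Q_add[symmetric] L.Q_smult[symmetric])
  have \<theta>: "submodule_hom RA PM (J 0) (carrier PM) (carrier (J 0)) \<theta>"
    using \<theta>hom by (intro submodule_hom.intro submodule_hom_axioms.intro PM.module_axioms T.Ji.module_axioms
        PM.carrier_is_submodule T.Ji.carrier_is_submodule) simp
  interpret \<theta>: submodule_hom RA PM "J 0" "carrier PM" "carrier (J 0)" \<theta> by (rule \<theta>)
  have \<theta>im: "\<theta> ` carrier PM = T.kerd 0"
    unfolding im[symmetric] L.Q_carrier \<theta>_def by (simp add: image_image)
  have \<theta>0: "\<theta> f = \<zero>\<^bsub>J 0\<^esub> \<longleftrightarrow> f \<in> NL" if f: "f \<in> carrier PM" for f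
  proof -
    have "\<zero>\<^bsub>J 0\<^esub> = \<epsilon> (NL +>\<^bsub>PM\<^esub> \<zero>\<^bsub>PM\<^esub>)" using \<theta>.zero by (simp add: \<theta>_def)
    then have "\<theta> f = \<zero>\<^bsub>J 0\<^esub> \<longleftrightarrow> NL +>\<^bsub>PM\<^esub> f = NL +>\<^bsub>PM\<^esub> \<zero>\<^bsub>PM\<^esub>"
      unfolding \<theta>_def using inj_on_eq_iff[OF inj cosetQ[OF f] cosetQ[OF PM.M.zero_closed]] by simp
    then show ?thesis using L.coset_zero_iff[OF f] by (simp add: L.Q_zero)
  qed
  have tor: "\<theta> f \<in> T.tor 0 \<longleftrightarrow> f \<in> PN {\<zero>\<^bsub>M\<^esub>}" if f: "f \<in> carrier PM" for f
  proof -
    have pR: "p \<in> carrier RA" if "p \<in> ideal_pow RA MM K" for p K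
      using ideal.Icarr[OF RE.RA.ideal_pow_ideal[OF MM_ideal] that] .
    have "p \<odot>\<^bsub>J 0\<^esub> \<theta> f = \<zero>\<^bsub>J 0\<^esub> \<longleftrightarrow> p \<odot>\<^bsub>PM\<^esub> f \<in> NL" if "p \<in> carrier RA" for p
      using that f \<theta>0[of "p \<odot>\<^bsub>PM\<^esub> f"] \<theta>.smult[OF that f] by simp
    then have "\<theta> f \<in> T.tor 0 \<longleftrightarrow> (\<exists>K. \<forall>p\<in>ideal_pow RA MM K. p \<odot>\<^bsub>PM\<^esub> f \<in> NL)"
      using pR \<theta>.closed[OF f] unfolding T.tor_def torsion_part_def by blast
    also have "\<dots> \<longleftrightarrow> f \<in> PN {\<zero>\<^bsub>M\<^esub>}" using torsion_L_iff f by (simp add: poly_module_simps)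
    finally show ?thesis .
  qed
  show ?thesis
    by (rule T.koszul_vanishing_iff_cohomology_zero[OF \<theta> PN_sub[OF zero_submodule] _ tor \<theta>im s])
      (auto simp: PN_def gr_def poly_module_simps)
qed

end

theorem theorem5p5:
  fixes A :: "('a, 'z) ring_scheme" and \<mm> I :: "'a set"
    and M :: "('a, 'm, 'y) module_scheme"
    and xs :: "'a list" and r s :: nat
    and \<epsilon> :: "(nat \<Rightarrow> 'm) set \<Rightarrow> 'e"
    and J :: "nat \<Rightarrow> (nat \<Rightarrow> 'a, 'e) module"
    and d :: "nat \<Rightarrow> 'e \<Rightarrow> 'e"
  assumes "noetherian_ring A" and "local_ring A \<mm>" and "infinite (carrier (A Quot \<mm>))"
    and "module A M" and "fin_gen_module A M"
    and "cohen_macaulay_module A \<mm> M" and "module_dim A M = enat r" and "2 \<le> r"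
    and "ideal_of_definition A \<mm> I M"
    and "superficial_sequence A I M xs" and "length xs = s" and "1 \<le> s" and "s \<le> r - 1"
    and "injective_resolution (rees_algebra A I) (L_module A I M) \<epsilon> J d"
  shows "ratliff_rush_behaves_well A I M xs \<longleftrightarrow>
    (\<forall>i\<in>{1..s}. carrier (local_cohomology (rees_algebra A I) (rees_max_ideal A \<mm> I) J d i)
       = {\<zero>\<^bsub>local_cohomology (rees_algebra A I) (rees_max_ideal A \<mm> I) J d i\<^esub>})"
proof -
  interpret module A M by fact
  have I: "ideal I A" and fl: "finite_length_module A (module_quot M (ideal_times A I M))"
    using assms(9) by (auto simp: ideal_of_definition_def)
  have mm: "ideal \<mm> A" using assms(2) by (auto simp: local_ring_def dest: maximalideal.axioms(1))
  interpret rr_module A M I by (intro rr_module.intro rr_module_axioms.intro module_axioms I)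
  have IM1: "IM 1 = ideal_times A I M" unfolding IM_def R.ideal_pow_1[OF I] ..
  interpret Q: quotient_module A M "IM 1"
    by (intro quotient_module.intro quotient_module_axioms.intro module_axioms IM_sub)
  obtain c where c: "\<forall>a\<in>ideal_pow A \<mm> c. \<forall>x\<in>carrier (module_quot M (IM 1)).
      a \<odot>\<^bsub>module_quot M (IM 1)\<^esub> x = \<zero>\<^bsub>module_quot M (IM 1)\<^esub>"
    using Q.Q.finite_length_annihilated[OF assms(1,2)] fl unfolding IM1 by blast
  interpret rees_rr_local A M I \<mm> c
  proof (intro rees_rr_local.intro rees_rr.intro rees_rr_local_axioms.intro rr_module_axioms mm assms(1))
    fix a x assume a: "a \<in> ideal_pow A \<mm> c" and x: "x \<in> carrier M"
    have aA: "a \<in> carrier A" using ideal.Icarr[OF R.ideal_pow_ideal[OF mm] a] .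
    have "a \<odot>\<^bsub>module_quot M (IM 1)\<^esub> (IM 1 +>\<^bsub>M\<^esub> x) = \<zero>\<^bsub>module_quot M (IM 1)\<^esub>"
      by (rule c[rule_format, OF a]) (unfold Q.Q_carrier, rule imageI[OF x])
    then show "a \<odot>\<^bsub>M\<^esub> x \<in> IM 1" unfolding Q.Q_smult[OF aA x] using Q.coset_zero_iff[OF smult_closed[OF aA x]] by blast
  qed
  interpret RN: noetherian_ring RA by (rule RE.rees_noetherian[OF assms(1)])
  obtain F where F: "F \<subseteq> carrier RA" "finite F" "MM = Idl\<^bsub>RA\<^esub> F" using RN.finetely_gen[OF MM_ideal] by blast
  obtain fs where fs: "set fs = F" using F(2) finite_list by blast
  \<comment> \<open>The \<open>x t\<close> are appended to the generators \<open>F\<close> because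
    the null-homotopy behind \<open>koszul_vanishing_regular\<close> is available for members of the
    list.\<close>
  define zs where "zs = fs @ map (\<lambda>x. RE.mon x 1) xs"
  have xsI: "set xs \<subseteq> I" using assms(10) by (auto simp: superficial_sequence_def)
  have zsM: "set zs \<subseteq> MM" using F(3) RE.RA.genideal_self[OF F(1)] fs xsI mon_MM by (auto simp: zs_def)
  then have zsR: "set zs \<subseteq> carrier RA" by (auto simp: MM_iff)
  have gens: "MM = Idl\<^bsub>RA\<^esub> (set zs)"
  proof
    show "MM \<subseteq> Idl\<^bsub>RA\<^esub> (set zs)"
      unfolding F(3) using RE.RA.genideal_minimal[OF RE.RA.genideal_ideal[OF zsR]] RE.RA.genideal_self[OF zsR] fs
      by (auto simp: zs_def)
    show "Idl\<^bsub>RA\<^esub> (set zs) \<subseteq> MM" by (rule RE.RA.genideal_minimal[OF MM_ideal zsM])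
  qed
  interpret rees_rr_seq A M I \<mm> c xs zs
    by (intro rees_rr_seq.intro rees_rr_seq_axioms.intro rees_rr_local_axioms assms(10) gens zsR)
      (simp add: zs_def)
  show ?thesis
    using behaves_well_iff_koszul_vanishing koszul_vanishing_iff_cohomology[OF assms(14,12)] assms(11) by simp
qed

end
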